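(* Let $q\in(0,1)$, $n\ge1$. For every $f\in\mathbb{C}[\mathrm{Mat}_n]_q$, $$f(\mathbf{z})=\int_{S(\mathbb{U})_q}C_q(\mathbf{z},\boldsymbol{\zeta}^* )f(\boldsymbol{\zeta})\,d\nu(\boldsymbol{\zeta}),$$ where the right-hand side is defined as follows: writing the bihomogeneous components of $C_q$ as finite sums $\sum_l u_l\otimes v_l$ with $u_l\in\mathbb{C}[\mathrm{Mat}_n]_q$, $v_l\in\mathbb{C}[\overline{\mathrm{Mat}}_n]_q$, the right-hand side is $\sum u_l\cdot\int_{S(\mathbb{U})_q}\psi(v_lf)\,d\nu\in\mathbb{C}[\mathrm{Mat}_n]_q$ (summed over all components; only finitely many terms are nonzero).
   Context: All algebras are unital over $\mathbb{C}$. $\mathbb{C}[\mathrm{Mat}_n]_q$: generators $z_a^\alpha$ ($a,\alpha=1..n$), relations (R): $z_a^\alpha z_b^\beta-qz_b^\beta z_a^\alpha=0$ if ($a=b$, $\alpha<\beta$) or ($a<b$, $\alpha=\beta$); $z_a^\alpha z_b^\beta=z_b^\beta z_a^\alpha$ if $\alpha<\beta$, $a>b$; $z_a^\alpha z_b^\beta-z_b^\beta z_a^\alpha=(q-q^{-1})z_a^\beta z_b^\alpha$ if $\alpha<\beta$, $a<b$. $\mathrm{Pol}(\mathrm{Mat}_n)_q$: the $*$-algebra with generators $z_a^\alpha,(z_a^\alpha)^*$, relations (R) and $(z_b^\beta)^*z_a^\alpha=q^2\sum_{a',b',\alpha',\beta'}R_{ba}^{b'a'}R_{\beta\alpha}^{\beta'\alpha'}z_{a'}^{\alpha'}(z_{b'}^{\beta'})^*+(1-q^2)\delta_{ab}\delta^{\alpha\beta}$,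 where $R_{ij}^{kl}=q^{-1}$ if $i\ne j,i=k,j=l$; $=1$ if $i=j=k=l$; $=-(q^{-2}-1)$ if $i=j,k=l,l>j$; $=0$ otherwise. $\mathbb{C}[\mathrm{Mat}_n]_q$ and $\mathbb{C}[\overline{\mathrm{Mat}}_n]_q$ denote the subalgebras generated by the $z_a^\alpha$, resp. the $(z_a^\alpha)^*$. Quantum minors: $(z^{\wedge k})_{\{a_1..a_k\}}^{\{\alpha_1..\alpha_k\}}=\sum_{s\in S_k}(-q)^{l(s)}z_{a_1}^{\alpha_{s(1)}}\cdots z_{a_k}^{\alpha_{s(k)}}$ ($a_i$, $\alpha_i$ increasing; $l(s)$ inversions); $\det_q\mathbf{z}$ the $n\times n$ minor (central); $\det_q\mathbf{z}_a^\alpha=(z^{\wedge(n-1)})_{\{1..n\}\setminus\{a\}}^{\{1..n\}\setminus\{\alpha\}}$. Shilov boundary: $\mathbb{C}[GL_n]_q$ is the localization of $\mathbb{C}[\mathrm{Mat}_n]_q$ at powers of $\det_q\mathbf{z}$; $\mathrm{Pol}(S(\mathbb{U}))_q$ is $\mathbb{C}[GL_n]_q$ with the involution $(z_a^\alpha)^*=(-q)^{a+\alpha-2n}(\det_q\mathbf{z})^{-1}\det_q\mathbf{z}_a^\alpha$, and $\psi:\mathrm{Pol}(\mathrm{Mat}_n)_q\to\mathrm{Pol}(S(\mathbb{U}))_q$ is the $*$-homomorphism with $\psi(z_a^\alpha)=z_a^\alpha$; one writes $f(\boldsymbol\zeta)$ for $\psi(f)$. Integral: $\mathbb{C}[U_n]_q$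 is $\mathbb{C}[GL_n]_q$ with involution $(z_a^\alpha)^\star=(-q)^{a-\alpha}(\det_q\mathbf{z})^{-1}\det_q\mathbf{z}_a^\alpha$ and the Hopf structure with $\Delta(z_a^\alpha)=\sum_jz_a^j\otimes z_j^\alpha$; $h$ is its Haar state (the unique invariant linear functional with $h(1)=1$). The map $\theta:z_a^\alpha\mapsto q^{\alpha-n}z_a^\alpha$ is an isomorphism of $*$-algebras $\mathrm{Pol}(S(\mathbb{U}))_q\to\mathbb{C}[U_n]_q$, and $\int_{S(\mathbb{U})_q}g\,d\nu:=h(\theta(g))$. Kernels: $\mathbb{C}[\mathrm{Mat}_n\times\overline{\mathrm{Mat}}_n]_q=\mathbb{C}[\mathrm{Mat}_n]_q^{\mathrm{op}}\otimes\mathbb{C}[\overline{\mathrm{Mat}}_n]_q$ (op = opposite multiplication in the first factor), bigraded by $\deg(z_a^\alpha\otimes1)=(1,0)$, $\deg(1\otimes(z_a^\alpha)^* )=(0,1)$; $\mathbb{C}[[\mathrm{Mat}_n\times\overline{\mathrm{Mat}}_n]]_q$ is its completion with respect to this bigrading (formal sums of bihomogeneous components). Put $\chi_k=\sum_{J',J''\subset\{1..n\},\,\mathrm{card}J'=\mathrm{card}J''=k}(z^{\wedge k})_{J''}^{J'}\otimes\big((z^{\wedge k})_{J''}^{J'}\big)^*$ (these pairwise commute) and $C_q=\prod_{j=0}^{n-1}\big(1+\sum_{k=1}^n(-q^{2j})^k\chi_k\big)^{-1}$, the inverses taken in the completion. *)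

theory Defs
  imports Complex_Main "HOL-Combinatorics.Permutations"
begin

text \<open>Z a al = z_a^al (row a, column al); Zb a al = (z_a^al)^*; T = (det_q z)^{-1}.\<close>
datatype gen = Z nat nat | Zb nat nat | T

fun barg :: "gen \<Rightarrow> gen" where
  "barg (Z a al) = Zb a al" | "barg (Zb a al) = Z a al" | "barg T = T"

definition mat_alph :: "nat \<Rightarrow> gen set" where
  "mat_alph n = {Z a al | a al. a \<in> {1..n} \<and> al \<in> {1..n}}"
definition bar_alph :: "nat \<Rightarrow> gen set" where
  "bar_alph n = {Zb a al | a al. a \<in> {1..n} \<and> al \<in> {1..n}}"
definition gl_alph :: "nat \<Rightarrow> gen set" where
  "gl_alph n = insert T (mat_alph n)"

definition words :: "gen set \<Rightarrow> nat \<Rightarrow> gen list set" where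
  "words A d = {w. length w = d \<and> set w \<subseteq> A}"

section \<open>Free noncommutative algebra over gen (coefficient functions on words)\<close>

type_synonym poly = "gen list \<Rightarrow> complex"

definition pzero :: poly where "pzero w = 0"
definition pone :: poly where "pone w = (if w = [] then 1 else 0)"
definition pword :: "gen list \<Rightarrow> poly" where "pword u w = (if w = u then 1 else 0)"
definition padd :: "poly \<Rightarrow> poly \<Rightarrow> poly" where "padd p r w = p w + r w"
definition psub :: "poly \<Rightarrow> poly \<Rightarrow> poly" where "psub p r w = p w - r w"
definition psc :: "complex \<Rightarrow> poly \<Rightarrow> poly" where "psc c p w = c * p w"
definition pmul :: "poly \<Rightarrow> poly \<Rightarrow> poly" where
  "pmul p r w = (\<Sum>i\<le>length w. p (take i w) * r (drop i w))"
definition pfin :: "poly \<Rightarrow> bool" where "pfin p = finite {w. p w \<noteq> 0}"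
definition psum :: "'a set \<Rightarrow> ('a \<Rightarrow> poly) \<Rightarrow> poly" where
  "psum A F w = (\<Sum>x\<in>A. F x w)"
definition psum_list :: "poly list \<Rightarrow> poly" where "psum_list ps = foldr padd ps pzero"
definition pprod_list :: "poly list \<Rightarrow> poly" where "pprod_list ps = foldr pmul ps pone"

text \<open>Algebra homomorphism extending a map on generators (applied to finitely supported p).\<close>
definition pextend :: "(gen \<Rightarrow> poly) \<Rightarrow> poly \<Rightarrow> poly" where
  "pextend \<phi> p = psum {w. p w \<noteq> 0} (\<lambda>w. psc (p w) (pprod_list (map \<phi> w)))"

definition pstar :: "poly \<Rightarrow> poly" where "pstar p w = cnj (p (rev (map barg w)))"

inductive_set ideal :: "poly set \<Rightarrow> poly set" for Rel where
  zero: "pzero \<in> ideal Rel"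
| add: "p \<in> ideal Rel \<Longrightarrow> r \<in> ideal Rel \<Longrightarrow> padd p r \<in> ideal Rel"
| gen: "r \<in> Rel \<Longrightarrow> pfin a \<Longrightarrow> pfin b \<Longrightarrow> pmul (pmul a r) b \<in> ideal Rel"

definition congr :: "poly set \<Rightarrow> poly \<Rightarrow> poly \<Rightarrow> bool" where
  "congr Rel p r \<longleftrightarrow> psub p r \<in> ideal Rel"

definition rel_mat :: "nat \<Rightarrow> real \<Rightarrow> poly set" where
  "rel_mat n q = {r. \<exists>a b al be. a \<in> {1..n} \<and> b \<in> {1..n} \<and> al \<in> {1..n} \<and> be \<in> {1..n} \<and>
     (((a = b \<and> al < be) \<or> (a < b \<and> al = be)) \<and>
        r = psub (pword [Z a al, Z b be]) (psc (of_real q) (pword [Z b be, Z a al]))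
    \<or> (al < be \<and> b < a \<and> r = psub (pword [Z a al, Z b be]) (pword [Z b be, Z a al]))
    \<or> (al < be \<and> a < b \<and> r = psub (psub (pword [Z a al, Z b be]) (pword [Z b be, Z a al]))
                              (psc (of_real (q - inverse q)) (pword [Z a be, Z b al]))))}"

definition ninv :: "nat \<Rightarrow> (nat \<Rightarrow> nat) \<Rightarrow> nat" where
  "ninv k s = card {(i, j). i < j \<and> j < k \<and> s j < s i}"

definition qminor :: "real \<Rightarrow> nat set \<Rightarrow> nat set \<Rightarrow> poly" where
  "qminor q A B = (let k = card A; as = sorted_list_of_set A; bs = sorted_list_of_set B in
     psum {s. s permutes {..<k}}
       (\<lambda>s. psc ((- of_real q) ^ ninv k s) (pword (map (\<lambda>i. Z (as ! i) (bs ! s i)) [0..<k]))))"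

definition qdet :: "nat \<Rightarrow> real \<Rightarrow> poly" where "qdet n q = qminor q {1..n} {1..n}"
definition qcof :: "nat \<Rightarrow> real \<Rightarrow> nat \<Rightarrow> nat \<Rightarrow> poly" where
  "qcof n q a al = qminor q ({1..n} - {a}) ({1..n} - {al})"

text \<open>C[GL_n]_q: adjoin T with T det = det T = 1 (localization at the central det).\<close>
definition rel_gl :: "nat \<Rightarrow> real \<Rightarrow> poly set" where
  "rel_gl n q = rel_mat n q \<union> {psub (pmul (pword [T]) (qdet n q)) pone, psub (pmul (qdet n q) (pword [T])) pone}"

fun psi_gen :: "nat \<Rightarrow> real \<Rightarrow> gen \<Rightarrow> poly" where
  "psi_gen n q (Z a al) = pword [Z a al]"
| "psi_gen n q (Zb a al) = psc ((- of_real q) powi (int a + int al - 2 * int n)) (pmul (pword [T]) (qcof n q a al))"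
| "psi_gen n q T = pword [T]"

fun theta_gen :: "nat \<Rightarrow> real \<Rightarrow> gen \<Rightarrow> poly" where
  "theta_gen n q (Z a al) = psc (of_real q powi (int al - int n)) (pword [Z a al])"
| "theta_gen n q T = psc (inverse (\<Prod>al\<in>{1..n}. of_real q powi (int al - int n))) (pword [T])"
| "theta_gen n q (Zb a al) = pword [Zb a al]"

fun cop :: "nat \<Rightarrow> gen list \<Rightarrow> (gen list \<times> gen list) list" where
  "cop n [] = [([], [])]"
| "cop n (Z a al # w) = concat (map (\<lambda>j. map (\<lambda>(u, v). (Z a j # u, Z j al # v)) (cop n w)) [1..<n+1])"
| "cop n (T # w) = map (\<lambda>(u, v). (T # u, T # v)) (cop n w)"
| "cop n (Zb a al # w) = []"

definition lin :: "(gen list \<Rightarrow> complex) \<Rightarrow> poly \<Rightarrow> complex" where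
  "lin h p = (\<Sum>w\<in>{w. p w \<noteq> 0}. p w * h w)"

text \<open>h: linear functional on C[GL_n]_q (given by its values on words over the GL alphabet;
  normalised to 0 on other words), h(1)=1, left and right invariant.\<close>
definition haar_cond :: "nat \<Rightarrow> real \<Rightarrow> (gen list \<Rightarrow> complex) \<Rightarrow> bool" where
  "haar_cond n q h \<longleftrightarrow> h [] = 1
     \<and> (\<forall>w. \<not> set w \<subseteq> gl_alph n \<longrightarrow> h w = 0)
     \<and> (\<forall>p \<in> ideal (rel_gl n q). pfin p \<longrightarrow> lin h p = 0)
     \<and> (\<forall>w. set w \<subseteq> gl_alph n \<longrightarrow>
          congr (rel_gl n q) (psum_list (map (\<lambda>(u, v). psc (h v) (pword u)) (cop n w))) (psc (h w) pone)
        \<and> congr (rel_gl n q) (psum_list (map (\<lambda>(u, v). psc (h u) (pword v)) (cop n w))) (psc (h w) pone))"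

definition haar :: "nat \<Rightarrow> real \<Rightarrow> gen list \<Rightarrow> complex" where
  "haar n q = (THE h. haar_cond n q h)"

text \<open>int_{S(U)_q} g dnu = h(theta(g)), g in Pol(S(U))_q = C[GL_n]_q.\<close>
definition integral_S :: "nat \<Rightarrow> real \<Rightarrow> poly \<Rightarrow> complex" where
  "integral_S n q g = lin (haar n q) (pextend (theta_gen n q) g)"

section \<open>Completed tensor product C[Mat]^op (x) C[Mat-bar], kernel C_q\<close>

type_synonym tens = "gen list \<times> gen list \<Rightarrow> complex"

definition tone :: tens where "tone uv = (if uv = ([], []) then 1 else 0)"
definition tadd :: "tens \<Rightarrow> tens \<Rightarrow> tens" where "tadd X Y uv = X uv + Y uv"
definition tsc :: "complex \<Rightarrow> tens \<Rightarrow> tens" where "tsc c X uv = c * X uv"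
definition tsum :: "'a set \<Rightarrow> ('a \<Rightarrow> tens) \<Rightarrow> tens" where "tsum A F uv = (\<Sum>x\<in>A. F x uv)"
definition tpure :: "poly \<Rightarrow> poly \<Rightarrow> tens" where "tpure p r uv = p (fst uv) * r (snd uv)"
text \<open>(u1 (x) v1)(u2 (x) v2) = (u2 u1) (x) (v1 v2) (opposite multiplication in the first factor).\<close>
definition tmul :: "tens \<Rightarrow> tens \<Rightarrow> tens" where
  "tmul X Y uv = (\<Sum>i\<le>length (fst uv). \<Sum>j\<le>length (snd uv).
      X (drop i (fst uv), take j (snd uv)) * Y (take i (fst uv), drop j (snd uv)))"
definition tinv :: "tens \<Rightarrow> tens" where
  "tinv X = (THE Y. tmul X Y = tone \<and> tmul Y X = tone)"

definition chi :: "nat \<Rightarrow> real \<Rightarrow> nat \<Rightarrow> tens" where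
  "chi n q k = tsum {(J1, J2). J1 \<subseteq> {1..n} \<and> J2 \<subseteq> {1..n} \<and> card J1 = k \<and> card J2 = k}
     (\<lambda>(J1, J2). tpure (qminor q J2 J1) (pstar (qminor q J2 J1)))"

definition Cq :: "nat \<Rightarrow> real \<Rightarrow> tens" where
  "Cq n q = foldr (\<lambda>j acc. tmul (tinv (tadd tone
       (tsum {1..n} (\<lambda>k. tsc ((- (of_real q ^ (2 * j))) ^ k) (chi n q k))))) acc) [0..<n] tone"

definition rhs_comp :: "nat \<Rightarrow> real \<Rightarrow> poly \<Rightarrow> nat \<Rightarrow> nat \<Rightarrow> poly" where
  "rhs_comp n q f d1 d2 = psum (words (mat_alph n) d1 \<times> words (bar_alph n) d2)
     (\<lambda>(u, v). psc (Cq n q (u, v) * integral_S n q (pextend (psi_gen n q) (pmul (pword v) f))) (pword u))"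

end

theory Submission
  imports Defs "HOL-Combinatorics.Multiset_Permutations" "HOL-Library.Product_Lexorder"
begin

text \<open>The exchange relations of the generators say that the matrix of words \<open>T(i,j)\<close> commutes with a
  symmetric Hecke braiding. This yields a basis of ordered monomials, and with it that \<open>det\<close> is not a
  zero divisor; the Haar functional \<open>h\<close> is given by orthogonal projections onto determinant-invariant
  vectors.

  Let \<open>S\<close> be the inverse of the matrix \<open>T\<close> of words (the antipode). Invariance of \<open>h\<close> has the strong form
  \<open>\<Sum>\<^sub>m T(k,m) h(S(i,r) T(m,l)) = \<Sum>\<^sub>j T(j,r) h(S(i,j) T(k,l))\<close>. Pairing with the kernel replaces \<open>z \<otimes> z\<^sup>*\<close>
  by a matrix \<open>tau\<close> of operators which again satisfies the exchange relations, and \<open>\<chi>\<^sub>k\<close> by the sum of its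
  principal quantum minors of size \<open>k\<close>. By the quantum MacMahon master theorem the inverse factors of
  \<open>C\<^sub>q\<close> become complete symmetric traces, so that \<open>C\<^sub>q\<close> becomes a weighted sum over ordered monomials in
  \<open>tau\<close>. Applying strong invariance to each monomial, once to \<open>T\<close> and once to its coordinate functional,
  and resumming the basis expansion leaves
  \<open>\<Sum>\<^sub>p q\<^bsup>2(m-p)\<^esup> S(m,p) T(p,l) = \<delta>\<^bsub>ml\<^esub>\<close>.\<close>

section \<open>Exchange relations on words\<close>

text \<open>The working notion is \<open>RC\<close>: a function of two words that commutes with the
  braiding. Such functions amount to linear maps on the homogeneous parts of the algebra, so an
  identity proved once for words in the generators holds for every \<open>RC\<close> function: for
  matrices of operators such as \<open>tau\<close>, for the coordinate functionals, for the
  antipode. Because the braiding is a real symmetric matrix, rows and columns can be exchanged, and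
  orthogonal projections onto subspaces stable under it are \<open>RC\<close> again. All structure
  is therefore built over the reals; the complex coefficients of \<open>f\<close> enter at the end,
  by linearity. The obstacle is the localization: the integral lives where \<open>det\<close> is
  invertible, the assertion in the algebra without the inverse. Regularity of \<open>det\<close> is
  used twice, to make the projections in different degrees fit together and to bring identities back
  from the localization. The weights have two sources, \<open>q^(2 j)\<close> in the factors of
  \<open>C_q\<close> and \<open>q^(al - n)\<close> in \<open>theta\<close>. Together they produce
  \<open>q^(2 (m - p))\<close>, which is the square of the antipode and makes the last sum
  collapse.\<close>

definition swp :: "nat \<Rightarrow> 'a list \<Rightarrow> 'a list" where
  "swp k i = i[k := i ! Suc k, Suc k := i ! k]"

lemma length_swp [simp]: "length (swp k i) = length i"
  by (simp add: swp_def)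

lemma nth_swp: "Suc k < length i \<Longrightarrow> l < length i \<Longrightarrow>
    swp k i ! l = (if l = k then i ! Suc k else if l = Suc k then i ! k else i ! l)"
  by (auto simp: swp_def nth_list_update)

lemma swp_nth [simp]:
  "Suc k < length i \<Longrightarrow> swp k i ! k = i ! Suc k"
  "Suc k < length i \<Longrightarrow> swp k i ! Suc k = i ! k"
  by (simp_all add: nth_swp)

lemma mset_swp [simp]: "Suc k < length i \<Longrightarrow> mset (swp k i) = mset i"
  using mset_swap[of k i "Suc k"] unfolding swp_def by (simp add: list_update_swap)

lemma set_swp [simp]: "Suc k < length i \<Longrightarrow> set (swp k i) = set i"
  using mset_swp mset_eq_setD by metis

lemma distinct_swp [simp]: "Suc k < length i \<Longrightarrow> distinct (swp k i) = distinct i"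
  using mset_swp mset_eq_imp_distinct_iff by metis

lemma swp_swp [simp]: "Suc k < length i \<Longrightarrow> swp k (swp k i) = i"
  by (rule nth_equalityI) (auto simp: nth_swp)

lemma swp_same: "Suc k < length i \<Longrightarrow> i ! k = i ! Suc k \<Longrightarrow> swp k i = i"
  by (rule nth_equalityI) (auto simp: nth_swp)

lemma swp_0_Cons [simp]: "swp 0 (a # b # i) = b # a # i"
  by (simp add: swp_def)

lemma swp_Suc_Cons [simp]: "swp (Suc k) (a # i) = a # swp k i"
  by (simp add: swp_def)

lemma swp_append2: "swp (length i + k) (i @ j) = i @ swp k j"
  by (induction i) auto

lemma zip_swp: "Suc k < length i \<Longrightarrow> length j = length i \<Longrightarrow> zip (swp k i) (swp k j) = swp k (zip i j)"
  by (rule nth_equalityI) (auto simp: nth_swp)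

fun invs :: "'a::linorder list \<Rightarrow> nat" where
  "invs [] = 0"
| "invs (x # xs) = length (filter (\<lambda>y. y < x) xs) + invs xs"

lemma length_filter_mset: "mset xs = mset ys \<Longrightarrow> length (filter P xs) = length (filter P ys)"
  by (metis mset_filter size_mset)

lemma invs_swp: "Suc k < length i \<Longrightarrow> i ! k < i ! Suc k \<Longrightarrow> invs (swp k i) = Suc (invs i)"
proof (induction k arbitrary: i)
  case 0
  then obtain a b i' where "i = a # b # i'" by (metis Suc_length_conv less_Suc_eq_0_disj Suc_less_eq length_Suc_conv list.exhaust list.size(3) not_less_zero)
  with 0 show ?case by auto
next
  case (Suc k)
  then obtain a i' where i: "i = a # i'" by (cases i) auto
  with Suc have "invs (swp k i') = Suc (invs i')" by auto
  moreover have "length (filter (\<lambda>y. y < a) (swp k i')) = length (filter (\<lambda>y. y < a) i')"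
    using Suc.prems i by (intro length_filter_mset) simp
  ultimately show ?case by (simp add: i)
qed

lemma invs_sorted: "sorted i \<Longrightarrow> invs i = 0"
  by (induction i) (auto simp: filter_empty_conv)

lemma unsorted_descent: "\<not> sorted i \<Longrightarrow> \<exists>k. Suc k < length i \<and> i ! k > i ! Suc k"
  for i :: "'a::linorder list"
  by (metis linorder_not_less sorted_iff_nth_Suc)

section \<open>The braiding on words and its eigenvectors\<close>

locale qp =
  fixes q :: real and n :: nat
  assumes q0: "0 < q" and q1: "q < 1" and n1: "1 \<le> n"
begin

text \<open>Diagonal of the Hecke braiding. On two different letters, the increasing order first,
  the block of the braiding has rows \<open>q - 1 / q, 1\<close> and \<open>1, 0\<close>, so its
  eigenvalues are \<open>q\<close> and \<open>- (1 / q)\<close>.\<close>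

definition cc :: "'b::linorder \<Rightarrow> 'b \<Rightarrow> real" where
  "cc a b = (if a = b then q else if a < b then q - 1 / q else 0)"

text \<open>The matrix of the Hecke-type braiding on the tensor square is symmetric, so \<open>RR k\<close>
  is its action both on row and on column indices.\<close>
definition RR :: "nat \<Rightarrow> ('b::linorder list \<Rightarrow> 'a::real_vector) \<Rightarrow> 'b list \<Rightarrow> 'a" where
  "RR k f i = cc (i ! k) (i ! Suc k) *\<^sub>R f i + (if i ! k = i ! Suc k then 0 else f (swp k i))"

text \<open>The relations \<open>R T T = T T R\<close> at all adjacent positions. This is the
  condition for \<open>\<Theta>\<close> to factor through the presented algebra:
  \<open>RC_Tw\<close> gives it for words in the generators, \<open>kills_wordfn\<close> the
  converse for functionals.\<close>

definition RC :: "('b::linorder list \<Rightarrow> 'c::linorder list \<Rightarrow> 'a::real_vector) \<Rightarrow> bool" where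
  "RC \<Theta> \<longleftrightarrow> (\<forall>i j k. length i = length j \<longrightarrow> Suc k < length i \<longrightarrow>
     RR k (\<lambda>i. \<Theta> i j) i = RR k (\<lambda>j. \<Theta> i j) j)"

lemma RCD: "RC \<Theta> \<Longrightarrow> length i = length j \<Longrightarrow> Suc k < length i \<Longrightarrow>
     RR k (\<lambda>i. \<Theta> i j) i = RR k (\<lambda>j. \<Theta> i j) j"
  by (auto simp: RC_def)

lemma RC_transpose: "RC \<Theta> \<Longrightarrow> RC (\<lambda>i j. \<Theta> j i)"
  unfolding RC_def by metis

text \<open>The eigenvalues of the Hecke braiding: \<open>q\<close> on symmetric,
  \<open>- (1 / q)\<close> on antisymmetric tensors.\<close>

definition kap :: "real set" where "kap = {q, - (1 / q)}"

lemma kap_nz: "\<kappa> \<in> kap \<Longrightarrow> \<kappa> \<noteq> 0"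
  using q0 by (auto simp: kap_def)

lemma kap_quad: "\<kappa> \<in> kap \<Longrightarrow> \<kappa> - (q - 1 / q) = 1 / \<kappa>"
  using q0 by (auto simp: kap_def)

lemma kap_sq: "\<kappa> \<in> kap \<Longrightarrow> \<kappa> * \<kappa> = \<kappa> * (q - 1 / q) + 1"
  using kap_quad[of \<kappa>] kap_nz[of \<kappa>] by (simp add: field_simps)

text \<open>Coefficients of the q-symmetric or q-antisymmetric tensor of a given content, equal to 1
  on the sorted word unless they vanish identically. For \<open>\<kappa> = - (1 / q)\<close> an
  inversion costs \<open>- q\<close>, the sign in a quantum minor, and repeated letters are
  excluded.\<close>

definition eps :: "real \<Rightarrow> 'b::linorder list \<Rightarrow> real" where
  "eps \<kappa> i = (if \<kappa> = q \<or> distinct i then (1 / \<kappa>) ^ invs i else 0)"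

definition eig :: "real \<Rightarrow> nat \<Rightarrow> ('b::linorder list \<Rightarrow> 'a::real_vector) \<Rightarrow> bool" where
  "eig \<kappa> d f \<longleftrightarrow> (\<forall>i k. length i = d \<longrightarrow> Suc k < d \<longrightarrow> RR k f i = \<kappa> *\<^sub>R f i)"

lemma eigD: "eig \<kappa> d f \<Longrightarrow> length i = d \<Longrightarrow> Suc k < d \<Longrightarrow> RR k f i = \<kappa> *\<^sub>R f i"
  by (auto simp: eig_def)

lemma neg_kap_not_q: "- (1 / q) \<noteq> q"
proof -
  have "- (1 / q) < 0" using q0 by simp
  with q0 show ?thesis by linarith
qed

lemma eig_equal:
  assumes "eig \<kappa> d f" "\<kappa> \<in> kap" "\<kappa> \<noteq> q" "length i = d" "Suc k < d" "i ! k = i ! Suc k"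
  shows "f i = 0"
proof -
  have "q *\<^sub>R f i = \<kappa> *\<^sub>R f i"
    using eigD[OF assms(1,4,5)] assms(6) by (simp add: RR_def cc_def)
  then have "(q - \<kappa>) *\<^sub>R f i = 0" by (simp add: scaleR_diff_left)
  with assms(3) show ?thesis by simp
qed

lemma eig_swp:
  assumes "eig \<kappa> d f" "\<kappa> \<in> kap" "length i = d" "Suc k < d" "i ! k < i ! Suc k"
  shows "f (swp k i) = (1 / \<kappa>) *\<^sub>R f i"
proof -
  have "(q - 1 / q) *\<^sub>R f i + f (swp k i) = \<kappa> *\<^sub>R f i"
    using eigD[OF assms(1,3,4)] assms(5) by (auto simp: RR_def cc_def split: if_splits)
  then have "f (swp k i) = (\<kappa> - (q - 1 / q)) *\<^sub>R f i" by (simp add: scaleR_diff_left algebra_simps)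
  then show ?thesis by (simp only: kap_quad[OF assms(2)])
qed

text \<open>One inversion at a time: undoing a descent costs \<open>1 / \<kappa>\<close>. Equal
  neighbours in the antisymmetric case force the value 0, since the braiding would act there by two
  different scalars.\<close>

lemma eig_sort:
  assumes "eig \<kappa> d f" "\<kappa> \<in> kap" "length i = d"
  shows "f i = eps \<kappa> i *\<^sub>R f (sort i)"
  using assms(3)
proof (induction "invs i" arbitrary: i rule: less_induct)
  case less
  show ?case
  proof (cases "sorted i")
    case True
    show ?thesis
    proof (cases "\<kappa> = q \<or> distinct i")
      case True
      then show ?thesis using \<open>sorted i\<close> by (simp add: eps_def invs_sorted sort_key_id_if_sorted)
    next
      case False
      then have "\<not> sorted_wrt (<) i" using strict_sorted_iff by blast
      then obtain k where k: "Suc k < length i" "\<not> i ! k < i ! Suc k"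
        using sorted_wrt_iff_nth_Suc_transp[of "(<)" i] by auto
      moreover have "i ! k \<le> i ! Suc k" using \<open>sorted i\<close> k by (simp add: sorted_iff_nth_Suc)
      ultimately have "i ! k = i ! Suc k" by simp
      then have "f i = 0" using eig_equal[OF assms(1,2)] False k less.prems by auto
      then show ?thesis using False by (simp add: eps_def)
    qed
  next
    case False
    then obtain k where k: "Suc k < length i" "i ! k > i ! Suc k" using unsorted_descent by blast
    define j where "j = swp k i"
    have j: "length j = d" "i = swp k j" "j ! k < j ! Suc k" "Suc k < length j"
      using k less.prems by (auto simp: j_def nth_swp)
    have inv: "invs i = Suc (invs j)" using invs_swp[OF j(4,3)] j(2) by simp
    have "f i = (1 / \<kappa>) *\<^sub>R f j" using eig_swp[OF assms(1,2) j(1) _ j(3)] j by simp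
    also have "f j = eps \<kappa> j *\<^sub>R f (sort j)" using less.hyps[of j] inv j by simp
    also have "sort j = sort i" unfolding j_def using k by (intro properties_for_sort) simp_all
    also have "eps \<kappa> j = \<kappa> * eps \<kappa> i"
      using inv kap_nz[OF assms(2)] k j(2) j(4) distinct_swp[of k j] by (auto simp: eps_def)
    finally show ?thesis using kap_nz[OF assms(2)] by simp
  qed
qed

lemma eig_eps: "\<kappa> \<in> kap \<Longrightarrow> eig \<kappa> d (eps \<kappa>)"
  unfolding eig_def
proof (intro allI impI)
  fix i :: "'b::linorder list" and k assume \<kappa>: "\<kappa> \<in> kap" and i: "length i = d" "Suc k < d"
  have *: "eps \<kappa> (swp k j) = (1 / \<kappa>) * eps \<kappa> j" if "j ! k < j ! Suc k" "length j = d" for j :: "'b list"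
    using that i invs_swp[of k j] by (auto simp: eps_def)
  consider "i ! k = i ! Suc k" | "i ! k < i ! Suc k" | "i ! k > i ! Suc k" by fastforce
  then show "RR k (eps \<kappa>) i = \<kappa> *\<^sub>R eps \<kappa> i"
  proof cases
    case 1
    then have "\<not> distinct i" using i by (metis Suc_lessD n_not_Suc_n nth_eq_iff_index_eq)
    then show ?thesis using 1 by (auto simp: RR_def cc_def eps_def)
  next
    case 2
    have "(q - 1 / q) + 1 / \<kappa> = \<kappa>" using kap_quad[OF \<kappa>] by simp
    then have "((q - 1 / q) + 1 / \<kappa>) * eps \<kappa> i = \<kappa> * eps \<kappa> i" by simp
    then show ?thesis using 2 *[of i] i by (auto simp: RR_def cc_def algebra_simps)
  next
    case 3
    then have "eps \<kappa> (swp k (swp k i)) = (1 / \<kappa>) * eps \<kappa> (swp k i)"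
      using i by (intro *) (auto simp: nth_swp)
    then have "eps \<kappa> (swp k i) = \<kappa> * eps \<kappa> i" using i kap_nz[OF \<kappa>] by simp
    then show ?thesis using 3 by (auto simp: RR_def cc_def)
  qed
qed

lemma RR_sum_symmetric:
  assumes "Suc k < size m"
  shows "(\<Sum>j\<in>permutations_of_multiset m. f j *\<^sub>R RR k g j)
       = (\<Sum>j\<in>permutations_of_multiset m. RR k f j *\<^sub>R g j)"
proof -
  let ?P = "permutations_of_multiset m"
  have len: "j \<in> ?P \<Longrightarrow> Suc k < length j" for j
    using assms by (auto dest: permutations_of_multisetD)
  have "(\<Sum>j\<in>?P. if j ! k = j ! Suc k then 0 else f j *\<^sub>R g (swp k j))
     = (\<Sum>j\<in>?P. if j ! k = j ! Suc k then 0 else f (swp k j) *\<^sub>R g j)"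
    using assms by (intro sum.reindex_bij_witness[of _ "swp k" "swp k"])
      (auto simp: permutations_of_multiset_def)
  moreover have "f j *\<^sub>R RR k g j = cc (j ! k) (j ! Suc k) *\<^sub>R f j *\<^sub>R g j
      + (if j ! k = j ! Suc k then 0 else f j *\<^sub>R g (swp k j))" for j
    by (simp add: RR_def algebra_simps)
  moreover have "RR k f j *\<^sub>R g j = cc (j ! k) (j ! Suc k) *\<^sub>R f j *\<^sub>R g j
      + (if j ! k = j ! Suc k then 0 else f (swp k j) *\<^sub>R g j)" for j
    by (simp add: RR_def algebra_simps)
  ultimately show ?thesis by (simp add: sum.distrib)
qed

text \<open>For \<open>\<kappa> = - (1 / q)\<close> a quantum minor with rows \<open>i\<close> and
  columns \<open>m\<close>, see \<open>minor_EE\<close>; for \<open>\<kappa> = q\<close> its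
  symmetric counterpart.\<close>

definition EE :: "real \<Rightarrow> ('b::linorder list \<Rightarrow> 'c::linorder list \<Rightarrow> 'a::real_vector) \<Rightarrow> 'b list \<Rightarrow> 'c multiset \<Rightarrow> 'a" where
  "EE \<kappa> \<Theta> i m = (\<Sum>j\<in>permutations_of_multiset m. eps \<kappa> j *\<^sub>R \<Theta> i j)"

lemma RR_sum: "finite A \<Longrightarrow> RR k (\<lambda>i. \<Sum>j\<in>A. c j *\<^sub>R \<Theta> i j) i = (\<Sum>j\<in>A. c j *\<^sub>R RR k (\<lambda>i. \<Theta> i j) i)"
  by (simp add: RR_def scaleR_sum_right sum.distrib algebra_simps)

text \<open>\<open>RC\<close> moves the braiding from the rows to the columns, symmetry moves it on
  to the coefficients \<open>eps\<close>, and these form an eigenvector.\<close>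

lemma eig_EE:
  assumes "RC \<Theta>" "\<kappa> \<in> kap" "size m = d"
  shows "eig \<kappa> d (\<lambda>i. EE \<kappa> \<Theta> i m)"
  unfolding eig_def
proof (intro allI impI)
  fix i :: "'a list" and k assume i: "length i = d" "Suc k < d"
  let ?P = "permutations_of_multiset m"
  have len: "length j = d" if "j \<in> ?P" for j using that assms(3) by (auto dest: permutations_of_multisetD)
  have "RR k (\<lambda>i. EE \<kappa> \<Theta> i m) i = (\<Sum>j\<in>?P. eps \<kappa> j *\<^sub>R RR k (\<lambda>i. \<Theta> i j) i)"
    unfolding EE_def by (rule RR_sum) simp
  also have "\<dots> = (\<Sum>j\<in>?P. eps \<kappa> j *\<^sub>R RR k (\<lambda>j. \<Theta> i j) j)"
    using i len by (intro sum.cong refl arg_cong2[where f="scaleR"] RCD[OF assms(1)]) auto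
  also have "\<dots> = (\<Sum>j\<in>?P. RR k (eps \<kappa>) j *\<^sub>R \<Theta> i j)"
    using assms(3) i by (intro RR_sum_symmetric) simp
  also have "\<dots> = \<kappa> *\<^sub>R EE \<kappa> \<Theta> i m"
    unfolding EE_def scaleR_sum_right
    using eigD[OF eig_eps[OF assms(2)] len i(2)] by (intro sum.cong refl) simp
  finally show "RR k (\<lambda>i. EE \<kappa> \<Theta> i m) i = \<kappa> *\<^sub>R EE \<kappa> \<Theta> i m" .
qed

lemma EE_sort:
  assumes "RC \<Theta>" "\<kappa> \<in> kap" "size m = length i"
  shows "EE \<kappa> \<Theta> i m = eps \<kappa> i *\<^sub>R EE \<kappa> \<Theta> (sort i) m"
  using eig_sort[OF eig_EE[OF assms(1,2,3)] assms(2) refl] by simp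

definition NN :: "real \<Rightarrow> 'b::linorder multiset \<Rightarrow> real" where
  "NN \<kappa> m = (\<Sum>j\<in>permutations_of_multiset m. (eps \<kappa> j)\<^sup>2)"

lemma sort_perm: "j \<in> permutations_of_multiset m \<Longrightarrow> sort j = sorted_list_of_multiset m"
  by (metis permutations_of_multisetD sorted_list_of_multiset_mset)

text \<open>Both sides are the double sum of \<open>eps \<kappa> i * eps \<kappa> j\<close> times
  \<open>\<Theta> i j\<close> over all arrangements, evaluated first by rows or first by
  columns.\<close>

lemma NN_EE_transpose:
  assumes "RC \<Theta>" "\<kappa> \<in> kap" "size m = size m'"
  shows "NN \<kappa> m *\<^sub>R EE \<kappa> \<Theta> (sorted_list_of_multiset m) m'
       = NN \<kappa> m' *\<^sub>R EE \<kappa> (\<lambda>i j. \<Theta> j i) (sorted_list_of_multiset m') m"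
proof -
  have *: "NN \<kappa> m *\<^sub>R EE \<kappa> \<Theta> (sorted_list_of_multiset m) m' =
     (\<Sum>i\<in>permutations_of_multiset m. \<Sum>j\<in>permutations_of_multiset m'. (eps \<kappa> i * eps \<kappa> j) *\<^sub>R \<Theta> i j)"
    if "RC \<Theta>" "size m = size m'" for \<Theta> :: "'x::linorder list \<Rightarrow> 'y::linorder list \<Rightarrow> 'c" and m m'
  proof -
    have "(\<Sum>j\<in>permutations_of_multiset m'. (eps \<kappa> i * eps \<kappa> j) *\<^sub>R \<Theta> i j)
        = (eps \<kappa> i)\<^sup>2 *\<^sub>R EE \<kappa> \<Theta> (sorted_list_of_multiset m) m'" if i: "i \<in> permutations_of_multiset m" for i
    proof -
      have "size m' = length i" using that i \<open>size m = size m'\<close> by (auto dest: permutations_of_multisetD)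
      from EE_sort[OF \<open>RC \<Theta>\<close> assms(2) this] sort_perm[OF i]
      have "eps \<kappa> i *\<^sub>R EE \<kappa> \<Theta> i m' = (eps \<kappa> i)\<^sup>2 *\<^sub>R EE \<kappa> \<Theta> (sorted_list_of_multiset m) m'"
        by (simp add: power2_eq_square)
      then show ?thesis by (simp add: EE_def scaleR_sum_right)
    qed
    then show ?thesis by (simp add: NN_def scaleR_sum_left)
  qed
  show ?thesis
    unfolding *[OF assms(1,3)] *[OF RC_transpose[OF assms(1)] assms(3)[symmetric]]
    by (subst sum.swap) (simp add: mult.commute)
qed

end

section \<open>Quantum matrices and quantum minors\<close>

definition Tw :: "(nat \<Rightarrow> nat \<Rightarrow> 'a::real_algebra_1) \<Rightarrow> nat list \<Rightarrow> nat list \<Rightarrow> 'a" where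
  "Tw t i j = prod_list (map2 t i j)"

lemma Tw_Nil [simp]: "Tw t [] [] = 1"
  and Tw_Cons [simp]: "Tw t (a # i) (b # j) = t a b * Tw t i j"
  by (simp_all add: Tw_def)

lemma Tw_append: "length i = length j \<Longrightarrow> Tw t (i @ i') (j @ j') = Tw t i j * Tw t i' j'"
  by (simp add: Tw_def)

lemma Tw_snoc: "length i = length j \<Longrightarrow> Tw t (i @ [a]) (j @ [b]) = Tw t i j * t a b"
  by (simp add: Tw_append)

lemma Tw_transpose: "length i = length j \<Longrightarrow> Tw (\<lambda>a b. t b a) i j = Tw t j i"
  by (induction i j rule: list_induct2) auto

lemma Tw_scale:
  "length i = length j \<Longrightarrow> Tw (\<lambda>a b. w a b *\<^sub>R t a b) i j = prod_list (map2 w i j) *\<^sub>R Tw t i j"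
  by (induction i j rule: list_induct2) auto

definition ix :: "nat \<Rightarrow> nat set" where "ix n = {1..n}"

lemma finite_ix [simp]: "finite (ix n)" and card_ix [simp]: "card (ix n) = n"
  by (simp_all add: ix_def)

lemma ix_iff: "a \<in> ix n \<longleftrightarrow> 1 \<le> a \<and> a \<le> n"
  by (simp add: ix_def)

definition LL :: "nat \<Rightarrow> nat \<Rightarrow> nat list set" where
  "LL n d = {l. length l = d \<and> set l \<subseteq> ix n}"

lemma finite_LL [simp]: "finite (LL n d)"
  unfolding LL_def using finite_lists_length_eq[of "ix n" d] by (simp add: conj_commute)

lemma LL_0 [simp]: "LL n 0 = {[]}"
  by (auto simp: LL_def)

lemma LL_Suc: "LL n (Suc d) = (\<lambda>(x, xs). x # xs) ` (ix n \<times> LL n d)"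
  by (force simp: LL_def length_Suc_conv image_iff)

lemma LL_length: "l \<in> LL n d \<Longrightarrow> length l = d"
  by (simp add: LL_def)

lemma LL_swp [simp]: "Suc k < d \<Longrightarrow> length l = d \<Longrightarrow> swp k l \<in> LL n d \<longleftrightarrow> l \<in> LL n d"
  by (simp add: LL_def)

lemma sum_LL_swp: "Suc k < d \<Longrightarrow> (\<Sum>l\<in>LL n d. f (swp k l)) = (\<Sum>l\<in>LL n d. f l)"
  by (rule sum.reindex_bij_witness[of _ "swp k" "swp k"]) (simp_all add: LL_length)

lemma sum_LL_Suc: "(\<Sum>l\<in>LL n (Suc d). f l) = (\<Sum>x\<in>ix n. \<Sum>l\<in>LL n d. f (x # l))"
  unfolding LL_Suc by (subst sum.reindex) (auto simp: inj_on_def sum.cartesian_product intro!: sum.cong)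

lemma sum_LL_add: "(\<Sum>l\<in>LL n (k + d). f l) = (\<Sum>x\<in>LL n k. \<Sum>l\<in>LL n d. f (x @ l))"
proof (induction k arbitrary: f)
  case (Suc k)
  then show ?case by (simp add: sum_LL_Suc)
qed simp

lemma Tw_prod:
  fixes t t' :: "nat \<Rightarrow> nat \<Rightarrow> 'a::real_algebra_1"
  assumes comm: "\<And>a b c d. t' a b * t c d = t c d * t' a b"
    and "length i = length j"
  shows "Tw (\<lambda>a b. \<Sum>c\<in>ix n. t a c * t' c b) i j = (\<Sum>k\<in>LL n (length i). Tw t i k * Tw t' k j)"
  using assms(2)
proof (induction i j rule: list_induct2)
  case (Cons a i b j)
  have cw: "t' c b * Tw t i k = Tw t i k * t' c b" if "length i = length k" for c b i k
    using that
  proof (induction i k rule: list_induct2)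
    case (Cons x xs y ys)
    have "t' c b * (t x y * Tw t xs ys) = t x y * (t' c b * Tw t xs ys)"
      by (simp add: comm mult.assoc[symmetric])
    then show ?case using Cons by (simp add: mult.assoc)
  qed simp
  have "(\<Sum>c\<in>ix n. t a c * t' c b) * (\<Sum>k\<in>LL n (length i). Tw t i k * Tw t' k j)
      = (\<Sum>c\<in>ix n. \<Sum>k\<in>LL n (length i). (t a c * Tw t i k) * (t' c b * Tw t' k j))"
    unfolding sum_product
  proof (intro sum.cong refl)
    fix c k assume "k \<in> LL n (length i)"
    then have "t' c b * Tw t i k = Tw t i k * t' c b" by (intro cw) (simp add: LL_def)
    then show "t a c * t' c b * (Tw t i k * Tw t' k j) = (t a c * Tw t i k) * (t' c b * Tw t' k j)"
      by (metis mult.assoc)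
  qed
  then show ?case using Cons by (simp add: sum_LL_Suc)
qed simp

section \<open>Matrices satisfying the exchange relations\<close>

context qp
begin

text \<open>The \<open>RC\<close> condition on words of length two. Entries outside the index range
  are 0, so that the relations hold for all indices without side conditions.\<close>

definition qm :: "(nat \<Rightarrow> nat \<Rightarrow> 'a::real_algebra_1) \<Rightarrow> bool" where
  "qm t \<longleftrightarrow> (\<forall>a b. a \<notin> ix n \<or> b \<notin> ix n \<longrightarrow> t a b = 0) \<and>
     (\<forall>a b c d. cc a b *\<^sub>R (t a c * t b d) + (if a = b then 0 else t b c * t a d)
              = cc c d *\<^sub>R (t a c * t b d) + (if c = d then 0 else t a d * t b c))"

lemma qm_zero: "qm t \<Longrightarrow> a \<notin> ix n \<or> b \<notin> ix n \<Longrightarrow> t a b = 0"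
  by (auto simp: qm_def)

lemma qm_transpose: "qm t \<Longrightarrow> qm (\<lambda>a b. t b a)"
  unfolding qm_def
  by (rule conjI, blast, intro allI) (metis (no_types, lifting))

lemma RR_Suc_Cons: "RR (Suc k) f (a # i) = RR k (\<lambda>i. f (a # i)) i"
  by (simp add: RR_def)

lemma RR_mult_left: "RR k (\<lambda>i. c * f i) i = c * RR k f i" for c :: "'a::real_algebra_1"
  by (simp add: RR_def algebra_simps)

lemma RC_Tw:
  assumes "qm t" shows "RC (Tw t)"
  unfolding RC_def
proof (intro allI impI)
  fix i j :: "nat list" and k assume "length i = length j" "Suc k < length i"
  then show "RR k (\<lambda>i. Tw t i j) i = RR k (\<lambda>j. Tw t i j) j"
  proof (induction k arbitrary: i j)
    case 0
    then obtain a b i' c d j' where ij: "i = a # b # i'" "j = c # d # j'"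
      by (cases i; cases j; cases "tl i"; cases "tl j") auto
    have *: "(cc a b *\<^sub>R (t a c * t b d) + (if a = b then 0 else t b c * t a d)) * Tw t i' j'
              = (cc c d *\<^sub>R (t a c * t b d) + (if c = d then 0 else t a d * t b c)) * Tw t i' j'"
      using assms unfolding qm_def by metis
    have "RR 0 (\<lambda>i. Tw t i j) i = (cc a b *\<^sub>R (t a c * t b d) + (if a = b then 0 else t b c * t a d)) * Tw t i' j'"
      by (simp add: RR_def ij distrib_right mult.assoc)
    moreover have "RR 0 (\<lambda>j. Tw t i j) j = (cc c d *\<^sub>R (t a c * t b d) + (if c = d then 0 else t a d * t b c)) * Tw t i' j'"
      by (simp add: RR_def ij distrib_right mult.assoc)
    ultimately show ?case using * by simp
  next
    case (Suc k)
    then obtain a i' c j' where ij: "i = a # i'" "j = c # j'" by (cases i; cases j) auto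
    with Suc show ?case by (simp add: RR_Suc_Cons RR_mult_left)
  qed
qed

lemma qmI_RC:
  assumes "\<And>a b. a \<notin> ix n \<or> b \<notin> ix n \<Longrightarrow> t a b = 0"
    and "\<And>a b c d. a \<in> ix n \<Longrightarrow> b \<in> ix n \<Longrightarrow> c \<in> ix n \<Longrightarrow> d \<in> ix n \<Longrightarrow>
     RR 0 (\<lambda>i. Tw t i [c, d]) [a, b] = RR 0 (\<lambda>j. Tw t [a, b] j) [c, d]"
  shows "qm t"
  unfolding qm_def
proof (intro conjI allI impI)
  fix a b c d
  show "cc a b *\<^sub>R (t a c * t b d) + (if a = b then 0 else t b c * t a d)
              = cc c d *\<^sub>R (t a c * t b d) + (if c = d then 0 else t a d * t b c)"
  proof (cases "a \<in> ix n \<and> b \<in> ix n \<and> c \<in> ix n \<and> d \<in> ix n")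
    case True
    then show ?thesis using assms(2)[of a b c d] by (simp add: RR_def cong: if_cong)
  next
    case False
    then have "t a c * t b d = 0" "t b c * t a d = 0" "t a d * t b c = 0"
      using assms(1) by (metis mult_zero_left mult_zero_right)+
    then show ?thesis by simp
  qed
qed (use assms(1) in auto)

text \<open>The braiding travels from the row index to the inner summation index, passes between the
  two factors because it is symmetric, and leaves at the column index. The coproduct
  \<open>Dt\<close> and the matrix \<open>tau\<close> are instances.\<close>

lemma qm_prod:
  assumes "qm t" "qm t'" and comm: "\<And>a b c d. t' a b * t c d = t c d * t' a b"
  shows "qm (\<lambda>a b. \<Sum>c\<in>ix n. t a c * t' c b)"
proof (rule qmI_RC, goal_cases)
  case (1 a b)
  then show ?case using qm_zero[OF assms(1)] qm_zero[OF assms(2)]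
    by (intro sum.neutral) (metis mult_zero_left mult_zero_right)
next
  case (2 a b c d)
  let ?u = "\<lambda>a b. \<Sum>c\<in>ix n. t a c * t' c b"
  have Tu: "Tw ?u i j = (\<Sum>k\<in>LL n 2. Tw t i k * Tw t' k j)" if "length i = 2" "length j = 2" for i j
    using Tw_prod[of t' t i j n, OF comm] that by simp
  have L: "k \<in> LL n 2 \<Longrightarrow> length k = 2" for k by (simp add: LL_def)
  have "RR 0 (\<lambda>i. Tw ?u i [c, d]) [a, b] = (\<Sum>k\<in>LL n 2. RR 0 (\<lambda>i. Tw t i k) [a, b] * Tw t' k [c, d])"
    by (simp add: RR_def Tu scaleR_sum_right distrib_right sum.distrib del: Tw_Cons)
  also have "\<dots> = (\<Sum>k\<in>LL n 2. RR 0 (\<lambda>k. Tw t [a, b] k) k * Tw t' k [c, d])"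
  proof (rule sum.cong[OF refl], rule arg_cong2[where f="(*)", OF _ refl])
    fix k assume "k \<in> LL n 2"
    then show "RR 0 (\<lambda>i. Tw t i k) [a, b] = RR 0 (\<lambda>k. Tw t [a, b] k) k"
      by (intro RCD[OF RC_Tw[OF assms(1)], of "[a, b]" k 0]) (simp_all add: L)
  qed
  also have "\<dots> = (\<Sum>k\<in>LL n 2. Tw t [a, b] k * RR 0 (\<lambda>k. Tw t' k [c, d]) k)"
  proof -
    have "(\<Sum>k\<in>LL n 2. if k ! 0 = k ! 1 then 0 else Tw t [a,b] (swp 0 k) * Tw t' k [c,d])
      = (\<Sum>k\<in>LL n 2. if k ! 0 = k ! 1 then 0 else Tw t [a,b] k * Tw t' (swp 0 k) [c,d])"
      by (subst sum_LL_swp[of 0 2, symmetric]) (auto simp: L intro!: sum.cong)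
    moreover have "RR 0 (\<lambda>k. Tw t [a, b] k) k * Tw t' k [c, d] = cc (k ! 0) (k ! 1) *\<^sub>R (Tw t [a, b] k * Tw t' k [c,d])
      + (if k ! 0 = k ! 1 then 0 else Tw t [a,b] (swp 0 k) * Tw t' k [c,d])" for k
      by (simp add: RR_def distrib_right)
    moreover have "Tw t [a, b] k * RR 0 (\<lambda>k. Tw t' k [c, d]) k = cc (k ! 0) (k ! 1) *\<^sub>R (Tw t [a, b] k * Tw t' k [c,d])
      + (if k ! 0 = k ! 1 then 0 else Tw t [a,b] k * Tw t' (swp 0 k) [c,d])" for k
      by (simp add: RR_def distrib_left)
    ultimately show ?thesis by (simp add: sum.distrib)
  qed
  also have "\<dots> = (\<Sum>k\<in>LL n 2. Tw t [a, b] k * RR 0 (\<lambda>j. Tw t' k j) [c, d])"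
  proof (rule sum.cong[OF refl], rule arg_cong2[where f="(*)", OF refl])
    fix k assume "k \<in> LL n 2"
    then show "RR 0 (\<lambda>k. Tw t' k [c, d]) k = RR 0 (\<lambda>j. Tw t' k j) [c, d]"
      by (intro RCD[OF RC_Tw[OF assms(2)], of k "[c, d]" 0]) (simp_all add: L)
  qed
  also have "\<dots> = RR 0 (\<lambda>j. Tw ?u [a, b] j) [c, d]"
    by (simp add: RR_def Tu scaleR_sum_right distrib_left sum.distrib del: Tw_Cons)
  finally show ?case .
qed

lemma qm_scale_rows:
  assumes "qm t" shows "qm (\<lambda>a b. w a *\<^sub>R t a b)"
proof (rule qmI_RC, goal_cases)
  case (2 a b c d)
  have "RR 0 (\<lambda>i. Tw t i [c, d]) [a, b] = RR 0 (\<lambda>j. Tw t [a, b] j) [c, d]"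
    by (rule RCD[OF RC_Tw[OF assms]]) auto
  then have "(w a * w b) *\<^sub>R RR 0 (\<lambda>i. Tw t i [c, d]) [a, b] = (w a * w b) *\<^sub>R RR 0 (\<lambda>j. Tw t [a, b] j) [c, d]"
    by simp
  then show ?case by (simp add: RR_def algebra_simps split: if_splits)
qed (simp add: qm_zero[OF assms])

definition nk :: real where "nk = - (1 / q)"

lemma nk_kap [simp]: "nk \<in> kap" and q_kap [simp]: "q \<in> kap"
  by (simp_all add: nk_def kap_def)

lemma inv_nk: "1 / nk = - q"
  by (simp add: nk_def)

lemma nk_neq_q [simp]: "nk \<noteq> q"
  using neg_kap_not_q by (simp add: nk_def)

lemma eps_nk_distinct: "distinct i \<Longrightarrow> eps nk i = (- q) ^ invs i"
  by (simp add: eps_def inv_nk)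

lemma eps_nk_not_distinct: "\<not> distinct i \<Longrightarrow> eps nk i = 0"
  by (simp add: eps_def)

end

lemma permutations_of_multiset_set: "finite J \<Longrightarrow> permutations_of_multiset (mset_set J) = permutations_of_set J"
  by (simp add: permutations_of_set_altdef)

lemma invs_map_strict_mono:
  "strict_mono_on A f \<Longrightarrow> set j \<subseteq> A \<Longrightarrow> invs (map f j) = invs j"
proof (induction j)
  case (Cons a j)
  have "f y < f a \<longleftrightarrow> y < a" if "y \<in> set j" for y
    using Cons.prems that by (intro strict_mono_on_less[OF Cons.prems(1)]) auto
  then have "filter (\<lambda>y. y < f a) (map f j) = map f (filter (\<lambda>y. y < a) j)"
    by (auto simp: filter_map comp_def intro!: arg_cong[where f="map f"] filter_cong)
  then show ?case using Cons by simp
qed simp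

lemma invs_snoc: "invs (i @ [a]) = invs i + length (filter (\<lambda>y. a < y) i)"
  by (induction i) auto

lemma length_filter_set: "distinct i \<Longrightarrow> length (filter P i) = card {y \<in> set i. P y}"
  by (simp add: distinct_card[symmetric])

lemma sum_permutations_Cons:
  assumes "finite J" "J \<noteq> {}"
  shows "(\<Sum>j\<in>permutations_of_set J. f j) = (\<Sum>c\<in>J. \<Sum>j\<in>permutations_of_set (J - {c}). f (c # j))"
proof -
  have "(\<Sum>j\<in>permutations_of_set J. f j) = (\<Sum>j\<in>(\<Union>c\<in>J. (#) c ` permutations_of_set (J - {c})). f j)"
    using permutations_of_set_nonempty[OF assms(2)] by simp
  also have "\<dots> = (\<Sum>c\<in>J. \<Sum>j\<in>(#) c ` permutations_of_set (J - {c}). f j)"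
    using assms by (intro sum.UNION_disjoint) auto
  also have "\<dots> = (\<Sum>c\<in>J. \<Sum>j\<in>permutations_of_set (J - {c}). f (c # j))"
    by (rule sum.cong[OF refl]) (simp add: sum.reindex comp_def)
  finally show ?thesis .
qed

lemma sum_permutations_rev: "(\<Sum>j\<in>permutations_of_set J. f j) = (\<Sum>j\<in>permutations_of_set J. f (rev j))"
  by (rule sum.reindex_bij_witness[of _ rev rev]) (auto simp: permutations_of_set_def)

lemma sum_permutations_snoc:
  assumes "finite J" "J \<noteq> {}"
  shows "(\<Sum>j\<in>permutations_of_set J. f j) = (\<Sum>c\<in>J. \<Sum>j\<in>permutations_of_set (J - {c}). f (j @ [c]))"
  by (subst sum_permutations_rev, subst sum_permutations_Cons[OF assms])
     (simp add: sum_permutations_rev[where f="\<lambda>j. f (j @ _)"])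

section \<open>Quantum minors, Laplace expansions and centrality of the determinant\<close>

context qp
begin

definition minor :: "(nat \<Rightarrow> nat \<Rightarrow> 'a::real_algebra_1) \<Rightarrow> nat list \<Rightarrow> nat set \<Rightarrow> 'a" where
  "minor t i J = (\<Sum>j\<in>permutations_of_set J. (- q) ^ invs j *\<^sub>R Tw t i j)"

lemma minor_EE: "finite J \<Longrightarrow> minor t i J = EE nk (Tw t) i (mset_set J)"
  unfolding minor_def EE_def permutations_of_multiset_set
  by (intro sum.cong refl) (auto simp: eps_nk_distinct permutations_of_set_def)

lemma minor_sort:
  assumes "qm t" "finite J" "card J = length i"
  shows "minor t i J = (if distinct i then (- q) ^ invs i *\<^sub>R minor t (sort i) J else 0)"
  using EE_sort[OF RC_Tw[OF assms(1)] nk_kap, of "mset_set J" i] assms(2,3)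
  by (auto simp: minor_EE eps_nk_distinct eps_nk_not_distinct)

text \<open>The increasing enumeration of \<open>J\<close> preserves inversions. Hence the norm
  depends on the cardinality alone and cancels in \<open>minor_transpose\<close>.\<close>

lemma NN_card:
  assumes "finite J"
  shows "NN nk (mset_set J) = (\<Sum>s\<in>permutations_of_set {..<card J}. ((- q) ^ invs s)\<^sup>2)"
proof -
  let ?l = "sorted_list_of_set J"
  have l: "length ?l = card J" "set ?l = J" "distinct ?l" using assms by auto
  have J: "J = (!) ?l ` {..<card J}" using l nth_image[of "card J" ?l] by (simp add: atLeast0LessThan)
  have sm: "strict_mono_on {..<card J} ((!) ?l)"
    using l strict_sorted_list_of_set[of J] by (auto simp: strict_mono_on_def sorted_wrt_iff_nth_less)
  have inj: "inj_on ((!) ?l) {..<card J}" using sm by (rule strict_mono_on_imp_inj_on)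
  have "NN nk (mset_set J) = (\<Sum>j\<in>permutations_of_set J. ((- q) ^ invs j)\<^sup>2)"
    unfolding NN_def permutations_of_multiset_set[OF assms]
    by (intro sum.cong refl) (auto simp: eps_nk_distinct permutations_of_set_def)
  also have "permutations_of_set J = map ((!) ?l) ` permutations_of_set {..<card J}"
    by (subst J, rule permutations_of_set_image_inj[OF inj])
  also have "(\<Sum>j\<in>\<dots>. ((- q) ^ invs j)\<^sup>2) = (\<Sum>s\<in>permutations_of_set {..<card J}. ((- q) ^ invs (map ((!) ?l) s))\<^sup>2)"
    by (subst sum.reindex) (auto intro!: inj_on_mapI inj_on_subset[OF inj] simp: permutations_of_set_def)
  also have "\<dots> = (\<Sum>s\<in>permutations_of_set {..<card J}. ((- q) ^ invs s)\<^sup>2)"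
    by (intro sum.cong refl) (auto simp: invs_map_strict_mono[OF sm] permutations_of_set_def)
  finally show ?thesis .
qed

lemma NN_nk_pos: "finite J \<Longrightarrow> NN nk (mset_set J) > 0"
  unfolding NN_card using q0 by (intro sum_pos) auto

text \<open>\<open>NN_EE_transpose\<close> with equal positive norms on both sides: expanding over
  column arrangements and over row arrangements agrees.\<close>

lemma minor_transpose:
  assumes "qm t" "finite I" "finite J" "card I = card J"
  shows "minor (\<lambda>a b. t b a) (sorted_list_of_set I) J = minor t (sorted_list_of_set J) I"
proof -
  have s: "sorted_list_of_multiset (mset_set A) = sorted_list_of_set A" for A :: "nat set"
    by (cases "finite A") (simp_all add: sorted_list_of_mset_set)
  have "NN nk (mset_set J) *\<^sub>R EE nk (Tw t) (sorted_list_of_set J) (mset_set I)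
     = NN nk (mset_set I) *\<^sub>R EE nk (\<lambda>i j. Tw t j i) (sorted_list_of_set I) (mset_set J)"
    using NN_EE_transpose[OF RC_Tw[OF assms(1)] nk_kap, of "mset_set J" "mset_set I"] assms(4) by (simp add: s)
  moreover have "NN nk (mset_set I) = NN nk (mset_set J)"
    unfolding NN_card[OF assms(2)] NN_card[OF assms(3)] assms(4) ..
  moreover have "EE nk (\<lambda>i j. Tw t j i) (sorted_list_of_set I) (mset_set J)
       = EE nk (Tw (\<lambda>a b. t b a)) (sorted_list_of_set I) (mset_set J)"
    unfolding EE_def permutations_of_multiset_set[OF assms(3)]
  proof (rule sum.cong[OF refl])
    fix j assume "j \<in> permutations_of_set J"
    then have "length (sorted_list_of_set I) = length j"
      using assms(4) by (simp add: length_finite_permutations_of_set)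
    then show "eps nk j *\<^sub>R Tw t j (sorted_list_of_set I) = eps nk j *\<^sub>R Tw (\<lambda>a b. t b a) (sorted_list_of_set I) j"
      by (simp add: Tw_transpose[where t=t])
  qed
  ultimately show ?thesis using NN_nk_pos[OF assms(3)] assms(2,3) by (simp add: minor_EE)
qed

definition det :: "(nat \<Rightarrow> nat \<Rightarrow> 'a::real_algebra_1) \<Rightarrow> 'a" where
  "det t = minor t [1..<Suc n] (ix n)"

definition cof :: "(nat \<Rightarrow> nat \<Rightarrow> 'a::real_algebra_1) \<Rightarrow> nat \<Rightarrow> nat \<Rightarrow> 'a" where
  "cof t a b = minor t (sorted_list_of_set (ix n - {a})) (ix n - {b})"

lemma sorted_list_1n: "sorted_list_of_set (ix n) = [1..<Suc n]"
  unfolding ix_def by (metis atLeastLessThanSuc_atLeastAtMost sorted_list_of_set_range)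

lemma det_transpose: "qm t \<Longrightarrow> det (\<lambda>a b. t b a) = det t"
  using minor_transpose[of t "ix n" "ix n"] unfolding det_def sorted_list_1n by simp

lemma cof_transpose: "qm t \<Longrightarrow> a \<in> ix n \<Longrightarrow> b \<in> ix n \<Longrightarrow> cof (\<lambda>a b. t b a) a b = cof t b a"
  unfolding cof_def by (rule minor_transpose) auto

lemma det_minor:
  assumes "qm t" "distinct i" "set i = ix n"
  shows "minor t i (ix n) = (- q) ^ invs i *\<^sub>R det t"
proof -
  have "sort i = [1..<Suc n]" using assms(2,3)
    by (metis sorted_list_1n sorted_list_of_set_sort_remdups distinct_remdups_id)
  moreover have "length i = n" using assms(2,3) distinct_card[of i] by simp
  ultimately show ?thesis using minor_sort[OF assms(1), of "ix n" i] assms(2) by (simp add: det_def)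
qed

lemma laplace_first:
  assumes "finite J" "J \<noteq> {}" 
  shows "minor t (a # i) J = (\<Sum>c\<in>J. (- q) ^ card {y\<in>J. y < c} *\<^sub>R (t a c * minor t i (J - {c})))"
proof -
  have "minor t (a # i) J = (\<Sum>c\<in>J. \<Sum>j\<in>permutations_of_set (J - {c}). (- q) ^ invs (c # j) *\<^sub>R (t a c * Tw t i j))"
    unfolding minor_def by (subst sum_permutations_Cons[OF assms]) simp
  also have "\<dots> = (\<Sum>c\<in>J. (- q) ^ card {y\<in>J. y < c} *\<^sub>R (t a c * minor t i (J - {c})))"
  proof (rule sum.cong[OF refl])
    fix c assume "c \<in> J"
    have "length (filter (\<lambda>y. y < c) j) = card {y\<in>J. y < c}" if "j \<in> permutations_of_set (J - {c})" for j
      using that \<open>c \<in> J\<close> by (auto simp: length_filter_set permutations_of_set_def intro!: arg_cong[where f=card])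
    then show "(\<Sum>j\<in>permutations_of_set (J - {c}). (- q) ^ invs (c # j) *\<^sub>R (t a c * Tw t i j))
      = (- q) ^ card {y\<in>J. y < c} *\<^sub>R (t a c * minor t i (J - {c}))"
      by (simp add: minor_def sum_distrib_left scaleR_sum_right power_add)
  qed
  finally show ?thesis .
qed

lemma laplace_last:
  assumes "finite J" "J \<noteq> {}" "card J = Suc (length i)"
  shows "minor t (i @ [a]) J = (\<Sum>c\<in>J. (- q) ^ card {y\<in>J. c < y} *\<^sub>R (minor t i (J - {c}) * t a c))"
proof -
  have "minor t (i @ [a]) J = (\<Sum>c\<in>J. \<Sum>j\<in>permutations_of_set (J - {c}). (- q) ^ invs (j @ [c]) *\<^sub>R Tw t (i @ [a]) (j @ [c]))"
    unfolding minor_def by (rule sum_permutations_snoc[OF assms(1,2)])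
  also have "\<dots> = (\<Sum>c\<in>J. (- q) ^ card {y\<in>J. c < y} *\<^sub>R (minor t i (J - {c}) * t a c))"
  proof (rule sum.cong[OF refl])
    fix c assume c: "c \<in> J"
    have *: "length (filter (\<lambda>y. c < y) j) = card {y\<in>J. c < y}" "length i = length j"
      if "j \<in> permutations_of_set (J - {c})" for j
    proof -
      show "length (filter (\<lambda>y. c < y) j) = card {y\<in>J. c < y}"
        using that c by (auto simp: length_filter_set permutations_of_set_def intro!: arg_cong[where f=card])
      show "length i = length j" using assms c length_finite_permutations_of_set[OF that] by simp
    qed
    have "(- q) ^ invs (j @ [c]) *\<^sub>R Tw t (i @ [a]) (j @ [c])
       = (- q) ^ card {y\<in>J. c < y} *\<^sub>R ((- q) ^ invs j *\<^sub>R (Tw t i j * t a c))"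
      if "j \<in> permutations_of_set (J - {c})" for j
      using *[OF that] by (simp add: invs_snoc Tw_snoc power_add)
    then show "(\<Sum>j\<in>permutations_of_set (J - {c}). (- q) ^ invs (j @ [c]) *\<^sub>R Tw t (i @ [a]) (j @ [c]))
      = (- q) ^ card {y\<in>J. c < y} *\<^sub>R (minor t i (J - {c}) * t a c)"
      by (simp add: minor_def sum_distrib_right scaleR_sum_right)
  qed
  finally show ?thesis .
qed

lemma card_less_1n: "c \<in> ix n \<Longrightarrow> card {y\<in>ix n. y < c} = c - 1"
  by (subgoal_tac "{y\<in>ix n. y < c} = {1..<c}") (auto simp: ix_iff)

lemma card_greater_1n: "c \<in> ix n \<Longrightarrow> card {y\<in>ix n. c < y} = n - c"
  by (subgoal_tac "{y\<in>ix n. c < y} = {c<..n}") (auto simp: ix_iff)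

lemma ix_nonempty [simp]: "ix n \<noteq> {}"
  using n1 by (auto simp: ix_def)

text \<open>Row \<open>a\<close> is put in front of all rows except \<open>l\<close>; for
  \<open>a \<noteq> l\<close> a row is repeated and the minor vanishes. The exponent is the
  difference of the \<open>c - 1\<close> inversions caused by column \<open>c\<close> and the
  \<open>l - 1\<close> inversions of moving row \<open>l\<close> to the front. The next three lemmas
  use the last row or the transpose instead.\<close>

lemma lapA:
  assumes "qm t" "a \<in> ix n" "l \<in> ix n"
  shows "(\<Sum>c\<in>ix n. (- q) powi (int c - int l) *\<^sub>R (t a c * cof t l c)) = (if a = l then det t else 0)"
proof -
  let ?I = "sorted_list_of_set (ix n - {l})"
  have I: "set ?I = ix n - {l}" "distinct ?I" "length ?I = n - 1" using assms(3) by auto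
  have e: "(- q) powi (int c - int l) = (- q) powi (1 - int l) * (- q) ^ (c - 1)" if "c \<in> ix n" for c
    using that q0
    by (simp add: ix_iff power_int_add[symmetric] power_int_of_nat[symmetric] of_nat_diff del: power_int_of_nat)
  have "(\<Sum>c\<in>ix n. (- q) powi (int c - int l) *\<^sub>R (t a c * cof t l c))
      = (- q) powi (1 - int l) *\<^sub>R (\<Sum>c\<in>ix n. (- q) ^ (c - 1) *\<^sub>R (t a c * cof t l c))"
    unfolding scaleR_sum_right by (intro sum.cong refl) (simp add: e)
  also have "(\<Sum>c\<in>ix n. (- q) ^ (c - 1) *\<^sub>R (t a c * cof t l c)) = minor t (a # ?I) (ix n)"
    using n1 by (subst laplace_first) (auto simp: cof_def card_less_1n)
  also have "(- q) powi (1 - int l) *\<^sub>R minor t (a # ?I) (ix n) = (if a = l then det t else 0)"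
  proof (cases "a = l")
    case True
    have "invs (a # ?I) = l - 1"
    proof -
      have "{y \<in> ix n. y \<noteq> l \<and> y < l} = {y \<in> ix n. y < l}" by auto
      then show ?thesis
        using True card_less_1n[OF assms(3)] I(2) by (simp add: length_filter_set invs_sorted)
    qed
    then have "minor t (a # ?I) (ix n) = (- q) ^ (l - 1) *\<^sub>R det t"
      using True assms(2) I by (subst det_minor[OF assms(1)]) auto
    moreover have "(- q) powi (1 - int l) * (- q) ^ (l - 1) = 1"
      using assms(3) e[OF assms(3)] by simp
    ultimately show ?thesis using True by simp
  next
    case False
    then have "minor t (a # ?I) (ix n) = 0" using assms I n1 by (subst minor_sort) auto
    with False show ?thesis by simp
  qed
  finally show ?thesis .
qed

lemma lapB:
  assumes "qm t" "a \<in> ix n" "l \<in> ix n"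
  shows "(\<Sum>c\<in>ix n. (- q) powi (int l - int c) *\<^sub>R (cof t l c * t a c)) = (if a = l then det t else 0)"
proof -
  let ?I = "sorted_list_of_set (ix n - {l})"
  have I: "set ?I = ix n - {l}" "distinct ?I" "length ?I = n - 1" using assms(3) by auto
  have e: "(- q) powi (int l - int c) = (- q) powi (int l - int n) * (- q) ^ (n - c)" if "c \<in> ix n" for c
    using that q0
    by (simp add: ix_iff power_int_add[symmetric] power_int_of_nat[symmetric] of_nat_diff del: power_int_of_nat)
  have "(\<Sum>c\<in>ix n. (- q) powi (int l - int c) *\<^sub>R (cof t l c * t a c))
      = (- q) powi (int l - int n) *\<^sub>R (\<Sum>c\<in>ix n. (- q) ^ (n - c) *\<^sub>R (cof t l c * t a c))"
    unfolding scaleR_sum_right by (intro sum.cong refl) (simp add: e)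
  also have "(\<Sum>c\<in>ix n. (- q) ^ (n - c) *\<^sub>R (cof t l c * t a c)) = minor t (?I @ [a]) (ix n)"
    using n1 I by (subst laplace_last) (auto simp: cof_def card_greater_1n)
  also have "(- q) powi (int l - int n) *\<^sub>R minor t (?I @ [a]) (ix n) = (if a = l then det t else 0)"
  proof (cases "a = l")
    case True
    have "invs (?I @ [a]) = n - l"
    proof -
      have "{y \<in> ix n. y \<noteq> l \<and> l < y} = {y \<in> ix n. l < y}" by auto
      then show ?thesis
        using True card_greater_1n[OF assms(3)] I(2) by (simp add: invs_snoc length_filter_set invs_sorted)
    qed
    then have "minor t (?I @ [a]) (ix n) = (- q) ^ (n - l) *\<^sub>R det t"
      using True assms(2) I by (subst det_minor[OF assms(1)]) auto
    moreover have "(- q) powi (int l - int n) * (- q) ^ (n - l) = 1"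
      using assms(3) e[OF assms(3)] by simp
    ultimately show ?thesis using True by simp
  next
    case False
    then have "minor t (?I @ [a]) (ix n) = 0" using assms I n1 by (subst minor_sort) auto
    with False show ?thesis by simp
  qed
  finally show ?thesis .
qed

lemma lapC:
  assumes "qm t" "a \<in> ix n" "l \<in> ix n"
  shows "(\<Sum>c\<in>ix n. (- q) powi (int c - int l) *\<^sub>R (t c a * cof t c l)) = (if a = l then det t else 0)"
  using lapA[OF qm_transpose[OF assms(1)] assms(2,3)] assms
  by (simp add: cof_transpose[of t] det_transpose[of t] cong: sum.cong if_cong)

lemma lapD:
  assumes "qm t" "a \<in> ix n" "l \<in> ix n"
  shows "(\<Sum>c\<in>ix n. (- q) powi (int l - int c) *\<^sub>R (cof t c l * t c a)) = (if a = l then det t else 0)"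
  using lapB[OF qm_transpose[OF assms(1)] assms(2,3)] assms
  by (simp add: cof_transpose[of t] det_transpose[of t] cong: sum.cong if_cong)

text \<open>The signed cofactors form one matrix \<open>?M\<close> with \<open>t M = det\<close> by
  \<open>lapA\<close> and \<open>M t = det\<close> by \<open>lapD\<close>; bracketing
  \<open>t M t\<close> in two ways gives the claim.\<close>

lemma det_central:
  assumes "qm t" shows "t a b * det t = det t * t a b"
proof (cases "a \<in> ix n \<and> b \<in> ix n")
  case True
  let ?M = "\<lambda>c l. (- q) powi (int c - int l) *\<^sub>R cof t l c"
  have A: "(\<Sum>c\<in>ix n. t x c * ?M c l) = (if x = l then det t else 0)" if "x \<in> ix n" "l \<in> ix n" for x l
    using lapA[OF assms that] by simp
  have D: "(\<Sum>c\<in>ix n. ?M l c * t c x) = (if x = l then det t else 0)" if "x \<in> ix n" "l \<in> ix n" for x l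
    using lapD[OF assms that] by simp
  have "(\<Sum>l\<in>ix n. (\<Sum>c\<in>ix n. t a c * ?M c l) * t l b) = (\<Sum>l\<in>ix n. (if a = l then det t else 0) * t l b)"
    using A True by (intro sum.cong refl) auto
  also have "\<dots> = det t * t a b" using True by (simp add: if_distrib[where f="\<lambda>x. x * _"] sum.delta cong: if_cong)
  finally have 1: "(\<Sum>l\<in>ix n. (\<Sum>c\<in>ix n. t a c * ?M c l) * t l b) = det t * t a b" .
  have "(\<Sum>l\<in>ix n. (\<Sum>c\<in>ix n. t a c * ?M c l) * t l b) = (\<Sum>c\<in>ix n. t a c * (\<Sum>l\<in>ix n. ?M c l * t l b))"
    unfolding sum_distrib_left sum_distrib_right by (subst sum.swap) (simp add: mult.assoc)
  also have "\<dots> = (\<Sum>c\<in>ix n. t a c * (if b = c then det t else 0))"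
    using D True by (intro sum.cong refl) auto
  also have "\<dots> = t a b * det t" using True by (simp add: if_distrib[where f="\<lambda>x. _ * x"] sum.delta cong: if_cong)
  finally show ?thesis using 1 by simp
next
  case False
  then show ?thesis using qm_zero[OF assms] by (metis mult_zero_left mult_zero_right)
qed

lemma det_central_word:
  assumes "qm t" "length i = length j" shows "Tw t i j * det t = det t * Tw t i j"
  using assms(2)
proof (induction i j rule: list_induct2)
  case (Cons a i b j)
  have "Tw t (a # i) (b # j) * det t = t a b * (Tw t i j * det t)" by (simp add: mult.assoc)
  also have "\<dots> = (t a b * det t) * Tw t i j" by (simp only: Cons.IH mult.assoc)
  also have "\<dots> = det t * Tw t (a # i) (b # j)"
    unfolding det_central[OF assms(1)] by (simp add: mult.assoc)
  finally show ?case .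
qed simp

end

section \<open>The quantum MacMahon theorem\<close>

text \<open>Operators form a type of class \<open>real_algebra_1\<close>, so that matrices with
  operator entries fall under \<open>qm\<close> and symmetrizers can be treated in an abstract
  algebra.\<close>

typedef (overloaded) ('x, 'a) op = "{F :: ('x \<Rightarrow> 'a::real_vector) \<Rightarrow> 'x \<Rightarrow> 'a.
    (\<forall>f g. F (\<lambda>x. f x + g x) = (\<lambda>x. F f x + F g x)) \<and>
    (\<forall>c f. F (\<lambda>x. c *\<^sub>R f x) = (\<lambda>x. c *\<^sub>R F f x))}"
  morphisms app Op
  by (rule exI[of _ "\<lambda>f. f"]) simp

setup_lifting type_definition_op

lemma op_eqI: "(\<And>f x. app F f x = app G f x) \<Longrightarrow> F = G"
  by (metis app_inject ext)

lemma app_add: "app F (\<lambda>x. f x + g x) x = app F f x + app F g x"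
  and app_scaleR: "app F (\<lambda>x. c *\<^sub>R f x) x = c *\<^sub>R app F f x"
  using app[of F] by (auto simp: fun_eq_iff)

lemma app_zero: "app F (\<lambda>x. 0) x = 0"
  using app_scaleR[of F 0 "\<lambda>x. 0"] by simp

lemma app_sum: "app F (\<lambda>x. \<Sum>j\<in>A. c j *\<^sub>R f j x) x = (\<Sum>j\<in>A. c j *\<^sub>R app F (f j) x)"
  by (induction A rule: infinite_finite_induct) (simp_all add: app_zero app_add app_scaleR)

instantiation op :: (type, real_algebra_1) real_algebra_1
begin
lift_definition zero_op :: "('a, 'b) op" is "\<lambda>f x. 0" by simp
lift_definition one_op :: "('a, 'b) op" is "\<lambda>f. f" by simp
lift_definition plus_op :: "('a, 'b) op \<Rightarrow> ('a, 'b) op \<Rightarrow> ('a, 'b) op" is "\<lambda>F G f x. F f x + G f x"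
  by (auto simp: fun_eq_iff algebra_simps)
lift_definition minus_op :: "('a, 'b) op \<Rightarrow> ('a, 'b) op \<Rightarrow> ('a, 'b) op" is "\<lambda>F G f x. F f x - G f x"
  by (auto simp: fun_eq_iff algebra_simps)
lift_definition uminus_op :: "('a, 'b) op \<Rightarrow> ('a, 'b) op" is "\<lambda>F f x. - F f x"
  by (auto simp: fun_eq_iff algebra_simps)
lift_definition times_op :: "('a, 'b) op \<Rightarrow> ('a, 'b) op \<Rightarrow> ('a, 'b) op" is "\<lambda>F G f. F (G f)"
  by simp
lift_definition scaleR_op :: "real \<Rightarrow> ('a, 'b) op \<Rightarrow> ('a, 'b) op" is "\<lambda>c F f x. c *\<^sub>R F f x"
  by (auto simp: fun_eq_iff algebra_simps)

instance
proof
  show "(0::('a, 'b) op) \<noteq> 1"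
  proof
    assume "(0::('a, 'b) op) = 1"
    then have "app (0::('a, 'b) op) (\<lambda>x. 1) x = app 1 (\<lambda>x. 1) x" for x by simp
    then show False by (simp add: zero_op.rep_eq one_op.rep_eq)
  qed
qed (transfer; auto simp: fun_eq_iff algebra_simps)+
end

lemma app_simps [simp]:
  "app (F + G) f x = app F f x + app G f x" "app (F - G) f x = app F f x - app G f x"
  "app (- F) f x = - app F f x" "app (F * G) f = app F (app G f)" "app 1 f = f" "app 0 f x = 0"
  "app (c *\<^sub>R F) f x = c *\<^sub>R app F f x"
  for F G :: "('a, 'b::real_algebra_1) op"
  by (transfer; simp)+

lemma app_sum_op: "app (\<Sum>i\<in>A. F i) f x = (\<Sum>i\<in>A. app (F i) f x)" for F :: "_ \<Rightarrow> ('a, 'b::real_algebra_1) op"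
  by (induction A rule: infinite_finite_induct) auto

text \<open>Functions on \<open>unit\<close> stand for elements, so these are left and right
  multiplication. \<open>rml\<close> reverses products and thereby turns statements into their
  mirror images.\<close>

lift_definition lml :: "'a::real_algebra_1 \<Rightarrow> (unit, 'a) op" is "\<lambda>u f x. u * f x"
  by (auto simp: fun_eq_iff algebra_simps)

lift_definition rml :: "'a::real_algebra_1 \<Rightarrow> (unit, 'a) op" is "\<lambda>u f x. f x * u"
  by (auto simp: fun_eq_iff algebra_simps)

lemma app_lml [simp]: "app (lml u) f x = u * f x" "app (rml u) f x = f x * u"
  by (simp_all add: lml.rep_eq rml.rep_eq)

lemma lml_hom: "lml (u * v) = lml u * lml v" "lml (u + v) = lml u + lml v" "lml (c *\<^sub>R u) = c *\<^sub>R lml u" "lml 1 = 1"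
  by (auto intro!: op_eqI simp: algebra_simps)

lemma rml_hom: "rml (u * v) = rml v * rml u" "rml (u + v) = rml u + rml v" "rml (c *\<^sub>R u) = c *\<^sub>R rml u" "rml 1 = 1"
  by (auto intro!: op_eqI simp: algebra_simps)

lemma rml_lml: "rml u * lml v = lml v * rml u"
  by (auto intro!: op_eqI simp: mult.assoc)

lemma rml_inject: "rml u = rml v \<Longrightarrow> u = v"
proof -
  assume "rml u = rml v"
  then have "app (rml u) (\<lambda>_. 1) () = app (rml v) (\<lambda>_. 1) ()" by simp
  then show "u = v" by simp
qed

section \<open>Symmetrizers in the Hecke algebra\<close>

context qp
begin

text \<open>Relations of the type A Hecke algebra on the generators
  \<open>R 0, ..., R (m - 1)\<close>.\<close>

definition braid :: "nat \<Rightarrow> (nat \<Rightarrow> 'h::real_algebra_1) \<Rightarrow> bool" where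
  "braid m R \<longleftrightarrow> (\<forall>k<m. R k * R k = (q - 1 / q) *\<^sub>R R k + 1)
    \<and> (\<forall>k. Suc k < m \<longrightarrow> R k * (R (Suc k) * R k) = R (Suc k) * (R k * R (Suc k)))
    \<and> (\<forall>j k. Suc j < k \<longrightarrow> k < m \<longrightarrow> R j * R k = R k * R j)"

lemma braid_sq: "braid m R \<Longrightarrow> k < m \<Longrightarrow> R k * R k = (q - 1 / q) *\<^sub>R R k + 1"
  by (auto simp: braid_def)

lemma braid3: "braid m R \<Longrightarrow> Suc k < m \<Longrightarrow> R k * (R (Suc k) * R k) = R (Suc k) * (R k * R (Suc k))"
  by (auto simp: braid_def)

lemma braid_comm: "braid m R \<Longrightarrow> Suc j < k \<Longrightarrow> k < m \<Longrightarrow> R j * R k = R k * R j"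
  by (auto simp: braid_def)

lemma braid_rev:
  assumes "braid m R" shows "braid m (\<lambda>j. R (m - 1 - j))"
  unfolding braid_def
proof (intro conjI allI impI)
  fix k assume "k < m"
  then show "R (m - 1 - k) * R (m - 1 - k) = (q - 1 / q) *\<^sub>R R (m - 1 - k) + 1"
    by (intro braid_sq[OF assms]) simp
next
  fix k assume "Suc k < m"
  then have "m - 1 - k = Suc (m - 1 - Suc k)" "Suc (m - 1 - Suc k) < m" by auto
  then show "R (m - 1 - k) * (R (m - 1 - Suc k) * R (m - 1 - k)) = R (m - 1 - Suc k) * (R (m - 1 - k) * R (m - 1 - Suc k))"
    by (simp only: braid3[OF assms])
next
  fix j k assume "Suc j < k" "k < m"
  then show "R (m - 1 - j) * R (m - 1 - k) = R (m - 1 - k) * R (m - 1 - j)"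
    by (intro braid_comm[OF assms, symmetric]) auto
qed

text \<open>\<open>Bs \<kappa> R k\<close> is the unnormalised (anti)symmetrizer generated by \<open>R 0, \<dots>, R (k - 1)\<close>,
  factored through minimal coset representatives; \<open>Bs'\<close> is its mirror image.\<close>
fun Zs :: "real \<Rightarrow> (nat \<Rightarrow> 'h::real_algebra_1) \<Rightarrow> nat \<Rightarrow> 'h" where
  "Zs \<kappa> R 0 = 1"
| "Zs \<kappa> R (Suc k) = 1 + \<kappa> *\<^sub>R (R k * Zs \<kappa> R k)"

fun Bs :: "real \<Rightarrow> (nat \<Rightarrow> 'h::real_algebra_1) \<Rightarrow> nat \<Rightarrow> 'h" where
  "Bs \<kappa> R 0 = 1"
| "Bs \<kappa> R (Suc k) = Bs \<kappa> R k * Zs \<kappa> R (Suc k)"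

fun Zs' :: "real \<Rightarrow> (nat \<Rightarrow> 'h::real_algebra_1) \<Rightarrow> nat \<Rightarrow> 'h" where
  "Zs' \<kappa> R 0 = 1"
| "Zs' \<kappa> R (Suc k) = 1 + \<kappa> *\<^sub>R (Zs' \<kappa> R k * R k)"

fun Bs' :: "real \<Rightarrow> (nat \<Rightarrow> 'h::real_algebra_1) \<Rightarrow> nat \<Rightarrow> 'h" where
  "Bs' \<kappa> R 0 = 1"
| "Bs' \<kappa> R (Suc k) = Zs' \<kappa> R (Suc k) * Bs' \<kappa> R k"

text \<open>The q-integer \<open>1 + \<kappa>^2 + ... + \<kappa>^(2 k)\<close> with
  \<open>k + 1\<close> terms; \<open>zfac\<close> is the matching factorial. They are the
  eigenvalues of \<open>Zs\<close> and \<open>Bs\<close> on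
  \<open>\<kappa>\<close>-eigenvectors.\<close>

fun zeta :: "real \<Rightarrow> nat \<Rightarrow> real" where
  "zeta \<kappa> 0 = 1"
| "zeta \<kappa> (Suc k) = 1 + \<kappa> * \<kappa> * zeta \<kappa> k"

fun zfac :: "real \<Rightarrow> nat \<Rightarrow> real" where
  "zfac \<kappa> 0 = 1"
| "zfac \<kappa> (Suc k) = zfac \<kappa> k * zeta \<kappa> (Suc k)"

lemma zeta_pos: "zeta \<kappa> k > 0"
  by (induction k) (auto intro!: add_pos_nonneg)

lemma zfac_pos: "zfac \<kappa> k > 0"
  by (induction k) (auto simp: zeta_pos simp del: zeta.simps)

lemma Zs_comm: "(\<And>i. i < k \<Longrightarrow> y * R i = R i * y) \<Longrightarrow> y * Zs \<kappa> R k = Zs \<kappa> R k * y"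
proof (induction k)
  case (Suc k)
  have "y * (R k * Zs \<kappa> R k) = R k * Zs \<kappa> R k * y"
    using Suc.IH Suc.prems by (metis less_Suc_eq mult.assoc)
  then show ?case by (simp add: distrib_left distrib_right)
qed simp

lemma braid_quad:
  assumes "braid m R" "k < m" "\<kappa> \<in> kap"
  shows "(1 + \<kappa> *\<^sub>R R k) * (R k - \<kappa> *\<^sub>R 1) = 0" "(R k - \<kappa> *\<^sub>R 1) * (1 + \<kappa> *\<^sub>R R k) = 0"
proof -
  have "(1 + \<kappa> *\<^sub>R R k) * (R k - \<kappa> *\<^sub>R 1) = (1 - \<kappa> * \<kappa> + \<kappa> * (q - 1 / q)) *\<^sub>R R k"
    by (simp add: algebra_simps braid_sq[OF assms(1,2)])
  then show "(1 + \<kappa> *\<^sub>R R k) * (R k - \<kappa> *\<^sub>R 1) = 0" using kap_sq[OF assms(3)] by simp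
  have "(R k - \<kappa> *\<^sub>R 1) * (1 + \<kappa> *\<^sub>R R k) = (1 - \<kappa> * \<kappa> + \<kappa> * (q - 1 / q)) *\<^sub>R R k"
    by (simp add: algebra_simps braid_sq[OF assms(1,2)])
  then show "(R k - \<kappa> *\<^sub>R 1) * (1 + \<kappa> *\<^sub>R R k) = 0" using kap_sq[OF assms(3)] by simp
qed

lemma braid3_shift:
  assumes "braid m R" "Suc k < m"
  shows "R (Suc k) * (R k * (R (Suc k) - \<kappa> *\<^sub>R 1)) = (R k - \<kappa> *\<^sub>R 1) * (R (Suc k) * R k)"
    "(R (Suc k) - \<kappa> *\<^sub>R 1) * (R k * R (Suc k)) = R k * (R (Suc k) * (R k - \<kappa> *\<^sub>R 1))"
  using braid3[OF assms] by (simp_all add: algebra_simps)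

text \<open>The factor \<open>R j - \<kappa>\<close> is pushed through the sum of coset
  representatives, by commutation or, for the last generator, by the braid relation. It comes out on
  the left with an index for which the smaller symmetrizer \<open>Bs\<close> annihilates it.\<close>

lemma Zs_right:
  assumes "braid m R" "\<kappa> \<in> kap"
  shows "k \<le> m \<Longrightarrow> j < k \<Longrightarrow> \<exists>x. Zs \<kappa> R k * (R j - \<kappa> *\<^sub>R 1) = (\<Sum>i<k-1. (R i - \<kappa> *\<^sub>R 1) * x i)"
proof (induction k)
  case (Suc k)
  have eq: "Zs \<kappa> R (Suc k) * (R j - \<kappa> *\<^sub>R 1) = (R j - \<kappa> *\<^sub>R 1) + \<kappa> *\<^sub>R (R k * (Zs \<kappa> R k * (R j - \<kappa> *\<^sub>R 1)))"
    by (simp add: distrib_right mult.assoc)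
  show ?case
  proof (cases "j < k")
    case True
    then obtain x where x: "Zs \<kappa> R k * (R j - \<kappa> *\<^sub>R 1) = (\<Sum>i<k-1. (R i - \<kappa> *\<^sub>R 1) * x i)"
      using Suc by auto
    have c: "R k * ((R i - \<kappa> *\<^sub>R 1) * x i) = (R i - \<kappa> *\<^sub>R 1) * (R k * x i)" if "i < k - 1" for i
    proof -
      have "R k * (R i - \<kappa> *\<^sub>R 1) = (R i - \<kappa> *\<^sub>R 1) * R k"
        using braid_comm[OF assms(1), of i k] that Suc.prems by (simp add: algebra_simps)
      then show ?thesis by (metis mult.assoc)
    qed
    have "Zs \<kappa> R (Suc k) * (R j - \<kappa> *\<^sub>R 1) = (R j - \<kappa> *\<^sub>R 1) + (\<Sum>i<k-1. (R i - \<kappa> *\<^sub>R 1) * (\<kappa> *\<^sub>R (R k * x i)))"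
      unfolding eq x sum_distrib_left scaleR_sum_right using c by simp
    also have "\<dots> = (\<Sum>i<k. (R i - \<kappa> *\<^sub>R 1) * ((if i = j then 1 else 0) + (if i < k - 1 then \<kappa> *\<^sub>R (R k * x i) else 0)))"
    proof -
      have "(\<Sum>i<k. (R i - \<kappa> *\<^sub>R 1) * (if i < k - 1 then \<kappa> *\<^sub>R (R k * x i) else 0)) = (\<Sum>i<k-1. (R i - \<kappa> *\<^sub>R 1) * (\<kappa> *\<^sub>R (R k * x i)))"
        by (rule sum.mono_neutral_cong_right) auto
      moreover have "(\<Sum>i<k. (R i - \<kappa> *\<^sub>R 1) * (if i = j then 1 else 0)) = R j - \<kappa> *\<^sub>R 1"
        using True by (simp add: if_distrib[where f="\<lambda>x. _ * x"] cong: if_cong)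
      ultimately show ?thesis by (simp add: distrib_left sum.distrib)
    qed
    finally show ?thesis by (auto intro!: exI)
  next
    case False
    then have j: "j = k" using Suc.prems by simp
    show ?thesis
    proof (cases k)
      case 0
      have "Zs \<kappa> R (Suc k) * (R j - \<kappa> *\<^sub>R 1) = 0"
        using braid_quad(1)[OF assms(1) _ assms(2), of 0] Suc.prems j 0 by simp
      then show ?thesis using 0 by simp
    next
      case (Suc k')
      let ?Y = "Zs \<kappa> R k'"
      have km: "k < m" "Suc k' < m" using Suc.prems Suc by auto
      have cY: "R k * ?Y = ?Y * R k"
        using km Suc by (intro Zs_comm braid_comm[OF assms(1), symmetric]) auto
      then have cY': "?Y * (R k - \<kappa> *\<^sub>R 1) = (R k - \<kappa> *\<^sub>R 1) * ?Y" by (simp add: algebra_simps)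
      have "Zs \<kappa> R (Suc k) * (R k - \<kappa> *\<^sub>R 1) = (1 + \<kappa> *\<^sub>R R k) * (R k - \<kappa> *\<^sub>R 1)
         + (\<kappa> * \<kappa>) *\<^sub>R (R k * (R k' * (?Y * (R k - \<kappa> *\<^sub>R 1))))"
        using Suc by (simp add: distrib_left distrib_right mult.assoc scaleR_add_right)
      also have "\<dots> = (\<kappa> * \<kappa>) *\<^sub>R ((R k * (R k' * (R k - \<kappa> *\<^sub>R 1))) * ?Y)"
        unfolding braid_quad(1)[OF assms(1) km(1) assms(2)] cY' by (simp add: mult.assoc)
      also have "R k * (R k' * (R k - \<kappa> *\<^sub>R 1)) = (R k' - \<kappa> *\<^sub>R 1) * (R k * R k')"
        using braid3_shift(1)[OF assms(1) km(2)] Suc by simp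
      finally have *: "Zs \<kappa> R (Suc k) * (R j - \<kappa> *\<^sub>R 1) = (R k' - \<kappa> *\<^sub>R 1) * ((\<kappa> * \<kappa>) *\<^sub>R ((R k * R k') * ?Y))"
        using j by (simp add: mult.assoc)
      show ?thesis unfolding *
        by (rule exI[where x="\<lambda>i. if i = k' then (\<kappa> * \<kappa>) *\<^sub>R ((R k * R k') * ?Y) else 0"])
          (simp add: Suc if_distrib[where f="\<lambda>x. _ * x"] cong: if_cong)
    qed
  qed
qed simp

lemma Bs_right0:
  assumes "braid m R" "\<kappa> \<in> kap"
  shows "k \<le> m \<Longrightarrow> j < k \<Longrightarrow> Bs \<kappa> R k * (R j - \<kappa> *\<^sub>R 1) = 0"
proof (induction k arbitrary: j)
  case (Suc k)
  obtain x where x: "Zs \<kappa> R (Suc k) * (R j - \<kappa> *\<^sub>R 1) = (\<Sum>i<k. (R i - \<kappa> *\<^sub>R 1) * x i)"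
    using Zs_right[OF assms Suc.prems] by auto
  have "Bs \<kappa> R (Suc k) * (R j - \<kappa> *\<^sub>R 1) = (\<Sum>i<k. (Bs \<kappa> R k * (R i - \<kappa> *\<^sub>R 1)) * x i)"
    by (simp only: Bs.simps mult.assoc x sum_distrib_left)
  then show ?case using Suc by simp
qed simp

lemma Bs_right:
  assumes "braid m R" "\<kappa> \<in> kap" "k \<le> m" "j < k"
  shows "Bs \<kappa> R k * R j = \<kappa> *\<^sub>R Bs \<kappa> R k"
  using Bs_right0[OF assms] by (simp add: right_diff_distrib)

text \<open>Passing to the opposite algebra turns \<open>Bs_right\<close> into the statement
  \<open>Bs'_left\<close> about the mirror image.\<close>

lemma Bs_rml: "Bs \<kappa> (\<lambda>j. rml (R j)) k = rml (Bs' \<kappa> R k)"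
proof -
  have Zs: "Zs \<kappa> (\<lambda>j. rml (R j)) k = rml (Zs' \<kappa> R k)" for k
    by (induction k) (simp_all add: rml_hom)
  show ?thesis by (induction k) (simp_all only: Bs.simps Bs'.simps Zs rml_hom)
qed

lemma braid_rml: "braid m R \<Longrightarrow> braid m (\<lambda>j. rml (R j))"
  unfolding braid_def[of m "\<lambda>j. rml (R j)"]
proof (intro conjI allI impI)
  assume b: "braid m R"
  show "rml (R k) * rml (R k) = (q - 1 / q) *\<^sub>R rml (R k) + 1" if "k < m" for k
    using arg_cong[OF braid_sq[OF b that], of rml] by (simp add: rml_hom)
  show "rml (R k) * (rml (R (Suc k)) * rml (R k)) = rml (R (Suc k)) * (rml (R k) * rml (R (Suc k)))" if "Suc k < m" for k
    using arg_cong[OF braid3[OF b that], of rml] by (simp add: rml_hom mult.assoc)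
  show "rml (R j) * rml (R k) = rml (R k) * rml (R j)" if "Suc j < k" "k < m" for j k
    using arg_cong[OF braid_comm[OF b that], of rml] by (simp add: rml_hom)
qed

lemma Bs'_left:
  assumes "braid m R" "\<kappa> \<in> kap" "k \<le> m" "j < k"
  shows "R j * Bs' \<kappa> R k = \<kappa> *\<^sub>R Bs' \<kappa> R k"
  using Bs_right[OF braid_rml[OF assms(1)] assms(2-4)]
  unfolding Bs_rml rml_hom(1,3)[symmetric] by (rule rml_inject)

lemma eig_Zs: "(\<And>j. j < k \<Longrightarrow> R j * v = \<kappa> *\<^sub>R v) \<Longrightarrow> Zs \<kappa> R k * v = zeta \<kappa> k *\<^sub>R v"
  by (induction k) (auto simp: distrib_right mult.assoc scaleR_add_left)

lemma eig_Bs: "(\<And>j. j < k \<Longrightarrow> R j * v = \<kappa> *\<^sub>R v) \<Longrightarrow> Bs \<kappa> R k * v = zfac \<kappa> k *\<^sub>R v"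
proof (induction k)
  case (Suc k)
  have "Bs \<kappa> R (Suc k) * v = Bs \<kappa> R k * (Zs \<kappa> R (Suc k) * v)" by (simp add: mult.assoc)
  also have "Zs \<kappa> R (Suc k) * v = zeta \<kappa> (Suc k) *\<^sub>R v" using Suc.prems by (rule eig_Zs)
  finally show ?case using Suc by simp
qed simp

lemma eig_Zs': "(\<And>j. j < k \<Longrightarrow> v * R j = \<kappa> *\<^sub>R v) \<Longrightarrow> v * Zs' \<kappa> R k = zeta \<kappa> k *\<^sub>R v"
  by (induction k) (auto simp: distrib_left mult.assoc[symmetric] scaleR_add_left)

lemma eig_Bs': "(\<And>j. j < k \<Longrightarrow> v * R j = \<kappa> *\<^sub>R v) \<Longrightarrow> v * Bs' \<kappa> R k = zfac \<kappa> k *\<^sub>R v"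
proof (induction k)
  case (Suc k)
  have "v * Bs' \<kappa> R (Suc k) = (v * Zs' \<kappa> R (Suc k)) * Bs' \<kappa> R k" by (simp add: mult.assoc)
  also have "v * Zs' \<kappa> R (Suc k) = zeta \<kappa> (Suc k) *\<^sub>R v" using Suc.prems by (rule eig_Zs')
  finally show ?case using Suc by (simp add: mult.commute)
qed simp

text \<open>The product of \<open>Bs\<close> and \<open>Bs'\<close> is \<open>zfac\<close> times
  either of them: \<open>Bs\<close> is an eigenvector for the generators from the right,
  \<open>Bs'\<close> from the left.\<close>

lemma Bs_eq_Bs':
  assumes "braid m R" "\<kappa> \<in> kap" "k \<le> m"
  shows "Bs \<kappa> R k = Bs' \<kappa> R k"
proof -
  have "zfac \<kappa> k *\<^sub>R Bs \<kappa> R k = Bs \<kappa> R k * Bs' \<kappa> R k"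
    by (rule eig_Bs'[symmetric], rule Bs_right[OF assms])
  also have "\<dots> = zfac \<kappa> k *\<^sub>R Bs' \<kappa> R k"
    by (rule eig_Bs, rule Bs'_left[OF assms])
  finally show ?thesis using zfac_pos[of \<kappa> k] by simp
qed

definition symz :: "real \<Rightarrow> (nat \<Rightarrow> 'h::real_algebra_1) \<Rightarrow> nat \<Rightarrow> 'h" where
  "symz \<kappa> R k = (1 / zfac \<kappa> k) *\<^sub>R Bs \<kappa> R k"

lemma symz_0 [simp]: "symz \<kappa> R 0 = 1" by (simp add: symz_def)

lemma symz_right: "braid m R \<Longrightarrow> \<kappa> \<in> kap \<Longrightarrow> k \<le> m \<Longrightarrow> j < k \<Longrightarrow> symz \<kappa> R k * R j = \<kappa> *\<^sub>R symz \<kappa> R k"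
  by (simp add: symz_def Bs_right)

lemma symz_left: "braid m R \<Longrightarrow> \<kappa> \<in> kap \<Longrightarrow> k \<le> m \<Longrightarrow> j < k \<Longrightarrow> R j * symz \<kappa> R k = \<kappa> *\<^sub>R symz \<kappa> R k"
  by (simp add: symz_def Bs_eq_Bs' Bs'_left)

lemma symz_fix: "(\<And>j. j < k \<Longrightarrow> R j * v = \<kappa> *\<^sub>R v) \<Longrightarrow> symz \<kappa> R k * v = v"
  using eig_Bs[of k R v \<kappa>] zfac_pos[of \<kappa> k] by (simp add: symz_def)

lemma symz_idem: "braid m R \<Longrightarrow> \<kappa> \<in> kap \<Longrightarrow> k \<le> m \<Longrightarrow> symz \<kappa> R k * symz \<kappa> R k = symz \<kappa> R k"
  by (rule symz_fix) (rule symz_left)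

lemma symz_comm: "(\<And>j. j < k \<Longrightarrow> y * R j = R j * y) \<Longrightarrow> y * symz \<kappa> R k = symz \<kappa> R k * y"
proof -
  assume c: "\<And>j. j < k \<Longrightarrow> y * R j = R j * y"
  then have "y * Bs \<kappa> R k = Bs \<kappa> R k * y"
  proof (induction k)
    case (Suc k)
    have "y * Zs \<kappa> R (Suc k) = Zs \<kappa> R (Suc k) * y" using Suc.prems by (rule Zs_comm)
    moreover have "y * Bs \<kappa> R k = Bs \<kappa> R k * y" using Suc by simp
    ultimately show ?case unfolding Bs.simps(2) by (metis mult.assoc)
  qed simp
  then show ?thesis by (simp add: symz_def)
qed

text \<open>The larger symmetrizer absorbs the smaller one from the right, and
  \<open>Zs \<kappa> R k\<close> acts on the smaller one by the scalar
  \<open>zeta \<kappa> k\<close>.\<close>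

lemma symz_rec:
  assumes "braid m R" "\<kappa> \<in> kap" "Suc k \<le> m"
  shows "zeta \<kappa> (Suc k) *\<^sub>R symz \<kappa> R (Suc k)
    = symz \<kappa> R k + (\<kappa> * zeta \<kappa> k) *\<^sub>R (symz \<kappa> R k * R k * symz \<kappa> R k)"
proof -
  let ?s = "symz \<kappa> R k"
  have Zs: "Zs \<kappa> R k * ?s = zeta \<kappa> k *\<^sub>R ?s"
    using assms by (intro eig_Zs symz_left) auto
  have "symz \<kappa> R (Suc k) * ?s = symz \<kappa> R (Suc k)"
  proof -
    have "symz \<kappa> R (Suc k) * Bs' \<kappa> R k = zfac \<kappa> k *\<^sub>R symz \<kappa> R (Suc k)"
      by (rule eig_Bs') (rule symz_right[OF assms], simp)
    then show ?thesis using assms zfac_pos[of \<kappa> k] by (simp add: symz_def Bs_eq_Bs')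
  qed
  moreover have "zeta \<kappa> (Suc k) *\<^sub>R symz \<kappa> R (Suc k) = ?s * Zs \<kappa> R (Suc k)"
    using zeta_pos[of \<kappa> "Suc k"] by (simp add: symz_def field_simps del: zeta.simps Zs.simps)
  ultimately have "zeta \<kappa> (Suc k) *\<^sub>R symz \<kappa> R (Suc k) = ?s * (Zs \<kappa> R (Suc k) * ?s)"
    by (metis mult.assoc mult_scaleR_left)
  also have "Zs \<kappa> R (Suc k) * ?s = ?s + \<kappa> *\<^sub>R (R k * (zeta \<kappa> k *\<^sub>R ?s))"
    by (simp add: distrib_right mult.assoc Zs)
  finally show ?thesis
    using assms by (simp add: distrib_left mult.assoc symz_idem)
qed

definition qn :: "nat \<Rightarrow> real" where "qn k = (q ^ k - (1 / q) ^ k) / (q - 1 / q)"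

lemma q_diff_neg: "q - 1 / q < 0"
  using q0 q1 by (simp add: field_simps mult_less_cancel_left2 power2_eq_square[symmetric] power_less_one_iff)

lemma qn_0 [simp]: "qn 0 = 0" and qn_1 [simp]: "qn (Suc 0) = 1"
  using q_diff_neg by (simp_all add: qn_def)

lemma qn_pos: "k > 0 \<Longrightarrow> qn k > 0"
proof -
  assume k: "k > 0"
  have "q ^ k < 1" using k q0 q1 by (simp add: power_less_one_iff)
  moreover have "1 < (1 / q) ^ k" using k q0 q1 by (intro one_less_power) auto
  ultimately show ?thesis using q_diff_neg by (simp add: qn_def divide_neg_neg)
qed

lemma qn_add: "qn (k + l) = q ^ k * qn l + (1 / q) ^ l * qn k"
proof -
  define p where "p = 1 / q"
  show ?thesis unfolding qn_def p_def[symmetric] times_divide_eq_right add_divide_distrib[symmetric]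
    by (simp add: power_add algebra_simps)
qed

lemma qn_Suc: "qn (Suc k) = q ^ k + (1 / q) * qn k"
  using qn_add[of k 1] by simp

lemma qn_Suc': "qn (Suc k) = q * qn k + (1 / q) ^ k"
  using qn_add[of 1 k] by simp

lemma zeta_q: "zeta q k = q ^ k * qn (Suc k)"
proof (induction k)
  case (Suc k)
  have "q ^ Suc k * qn (Suc (Suc k)) = q ^ Suc k * (1 / q) ^ Suc k + q * q * (q ^ k * qn (Suc k))"
    by (subst qn_Suc') (simp add: algebra_simps)
  also have "q ^ Suc k * (1 / q) ^ Suc k = 1" using q0 by (simp add: power_mult_distrib[symmetric])
  finally show ?case using Suc by simp
qed simp

lemma zeta_nk: "zeta nk k = (1 / q) ^ k * qn (Suc k)"
proof (induction k)
  case (Suc k)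
  have "(1 / q) ^ Suc k * qn (Suc (Suc k)) = (1 / q) ^ Suc k * q ^ Suc k + (1 / q) * (1 / q) * ((1 / q) ^ k * qn (Suc k))"
    by (subst qn_Suc) (simp add: algebra_simps)
  also have "(1 / q) ^ Suc k * q ^ Suc k = 1" using q0 by (simp add: power_mult_distrib[symmetric])
  finally show ?case using Suc by (simp add: nk_def)
qed simp

text \<open>Traces of matrices with noncommuting entries are not cyclic in general. Cyclicity for
  the generators is passed on to their symmetrizers by moving one generator at a time.\<close>

lemma trace_symz:
  fixes tr :: "'h::real_algebra_1 \<Rightarrow> 'a::real_vector"
  assumes add: "\<And>x y. tr (x + y) = tr x + tr y" and sc: "\<And>c x. tr (c *\<^sub>R x) = c *\<^sub>R tr x"
    and cyc: "\<And>j x. j < k \<Longrightarrow> tr (x * R j) = tr (R j * x)"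
  shows "tr (x * symz \<kappa> R k) = tr (symz \<kappa> R k * x)"
proof -
  have Z: "tr (x * Zs \<kappa> R l) = tr (Zs \<kappa> R l * x)" if "l \<le> k" for l x
    using that
  proof (induction l arbitrary: x)
    case (Suc l)
    have "tr (x * (R l * Zs \<kappa> R l)) = tr (Zs \<kappa> R l * (x * R l))"
      using Suc.IH[of "x * R l"] Suc.prems by (simp add: mult.assoc)
    also have "\<dots> = tr (R l * Zs \<kappa> R l * x)"
      using cyc[of l "Zs \<kappa> R l * x"] Suc.prems by (simp add: mult.assoc)
    finally show ?case by (simp add: distrib_left distrib_right add sc)
  qed simp
  have "tr (x * Bs \<kappa> R l) = tr (Bs \<kappa> R l * x)" if "l \<le> k" for l x
    using that
  proof (induction l arbitrary: x)
    case (Suc l)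
    have "tr (x * Bs \<kappa> R (Suc l)) = tr (x * Bs \<kappa> R l * Zs \<kappa> R (Suc l))"
      by (simp only: Bs.simps mult.assoc)
    also have "\<dots> = tr (Zs \<kappa> R (Suc l) * x * Bs \<kappa> R l)"
      using Z[OF Suc.prems, of "x * Bs \<kappa> R l"] by (simp only: mult.assoc)
    also have "\<dots> = tr (Bs \<kappa> R (Suc l) * x)"
      using Suc.IH[of "Zs \<kappa> R (Suc l) * x"] Suc.prems by (simp only: Bs.simps mult.assoc)
    finally show ?case .
  qed simp
  then show ?thesis by (simp add: symz_def sc)
qed

lemma alternating_telescope:
  fixes W :: "nat \<Rightarrow> 'a::real_vector"
  shows "(\<Sum>k\<le>d. (- 1) ^ k *\<^sub>R (W k + W (Suc k))) = W 0 + (- 1) ^ d *\<^sub>R W (Suc d)"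
  by (induction d) (auto simp: algebra_simps)

text \<open>The alternating sum telescopes because
  \<open>[d] w\<^sub>k = [k][d-k+1] U\<^sub>k + [k+1][d-k] U\<^bsub>k+1\<^esub>\<close>, where \<open>U\<^sub>k\<close> is the trace of the antisymmetrizer on the
  first \<open>k\<close> letters times the symmetrizer on the last \<open>d - k + 1\<close> letters (they overlap in one letter).\<close>
lemma trace_hook_sum:
  fixes tr :: "'h::real_algebra_1 \<Rightarrow> 'a::real_vector"
  assumes add: "\<And>x y. tr (x + y) = tr x + tr y" and sc: "\<And>c x. tr (c *\<^sub>R x) = c *\<^sub>R tr x"
    and cyc: "\<And>j x. j < d - 1 \<Longrightarrow> tr (x * R j) = tr (R j * x)"
    and br: "braid (d - 1) R" and d: "1 \<le> d"
  shows "(\<Sum>k\<le>d. (- 1) ^ k *\<^sub>R tr (symz nk R (k - 1) * symz q (\<lambda>j. R (d - 2 - j)) (d - k - 1))) = 0"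
proof -
  let ?R' = "\<lambda>j. R (d - 2 - j)"
  define al where "al k = symz nk R (k - 1)" for k
  define sy where "sy l = symz q ?R' (l - 1)" for l
  define w where "w k = tr (al k * sy (d - k))" for k
  define U where "U k = tr (al k * sy (Suc (d - k)))" for k
  define W where "W k = (if k \<le> d then (qn k * qn (Suc (d - k))) *\<^sub>R U k else 0)" for k
  have br': "braid (d - 1) ?R'" using braid_rev[OF br] by (simp add: numeral_2_eq_2)
  have main: "qn d *\<^sub>R w k = W k + W (Suc k)" if "k \<le> d" for k
  proof -
    consider "k = 0" | "k = d" "k \<noteq> 0" | "0 < k" "k < d" 
      using \<open>k \<le> d\<close> by (metis le_neq_implies_less neq0_conv)
    then show ?thesis
    proof cases
      case 1
      then show ?thesis using d by (simp add: W_def w_def U_def al_def Suc_diff_Suc)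
    next
      case 2
      then show ?thesis by (simp add: W_def w_def U_def sy_def)
    next
      case 3
      define l where "l = d - k"
      have l: "0 < l" "l < d" "k + l = d" "d - 2 - (l - 1) = k - 1" using 3 by (auto simp: l_def)
      let ?A = "al k" and ?S = "sy l" and ?r = "R (k - 1)"
      \<comment> \<open>The trace with one crossing between the two blocks. The recursions of
        \<open>symz_rec\<close> for both blocks lead to it, so it can be eliminated.\<close>
      define x where "x = tr (?A * ?S * ?r)"
      have idA: "?A * ?A = ?A" unfolding al_def using 3 by (intro symz_idem[OF br]) auto
      have idS: "?S * ?S = ?S" unfolding sy_def using l by (intro symz_idem[OF br']) auto
      have comm: "?A * ?S = ?S * ?A" unfolding sy_def
      proof (rule symz_comm)
        fix j assume "j < l - 1"
        then have j: "k - 1 < d - 2 - j" "d - 2 - j < d - 1" using 3 l by auto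
        show "?A * R (d - 2 - j) = R (d - 2 - j) * ?A"
          unfolding al_def using j
          by (intro symz_comm[symmetric] braid_comm[OF br, symmetric]) auto
      qed
      have trA: "tr (y * ?A) = tr (?A * y)" for y
        unfolding al_def using 3 by (intro trace_symz add sc cyc) auto
      have trS: "tr (y * ?S) = tr (?S * y)" for y
        unfolding sy_def using l by (intro trace_symz add sc cyc) auto
      have "tr (?A * ?r * ?A * ?S) = tr (?r * (?A * ?S * ?A))"
        using trA[of "?r * ?A * ?S"] by (simp add: mult.assoc)
      also have "?A * ?S * ?A = ?A * ?S" by (metis comm idA mult.assoc)
      also have "tr (?r * (?A * ?S)) = x" unfolding x_def using 3 by (intro cyc[symmetric]) auto
      finally have xA: "tr (?A * ?r * ?A * ?S) = x" .
      have "tr (?A * (?S * ?r * ?S)) = tr (?S * ?A * ?S * ?r)"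
        using trS[of "?A * ?S * ?r"] by (simp add: mult.assoc)
      also have "?S * ?A * ?S = ?A * ?S" by (metis comm idS mult.assoc)
      finally have xS: "tr (?A * (?S * ?r * ?S)) = x" by (simp add: x_def)
      have "zeta nk k *\<^sub>R al (Suc k) = ?A + (nk * zeta nk (k - 1)) *\<^sub>R (?A * ?r * ?A)"
        unfolding al_def using symz_rec[OF br nk_kap, of "k - 1"] 3 by simp
      from arg_cong[OF this, of "\<lambda>y. tr (y * ?S)"]
      have "zeta nk k *\<^sub>R tr (al (Suc k) * ?S) = tr (?A * ?S) + (nk * zeta nk (k - 1)) *\<^sub>R tr (?A * ?r * ?A * ?S)"
        by (simp only: distrib_right mult_scaleR_left add sc)
      moreover have "Suc (d - Suc k) = l" using 3 by (simp add: l_def)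
      ultimately have 1: "zeta nk k *\<^sub>R U (Suc k) = w k + (nk * zeta nk (k - 1)) *\<^sub>R x"
        using xA by (simp add: U_def w_def l_def)
      have "zeta q l *\<^sub>R sy (Suc l) = ?S + (q * zeta q (l - 1)) *\<^sub>R (?S * ?r * ?S)"
        unfolding sy_def using symz_rec[OF br' q_kap, of "l - 1"] l by simp
      from arg_cong[OF this, of "\<lambda>y. tr (?A * y)"]
      have "zeta q l *\<^sub>R tr (?A * sy (Suc l)) = tr (?A * ?S) + (q * zeta q (l - 1)) *\<^sub>R tr (?A * (?S * ?r * ?S))"
        by (simp only: distrib_left mult_scaleR_right add sc)
      then have 2: "zeta q l *\<^sub>R U k = w k + (q * zeta q (l - 1)) *\<^sub>R x"
        using xS by (simp add: U_def w_def l_def)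
      have z: "q * zeta q (l - 1) = q ^ l * qn l" "nk * zeta nk (k - 1) = - ((1 / q) ^ k * qn k)"
      proof -
        obtain l' k' where lk: "l = Suc l'" "k = Suc k'" using l(1) 3(1) by (metis gr0_implies_Suc)
        show "q * zeta q (l - 1) = q ^ l * qn l" unfolding lk by (simp add: zeta_q)
        have "nk * zeta nk k' = nk * ((1 / q) ^ k' * qn (Suc k'))" by (simp only: zeta_nk)
        then show "nk * zeta nk (k - 1) = - ((1 / q) ^ k * qn k)" unfolding lk by (simp add: nk_def)
      qed
      \<comment> \<open>These multipliers cancel the terms in \<open>x\<close>. The factor left at
        \<open>w k\<close> becomes \<open>qn d\<close> after multiplication by
        \<open>q ^ k * (1 / q) ^ l\<close>.\<close>
      have "(q ^ l * qn l) *\<^sub>R (zeta nk k *\<^sub>R U (Suc k)) + ((1 / q) ^ k * qn k) *\<^sub>R (zeta q l *\<^sub>R U k)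
         = (q ^ l * qn l + (1 / q) ^ k * qn k) *\<^sub>R w k"
        unfolding 1 2 z by (simp add: algebra_simps)
      then have "q ^ k *\<^sub>R ((1 / q) ^ l *\<^sub>R ((q ^ l * qn l) *\<^sub>R (zeta nk k *\<^sub>R U (Suc k)) + ((1 / q) ^ k * qn k) *\<^sub>R (zeta q l *\<^sub>R U k)))
         = (q ^ k * (1 / q) ^ l * (q ^ l * qn l + (1 / q) ^ k * qn k)) *\<^sub>R w k" by simp
      moreover have e: "q ^ k * (1 / q) ^ k = 1" "q ^ l * (1 / q) ^ l = 1" using q0 by (simp_all add: power_mult_distrib[symmetric])
      moreover have "q ^ k * (1 / q) ^ l * (q ^ l * qn l + (1 / q) ^ k * qn k) = qn d"
      proof -
        have "q ^ k * (1 / q) ^ l * (q ^ l * qn l + (1 / q) ^ k * qn k)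
           = (q ^ l * (1 / q) ^ l) * (q ^ k * qn l) + (q ^ k * (1 / q) ^ k) * ((1 / q) ^ l * qn k)"
          by (simp only: algebra_simps)
        then show ?thesis unfolding e l(3)[symmetric] qn_add by simp
      qed
      moreover have "q ^ k *\<^sub>R ((1 / q) ^ l *\<^sub>R ((q ^ l * qn l) *\<^sub>R (zeta nk k *\<^sub>R U (Suc k)) + ((1 / q) ^ k * qn k) *\<^sub>R (zeta q l *\<^sub>R U k)))
        = ((q ^ k * (1 / q) ^ k) * (q ^ l * (1 / q) ^ l) * qn l * qn (Suc k)) *\<^sub>R U (Suc k)
        + ((q ^ k * (1 / q) ^ k) * (q ^ l * (1 / q) ^ l) * qn k * qn (Suc l)) *\<^sub>R U k"
        unfolding zeta_q zeta_nk by (simp only: scaleR_scaleR scaleR_add_right ac_simps)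
      ultimately have "qn d *\<^sub>R w k = (qn (Suc k) * qn l) *\<^sub>R U (Suc k) + (qn k * qn (Suc l)) *\<^sub>R U k"
        by (simp add: mult.commute)
      moreover have "Suc (d - Suc k) = l" using 3 by (simp add: l_def)
      ultimately show ?thesis using 3 by (simp add: W_def l_def)
    qed
  qed
  have "qn d *\<^sub>R (\<Sum>k\<le>d. (- 1) ^ k *\<^sub>R w k) = (\<Sum>k\<le>d. (- 1) ^ k *\<^sub>R (W k + W (Suc k)))"
    unfolding scaleR_sum_right by (intro sum.cong refl) (simp add: main[symmetric] mult.commute)
  also have "\<dots> = 0" unfolding alternating_telescope by (simp add: W_def)
  finally have "(\<Sum>k\<le>d. (- 1) ^ k *\<^sub>R w k) = 0" using qn_pos[of d] d by simp
  then show ?thesis by (simp add: w_def al_def sy_def)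
qed

section \<open>The Hecke action on words and its traces\<close>

lemma RR_add: "RR k (\<lambda>x. f x + g x) i = RR k f i + RR k g i"
  and RR_scaleR: "RR k (\<lambda>x. c *\<^sub>R f x) i = c *\<^sub>R RR k f i"
  by (simp_all add: RR_def algebra_simps)

text \<open>Outside the range the operator is multiplication by the eigenvalue \<open>q\<close>,
  which satisfies the Hecke relations as well; so these hold on all functions of words.\<close>

lift_definition Rd :: "nat \<Rightarrow> nat \<Rightarrow> (nat list, 'a::real_vector) op" is
  "\<lambda>d k f i. if length i = d \<and> Suc k < d then RR k f i else q *\<^sub>R f i"
  by (auto simp: fun_eq_iff RR_add RR_scaleR algebra_simps)

lemma app_Rd: "app (Rd d k) f i = (if length i = d \<and> Suc k < d then RR k f i else q *\<^sub>R f i)"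
  by (simp add: Rd.rep_eq)

lemma RR_cong: "f i = g i \<Longrightarrow> f (swp k i) = g (swp k i) \<Longrightarrow> RR k f i = RR k g i"
  by (simp add: RR_def)

lemma RR_app_Rd: "length i = d \<Longrightarrow> Suc l < d \<Longrightarrow> RR k (app (Rd d l) f) i = RR k (RR l f) i"
  by (rule RR_cong) (simp_all add: app_Rd)

lemma q_sq: "q * q = (q - 1 / q) * q + 1" and s_sq: "(q - 1 / q) * (q - 1 / q) = (q - 1 / q) * q - (q - 1 / q) * (1 / q)"
  using q0 by (simp_all add: field_simps)

lemma RR_sq:
  assumes "Suc k < length i" shows "RR k (RR k f) i = (q - 1 / q) *\<^sub>R RR k f i + f i"
proof -
  consider "i ! k = i ! Suc k" | "i ! k < i ! Suc k" | "i ! k > i ! Suc k" by fastforce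
  then show ?thesis
  proof cases
    case 1
    then have "RR k (RR k f) i = (q * q) *\<^sub>R f i" by (simp add: RR_def cc_def)
    then show ?thesis using 1 unfolding q_sq by (simp add: RR_def cc_def scaleR_add_left)
  next
    case 2
    then have "i ! k \<noteq> i ! Suc k" "\<not> i ! Suc k < i ! k" by auto
    with 2 assms show ?thesis by (simp add: RR_def cc_def algebra_simps)
  next
    case 3
    then have "i ! k \<noteq> i ! Suc k" "\<not> i ! k < i ! Suc k" by auto
    with 3 assms show ?thesis by (simp add: RR_def cc_def algebra_simps)
  qed
qed

lemma RR_at1: "RR (length u) f (u @ x # y # v) = cc x y *\<^sub>R f (u @ x # y # v) + (if x = y then 0 else f (u @ y # x # v))"
proof -
  have "swp (length u) (u @ x # y # v) = u @ y # x # v"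
    using swp_append2[of u 0 "x # y # v"] by simp
  then show ?thesis by (simp add: RR_def nth_append)
qed

lemma RR_at2: "RR (Suc (length u)) f (u @ x # y # z # v) =
    cc y z *\<^sub>R f (u @ x # y # z # v) + (if y = z then 0 else f (u @ x # z # y # v))"
  using RR_at1[of "u @ [x]" f y z v] by simp

lemma RR_braid:
  fixes f :: "nat list \<Rightarrow> 'a::real_vector"
  assumes "Suc (Suc k) < length i"
  shows "RR k (RR (Suc k) (RR k f)) i = RR (Suc k) (RR k (RR (Suc k) f)) i"
proof -
  define u where "u = take k i"
  have "drop k i = i ! k # i ! Suc k # i ! Suc (Suc k) # drop (Suc (Suc (Suc k))) i"
    using assms by (simp add: Cons_nth_drop_Suc)
  then obtain x y z v where i: "i = u @ x # y # z # v" and k: "k = length u"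
    using assms unfolding u_def by (metis append_take_drop_id length_take min.absorb2 Suc_lessD less_imp_le)
  have s: "q * (q - 1 / q) = q * q - 1" "(q - 1 / q) * q = q * q - 1" using q0 by (simp_all add: field_simps)
  define r where "r = q - 1 / q"
  have s': "q * q = r * q + 1" using s by (simp add: r_def)
  have s'': "q * (q * x) = r * (q * x) + x" for x
    using s' by (metis mult.assoc distrib_right mult_1)
  have c: "cc a b = (if a = b then q else if a < b then r else 0)" for a b :: nat by (simp add: cc_def r_def)
  show ?thesis
    unfolding i k RR_at1 RR_at2
    by (cases x y rule: linorder_cases; cases y z rule: linorder_cases; cases x z rule: linorder_cases)
       (simp_all add: c algebra_simps s' s'' cong: if_cong)
qed

lemma RR_commute:
  assumes "Suc k < l" "Suc l < length i"
  shows "RR k (RR l f) i = RR l (RR k f) i"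
proof -
  have "swp k (swp l i) = swp l (swp k i)"
    using assms by (intro nth_equalityI) (auto simp: nth_swp)
  moreover have "swp l i ! k = i ! k" "swp l i ! Suc k = i ! Suc k" "swp k i ! l = i ! l" "swp k i ! Suc l = i ! Suc l"
    using assms by (auto simp: nth_swp)
  ultimately show ?thesis by (simp add: RR_def algebra_simps)
qed

lemma braid_Rd: "braid (d - 1) (Rd d :: nat \<Rightarrow> (nat list, 'a::real_algebra_1) op)"
  unfolding braid_def
proof (intro conjI allI impI; rule op_eqI)
  fix k and f :: "nat list \<Rightarrow> 'a" and i :: "nat list" assume "k < d - 1"
  then show "app (Rd d k * Rd d k) f i = app ((q - 1 / q) *\<^sub>R Rd d k + 1) f i"
    by (cases "length i = d") (simp_all add: app_Rd RR_app_Rd RR_sq q_sq scaleR_add_left)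
next
  fix k and f :: "nat list \<Rightarrow> 'a" and i :: "nat list" assume k: "Suc k < d - 1"
  show "app (Rd d k * (Rd d (Suc k) * Rd d k)) f i = app (Rd d (Suc k) * (Rd d k * Rd d (Suc k))) f i"
  proof (cases "length i = d")
    case True
    have *: "RR a (app (Rd d b) (app (Rd d c) f)) i = RR a (RR b (RR c f)) i" if "Suc a < d" "Suc b < d" "Suc c < d" for a b c
    proof -
      have "app (Rd d b) (app (Rd d c) f) j = RR b (RR c f) j" if "length j = d" for j
        using that \<open>Suc b < d\<close> \<open>Suc c < d\<close> by (simp add: app_Rd RR_app_Rd)
      then show ?thesis using True by (intro RR_cong) simp_all
    qed
    have "Suc k < d" "Suc (Suc k) < d" using k by auto
    then show ?thesis using True by (simp add: app_Rd[of d k] app_Rd[of d "Suc k"] * RR_braid)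
  qed (simp add: app_Rd)
next
  fix j k and f :: "nat list \<Rightarrow> 'a" and i :: "nat list" assume "Suc j < k" "k < d - 1"
  then have "Suc j < k" "Suc j < d" "Suc k < d" by auto
  then show "app (Rd d j * Rd d k) f i = app (Rd d k * Rd d j) f i"
    by (cases "length i = d") (simp_all add: app_Rd RR_app_Rd RR_commute[of j k i f])
qed

definition rowfun :: "(nat list \<Rightarrow> nat list \<Rightarrow> 'a::real_vector) \<Rightarrow> nat \<Rightarrow> nat list \<Rightarrow> nat list \<Rightarrow> 'a" where
  "rowfun \<Theta> d j i = (if i \<in> LL n d then \<Theta> i j else 0)"

lemma app_add_fun: "app F (\<lambda>x. f x + g x) = (\<lambda>x. app F f x + app F g x)"
  and app_scaleR_fun: "app F (\<lambda>x. c *\<^sub>R f x) = (\<lambda>x. c *\<^sub>R app F f x)"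
  by (auto simp: app_add app_scaleR)

lemma app_Rd_rowfun:
  assumes "RC \<Theta>" "length j = d" "Suc k < d"
  shows "app (Rd d k) (rowfun \<Theta> d j) = (\<lambda>i. cc (j ! k) (j ! Suc k) *\<^sub>R rowfun \<Theta> d j i
       + (if j ! k = j ! Suc k then 0 else 1) *\<^sub>R rowfun \<Theta> d (swp k j) i)"
proof
  fix i
  show "app (Rd d k) (rowfun \<Theta> d j) i = cc (j ! k) (j ! Suc k) *\<^sub>R rowfun \<Theta> d j i
       + (if j ! k = j ! Suc k then 0 else 1) *\<^sub>R rowfun \<Theta> d (swp k j) i"
  proof (cases "i \<in> LL n d")
    case True
    then have "length i = d" by (simp add: LL_def)
    have "RR k (rowfun \<Theta> d j) i = RR k (\<lambda>i. \<Theta> i j) i"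
      using True \<open>length i = d\<close> assms by (intro RR_cong) (simp_all add: rowfun_def)
    also have "\<dots> = RR k (\<Theta> i) j" using assms \<open>length i = d\<close> by (intro RCD) auto
    finally show ?thesis using True \<open>length i = d\<close> assms by (simp add: app_Rd RR_def rowfun_def)
  next
    case False
    then show ?thesis using assms by (auto simp: app_Rd RR_def rowfun_def)
  qed
qed

text \<open>\<open>RC\<close> lets the generator act on the column index of \<open>\<Theta>\<close>
  instead of its row index; relabelling the summation word then moves it to the other end of the
  trace.\<close>

lemma trace_cyclic:
  assumes "RC \<Theta>" "k < d - 1"
  defines "tr \<equiv> \<lambda>X :: (nat list, 'a::real_algebra_1) op. \<Sum>j\<in>LL n d. app X (rowfun \<Theta> d j) j"
  shows "tr (X * Rd d k) = tr (Rd d k * X)"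
proof -
  have k: "Suc k < d" using assms(2) by simp
  let ?c = "\<lambda>j. if j ! k = j ! Suc k then 0 else (1::real)"
  have "tr (X * Rd d k) = (\<Sum>j\<in>LL n d. cc (j ! k) (j ! Suc k) *\<^sub>R app X (rowfun \<Theta> d j) j
      + ?c j *\<^sub>R app X (rowfun \<Theta> d (swp k j)) j)"
    unfolding tr_def
    by (intro sum.cong refl) (simp add: app_Rd_rowfun[OF assms(1) LL_length k] app_add app_scaleR)
  also have "\<dots> = (\<Sum>j\<in>LL n d. cc (j ! k) (j ! Suc k) *\<^sub>R app X (rowfun \<Theta> d j) j)
      + (\<Sum>j\<in>LL n d. ?c j *\<^sub>R app X (rowfun \<Theta> d (swp k j)) j)" by (simp add: sum.distrib)
  also have "(\<Sum>j\<in>LL n d. ?c j *\<^sub>R app X (rowfun \<Theta> d (swp k j)) j)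
     = (\<Sum>j\<in>LL n d. ?c j *\<^sub>R app X (rowfun \<Theta> d j) (swp k j))"
    using k by (subst sum_LL_swp[OF k, symmetric]) (auto simp: LL_length intro!: sum.cong)
  also have "(\<Sum>j\<in>LL n d. cc (j ! k) (j ! Suc k) *\<^sub>R app X (rowfun \<Theta> d j) j) + \<dots> = tr (Rd d k * X)"
    unfolding tr_def sum.distrib[symmetric]
    by (intro sum.cong refl) (use k in \<open>simp add: app_Rd LL_length RR_def\<close>)
  finally show ?thesis .
qed

lemma app_symz_map:
  fixes R :: "nat \<Rightarrow> ('x, 'a::real_algebra_1) op" and R' :: "nat \<Rightarrow> ('y, 'a) op"
  assumes add: "\<And>f g. \<phi> (\<lambda>x. f x + g x) = (\<lambda>x. \<phi> f x + \<phi> g x)"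
    and sc: "\<And>c f. \<phi> (\<lambda>x. c *\<^sub>R f x) = (\<lambda>x. c *\<^sub>R \<phi> f x)"
    and R: "\<And>j f. j < N \<Longrightarrow> app (R j) (\<phi> f) = \<phi> (app (R' j) f)"
  shows "app (symz \<kappa> R N) (\<phi> f) = \<phi> (app (symz \<kappa> R' N) f)"
proof -
  have ap: "app (F + G) h = (\<lambda>x. app F h x + app G h x)" "app (c *\<^sub>R F) h = (\<lambda>x. c *\<^sub>R app F h x)"
    for F G :: "('z, 'a) op" and h c by auto
  have Z: "app (Zs \<kappa> R l) (\<phi> f) = \<phi> (app (Zs \<kappa> R' l) f)" if "l \<le> N" for l f
    using that by (induction l arbitrary: f) (simp_all add: ap add sc R)
  have "app (Bs \<kappa> R l) (\<phi> f) = \<phi> (app (Bs \<kappa> R' l) f)" if "l \<le> N" for l f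
    using that by (induction l arbitrary: f) (simp_all add: Z del: Zs.simps)
  then show ?thesis by (simp add: symz_def ap sc)
qed

lemma app_symz_fix:
  fixes R :: "nat \<Rightarrow> ('x, 'a::real_algebra_1) op"
  assumes R: "\<And>j. j < N \<Longrightarrow> app (R j) f = (\<lambda>x. \<kappa> *\<^sub>R f x)"
  shows "app (symz \<kappa> R N) f = f"
proof -
  have Z: "app (Zs \<kappa> R l) f = (\<lambda>x. zeta \<kappa> l *\<^sub>R f x)" if "l \<le> N" for l
    using that by (induction l) (auto simp: app_scaleR_fun R scaleR_add_left)
  have "app (Bs \<kappa> R l) f = (\<lambda>x. zfac \<kappa> l *\<^sub>R f x)" if "l \<le> N" for l
    using that by (induction l) (auto simp: Z app_scaleR_fun mult.commute simp del: Zs.simps zeta.simps)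
  then show ?thesis using zfac_pos[of \<kappa> N] by (auto simp: symz_def)
qed

text \<open>Trace of a symmetrizer against words in \<open>t\<close>: for
  \<open>\<kappa> = q\<close> the complete symmetric trace, for \<open>\<kappa> = - (1 / q)\<close>
  the sum of principal quantum minors, see \<open>trk_minor\<close>.\<close>

definition trk :: "real \<Rightarrow> (nat \<Rightarrow> nat \<Rightarrow> 'a::real_algebra_1) \<Rightarrow> nat \<Rightarrow> 'a" where
  "trk \<kappa> t l = (\<Sum>g\<in>{g \<in> LL n l. sorted g}. EE \<kappa> (Tw t) g (mset g))"

lemma LL_mset: "mset i = mset j \<Longrightarrow> i \<in> LL n d \<longleftrightarrow> j \<in> LL n d"
  by (metis (mono_tags, lifting) LL_def mem_Collect_eq mset_eq_length mset_eq_setD)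

lemma sum_LL_sort:
  "(\<Sum>j\<in>LL n l. f j) = (\<Sum>g\<in>{g \<in> LL n l. sorted g}. \<Sum>j\<in>permutations_of_multiset (mset g). f j)"
proof -
  have "(\<Sum>j\<in>LL n l. f j) = (\<Sum>g\<in>{g \<in> LL n l. sorted g}. \<Sum>j\<in>{j \<in> LL n l. sort j = g}. f j)"
    by (rule sum.group[symmetric]) (simp, simp, auto simp: LL_def)
  also have "\<dots> = (\<Sum>g\<in>{g \<in> LL n l. sorted g}. \<Sum>j\<in>permutations_of_multiset (mset g). f j)"
  proof (rule sum.cong[OF refl], rule sum.cong[OF _ refl])
    fix g assume "g \<in> {g \<in> LL n l. sorted g}"
    then have g: "g \<in> LL n l" "sorted g" by auto
    have "j \<in> LL n l \<and> sort j = g \<longleftrightarrow> mset j = mset g" for j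
    proof -
      have "mset (sort j) = mset j" by simp
      then show ?thesis using LL_mset[of j g l] g properties_for_sort[of g j] by metis
    qed
    then show "{j \<in> LL n l. sort j = g} = permutations_of_multiset (mset g)"
      unfolding permutations_of_multiset_def by auto
  qed
  finally show ?thesis .
qed

text \<open>The result \<open>u\<close> of applying \<open>a\<close> to the columns is an
  eigenvector in both indices, hence determined by one entry \<open>u g g\<close> for each content.
  The combination \<open>f\<close> of columns is an eigenvector too, so \<open>a\<close> fixes it;
  its value at \<open>g\<close> is then the sum of the diagonal entries.\<close>

lemma trace_projection:
  fixes a :: "(nat list, 'a::real_algebra_1) op"
  assumes "RC (Tw t)" "\<kappa> \<in> kap"
    and left: "\<And>k. Suc k < l \<Longrightarrow> Rd l k * a = \<kappa> *\<^sub>R a" and right: "\<And>k. Suc k < l \<Longrightarrow> a * Rd l k = \<kappa> *\<^sub>R a"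
    and fixd: "\<And>f. (\<And>k. Suc k < l \<Longrightarrow> app (Rd l k) f = (\<lambda>x. \<kappa> *\<^sub>R f x)) \<Longrightarrow> app a f = f"
  shows "(\<Sum>j\<in>LL n l. app a (rowfun (Tw t) l j) j) = trk \<kappa> t l"
proof -
  let ?T = "Tw t"
  define u where "u i j = app a (rowfun ?T l j) i" for i j
  have 1: "eig \<kappa> l (\<lambda>i. u i j)" for j
    unfolding eig_def
  proof (intro allI impI)
    fix i :: "nat list" and k assume i: "length i = l" "Suc k < l"
    have "RR k (\<lambda>i. u i j) i = app (Rd l k) (app a (rowfun ?T l j)) i"
      using i by (simp add: app_Rd u_def)
    also have "\<dots> = \<kappa> *\<^sub>R u i j" using arg_cong[OF left[OF i(2)], of "\<lambda>F. app F (rowfun ?T l j) i"] by (simp add: u_def)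
    finally show "RR k (\<lambda>i. u i j) i = \<kappa> *\<^sub>R u i j" .
  qed
  have 2: "eig \<kappa> l (u i)" for i
    unfolding eig_def
  proof (intro allI impI)
    fix j :: "nat list" and k assume j: "length j = l" "Suc k < l"
    have "app a (app (Rd l k) (rowfun ?T l j)) i = RR k (u i) j"
      by (simp add: app_Rd_rowfun[OF assms(1) j] app_add app_scaleR u_def RR_def)
    moreover have "app a (app (Rd l k) (rowfun ?T l j)) i = \<kappa> *\<^sub>R u i j"
      using arg_cong[OF right[OF j(2)], of "\<lambda>F. app F (rowfun ?T l j) i"] by (simp add: u_def)
    ultimately show "RR k (u i) j = \<kappa> *\<^sub>R u i j" by simp
  qed
  have u1: "u i j = eps \<kappa> i *\<^sub>R u (sort i) j" if "length i = l" for i j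
    using eig_sort[OF 1 assms(2) that] .
  have u2: "u i j = eps \<kappa> j *\<^sub>R u i (sort j)" if "length j = l" for i j
    using eig_sort[OF 2 assms(2) that] .
  have "(\<Sum>j\<in>LL n l. u j j) = (\<Sum>g\<in>{g \<in> LL n l. sorted g}. \<Sum>j\<in>permutations_of_multiset (mset g). u j j)"
    by (rule sum_LL_sort)
  also have "\<dots> = (\<Sum>g\<in>{g \<in> LL n l. sorted g}. EE \<kappa> ?T g (mset g))"
  proof (rule sum.cong[OF refl])
    fix g assume g: "g \<in> {g \<in> LL n l. sorted g}"
    let ?P = "permutations_of_multiset (mset g)"
    have P: "sort j = g" "length j = l" "length (sort j) = l" "j \<in> LL n l" if "j \<in> ?P" for j
      using that g LL_mset[of j g l] by (auto simp: permutations_of_multiset_def LL_length properties_for_sort dest: mset_eq_length)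
    have s: "u j j = (eps \<kappa> j * eps \<kappa> j) *\<^sub>R u g g" if "j \<in> ?P" for j
      using u1[of j j] u2[of j "sort j"] P[OF that] by simp
    define f where "f i = (if i \<in> LL n l then EE \<kappa> ?T i (mset g) else 0)" for i
    have f: "f = (\<lambda>i. \<Sum>j\<in>?P. eps \<kappa> j *\<^sub>R rowfun ?T l j i)"
      by (auto simp: f_def EE_def rowfun_def fun_eq_iff)
    have "app a f = f"
    proof (rule fixd)
      fix k assume k: "Suc k < l"
      show "app (Rd l k) f = (\<lambda>x. \<kappa> *\<^sub>R f x)"
      proof
        fix i
        have e: "eig \<kappa> l (\<lambda>i. EE \<kappa> ?T i (mset g))" using g by (intro eig_EE assms) (auto simp: LL_length)
        show "app (Rd l k) f i = \<kappa> *\<^sub>R f i"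
        proof (cases "i \<in> LL n l")
          case True
          then have "RR k f i = RR k (\<lambda>i. EE \<kappa> ?T i (mset g)) i"
            using k by (intro RR_cong) (simp_all add: f_def LL_length)
          then show ?thesis using True k eigD[OF e, of i k] by (simp add: app_Rd LL_length f_def)
        next
          case False
          then show ?thesis using k by (auto simp: app_Rd RR_def f_def)
        qed
      qed
    qed
    then have "EE \<kappa> ?T g (mset g) = app a f g" using g by (simp add: f_def)
    also have "\<dots> = (\<Sum>j\<in>?P. eps \<kappa> j *\<^sub>R u g j)" unfolding f by (simp add: app_sum u_def)
    also have "\<dots> = (\<Sum>j\<in>?P. u j j)"
      using s u2 P by (intro sum.cong refl) (metis scaleR_scaleR)
    finally show "(\<Sum>j\<in>?P. u j j) = EE \<kappa> ?T g (mset g)" ..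
  qed
  finally show ?thesis by (simp add: u_def trk_def)
qed

lemma trace_symz_Rd:
  assumes "qm (t :: nat \<Rightarrow> nat \<Rightarrow> 'a::real_algebra_1)" "\<kappa> \<in> kap" "R = Rd l \<or> R = (\<lambda>j. Rd l (l - 2 - j))"
  shows "(\<Sum>j\<in>LL n l. app (symz \<kappa> R (l - 1)) (rowfun (Tw t) l j) j) = trk \<kappa> t l"
proof -
  have br: "braid (l - 1) (Rd l :: nat \<Rightarrow> (nat list, 'a) op)" by (rule braid_Rd)
  then have br': "braid (l - 1) (\<lambda>j. Rd l (l - 2 - j) :: (nat list, 'a) op)"
    using braid_rev[OF br] by (simp add: numeral_2_eq_2)
  have R: "braid (l - 1) R" using assms(3) br br' by auto
  have ex: "\<exists>j<l-1. Rd l k = R j" if "Suc k < l" for k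
    using assms(3)
  proof
    assume "R = (\<lambda>j. Rd l (l - 2 - j))"
    moreover have "l - 2 - (l - 2 - k) = k" "l - 2 - k < l - 1" using that by auto
    ultimately have "Rd l k = R (l - 2 - k)" "l - 2 - k < l - 1" by (simp_all only:)
    then show ?thesis by blast
  next
    assume "R = Rd l"
    with that show ?thesis by (intro exI[of _ k]) auto
  qed
  show ?thesis
  proof (rule trace_projection[OF RC_Tw[OF assms(1)] assms(2)])
    fix k assume k: "Suc k < l"
    then obtain j where j: "j < l - 1" "Rd l k = R j" using ex by blast
    show "Rd l k * symz \<kappa> R (l - 1) = \<kappa> *\<^sub>R symz \<kappa> R (l - 1)"
      unfolding j(2) by (rule symz_left[OF R assms(2) order_refl j(1)])
    show "symz \<kappa> R (l - 1) * Rd l k = \<kappa> *\<^sub>R symz \<kappa> R (l - 1)"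
      unfolding j(2) by (rule symz_right[OF R assms(2) order_refl j(1)])
  next
    fix f :: "nat list \<Rightarrow> 'a" assume f: "\<And>k. Suc k < l \<Longrightarrow> app (Rd l k) f = (\<lambda>x. \<kappa> *\<^sub>R f x)"
    have "\<exists>k. Suc k < l \<and> R j = Rd l k" if "j < l - 1" for j
      using assms(3)
    proof
      assume "R = (\<lambda>j. Rd l (l - 2 - j))"
      with that show ?thesis by (intro exI[of _ "l - 2 - j"]) auto
    next
      assume "R = Rd l"
      with that show ?thesis by (intro exI[of _ j]) auto
    qed
    with f show "app (symz \<kappa> R (l - 1)) f = f" by (intro app_symz_fix) metis
  qed
qed

definition ftens :: "nat \<Rightarrow> nat \<Rightarrow> (nat list \<Rightarrow> 'a::real_algebra_1) \<Rightarrow> (nat list \<Rightarrow> 'a) \<Rightarrow> nat list \<Rightarrow> 'a" where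
  "ftens k l f g i = (if length i = k + l then f (take k i) * g (drop k i) else 0)"

lemma Rd_ftens_left:
  assumes "Suc m < k" shows "app (Rd (k + l) m) (ftens k l f g) = ftens k l (app (Rd k m) f) g"
proof
  fix i :: "nat list"
  have "take k (swp m i) = swp m (take k i)" "drop k (swp m i) = drop k i"
    using assms by (auto simp: swp_def take_update_swap drop_update_swap)
  then show "app (Rd (k + l) m) (ftens k l f g) i = ftens k l (app (Rd k m) f) g i"
    using assms by (auto simp: app_Rd ftens_def RR_def distrib_right)
qed

lemma Rd_ftens_right:
  assumes "Suc m < l" shows "app (Rd (k + l) (k + m)) (ftens k l f g) = ftens k l f (app (Rd l m) g)"
proof
  fix i
  show "app (Rd (k + l) (k + m)) (ftens k l f g) i = ftens k l f (app (Rd l m) g) i"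
  proof (cases "length i = k + l")
    case True
    then obtain u v where i: "i = u @ v" "length u = k" "length v = l"
      by (metis append_take_drop_id length_take length_drop add_diff_cancel_left' le_add1 min.absorb2)
    have "swp (k + m) i = u @ swp m v" using i swp_append2 by blast
    then show ?thesis using assms i by (simp add: app_Rd ftens_def RR_def distrib_left nth_append)
  qed (use assms in \<open>simp add: app_Rd ftens_def\<close>)
qed

text \<open>An instance of \<open>trace_hook_sum\<close>. The blocks of \<open>k\<close> and
  \<open>d - k\<close> letters are disjoint, so each trace is a product of two traces. The
  symmetrizer numbers its generators from the right end, so that enlarging it by one generator
  reaches towards the antisymmetrizer.\<close>

lemma macmahon:
  assumes "qm (t :: nat \<Rightarrow> nat \<Rightarrow> 'a::real_algebra_1)" "1 \<le> d"
  shows "(\<Sum>k\<le>d. (- 1) ^ k *\<^sub>R (trk nk t k * trk q t (d - k))) = 0"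
proof -
  let ?R = "Rd d :: nat \<Rightarrow> (nat list, 'a) op"
  let ?tr = "\<lambda>X :: (nat list, 'a) op. \<Sum>j\<in>LL n d. app X (rowfun (Tw t) d j) j"
  have "?tr (symz nk ?R (k - 1) * symz q (\<lambda>j. ?R (d - 2 - j)) (d - k - 1)) = trk nk t k * trk q t (d - k)"
    if "k \<le> d" for k
  proof -
    define l where "l = d - k"
    have d: "d = k + l" using that by (simp add: l_def)
    let ?A = "symz nk (Rd k) (k - 1) :: (nat list, 'a) op"
    let ?S = "symz q (\<lambda>j. Rd l (l - 2 - j)) (l - 1) :: (nat list, 'a) op"
    have 1: "app (symz q (\<lambda>j. ?R (d - 2 - j)) (l - 1)) (ftens k l f g) = ftens k l f (app ?S g)" for f g
    proof (rule app_symz_map)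
      fix j g assume "j < l - 1"
      then have "d - 2 - j = k + (l - 2 - j)" "Suc (l - 2 - j) < l" using d by auto
      then show "app (?R (d - 2 - j)) (ftens k l f g) = ftens k l f (app (Rd l (l - 2 - j)) g)"
        unfolding d by (simp only: Rd_ftens_right)
    qed (auto simp: ftens_def fun_eq_iff algebra_simps)
    have 2: "app (symz nk ?R (k - 1)) (ftens k l f g) = ftens k l (app ?A f) g" for f g
    proof (rule app_symz_map[where \<phi>="\<lambda>f. ftens k l f g"])
      fix j f assume "j < k - 1"
      then show "app (?R j) (ftens k l f g) = ftens k l (app (Rd k j) f) g"
        unfolding d by (intro Rd_ftens_left) simp
    qed (auto simp: ftens_def fun_eq_iff algebra_simps)
    have row: "rowfun (Tw t) d (x @ y) = ftens k l (rowfun (Tw t) k x) (rowfun (Tw t) l y)"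
      if "x \<in> LL n k" "y \<in> LL n l" for x y
    proof
      fix i
      show "rowfun (Tw t) d (x @ y) i = ftens k l (rowfun (Tw t) k x) (rowfun (Tw t) l y) i"
      proof (cases "length i = k + l")
        case True
        then obtain u v where i: "i = u @ v" "length u = k" "length v = l"
          by (metis append_take_drop_id length_take length_drop add_diff_cancel_left' le_add1 min.absorb2)
        with that show ?thesis by (auto simp: rowfun_def ftens_def d LL_def Tw_append)
      qed (simp add: rowfun_def ftens_def d LL_def)
    qed
    have "?tr (symz nk ?R (k - 1) * symz q (\<lambda>j. ?R (d - 2 - j)) (l - 1))
       = (\<Sum>x\<in>LL n k. \<Sum>y\<in>LL n l. app ?A (rowfun (Tw t) k x) x * app ?S (rowfun (Tw t) l y) y)"
      unfolding d sum_LL_add unfolding d[symmetric]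
      by (intro sum.cong refl) (simp only: app_simps row 1 2, simp add: ftens_def LL_length)
    also have "\<dots> = (\<Sum>x\<in>LL n k. app ?A (rowfun (Tw t) k x) x) * (\<Sum>y\<in>LL n l. app ?S (rowfun (Tw t) l y) y)"
      by (simp add: sum_product)
    also have "\<dots> = trk nk t k * trk q t l"
      using trace_symz_Rd[OF assms(1) nk_kap, of "Rd k" k] trace_symz_Rd[OF assms(1) q_kap, of "\<lambda>j. Rd l (l - 2 - j)" l]
      by simp
    finally show ?thesis by (simp add: l_def)
  qed
  moreover have "(\<Sum>k\<le>d. (- 1) ^ k *\<^sub>R ?tr (symz nk ?R (k - 1) * symz q (\<lambda>j. ?R (d - 2 - j)) (d - k - 1))) = 0"
  proof (rule trace_hook_sum[where tr="?tr", OF _ _ _ braid_Rd assms(2)])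
    fix j and x :: "(nat list, 'a) op" assume "j < d - 1"
    then show "?tr (x * ?R j) = ?tr (?R j * x)" by (rule trace_cyclic[OF RC_Tw[OF assms(1)]])
  qed (simp_all add: sum.distrib scaleR_sum_right)
  ultimately show ?thesis by simp
qed

end

section \<open>Ordered monomials\<close>

text \<open>Ordered words give functionals: \<open>Opr Q a\<close> is the product of the \<open>Q k\<close> along an insertion
  sort of \<open>a\<close>. It is independent of the sorting procedure by the braid relations, see \<open>Opr_swp\<close>.\<close>

fun ch :: "(nat \<Rightarrow> 'h::monoid_mult) \<Rightarrow> nat \<Rightarrow> 'h" where
  "ch Q 0 = 1"
| "ch Q (Suc p) = ch Q p * Q p"

fun Opr :: "(nat \<Rightarrow> 'h::monoid_mult) \<Rightarrow> nat list \<Rightarrow> 'h" where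
  "Opr Q [] = 1"
| "Opr Q (b # a) = Opr (\<lambda>k. Q (Suc k)) a * ch Q (length (filter (\<lambda>x. x < b) a))"

definition qbraid :: "nat \<Rightarrow> (nat \<Rightarrow> 'h::monoid_mult) \<Rightarrow> bool" where
  "qbraid m Q \<longleftrightarrow> (\<forall>k. Suc k < m \<longrightarrow> Q k * (Q (Suc k) * Q k) = Q (Suc k) * (Q k * Q (Suc k)))
    \<and> (\<forall>j k. Suc j < k \<longrightarrow> k < m \<longrightarrow> Q j * Q k = Q k * Q j)"

lemma qbraid_Suc: "qbraid m Q \<Longrightarrow> qbraid (m - 1) (\<lambda>k. Q (Suc k))"
  unfolding qbraid_def
proof (elim conjE, intro conjI allI impI)
  fix j k assume "\<forall>j k. Suc j < k \<longrightarrow> k < m \<longrightarrow> Q j * Q k = Q k * Q j" "Suc j < k" "k < m - 1"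
  then show "Q (Suc j) * Q (Suc k) = Q (Suc k) * Q (Suc j)"
    by (metis Suc_less_eq less_diff_conv Suc_eq_plus1)
qed simp

lemma qbraid_comm: "qbraid m Q \<Longrightarrow> Suc j < k \<Longrightarrow> k < m \<Longrightarrow> Q j * Q k = Q k * Q j"
  unfolding qbraid_def by blast

lemma ch_comm: "(\<And>i. i < p \<Longrightarrow> y * Q i = Q i * y) \<Longrightarrow> y * ch Q p = ch Q p * y"
proof (induction p)
  case (Suc p)
  have "y * (ch Q p * Q p) = ch Q p * (y * Q p)" using Suc by (metis less_Suc_eq mult.assoc)
  also have "\<dots> = ch Q p * Q p * y" using Suc.prems[of p] by (simp add: mult.assoc)
  finally show ?case by simp
qed simp

lemma Opr_comm: "(\<And>i. Suc i < length a \<Longrightarrow> y * Q i = Q i * y) \<Longrightarrow> y * Opr Q a = Opr Q a * y"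
proof (induction a arbitrary: Q)
  case (Cons b a)
  let ?p = "length (filter (\<lambda>x. x < b) a)"
  have p: "?p \<le> length a" by (rule length_filter_le)
  have 1: "y * Opr (\<lambda>k. Q (Suc k)) a = Opr (\<lambda>k. Q (Suc k)) a * y"
    using Cons.prems by (intro Cons.IH) auto
  have 2: "y * ch Q ?p = ch Q ?p * y" 
  proof (intro ch_comm Cons.prems)
    fix i assume "i < ?p"
    from less_le_trans[OF this p] show "Suc i < length (b # a)" by simp
  qed
  have "y * (Opr (\<lambda>k. Q (Suc k)) a * ch Q ?p) = Opr (\<lambda>k. Q (Suc k)) a * (y * ch Q ?p)"
    by (simp only: mult.assoc[symmetric] 1)
  then show ?case by (simp add: 2 mult.assoc)
qed simp

lemma ch_Suc_left: "ch Q (Suc p) = Q 0 * ch (\<lambda>k. Q (Suc k)) p"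
  by (induction p) (simp_all add: mult.assoc[symmetric])

text \<open>In the braid picture a crossing slides along the chain and its index drops by
  one.\<close>

lemma ch_shift1:
  assumes "qbraid m Q"
  shows "p < m \<Longrightarrow> j < p \<Longrightarrow> Q (Suc j) * ch Q (Suc p) = ch Q (Suc p) * Q j"
proof (induction p)
  case (Suc p)
  show ?case
  proof (cases "j < p")
    case True
    have "Q j * Q (Suc p) = Q (Suc p) * Q j" using True Suc.prems by (intro qbraid_comm[OF assms]) auto
    then have "ch Q (Suc (Suc p)) * Q j = ch Q (Suc p) * Q j * Q (Suc p)"
      by (simp add: mult.assoc)
    also have "\<dots> = Q (Suc j) * ch Q (Suc p) * Q (Suc p)"
      using Suc.IH Suc.prems True by simp
    finally show ?thesis by (simp add: mult.assoc)
  next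
    case False
    then have j: "j = p" using Suc.prems by simp
    have c: "Q (Suc p) * ch Q p = ch Q p * Q (Suc p)"
      using Suc.prems by (intro ch_comm qbraid_comm[OF assms, symmetric]) auto
    have b: "Q p * (Q (Suc p) * Q p) = Q (Suc p) * (Q p * Q (Suc p))"
      using assms Suc.prems by (auto simp: qbraid_def)
    have "Q (Suc j) * ch Q (Suc (Suc p)) = (Q (Suc p) * ch Q p) * (Q p * Q (Suc p))"
      by (simp add: j mult.assoc)
    also have "\<dots> = ch Q p * (Q (Suc p) * (Q p * Q (Suc p)))" by (simp add: c mult.assoc)
    finally show ?thesis by (simp add: j b[symmetric] mult.assoc)
  qed
qed simp

lemma ch_shift:
  assumes "qbraid m Q"
  shows "r \<le> p \<Longrightarrow> p < m \<Longrightarrow> ch (\<lambda>k. Q (Suc k)) r * ch Q (Suc p) = ch Q (Suc p) * ch Q r"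
proof (induction r)
  case (Suc r)
  have "ch (\<lambda>k. Q (Suc k)) (Suc r) * ch Q (Suc p) = ch (\<lambda>k. Q (Suc k)) r * (Q (Suc r) * ch Q (Suc p))"
    by (simp add: mult.assoc)
  also have "Q (Suc r) * ch Q (Suc p) = ch Q (Suc p) * Q r" using Suc.prems by (intro ch_shift1[OF assms]) auto
  also have "ch (\<lambda>k. Q (Suc k)) r * (ch Q (Suc p) * Q r) = ch Q (Suc p) * ch Q r * Q r"
    using Suc by (simp add: mult.assoc[symmetric])
  finally show ?case by (simp add: mult.assoc)
qed simp

lemma list_two: "Suc 0 < length a \<Longrightarrow> \<exists>b c a'. a = b # c # a'"
  by (cases a; cases "tl a") auto

lemma Opr_comm_0:
  assumes "qbraid m Q" "length a < m"
  shows "Q 0 * Opr (\<lambda>k. Q (Suc (Suc k))) a = Opr (\<lambda>k. Q (Suc (Suc k))) a * Q 0"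
  using assms(2) by (intro Opr_comm qbraid_comm[OF assms(1)]) auto

text \<open>At the front of the word two letters are inserted one after the other, in either order;
  \<open>ch_shift\<close> exchanges the two insertions.\<close>

lemma Opr_swp:
  assumes "qbraid m Q" "length a \<le> Suc m" "Suc k < length a" "a ! k < a ! Suc k"
  shows "Opr Q (swp k a) = Q k * Opr Q a"
  using assms
proof (induction k arbitrary: Q m a)
  case 0
  then obtain b c a' where a: "a = b # c # a'" using list_two by blast
  have bc: "b < c" using 0 a by simp
  let ?X = "Opr (\<lambda>k. Q (Suc (Suc k))) a'" and ?Q' = "\<lambda>k. Q (Suc k)"
  let ?pb = "length (filter (\<lambda>x. x < b) a')" and ?pc = "length (filter (\<lambda>x. x < c) a')"
  have "?pc \<le> length a'" by (rule length_filter_le)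
  moreover have "Suc (length a') \<le> m" using 0(2) a by simp
  ultimately have pm: "?pc < m" "length a' < m" by linarith+
  have le: "?pb \<le> ?pc"
    using bc by (induction a') auto
  have "Opr Q (swp 0 a) = ?X * (ch ?Q' ?pb * ch Q (Suc ?pc))"
    using bc by (simp add: a mult.assoc)
  also have "ch ?Q' ?pb * ch Q (Suc ?pc) = ch Q (Suc ?pc) * ch Q ?pb"
    by (rule ch_shift[OF 0(1) le pm(1)])
  also have "\<dots> = Q 0 * (ch ?Q' ?pc * ch Q ?pb)" by (simp only: ch_Suc_left mult.assoc)
  also have "?X * \<dots> = Q 0 * Opr Q a"
    using bc Opr_comm_0[OF 0(1) pm(2)] by (simp add: a mult.assoc[symmetric])
  finally show ?case .
next
  case (Suc k)
  then obtain b a' where a: "a = b # a'" by (cases a) auto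
  have "Opr (\<lambda>k. Q (Suc k)) (swp k a') = Q (Suc k) * Opr (\<lambda>k. Q (Suc k)) a'"
    using Suc.prems by (intro Suc.IH[OF qbraid_Suc[OF Suc.prems(1)]]) (auto simp: a)
  moreover have "length (filter (\<lambda>x. x < b) (swp k a')) = length (filter (\<lambda>x. x < b) a')"
    using Suc.prems by (intro length_filter_mset) (simp add: a)
  ultimately show ?case by (simp add: a mult.assoc)
qed

lemma Opr_sorted: "sorted a \<Longrightarrow> Opr Q a = 1"
proof (induction a arbitrary: Q)
  case (Cons b a)
  then have "filter (\<lambda>x. x < b) a = []" by (auto simp: filter_empty_conv)
  then show ?case using Cons by simp
qed simp

lemma sort_Cons_split:
  fixes b :: nat and a :: "nat list"
  defines "p \<equiv> length (filter (\<lambda>x. x < b) a)"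
  shows "p \<le> length a" "\<And>j. j < p \<Longrightarrow> sort (b # a) ! j = sort a ! j \<and> sort a ! j < b" "sort (b # a) ! p = b"
    "\<And>j. p \<le> j \<Longrightarrow> j < length a \<Longrightarrow> sort (b # a) ! Suc j = sort a ! j \<and> b \<le> sort a ! j"
proof -
  let ?s = "sort a" let ?t = "takeWhile (\<lambda>x. x < b) ?s" and ?d = "dropWhile (\<lambda>x. x < b) ?s"
  have d: "x \<ge> b" if "x \<in> set ?d" for x
  proof -
    have "sorted ?d" by (metis sorted_sort sorted_wrt_dropWhile)
    moreover have ne: "?d \<noteq> []" using that by (intro notI) (simp only: list.set empty_iff)
    moreover obtain y ys where D: "?d = y # ys" using ne by (auto simp only: neq_Nil_conv)
    moreover have "\<not> y < b" using hd_dropWhile[OF ne] unfolding D by simp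
    ultimately show ?thesis using that by auto
  qed
  have t: "x < b" if "x \<in> set ?t" for x using that set_takeWhileD by fast
  have "?t = filter (\<lambda>x. x < b) ?s" using d by (intro takeWhile_eq_filter) force
  then have p: "length ?t = p" unfolding p_def by (metis length_filter_mset mset_sort)
  have st: "sorted (?t @ b # ?d)"
  proof -
    have "x \<le> y" if "x \<in> set ?t" "y \<in> set ?d" for x y using t[OF that(1)] d[OF that(2)] by simp
    then show ?thesis using t d
      by (auto simp: sorted_append less_imp_le sorted_wrt_dropWhile sorted_wrt_takeWhile)
  qed
  have "mset (?t @ b # ?d) = mset (b # a)"
  proof -
    have "mset (?t @ ?d) = mset a" unfolding takeWhile_dropWhile_id by simp
    then show ?thesis unfolding mset_append by simp
  qed
  then have s: "sort (b # a) = ?t @ b # ?d" using st by (rule properties_for_sort)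
  have a: "sort a = ?t @ ?d" by simp
  show "p \<le> length a" unfolding p_def by (rule length_filter_le)
  show "sort (b # a) ! j = sort a ! j \<and> sort a ! j < b" if "j < p" for j
  proof -
    have "sort (b # a) ! j = ?t ! j" unfolding s using that p by (simp add: nth_append)
    moreover have "sort a ! j = ?t ! j" using that p a by (metis nth_append)
    ultimately show ?thesis using t[of "?t ! j"] that p by simp
  qed
  show "sort (b # a) ! p = b" unfolding s using p by (simp add: nth_append)
  show "sort (b # a) ! Suc j = sort a ! j \<and> b \<le> sort a ! j" if "p \<le> j" "j < length a" for j
  proof -
    have len: "length ?t + length ?d = length a" by (metis a length_append length_sort)
    have "sort (b # a) ! Suc j = ?d ! (j - p)" unfolding s using that p by (simp add: nth_append Suc_diff_le)
    moreover have "sort a ! j = ?d ! (j - p)" using that p a by (metis nth_append not_less)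
    ultimately show ?thesis using d[of "?d ! (j - p)"] that p len by simp
  qed
qed

context qp
begin

text \<open>Equal neighbours stay neighbours under insertion sort. Sliding \<open>Q k\<close>
  through the product turns it into the generator at their place in the sorted word, where
  \<open>g\<close> is an eigenvector.\<close>

lemma Opr_eig:
  fixes Q :: "nat \<Rightarrow> ('x, 'a::real_algebra_1) op"
  assumes "qbraid m Q" "length a \<le> Suc m" "Suc k < length a" "a ! k = a ! Suc k"
    and "\<And>j. Suc j < length a \<Longrightarrow> sort a ! j = sort a ! Suc j \<Longrightarrow> app (Q j) g = (\<lambda>x. c *\<^sub>R g x)"
  shows "app (Q k) (app (Opr Q a) g) = (\<lambda>x. c *\<^sub>R app (Opr Q a) g x)"
  using assms
proof (induction k arbitrary: Q m a g)
  case 0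
  then obtain b a' where a: "a = b # b # a'" using list_two[of a] by auto
  let ?X = "Opr (\<lambda>k. Q (Suc (Suc k))) a'" and ?Q' = "\<lambda>k. Q (Suc k)"
  let ?p = "length (filter (\<lambda>x. x < b) a')"
  note sp = sort_Cons_split[where b=b and a="b # a'"] sort_Cons_split[where b=b and a=a']
  have p: "?p \<le> length a'" by (rule length_filter_le)
  moreover have "Suc (length a') \<le> m" using 0(2) a by simp
  ultimately have pm: "?p < m" "length a' < m" by linarith+
  have O: "Opr Q a = ?X * (ch ?Q' ?p * ch Q ?p)" by (simp add: a mult.assoc)
  have "Q 0 * Opr Q a = (Q 0 * ?X) * (ch ?Q' ?p * ch Q ?p)" by (simp only: O mult.assoc)
  also have "\<dots> = ?X * (Q 0 * ch ?Q' ?p * ch Q ?p)"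
    unfolding Opr_comm_0[OF 0(1) pm(2)] by (simp only: mult.assoc)
  also have "Q 0 * ch ?Q' ?p * ch Q ?p = ch ?Q' ?p * ch Q (Suc ?p)"
    unfolding ch_shift[OF 0(1) order_refl pm(1)] by (simp only: ch_Suc_left)
  finally have "Q 0 * Opr Q a = Opr Q a * Q ?p" by (simp add: O mult.assoc)
  then have "app (Q 0) (app (Opr Q a) g) = app (Opr Q a) (app (Q ?p) g)" by (metis app_simps(4))
  also have "app (Q ?p) g = (\<lambda>x. c *\<^sub>R g x)"
  proof (rule 0(5))
    show "Suc ?p < length a" by (simp add: a less_Suc_eq_le)
    show "sort a ! ?p = sort a ! Suc ?p"
      using sp(3)  sp(4)[of ?p] sp(7) p by (simp add: a)
  qed
  finally show ?case by (simp add: app_scaleR_fun)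
next
  case (Suc k)
  then obtain b a' where a: "a = b # a'" by (cases a) auto
  let ?p = "length (filter (\<lambda>x. x < b) a')" and ?Q' = "\<lambda>k. Q (Suc k)"
  note sp = sort_Cons_split[where b=b and a=a']
  have "app (?Q' k) (app (Opr ?Q' a') (app (ch Q ?p) g)) = (\<lambda>x. c *\<^sub>R app (Opr ?Q' a') (app (ch Q ?p) g) x)"
  proof (rule Suc.IH[OF qbraid_Suc[OF Suc.prems(1)]])
    fix j assume j: "Suc j < length a'" "sort a' ! j = sort a' ! Suc j"
    consider "Suc j < ?p" | "Suc j = ?p" | "?p \<le> j" by linarith
    then show "app (Q (Suc j)) (app (ch Q ?p) g) = (\<lambda>x. c *\<^sub>R app (ch Q ?p) g x)"
    proof cases
      case 1
      then obtain p where p: "?p = Suc p" "j < p" by (cases ?p) auto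
      have "Q (Suc j) * ch Q ?p = ch Q ?p * Q j"
        unfolding p(1) using p sp(1) Suc.prems(2) by (intro ch_shift1[OF Suc.prems(1)]) (auto simp: a)
      then have "app (Q (Suc j)) (app (ch Q ?p) g) = app (ch Q ?p) (app (Q j) g)" by (metis app_simps(4))
      also have "app (Q j) g = (\<lambda>x. c *\<^sub>R g x)"
        using 1 sp(2)[of j] sp(2)[of "Suc j"] j by (intro Suc.prems(5)) (auto simp: a)
      finally show ?thesis by (simp add: app_scaleR_fun)
    next
      case 2
      then have "sort a' ! j < b" "b \<le> sort a' ! Suc j" using sp(2)[of j] sp(4)[of "Suc j"] j by auto
      with j show ?thesis by simp
    next
      case 3
      have "Q (Suc j) * ch Q ?p = ch Q ?p * Q (Suc j)"
        using 3 j Suc.prems(2) by (intro ch_comm qbraid_comm[OF Suc.prems(1), symmetric]) (auto simp: a)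
      then have "app (Q (Suc j)) (app (ch Q ?p) g) = app (ch Q ?p) (app (Q (Suc j)) g)" by (metis app_simps(4))
      also have "app (Q (Suc j)) g = (\<lambda>x. c *\<^sub>R g x)"
        using 3 sp(4)[of j] sp(4)[of "Suc j"] j by (intro Suc.prems(5)) (auto simp: a)
      finally show ?thesis by (simp add: app_scaleR_fun)
    qed
  qed (use Suc.prems in \<open>auto simp: a\<close>)
  then show ?case by (simp add: a)
qed

text \<open>The inverse of \<open>Rd d k\<close>, by the quadratic relation.\<close>

definition Qd :: "nat \<Rightarrow> nat \<Rightarrow> (nat list, real) op" where
  "Qd d k = Rd d k - (q - 1 / q) *\<^sub>R 1"

lemma inverse_braid:
  fixes R :: "nat \<Rightarrow> 'h::real_algebra_1"
  assumes "braid m R" shows "qbraid m (\<lambda>k. R k - (q - 1 / q) *\<^sub>R 1)"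
proof -
  let ?Q = "\<lambda>k. R k - (q - 1 / q) *\<^sub>R 1"
  have inv: "R k * ?Q k = 1" "?Q k * R k = 1" if "k < m" for k
    using braid_sq[OF assms that] by (simp_all add: right_diff_distrib left_diff_distrib)
  have "?Q k * (?Q (Suc k) * ?Q k) = ?Q (Suc k) * (?Q k * ?Q (Suc k))" if k: "Suc k < m" for k
  proof -
    let ?a = "R k" and ?b = "R (Suc k)" and ?x = "?Q k" and ?y = "?Q (Suc k)"
    have iv: "?x * ?a = 1" "?a * ?x = 1" "?y * ?b = 1" "?b * ?y = 1"
      using inv[of k] inv[of "Suc k"] k by auto
    have 1: "?x * (?y * ?x) * (?a * (?b * ?a)) = 1"
    proof -
      have "?x * (?y * ?x) * (?a * (?b * ?a)) = ?x * (?y * ((?x * ?a) * (?b * ?a)))" by (simp only: mult.assoc)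
      also have "\<dots> = ?x * (?y * (?b * ?a))" by (simp only: iv mult_1_left)
      also have "\<dots> = ?x * ((?y * ?b) * ?a)" by (simp only: mult.assoc)
      also have "\<dots> = 1" by (simp only: iv mult_1_left)
      finally show ?thesis .
    qed
    have 2: "?b * (?a * ?b) * (?y * (?x * ?y)) = 1"
    proof -
      have "?b * (?a * ?b) * (?y * (?x * ?y)) = ?b * (?a * ((?b * ?y) * (?x * ?y)))" by (simp only: mult.assoc)
      also have "\<dots> = ?b * (?a * (?x * ?y))" by (simp only: iv mult_1_left)
      also have "\<dots> = ?b * ((?a * ?x) * ?y)" by (simp only: mult.assoc)
      also have "\<dots> = 1" by (simp only: iv mult_1_left)
      finally show ?thesis .
    qed
    have "?x * (?y * ?x) = ?x * (?y * ?x) * (?b * (?a * ?b) * (?y * (?x * ?y)))" by (simp only: 2 mult_1_right)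
    also have "\<dots> = (?x * (?y * ?x) * (?a * (?b * ?a))) * (?y * (?x * ?y))"
      by (simp only: braid3[OF assms k] mult.assoc)
    also have "\<dots> = ?y * (?x * ?y)" by (simp only: 1 mult_1_left)
    finally show ?thesis .
  qed
  moreover have "?Q j * ?Q k = ?Q k * ?Q j" if "Suc j < k" "k < m" for j k
    using braid_comm[OF assms that] by (simp add: algebra_simps)
  ultimately show ?thesis unfolding qbraid_def by blast
qed

lemma qbraid_Qd: "qbraid (d - 1) (Qd d)"
  using inverse_braid[OF braid_Rd[of d, where 'a=real]] by (simp add: Qd_def[abs_def])

text \<open>Values of the coordinate functional on rows that are already sorted. The columns may
  then be permuted only within blocks of equal rows, and the relation inside one row costs
  \<open>1 / q\<close> for each inversion.\<close>

definition gcoef :: "nat list \<Rightarrow> nat list \<Rightarrow> nat list \<Rightarrow> real" where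
  "gcoef a al g = (if length g = length a \<and> mset (zip a g) = mset (zip a al) then (1 / q) ^ invs (zip a g) else 0)"

text \<open>\<open>psi a al\<close> is the coordinate functional of the ordered monomial with row indices \<open>a\<close> and
  column indices \<open>al\<close>, as a function on words.\<close>
definition psi :: "nat list \<Rightarrow> nat list \<Rightarrow> nat list \<Rightarrow> nat list \<Rightarrow> real" where
  "psi a al i g = (if length i = length g \<and> sort i = a then app (Opr (Qd (length a)) i) (gcoef a al) g else 0)"

lemma gcoef_eig:
  assumes "sorted a" "Suc j < length a" "a ! j = a ! Suc j"
  shows "app (Qd (length a) j) (gcoef a al) = (\<lambda>g. (1 / q) *\<^sub>R gcoef a al g)"
proof
  fix g
  show "app (Qd (length a) j) (gcoef a al) g = (1 / q) *\<^sub>R gcoef a al g"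
  proof (cases "length g = length a")
    case True
    have sw: "zip a (swp j h) = swp j (zip a h)" if "length h = length a" for h :: "nat list"
      using zip_swp[of j a h] assms that by (simp add: swp_same)
    have asc: "gcoef a al (swp j h) = (1 / q) * gcoef a al h" if "length h = length a" "h ! j < h ! Suc j" for h
    proof -
      have "zip a h ! j < zip a h ! Suc j" using assms that by (simp add: less_prod_def)
      then have "invs (swp j (zip a h)) = Suc (invs (zip a h))" using assms that by (intro invs_swp) auto
      then show ?thesis using assms that by (simp add: gcoef_def sw)
    qed
    consider "g ! j = g ! Suc j" | "g ! j < g ! Suc j" | "g ! j > g ! Suc j" by fastforce
    then have "RR j (gcoef a al) g = q * gcoef a al g"
    proof cases
      case 2
      then have "g ! j \<noteq> g ! Suc j" by simp
      with 2 show ?thesis using asc[OF True 2] by (simp add: RR_def cc_def algebra_simps)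
    next
      case 3
      then have "gcoef a al (swp j (swp j g)) = (1 / q) * gcoef a al (swp j g)"
        using True assms by (intro asc) simp_all
      then have "gcoef a al (swp j g) = q * gcoef a al g" using True assms q0 by simp
      moreover have "g ! j \<noteq> g ! Suc j" "\<not> g ! j < g ! Suc j" using 3 by auto
      ultimately show ?thesis by (simp add: RR_def cc_def)
    qed (simp add: RR_def cc_def)
    then show ?thesis using True assms by (simp add: Qd_def app_Rd algebra_simps)
  next
    case False
    then show ?thesis by (simp add: Qd_def app_Rd gcoef_def)
  qed
qed

lemma psi_sorted:
  assumes "sorted (zip i g)" "length i = length g" "sorted (zip a al)" "length a = length al"
  shows "psi a al i g = (if i = a \<and> g = al then 1 else 0)"
proof -
  have si: "sorted i"
    using assms(1,2) by (auto simp: sorted_iff_nth_mono less_eq_prod_def) (metis nth_zip less_imp_le)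
  show ?thesis
  proof (cases "i = a")
    case True
    have "mset (zip a g) = mset (zip a al) \<longleftrightarrow> g = al"
    proof
      assume "mset (zip a g) = mset (zip a al)"
      then have "zip a g = zip a al" using assms True by (metis sort_key_id_if_sorted properties_for_sort)
      then show "g = al" using assms True by (metis map_snd_zip)
    qed simp
    then show ?thesis using True si assms invs_sorted[of "zip a g"] invs_sorted[of "zip a al"]
      by (simp add: psi_def Opr_sorted gcoef_def sort_key_id_if_sorted)
  qed (use si in \<open>simp add: psi_def sort_key_id_if_sorted\<close>)
qed

text \<open>Consistency of the relations. With equal rows it is the eigenvector property
  \<open>Opr_eig\<close>, at an ascent of the rows the recursion \<open>Opr_swp\<close>, at a
  descent the fact that \<open>Qd\<close> inverts \<open>Rd\<close>.\<close>

lemma RC_psi: "RC (psi a al)"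
  unfolding RC_def
proof (intro allI impI)
  fix i j :: "nat list" and k assume ij: "length i = length j" "Suc k < length i"
  let ?d = "length a"
  show "RR k (\<lambda>i. psi a al i j) i = RR k (psi a al i) j"
  proof (cases "sort i = a")
    case True
    have d: "length i = ?d" using True by (metis length_sort)
    have s: "sort (swp k i) = a" unfolding True[symmetric] using ij by (intro properties_for_sort) simp_all
    have sa: "sorted a" using True by (metis sorted_sort)
    let ?f = "app (Opr (Qd ?d) i) (gcoef a al)"
    have P: "psi a al i = (\<lambda>g. if length g = ?d then ?f g else 0)" using True d by (auto simp: psi_def fun_eq_iff)
    have col: "RR k (psi a al i) j = app (Rd ?d k) ?f j"
      unfolding P using ij d by (simp add: app_Rd RR_def)
    have R: "app (Rd ?d k) h x = app (Qd ?d k) h x + (q - 1 / q) * h x" for h x by (simp add: Qd_def)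
    consider "i ! k = i ! Suc k" | "i ! k < i ! Suc k" | "i ! k > i ! Suc k" by fastforce
    then show ?thesis
    proof cases
      case 1
      have "app (Qd ?d k) ?f = (\<lambda>x. (1 / q) *\<^sub>R ?f x)"
      proof (rule Opr_eig[OF qbraid_Qd])
        fix l assume "Suc l < length i" "sort i ! l = sort i ! Suc l"
        then show "app (Qd ?d l) (gcoef a al) = (\<lambda>x. (1 / q) *\<^sub>R gcoef a al x)"
          unfolding True d by (rule gcoef_eig[OF sa])
      qed (use ij d 1 in simp_all)
      then have "app (Rd ?d k) ?f j = q * ?f j" by (simp add: R algebra_simps)
      then show ?thesis unfolding col using 1 ij d by (simp add: RR_def cc_def P)
    next
      case 2
      have "Opr (Qd ?d) (swp k i) = Qd ?d k * Opr (Qd ?d) i"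
        using ij d 2 by (intro Opr_swp[OF qbraid_Qd]) auto
      then have "psi a al (swp k i) j = app (Qd ?d k) ?f j" using s ij by (simp add: psi_def)
      moreover have "i ! k \<noteq> i ! Suc k" using 2 by simp
      ultimately show ?thesis unfolding col using 2 ij d R[of ?f j] by (simp add: RR_def cc_def P)
    next
      case 3
      define i' where "i' = swp k i"
      have i': "i' ! k < i' ! Suc k" "length i' = ?d" "swp k i' = i" "sort i' = a"
        using 3 ij d s by (auto simp: i'_def)
      let ?f' = "app (Opr (Qd ?d) i') (gcoef a al)"
      have "Opr (Qd ?d) (swp k i') = Qd ?d k * Opr (Qd ?d) i'"
        using ij d i' by (intro Opr_swp[OF qbraid_Qd]) auto
      then have f: "?f = app (Qd ?d k) ?f'" using i' by simp
      have "Rd ?d k * Qd ?d k = 1"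
        using braid_sq[OF braid_Rd[of ?d, where 'a=real], of k] ij d by (simp add: Qd_def right_diff_distrib)
      from arg_cong[OF this, of "\<lambda>F. app F ?f'"] have "app (Rd ?d k) ?f = ?f'" unfolding f by simp
      then have "RR k (psi a al i) j = psi a al i' j" unfolding col using i' ij d by (simp add: psi_def)
      moreover have "i ! k \<noteq> i ! Suc k" "\<not> i ! k < i ! Suc k" using 3 by auto
      ultimately show ?thesis by (simp add: RR_def cc_def i'_def)
    qed
  next
    case False
    have "sort (swp k i) = sort i" using ij by (intro properties_for_sort) simp_all
    with False have "psi a al i = (\<lambda>g. 0)" "psi a al (swp k i) = (\<lambda>g. 0)" by (auto simp: psi_def fun_eq_iff)
    then show ?thesis by (simp add: RR_def)
  qed
qed

section \<open>Straightening of words into ordered monomials\<close>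

definition wt :: "nat list \<Rightarrow> nat list \<Rightarrow> nat" where
  "wt i j = sum_list (map (\<lambda>(x, y). x * y) (zip i j))"

lemma wt_mset: "mset (zip i j) = mset (zip i' j') \<Longrightarrow> wt i j = wt i' j'"
  unfolding wt_def by (metis mset_map sum_mset_sum_list)

lemma split_at_pair:
  assumes "Suc k < length i"
  obtains u x y v where "i = u @ x # y # v" "length u = k" "x = i ! k" "y = i ! Suc k"
proof
  show "i = take k i @ i ! k # i ! Suc k # drop (Suc (Suc k)) i"
    using assms by (simp add: Cons_nth_drop_Suc)
qed (use assms in auto)

text \<open>The rearrangement inequality for two letters. The correction term of an exchange
  relation swaps the rows but not the columns, so it has smaller \<open>wt\<close>, whereas swapping
  both preserves \<open>wt\<close>.\<close>

lemma wt_swp_less: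
  assumes "length i = length j" "Suc k < length i" "i ! Suc k < i ! k" "j ! Suc k < j ! k"
  shows "wt (swp k i) j < wt i j"
proof -
  obtain u x y v where i: "i = u @ x # y # v" "length u = k" "x = i ! k" "y = i ! Suc k"
    using split_at_pair assms(2) by metis
  obtain u' x' y' v' where j: "j = u' @ x' # y' # v'" "length u' = k" "x' = j ! k" "y' = j ! Suc k"
    using split_at_pair assms(1,2) by metis
  have "swp k i = u @ y # x # v" using i(1,2) swp_append2[of u 0 "x # y # v"] by simp
  moreover have "y * x' + x * y' < x * x' + y * y'"
  proof -
    have "y < x" "y' < x'" using assms(3,4) unfolding i(3,4) j(3,4) .
    then obtain c c' where "x = y + Suc c" "x' = y' + Suc c'" by (metis less_imp_Suc_add add_Suc_right)
    then show ?thesis by (simp add: algebra_simps)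
  qed
  ultimately show ?thesis using i(1,2) j(1,2) by (simp add: wt_def)
qed

text \<open>One straightening step, by the possible orders of rows and columns at \<open>k\<close>;
  only a descent in both produces the correction term. The coefficients are fixed before
  \<open>\<Theta>\<close>, and \<open>c > 0\<close> is what keeps leading coefficients
  positive.\<close>

lemma RC_descent:
  assumes "length i = length j" "Suc k < length i" "zip i j ! k > zip i j ! Suc k"
  obtains c e where "c > 0" "e = 0 \<or> wt (swp k i) j < wt i j"
    "\<And>\<Theta> :: nat list \<Rightarrow> nat list \<Rightarrow> 'a::real_vector. RC \<Theta> \<Longrightarrow>
        \<Theta> i j = c *\<^sub>R \<Theta> (swp k i) (swp k j) + e *\<^sub>R \<Theta> (swp k i) j"
proof -
  note len = assms(1,2)
  have R1: "RR k (\<lambda>i. \<Theta> i j) i = RR k (\<Theta> i) j" if "RC \<Theta>" for \<Theta> :: "nat list \<Rightarrow> nat list \<Rightarrow> 'a"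
    using that len by (intro RCD) auto
  have R2: "RR k (\<lambda>i. \<Theta> i j) (swp k i) = RR k (\<Theta> (swp k i)) j" if "RC \<Theta>" for \<Theta> :: "nat list \<Rightarrow> nat list \<Rightarrow> 'a"
    using that len by (intro RCD) auto
  have d: "i ! k > i ! Suc k \<or> (i ! k = i ! Suc k \<and> j ! k > j ! Suc k)"
    using assms by (auto simp: less_prod_def)
  then consider "i ! k = i ! Suc k" "j ! k > j ! Suc k" | "i ! k > i ! Suc k" "j ! k = j ! Suc k"
    | "i ! k > i ! Suc k" "j ! k > j ! Suc k" | "i ! k > i ! Suc k" "j ! k < j ! Suc k" by fastforce
  then show ?thesis
  proof cases
    case 1
    have e: "\<Theta> (swp k i) (swp k j) = q *\<^sub>R \<Theta> i j" if "RC \<Theta>" for \<Theta> :: "nat list \<Rightarrow> nat list \<Rightarrow> 'a"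
      using R1[OF that] 1 len by (simp add: RR_def cc_def swp_same)
    have "\<Theta> i j = (1 / q) *\<^sub>R \<Theta> (swp k i) (swp k j) + 0 *\<^sub>R \<Theta> (swp k i) j"
      if "RC \<Theta>" for \<Theta> :: "nat list \<Rightarrow> nat list \<Rightarrow> 'a"
      using e[OF that] q0 by simp
    then show ?thesis using that[of "1 / q" 0] q0 by simp
  next
    case 2
    then have ne: "i ! k \<noteq> i ! Suc k" "\<not> i ! k < i ! Suc k" by auto
    have e: "\<Theta> (swp k i) (swp k j) = q *\<^sub>R \<Theta> i j" if "RC \<Theta>" for \<Theta> :: "nat list \<Rightarrow> nat list \<Rightarrow> 'a"
      using R1[OF that] 2 ne len by (simp add: RR_def cc_def swp_same[of k j])
    have "\<Theta> i j = (1 / q) *\<^sub>R \<Theta> (swp k i) (swp k j) + 0 *\<^sub>R \<Theta> (swp k i) j"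
      if "RC \<Theta>" for \<Theta> :: "nat list \<Rightarrow> nat list \<Rightarrow> 'a"
      using e[OF that] q0 by simp
    then show ?thesis using that[of "1 / q" 0] q0 by simp
  next
    case 3
    then have ne: "i ! k \<noteq> i ! Suc k" "j ! k \<noteq> j ! Suc k" "\<not> j ! k < j ! Suc k" by auto
    have "\<Theta> i j = 1 *\<^sub>R \<Theta> (swp k i) (swp k j) + (- (q - 1 / q)) *\<^sub>R \<Theta> (swp k i) j"
      if "RC \<Theta>" for \<Theta> :: "nat list \<Rightarrow> nat list \<Rightarrow> 'a"
      using R2[OF that] 3 ne len by (simp add: RR_def cc_def algebra_simps)
    then show ?thesis using that[of 1 "- (q - 1 / q)"] wt_swp_less[OF len] 3 by simp
  next
    case 4
    then have ne: "i ! k \<noteq> i ! Suc k" "j ! k \<noteq> j ! Suc k" by auto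
    have "\<Theta> i j = 1 *\<^sub>R \<Theta> (swp k i) (swp k j) + 0 *\<^sub>R \<Theta> (swp k i) j"
      if "RC \<Theta>" for \<Theta> :: "nat list \<Rightarrow> nat list \<Rightarrow> 'a"
      using R2[OF that] 4 ne len by (simp add: RR_def cc_def algebra_simps)
    then show ?thesis using that[of 1 0] by simp
  qed
qed

text \<open>Termination is lexicographic in \<open>wt\<close> and the number of inversions: swapping
  both words keeps \<open>wt\<close> and removes an inversion, the correction term lowers
  \<open>wt\<close>.\<close>

lemma straighten_induct [consumes 1, case_names sorted descent]:
  assumes "length i = length j"
    and "\<And>i j. length i = length j \<Longrightarrow> sorted (zip i j) \<Longrightarrow> P i j"
    and "\<And>i j k. length i = length j \<Longrightarrow> Suc k < length i \<Longrightarrow> zip i j ! k > zip i j ! Suc k \<Longrightarrow>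
      P (swp k i) (swp k j) \<Longrightarrow> (wt (swp k i) j < wt i j \<Longrightarrow> P (swp k i) j) \<Longrightarrow> P i j"
  shows "P i j"
  using assms(1)
proof (induction "(wt i j, invs (zip i j))" arbitrary: i j rule: wf_induct_rule[OF wf_lex_prod[OF wf_less_than wf_less_than]])
  case (1 i j)
  show ?case
  proof (cases "sorted (zip i j)")
    case True
    then show ?thesis using assms(2) 1 by blast
  next
    case False
    then obtain k where k: "Suc k < length i" "zip i j ! k > zip i j ! Suc k"
      using unsorted_descent[of "zip i j"] 1(2) by auto
    let ?z = "zip (swp k i) (swp k j)"
    have z: "?z = swp k (zip i j)" by (rule zip_swp[OF k(1) 1(2)[symmetric]])
    have "swp k ?z = zip i j" unfolding z using k 1(2) by (intro swp_swp) simp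
    moreover have "invs (swp k ?z) = Suc (invs ?z)"
      unfolding z using k 1(2) by (intro invs_swp) simp_all
    ultimately have inv: "invs (zip i j) = Suc (invs ?z)" by simp
    have "wt (swp k i) (swp k j) = wt i j" using z k 1(2) by (intro wt_mset) simp
    then have "P (swp k i) (swp k j)" using inv 1 by simp
    moreover have "P (swp k i) j" if "wt (swp k i) j < wt i j" using that 1 by simp
    ultimately show ?thesis using assms(3)[of i j k] 1(2) k by blast
  qed
qed

definition SP :: "nat \<Rightarrow> (nat list \<times> nat list) set" where
  "SP d = {(a, al) \<in> LL n d \<times> LL n d. sorted (zip a al)}"

lemma finite_SP [simp]: "finite (SP d)"
  unfolding SP_def by (rule finite_subset[of _ "LL n d \<times> LL n d"]) auto

lemma RC_zero:
  fixes \<Theta> :: "nat list \<Rightarrow> nat list \<Rightarrow> 'a::real_vector"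
  assumes "RC \<Theta>" "\<And>a al. (a, al) \<in> SP d \<Longrightarrow> \<Theta> a al = 0" "i \<in> LL n d" "j \<in> LL n d"
  shows "\<Theta> i j = 0"
proof -
  have "length i = length j" using assms(3,4) by (simp add: LL_def)
  then show ?thesis using assms(3,4)
  proof (induction i j rule: straighten_induct)
    case (sorted i j)
    then show ?case by (intro assms(2)) (simp add: SP_def)
  next
    case (descent i j k)
    obtain c e where "c > 0" and e: "e = 0 \<or> wt (swp k i) j < wt i j"
      and ce: "\<Theta> i j = c *\<^sub>R \<Theta> (swp k i) (swp k j) + e *\<^sub>R \<Theta> (swp k i) j"
      using RC_descent[OF descent(1,2,3)] assms(1) by metis
    have L: "swp k i \<in> LL n d" "swp k j \<in> LL n d" using descent by (simp_all add: LL_length)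
    have "e *\<^sub>R \<Theta> (swp k i) j = 0" using e descent(5) L descent by auto
    then show ?case using ce descent(4) L by simp
  qed
qed

lemma RC_diff: "RC \<Theta> \<Longrightarrow> RC \<Phi> \<Longrightarrow> RC (\<lambda>i j. \<Theta> i j - \<Phi> i j)"
  unfolding RC_def
proof (intro allI impI)
  fix i :: "'a list" and j :: "'b list" and k
  assume "\<forall>i j k. length i = length j \<longrightarrow> Suc k < length i \<longrightarrow> RR k (\<lambda>i. \<Theta> i j) i = RR k (\<lambda>j. \<Theta> i j) j"
    "\<forall>i j k. length i = length j \<longrightarrow> Suc k < length i \<longrightarrow> RR k (\<lambda>i. \<Phi> i j) i = RR k (\<lambda>j. \<Phi> i j) j"
    "length i = length j" "Suc k < length i"
  then have "RR k (\<lambda>i. \<Theta> i j) i - RR k (\<lambda>i. \<Phi> i j) i = RR k (\<lambda>j. \<Theta> i j) j - RR k (\<lambda>j. \<Phi> i j) j" by metis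
  then show "RR k (\<lambda>i. \<Theta> i j - \<Phi> i j) i = RR k (\<lambda>j. \<Theta> i j - \<Phi> i j) j"
    by (simp add: RR_def algebra_simps split: if_splits)
qed

lemma RC_sum_psi: "RC (\<lambda>i j. \<Sum>p\<in>A. psi (fst p) (snd p) i j *\<^sub>R v p)"
  unfolding RC_def
proof (intro allI impI)
  fix i j :: "nat list" and k assume ij: "length i = length j" "Suc k < length i"
  have 1: "RR k (\<lambda>x. \<Sum>p\<in>A. F p x *\<^sub>R v p) x = (\<Sum>p\<in>A. RR k (F p) x *\<^sub>R v p)" for F :: "_ \<Rightarrow> nat list \<Rightarrow> real" and x
    by (simp add: RR_def scaleR_sum_right sum.distrib scaleR_add_left)
  show "RR k (\<lambda>i. \<Sum>p\<in>A. psi (fst p) (snd p) i j *\<^sub>R v p) i = RR k (\<lambda>j. \<Sum>p\<in>A. psi (fst p) (snd p) i j *\<^sub>R v p) j"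
    unfolding 1 RCD[OF RC_psi ij] ..
qed

text \<open>The spanning half of the PBW theorem; \<open>psi_triangular\<close> provides linear independence.\<close>
lemma RC_expand:
  fixes \<Theta> :: "nat list \<Rightarrow> nat list \<Rightarrow> 'a::real_vector"
  assumes "RC \<Theta>" "i \<in> LL n d" "j \<in> LL n d"
  shows "\<Theta> i j = (\<Sum>p\<in>SP d. psi (fst p) (snd p) i j *\<^sub>R \<Theta> (fst p) (snd p))"
proof -
  have "\<Theta> i j - (\<Sum>p\<in>SP d. psi (fst p) (snd p) i j *\<^sub>R \<Theta> (fst p) (snd p)) = 0"
  proof (rule RC_zero[OF RC_diff[OF assms(1) RC_sum_psi] _ assms(2,3)])
    fix a al assume p: "(a, al) \<in> SP d"
    have "psi (fst p) (snd p) a al *\<^sub>R \<Theta> (fst p) (snd p) = (if p = (a, al) then \<Theta> a al else 0)" if "p \<in> SP d" for p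
    proof (cases p)
      case (Pair b be)
      then show ?thesis using psi_sorted[of a al b be] p that by (auto simp: SP_def LL_length)
    qed
    then show "\<Theta> a al - (\<Sum>p\<in>SP d. psi (fst p) (snd p) a al *\<^sub>R \<Theta> (fst p) (snd p)) = 0"
      using p by (simp cong: sum.cong)
  qed
  then show ?thesis by simp
qed

text \<open>Straightening multiplies the term of the same content by positive factors only, and
  every other term has smaller \<open>wt\<close>. This nonvanishing leading coefficient is what
  \<open>det_regular_SP\<close> needs.\<close>

lemma psi_triangular:
  assumes "length i = length j" "sorted (zip a al)" "length a = length al"
  shows "(psi a al i j \<noteq> 0 \<longrightarrow> mset (zip i j) = mset (zip a al) \<or> wt a al < wt i j)
    \<and> (mset (zip i j) = mset (zip a al) \<longrightarrow> psi a al i j > 0)"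
  using assms(1)
proof (induction i j rule: straighten_induct)
  case (sorted i j)
  have "mset (zip i j) = mset (zip a al) \<longleftrightarrow> i = a \<and> j = al"
  proof
    assume "mset (zip i j) = mset (zip a al)"
    then have "zip i j = zip a al" using assms sorted by (metis sort_key_id_if_sorted properties_for_sort)
    then show "i = a \<and> j = al" using assms sorted by (metis map_fst_zip map_snd_zip)
  qed simp
  then show ?case using psi_sorted[OF sorted(2,1) assms(2,3)] by (cases "i = a \<and> j = al") auto
next
  case (descent i j k)
  obtain c e where c: "c > 0" and e: "e = 0 \<or> wt (swp k i) j < wt i j"
    and ce: "psi a al i j = c * psi a al (swp k i) (swp k j) + e * psi a al (swp k i) j"
    using RC_descent[OF descent(1,2,3), where 'a=real] RC_psi[of a al] by (metis real_scaleR_def)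
  have "zip (swp k i) (swp k j) = swp k (zip i j)" by (rule zip_swp[OF descent(2) descent(1)[symmetric]])
  then have m: "mset (zip (swp k i) (swp k j)) = mset (zip i j)" using descent(1,2) by simp
  have w: "wt (swp k i) (swp k j) = wt i j" by (rule wt_mset[OF m])
  show ?case
  proof (intro conjI impI)
    assume nz: "psi a al i j \<noteq> 0"
    then consider "psi a al (swp k i) (swp k j) \<noteq> 0" | "e \<noteq> 0" "psi a al (swp k i) j \<noteq> 0"
      using ce by force
    then show "mset (zip i j) = mset (zip a al) \<or> wt a al < wt i j"
    proof cases
      case 1
      then show ?thesis using descent(4) by (simp add: m w)
    next
      case 2
      then have "wt (swp k i) j < wt i j" using e by simp
      moreover from this have "mset (zip (swp k i) j) = mset (zip a al) \<or> wt a al < wt (swp k i) j"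
        using descent(5) 2 by blast
      ultimately show ?thesis using wt_mset[of "swp k i" j a al] by (metis less_trans)
    qed
  next
    assume eq: "mset (zip i j) = mset (zip a al)"
    have "e * psi a al (swp k i) j = 0"
    proof (rule ccontr)
      assume "e * psi a al (swp k i) j \<noteq> 0"
      then have less: "wt (swp k i) j < wt i j" and nz: "psi a al (swp k i) j \<noteq> 0" using e by auto
      have "wt i j = wt a al" by (rule wt_mset[OF eq])
      moreover have "wt a al \<le> wt (swp k i) j"
      proof -
        have "mset (zip (swp k i) j) = mset (zip a al) \<or> wt a al < wt (swp k i) j"
          using descent(5)[OF less] nz by blast
        then show ?thesis by (elim disjE) (simp_all add: wt_mset[of "swp k i" j a al])
      qed
      ultimately show False using less by simp
    qed
    then show "psi a al i j > 0" using ce c descent(4) eq m by auto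
  qed
qed

end

section \<open>The presented algebras\<close>

definition sp :: "'a list \<Rightarrow> ('a list \<times> 'a list) set" where "sp w = {p. fst p @ snd p = w}"

lemma sp_bij: "bij_betw (\<lambda>i. (take i w, drop i w)) {..length w} (sp w)"
  unfolding sp_def by (rule bij_betw_byWitness[where f'="\<lambda>p. length (fst p)"]) auto

lemma finite_sp [simp]: "finite (sp w)"
  using bij_betw_finite[OF sp_bij[of w]] by simp

lemma sp_assoc:
  fixes f :: "'a list \<Rightarrow> 'a list \<Rightarrow> 'a list \<Rightarrow> 'b::comm_monoid_add"
  shows "(\<Sum>p\<in>sp w. \<Sum>r\<in>sp (fst p). f (fst r) (snd r) (snd p)) = (\<Sum>p\<in>sp w. \<Sum>r\<in>sp (snd p). f (fst p) (fst r) (snd r))"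
proof -
  have "(\<Sum>p\<in>sp w. \<Sum>r\<in>sp (fst p). f (fst r) (snd r) (snd p))
     = (\<Sum>z\<in>(SIGMA p:sp w. sp (fst p)). f (fst (snd z)) (snd (snd z)) (snd (fst z)))"
    by (subst sum.Sigma) (auto simp: case_prod_unfold)
  also have "\<dots> = (\<Sum>z\<in>(SIGMA p:sp w. sp (snd p)). f (fst (fst z)) (fst (snd z)) (snd (snd z)))"
    by (rule sum.reindex_bij_witness[of _ "\<lambda>((a, x), (b, v)). ((a @ b, v), (a, b))" "\<lambda>((x, v), (a, b)). ((a, b @ v), (b, v))"])
       (auto simp: sp_def)
  also have "\<dots> = (\<Sum>p\<in>sp w. \<Sum>r\<in>sp (snd p). f (fst p) (fst r) (snd r))"
    by (subst sum.Sigma) (auto simp: case_prod_unfold)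
  finally show ?thesis .
qed

lemma pmul_sp: "pmul p r w = (\<Sum>x\<in>sp w. p (fst x) * r (snd x))"
  unfolding pmul_def by (subst sum.reindex_bij_betw[OF sp_bij[of w], symmetric]) simp

lemma pmul_assoc: "pmul (pmul p r) s = pmul p (pmul r s)"
proof
  show "pmul (pmul p r) s w = pmul p (pmul r s) w" for w
    using sp_assoc[of "\<lambda>a b v. p a * r b * s v" w]
    by (simp add: pmul_sp sum_distrib_left sum_distrib_right mult.assoc)
qed

lemma pmul_linear:
  "pmul (padd p r) s = padd (pmul p s) (pmul r s)" "pmul s (padd p r) = padd (pmul s p) (pmul s r)"
  "pmul (psub p r) s = psub (pmul p s) (pmul r s)" "pmul s (psub p r) = psub (pmul s p) (pmul s r)"
  "pmul (psc c p) s = psc c (pmul p s)" "pmul s (psc c p) = psc c (pmul s p)"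
  by (auto simp: fun_eq_iff pmul_def padd_def psub_def psc_def sum.distrib sum_subtractf sum_distrib_left algebra_simps)

lemma sum_sp_delta: "(\<Sum>p\<in>sp w. if p = a then f p else (0::complex)) = (if a \<in> sp w then f a else 0)"
  by (rule sum.delta) simp

lemma pword_mult [simp]: "pmul (pword u) (pword v) = pword (u @ v)"
proof
  fix w
  have "pmul (pword u) (pword v) w = (\<Sum>x\<in>sp w. if x = (u, v) then 1 else 0)"
    unfolding pmul_sp by (intro sum.cong) (auto simp: pword_def)
  then show "pmul (pword u) (pword v) w = pword (u @ v) w" unfolding sum_sp_delta by (auto simp: pword_def sp_def)
qed

lemma pone_pword: "pone = pword []"
  by (simp add: fun_eq_iff pone_def pword_def)

lemma pmul_pone [simp]: "pmul pone p = p" "pmul p pone = p"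
proof -
  have "pmul pone p w = (\<Sum>x\<in>sp w. if x = ([], w) then p w else 0)" for w
    unfolding pmul_sp by (intro sum.cong) (auto simp: pone_def sp_def)
  then show "pmul pone p = p" unfolding sum_sp_delta by (auto simp: sp_def)
  have "pmul p pone w = (\<Sum>x\<in>sp w. if x = (w, []) then p w else 0)" for w
    unfolding pmul_sp by (intro sum.cong) (auto simp: pone_def sp_def)
  then show "pmul p pone = p" unfolding sum_sp_delta by (auto simp: sp_def)
qed

lemma pmul_pzero [simp]: "pmul pzero p = pzero" "pmul p pzero = pzero"
  by (auto simp: fun_eq_iff pmul_def pzero_def)

lemma pfin_pzero [simp]: "pfin pzero" and pfin_pword [simp]: "pfin (pword w)" and pfin_pone [simp]: "pfin pone"
  by (auto simp: pfin_def pzero_def pword_def pone_def)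

lemma pfin_padd [simp]: "pfin p \<Longrightarrow> pfin r \<Longrightarrow> pfin (padd p r)"
  unfolding pfin_def padd_def by (rule finite_subset[of _ "{w. p w \<noteq> 0} \<union> {w. r w \<noteq> 0}"]) auto

lemma pfin_psub [simp]: "pfin p \<Longrightarrow> pfin r \<Longrightarrow> pfin (psub p r)"
  unfolding pfin_def psub_def by (rule finite_subset[of _ "{w. p w \<noteq> 0} \<union> {w. r w \<noteq> 0}"]) auto

lemma pfin_psc [simp]: "pfin p \<Longrightarrow> pfin (psc c p)"
  unfolding pfin_def psc_def by (rule finite_subset[of _ "{w. p w \<noteq> 0}"]) auto

lemma pfin_psum: "(\<And>x. x \<in> A \<Longrightarrow> pfin (F x)) \<Longrightarrow> pfin (psum A F)"
proof (cases "finite A")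
  case True
  assume "\<And>x. x \<in> A \<Longrightarrow> pfin (F x)"
  moreover have "{w. psum A F w \<noteq> 0} \<subseteq> (\<Union>x\<in>A. {w. F x w \<noteq> 0})"
  proof
    fix w assume "w \<in> {w. psum A F w \<noteq> 0}"
    then have "(\<Sum>x\<in>A. F x w) \<noteq> 0" by (simp add: psum_def)
    then obtain x where "x \<in> A" "F x w \<noteq> 0" by (rule sum.not_neutral_contains_not_neutral)
    then show "w \<in> (\<Union>x\<in>A. {w. F x w \<noteq> 0})" by blast
  qed
  ultimately show ?thesis unfolding pfin_def using True by (meson finite_UN finite_subset)
qed (simp add: pfin_def psum_def)

lemma pfin_pmul [simp]: "pfin p \<Longrightarrow> pfin r \<Longrightarrow> pfin (pmul p r)"
proof -
  assume "pfin p" "pfin r"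
  then have "finite ((\<lambda>(u, v). u @ v) ` ({w. p w \<noteq> 0} \<times> {w. r w \<noteq> 0}))" by (simp add: pfin_def)
  moreover have "{w. pmul p r w \<noteq> 0} \<subseteq> (\<lambda>(u, v). u @ v) ` ({w. p w \<noteq> 0} \<times> {w. r w \<noteq> 0})"
  proof
    fix w assume "w \<in> {w. pmul p r w \<noteq> 0}"
    then have "(\<Sum>x\<in>sp w. p (fst x) * r (snd x)) \<noteq> 0" by (simp add: pmul_sp)
    then obtain x where "x \<in> sp w" "p (fst x) * r (snd x) \<noteq> 0"
      by (rule sum.not_neutral_contains_not_neutral)
    then have "w = (\<lambda>(u, v). u @ v) x" "x \<in> {w. p w \<noteq> 0} \<times> {w. r w \<noteq> 0}" by (simp_all add: sp_def case_prod_unfold mem_Times_iff)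
    then show "w \<in> (\<lambda>(u, v). u @ v) ` ({w. p w \<noteq> 0} \<times> {w. r w \<noteq> 0})" by (rule image_eqI)
  qed
  ultimately show ?thesis unfolding pfin_def by (rule rev_finite_subset)
qed

lemma psum_empty [simp]: "psum {} F = pzero" and psum_infinite: "infinite A \<Longrightarrow> psum A F = pzero"
  by (simp_all add: fun_eq_iff psum_def pzero_def)

lemma psum_insert [simp]: "finite A \<Longrightarrow> x \<notin> A \<Longrightarrow> psum (insert x A) F = padd (F x) (psum A F)"
  by (simp add: fun_eq_iff psum_def padd_def)

lemma psum_cong: "A = B \<Longrightarrow> (\<And>x. x \<in> B \<Longrightarrow> F x = G x) \<Longrightarrow> psum A F = psum B G"
  by (auto simp: psum_def fun_eq_iff intro: sum.cong)

lemma lin_eq: "finite A \<Longrightarrow> {w. p w \<noteq> 0} \<subseteq> A \<Longrightarrow> lin h p = (\<Sum>w\<in>A. p w * h w)"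
  unfolding lin_def by (rule sum.mono_neutral_left) auto

lemma lin_pzero [simp]: "lin h pzero = 0"
  by (simp add: lin_def pzero_def)

lemma lin_pword [simp]: "lin h (pword w) = h w"
  by (subst lin_eq[of "{w}"]) (auto simp: pword_def)

lemma lin_padd: "pfin p \<Longrightarrow> pfin r \<Longrightarrow> lin h (padd p r) = lin h p + lin h r"
  and lin_psub: "pfin p \<Longrightarrow> pfin r \<Longrightarrow> lin h (psub p r) = lin h p - lin h r"
proof -
  assume *: "pfin p" "pfin r"
  let ?A = "{w. p w \<noteq> 0} \<union> {w. r w \<noteq> 0}"
  have A: "finite ?A" using * by (simp add: pfin_def)
  have S: "{w. padd p r w \<noteq> 0} \<subseteq> ?A" "{w. psub p r w \<noteq> 0} \<subseteq> ?A" "{w. p w \<noteq> 0} \<subseteq> ?A" "{w. r w \<noteq> 0} \<subseteq> ?A"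
    by (auto simp: padd_def psub_def)
  show "lin h (padd p r) = lin h p + lin h r"
    unfolding lin_eq[OF A S(1)] lin_eq[OF A S(3)] lin_eq[OF A S(4)] by (simp add: padd_def distrib_right sum.distrib)
  show "lin h (psub p r) = lin h p - lin h r"
    unfolding lin_eq[OF A S(2)] lin_eq[OF A S(3)] lin_eq[OF A S(4)] by (simp add: psub_def left_diff_distrib sum_subtractf)
qed

lemma lin_psc: "pfin p \<Longrightarrow> lin h (psc c p) = c * lin h p"
  by (subst lin_eq[of "{w. p w \<noteq> 0}" "psc c p"]) (auto simp: pfin_def psc_def lin_def sum_distrib_left mult.assoc)

lemma lin_psum: "finite A \<Longrightarrow> (\<And>x. x \<in> A \<Longrightarrow> pfin (F x)) \<Longrightarrow> lin h (psum A F) = (\<Sum>x\<in>A. lin h (F x))"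
  by (induction A rule: finite_induct) (auto simp: lin_padd pfin_psum)

lemma pfin_expand: "pfin p \<Longrightarrow> p = psum {w. p w \<noteq> 0} (\<lambda>w. psc (p w) (pword w))"
proof
  fix w assume "pfin p"
  have "(\<Sum>x | p x \<noteq> 0. p x * (if w = x then 1 else 0)) = (\<Sum>x | p x \<noteq> 0. if x = w then p x else 0)"
    by (intro sum.cong) auto
  then show "p w = psum {w. p w \<noteq> 0} (\<lambda>w. psc (p w) (pword w)) w"
    using \<open>pfin p\<close> by (auto simp: psum_def psc_def pword_def pfin_def sum.delta)
qed

lemma pmul_psum: "finite A \<Longrightarrow> pmul (psum A F) s = psum A (\<lambda>x. pmul (F x) s)"
  "finite A \<Longrightarrow> pmul s (psum A F) = psum A (\<lambda>x. pmul s (F x))"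
  by (induction A rule: finite_induct) (auto simp: pmul_linear)

lemma pmul_expand:
  assumes "pfin p" "pfin r"
  shows "pmul p r = psum {w. p w \<noteq> 0} (\<lambda>u. psum {w. r w \<noteq> 0} (\<lambda>v. psc (p u * r v) (pword (u @ v))))"
proof -
  have fin: "finite {w. p w \<noteq> 0}" "finite {w. r w \<noteq> 0}" using assms by (simp_all add: pfin_def)
  have "pmul p r = pmul (psum {w. p w \<noteq> 0} (\<lambda>w. psc (p w) (pword w))) (psum {w. r w \<noteq> 0} (\<lambda>w. psc (r w) (pword w)))"
    by (rule arg_cong2[where f=pmul, OF pfin_expand[OF assms(1)] pfin_expand[OF assms(2)]])
  also have "\<dots> = psum {w. r w \<noteq> 0} (\<lambda>x. psc (r x) (psum {w. p w \<noteq> 0} (\<lambda>u. psc (p u) (pword (u @ x)))))"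
    using fin by (simp add: pmul_psum pmul_linear)
  also have "\<dots> = psum {w. p w \<noteq> 0} (\<lambda>u. psum {w. r w \<noteq> 0} (\<lambda>v. psc (p u * r v) (pword (u @ v))))"
    unfolding psum_def psc_def sum_distrib_left
    by (rule ext, subst sum.swap) (simp add: ac_simps)
  finally show ?thesis .
qed

lemma lin_pmul:
  assumes "pfin p" "pfin r"
  shows "lin h (pmul p r) = (\<Sum>u | p u \<noteq> 0. p u * (\<Sum>v | r v \<noteq> 0. r v * h (u @ v)))"
proof -
  have fin: "finite {w. p w \<noteq> 0}" "finite {w. r w \<noteq> 0}" using assms by (simp_all add: pfin_def)
  have "lin h (pmul p r) = (\<Sum>u | p u \<noteq> 0. \<Sum>v | r v \<noteq> 0. p u * r v * h (u @ v))"
    unfolding pmul_expand[OF assms] using fin by (simp add: lin_psum pfin_psum lin_psc)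
  then show ?thesis by (simp add: sum_distrib_left mult.assoc)
qed

lemma psc_padd: "psc c (padd p r) = padd (psc c p) (psc c r)" and psc_psc: "psc c (psc d p) = psc (c * d) p"
  and psc_pzero [simp]: "psc c pzero = pzero" and psc_1 [simp]: "psc 1 p = p" and psc_0 [simp]: "psc 0 p = pzero"
  by (simp_all add: fun_eq_iff psc_def padd_def pzero_def algebra_simps)

lemma ideal_psc: "p \<in> ideal Rel \<Longrightarrow> psc c p \<in> ideal Rel"
proof (induction rule: ideal.induct)
  case (gen r a b)
  then have "pmul (pmul (psc c a) r) b \<in> ideal Rel" by (intro ideal.gen) auto
  then show ?case by (simp add: pmul_linear)
qed (auto simp: psc_padd intro: ideal.intros)

lemma ideal_pmul_right: "p \<in> ideal Rel \<Longrightarrow> pfin s \<Longrightarrow> pmul p s \<in> ideal Rel"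
proof (induction rule: ideal.induct)
  case (gen r a b)
  then have "pmul (pmul a r) (pmul b s) \<in> ideal Rel" by (intro ideal.gen) auto
  then show ?case by (simp add: pmul_assoc)
qed (auto simp: pmul_linear intro: ideal.intros)

lemma ideal_pmul_left: "p \<in> ideal Rel \<Longrightarrow> pfin s \<Longrightarrow> pmul s p \<in> ideal Rel"
proof (induction rule: ideal.induct)
  case (gen r a b)
  then have "pmul (pmul (pmul s a) r) b \<in> ideal Rel" by (intro ideal.gen) auto
  then show ?case by (simp add: pmul_assoc)
qed (auto simp: pmul_linear intro: ideal.intros)

lemma psub_rules:
  "psub p r = padd p (psc (-1) r)" "psub r p = psc (-1) (psub p r)" "psub p s = padd (psub p r) (psub r s)"
  "psub (padd p r) (padd p' r') = padd (psub p p') (psub r r')"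
  "psub (psub p r) (psub p' r') = psub (psub p p') (psub r r')"
  "psub (psc c p) (psc c p') = psc c (psub p p')"
  by (simp_all add: fun_eq_iff psub_def padd_def psc_def algebra_simps)

lemma ideal_psub: "p \<in> ideal Rel \<Longrightarrow> r \<in> ideal Rel \<Longrightarrow> psub p r \<in> ideal Rel"
  unfolding psub_rules(1)[of p r] by (intro ideal.add ideal_psc)

lemma ideal_Rel: "r \<in> Rel \<Longrightarrow> r \<in> ideal Rel"
  using ideal.gen[of r Rel pone pone] by simp

lemma psub_self [simp]: "psub p p = pzero" and psub_pzero [simp]: "psub p pzero = p"
  by (simp_all add: fun_eq_iff psub_def pzero_def)

lemma congr_refl [simp]: "congr Rel p p"
  by (simp add: congr_def ideal.zero)

lemma congr_sym: "congr Rel p r \<Longrightarrow> congr Rel r p"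
  unfolding congr_def psub_rules(2)[of r p] by (rule ideal_psc)

lemma congr_trans: "congr Rel p r \<Longrightarrow> congr Rel r s \<Longrightarrow> congr Rel p s"
  unfolding congr_def psub_rules(3)[of p s r] by (rule ideal.add)

lemma congr_padd: "congr Rel p p' \<Longrightarrow> congr Rel r r' \<Longrightarrow> congr Rel (padd p r) (padd p' r')"
  unfolding congr_def psub_rules(4) by (rule ideal.add)

lemma congr_psub: "congr Rel p p' \<Longrightarrow> congr Rel r r' \<Longrightarrow> congr Rel (psub p r) (psub p' r')"
  unfolding congr_def psub_rules(5)[of p r p' r'] by (rule ideal_psub)

lemma congr_psc: "congr Rel p p' \<Longrightarrow> congr Rel (psc c p) (psc c p')"
  unfolding congr_def psub_rules(6) by (rule ideal_psc)

lemma congr_pmul: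
  assumes "congr Rel p p'" "congr Rel r r'" "pfin r" "pfin p'"
  shows "congr Rel (pmul p r) (pmul p' r')"
proof (rule congr_trans)
  show "congr Rel (pmul p r) (pmul p' r)"
    using ideal_pmul_right[of "psub p p'" Rel r] assms by (simp add: congr_def pmul_linear)
  show "congr Rel (pmul p' r) (pmul p' r')"
    using ideal_pmul_left[of "psub r r'" Rel p'] assms by (simp add: congr_def pmul_linear)
qed

text \<open>The presented algebras depend on \<open>n\<close> and \<open>q\<close> (through \<open>Rel\<close>), whereas a type cannot. So the
  type below is the product, over all sets \<open>Rel\<close> of relations, of the algebras presented by \<open>Rel\<close>.\<close>
definition Urel :: "(poly set \<Rightarrow> poly) \<Rightarrow> (poly set \<Rightarrow> poly) \<Rightarrow> bool" where
  "Urel f g \<longleftrightarrow> (\<forall>Rel. pfin (f Rel) \<and> pfin (g Rel) \<and> congr Rel (f Rel) (g Rel))"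

quotient_type alg = "poly set \<Rightarrow> poly" / partial: Urel
  morphisms rep_alg abs_alg
proof (rule part_equivpI)
  show "\<exists>x. Urel x x" by (rule exI[of _ "\<lambda>_. pzero"]) (simp add: Urel_def)
  show "symp Urel" by (auto simp: symp_def Urel_def intro: congr_sym)
  show "transp Urel" by (auto simp: transp_def Urel_def intro: congr_trans)
qed

instantiation alg :: real_algebra_1
begin
lift_definition zero_alg :: alg is "\<lambda>Rel. pzero" by (simp add: Urel_def)
lift_definition one_alg :: alg is "\<lambda>Rel. pone" by (simp add: Urel_def)
lift_definition plus_alg :: "alg \<Rightarrow> alg \<Rightarrow> alg" is "\<lambda>f g Rel. padd (f Rel) (g Rel)"
  by (auto simp: Urel_def intro: congr_padd)
lift_definition minus_alg :: "alg \<Rightarrow> alg \<Rightarrow> alg" is "\<lambda>f g Rel. psub (f Rel) (g Rel)"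
  by (auto simp: Urel_def intro: congr_psub)
lift_definition uminus_alg :: "alg \<Rightarrow> alg" is "\<lambda>f Rel. psc (-1) (f Rel)"
  by (auto simp: Urel_def intro: congr_psc)
lift_definition times_alg :: "alg \<Rightarrow> alg \<Rightarrow> alg" is "\<lambda>f g Rel. pmul (f Rel) (g Rel)"
  by (auto simp: Urel_def intro: congr_pmul)
lift_definition scaleR_alg :: "real \<Rightarrow> alg \<Rightarrow> alg" is "\<lambda>c f Rel. psc (of_real c) (f Rel)"
  by (auto simp: Urel_def intro: congr_psc)

instance
proof
  fix a b c :: alg and x y :: real
  have U: "Urel f g" if "f = g" "\<And>Rel. pfin (f Rel)" for f g using that by (simp add: Urel_def)
  show "a + b + c = a + (b + c)" "a + b = b + a" "0 + a = a" "- a + a = 0" "a - b = a + - b"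
    "x *\<^sub>R (a + b) = x *\<^sub>R a + x *\<^sub>R b" "(x + y) *\<^sub>R a = x *\<^sub>R a + y *\<^sub>R a"
    "x *\<^sub>R y *\<^sub>R a = (x * y) *\<^sub>R a" "1 *\<^sub>R a = a"
    by (transfer; rule U; simp add: Urel_def fun_eq_iff padd_def psub_def psc_def pzero_def algebra_simps)+
  show "a * b * c = a * (b * c)" "1 * a = a" "a * 1 = a" "(a + b) * c = a * c + b * c" "a * (b + c) = a * b + a * c"
    "x *\<^sub>R a * b = x *\<^sub>R (a * b)" "a * x *\<^sub>R b = x *\<^sub>R (a * b)"
    by (transfer; rule U; simp add: Urel_def pmul_assoc pmul_linear)+
  show "(0::alg) \<noteq> 1"
  proof (transfer, unfold Urel_def, intro notI)
    assume "\<forall>Rel. pfin pzero \<and> pfin pone \<and> congr Rel pzero pone"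
    then have "psub pzero pone \<in> ideal {}" by (simp add: congr_def)
    moreover have "p = pzero" if "p \<in> ideal {}" for p
      using that by (induction rule: ideal.induct) (auto simp: fun_eq_iff padd_def pzero_def)
    ultimately have "psub pzero pone [] = pzero []" by metis
    then show False by (simp add: psub_def pzero_def pone_def)
  qed
qed
end

fun cgen :: "gen \<Rightarrow> bool" where
  "cgen (Z a al) = (a = al)" | "cgen (Zb a al) = False" | "cgen T = True"

text \<open>The counit of the matrix bialgebra on words, with the inverse determinant sent to 1. It
  is a character compatible with the relations, see \<open>good_rel_mat\<close> and
  \<open>good_rel_gl\<close>.\<close>

definition ceps :: "gen list \<Rightarrow> complex" where
  "ceps w = (if \<forall>g\<in>set w. cgen g then 1 else 0)"

lemma ceps_append [simp]: "ceps (u @ v) = ceps u * ceps v" and ceps_Nil [simp]: "ceps [] = 1"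
  by (auto simp: ceps_def)

lemma lin_ceps_pmul:
  assumes "pfin p" "pfin r" shows "lin ceps (pmul p r) = lin ceps p * lin ceps r"
proof -
  have "lin ceps (pmul p r) = (\<Sum>u | p u \<noteq> 0. p u * (\<Sum>v | r v \<noteq> 0. r v * ceps (u @ v)))"
    by (rule lin_pmul[OF assms])
  also have "\<dots> = lin ceps p * lin ceps r"
    unfolding lin_def sum_product by (simp add: sum_distrib_left ac_simps)
  finally show ?thesis .
qed

text \<open>At all other sets of relations the class of \<open>p\<close> is given by the counit, so that
  \<open>cls Rel\<close> is unital and respects the relations of \<open>Rel\<close> there as well.\<close>
definition cls :: "poly set \<Rightarrow> poly \<Rightarrow> alg" where
  "cls Rel p = abs_alg (\<lambda>R. if R = Rel then p else psc (lin ceps p) pone)"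

lemma Urel_refl: "(\<And>R. pfin (f R)) \<Longrightarrow> Urel f f"
  by (simp add: Urel_def)

lemma cls_padd: "pfin p \<Longrightarrow> pfin r \<Longrightarrow> cls Rel (padd p r) = cls Rel p + cls Rel r"
  unfolding cls_def
  by (subst plus_alg.abs_eq)
    (auto intro!: Urel_refl arg_cong[where f=abs_alg] simp: fun_eq_iff lin_padd padd_def psc_def algebra_simps)

lemma cls_psub: "pfin p \<Longrightarrow> pfin r \<Longrightarrow> cls Rel (psub p r) = cls Rel p - cls Rel r"
  unfolding cls_def
  by (subst minus_alg.abs_eq)
    (auto intro!: Urel_refl arg_cong[where f=abs_alg] simp: fun_eq_iff lin_psub psub_def psc_def algebra_simps)

lemma cls_psc: "pfin p \<Longrightarrow> cls Rel (psc (of_real c) p) = c *\<^sub>R cls Rel p"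
  unfolding cls_def
  by (subst scaleR_alg.abs_eq)
    (auto intro!: Urel_refl arg_cong[where f=abs_alg] simp: fun_eq_iff lin_psc psc_def algebra_simps)

lemma cls_pmul: "pfin p \<Longrightarrow> pfin r \<Longrightarrow> cls Rel (pmul p r) = cls Rel p * cls Rel r"
  unfolding cls_def
  by (subst times_alg.abs_eq)
    (auto intro!: Urel_refl arg_cong[where f=abs_alg] simp: fun_eq_iff lin_ceps_pmul pmul_linear psc_psc mult.commute)

lemma cls_pone [simp]: "cls Rel pone = 1"
  unfolding cls_def one_alg.abs_eq
  by (auto simp: fun_eq_iff pone_pword intro!: arg_cong[where f=abs_alg])

lemma cls_pzero [simp]: "cls Rel pzero = 0"
  unfolding cls_def zero_alg.abs_eq
  by (auto simp: fun_eq_iff intro!: arg_cong[where f=abs_alg])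

lemma cls_psum: "finite A \<Longrightarrow> (\<And>x. x \<in> A \<Longrightarrow> pfin (F x)) \<Longrightarrow> cls Rel (psum A F) = (\<Sum>x\<in>A. cls Rel (F x))"
  by (induction A rule: finite_induct) (auto simp: cls_padd pfin_psum)

definition Wd :: "poly set \<Rightarrow> gen list \<Rightarrow> alg" where
  "Wd Rel w = cls Rel (pword w)"

lemma Wd_append: "Wd Rel (u @ v) = Wd Rel u * Wd Rel v"
  by (simp add: Wd_def cls_pmul[symmetric])

lemma Wd_Nil [simp]: "Wd Rel [] = 1"
  by (simp add: Wd_def pone_pword[symmetric])

lemma Wd_Cons: "Wd Rel (g # w) = Wd Rel [g] * Wd Rel w"
  using Wd_append[of Rel "[g]" w] by simp

lemma lin_pmul2:
  assumes "pfin a" "pfin r" "pfin b"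
  shows "lin h (pmul (pmul a r) b) = (\<Sum>u | a u \<noteq> 0. a u * (\<Sum>v | b v \<noteq> 0. b v * lin h (pmul (pmul (pword u) r) (pword v))))"
proof -
  let ?A = "{u. a u \<noteq> 0}" and ?B = "{v. b v \<noteq> 0}"
  have fin: "finite ?A" "finite ?B" using assms by (simp_all add: pfin_def)
  have "lin h (pmul (pmul a r) b) = lin h (pmul (pmul (psum ?A (\<lambda>u. psc (a u) (pword u))) r) (psum ?B (\<lambda>u. psc (b u) (pword u))))"
    using pfin_expand[OF assms(1)] pfin_expand[OF assms(3)] by (intro arg_cong[where f="lin h"] arg_cong2[where f=pmul] refl) auto
  also have "\<dots> = (\<Sum>v\<in>?B. b v * (\<Sum>u\<in>?A. a u * lin h (pmul (pmul (pword u) r) (pword v))))"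
    using fin assms(2) by (simp add: pmul_psum pmul_linear lin_psum lin_psc pfin_psum)
  also have "\<dots> = (\<Sum>u\<in>?A. a u * (\<Sum>v\<in>?B. b v * lin h (pmul (pmul (pword u) r) (pword v))))"
    unfolding sum_distrib_left by (subst sum.swap) (simp add: ac_simps)
  finally show ?thesis .
qed

lemma lin_ideal:
  assumes "\<And>r u v. r \<in> Rel \<Longrightarrow> lin h (pmul (pmul (pword u) r) (pword v)) = 0" "\<And>r. r \<in> Rel \<Longrightarrow> pfin r"
    and "p \<in> ideal Rel"
  shows "pfin p \<and> lin h p = 0"
  using assms(3)
proof (induction rule: ideal.induct)
  case (gen r a b)
  then show ?case using assms(1,2)[OF gen(1)] by (subst lin_pmul2) simp_all
qed (simp_all add: lin_padd)

text \<open>The condition under which \<open>cls Rel\<close> respects the relations in every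
  component of \<open>alg\<close>, the components other than \<open>Rel\<close> being given by the
  counit.\<close>

definition good :: "poly set \<Rightarrow> bool" where
  "good Rel \<longleftrightarrow> (\<forall>r\<in>Rel. pfin r \<and> lin ceps r = 0)"

lemma good_ideal: "good Rel \<Longrightarrow> p \<in> ideal Rel \<Longrightarrow> pfin p \<and> lin ceps p = 0"
  by (rule lin_ideal) (auto simp: good_def lin_ceps_pmul)

lemma cls_eqI:
  assumes "good Rel" "congr Rel p r" "pfin p" "pfin r"
  shows "cls Rel p = cls Rel r"
proof -
  have "lin ceps (psub p r) = 0" using good_ideal[OF assms(1)] assms(2) by (simp add: congr_def)
  then have "lin ceps p = lin ceps r" using assms by (simp add: lin_psub)
  then have "Urel (\<lambda>R. if R = Rel then p else psc (lin ceps p) pone) (\<lambda>R. if R = Rel then r else psc (lin ceps r) pone)"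
    using assms by (auto simp: Urel_def)
  then show ?thesis unfolding cls_def by (rule Quotient_rel_abs[OF Quotient_alg])
qed

lemma cls_eqD:
  assumes "cls Rel p = cls Rel r" "pfin p" "pfin r"
  shows "congr Rel p r"
proof -
  let ?f = "\<lambda>R. if R = Rel then p else psc (lin ceps p) pone" and ?g = "\<lambda>R. if R = Rel then r else psc (lin ceps r) pone"
  have "Urel ?f ?f" "Urel ?g ?g" using assms by (auto intro: Urel_refl)
  moreover have "abs_alg ?f = abs_alg ?g" using assms(1) by (simp add: cls_def)
  ultimately have "Urel ?f ?g" using Quotient_rel[OF Quotient_alg, of ?f ?g] by blast
  from this[unfolded Urel_def, rule_format, of Rel] show ?thesis by simp
qed

lemma cls_rel: "good Rel \<Longrightarrow> r \<in> Rel \<Longrightarrow> cls Rel r = 0"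
  using cls_eqI[of Rel r pzero] ideal_Rel[of r Rel] by (auto simp: congr_def good_def)

text \<open>A functional on words, read off the component at \<open>Rel\<close>. The real part
  matches the real scalars of \<open>alg\<close>; \<open>kills\<close> makes the value independent
  of the representative.\<close>

definition fnl :: "poly set \<Rightarrow> (gen list \<Rightarrow> real) \<Rightarrow> alg \<Rightarrow> real" where
  "fnl Rel \<phi> x = Re (lin (\<lambda>w. of_real (\<phi> w)) (rep_alg x Rel))"

definition kills :: "poly set \<Rightarrow> (gen list \<Rightarrow> real) \<Rightarrow> bool" where
  "kills Rel \<phi> \<longleftrightarrow> (\<forall>p\<in>ideal Rel. lin (\<lambda>w. of_real (\<phi> w)) p = 0)"

lemma fnl_abs:
  assumes "kills Rel \<phi>" "\<And>R. pfin (f R)"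
  shows "fnl Rel \<phi> (abs_alg f) = Re (lin (\<lambda>w. of_real (\<phi> w)) (f Rel))"
proof -
  have "Urel (rep_alg (abs_alg f)) f"
    by (intro Quotient_rep_abs[OF Quotient_alg] Urel_refl assms(2))
  then have "pfin (rep_alg (abs_alg f) Rel)" "psub (rep_alg (abs_alg f) Rel) (f Rel) \<in> ideal Rel"
    by (auto simp: Urel_def congr_def)
  then have "lin (\<lambda>w. of_real (\<phi> w)) (rep_alg (abs_alg f) Rel) = lin (\<lambda>w. of_real (\<phi> w)) (f Rel)"
    using assms(1) lin_psub[of "rep_alg (abs_alg f) Rel" "f Rel" "\<lambda>w. of_real (\<phi> w)"] assms(2)[of Rel]
    unfolding kills_def by (metis eq_iff_diff_eq_0)
  then show ?thesis by (simp add: fnl_def)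
qed

lemma alg_cases: obtains f where "x = abs_alg f" "\<And>R. pfin (f R)"
proof
  show "x = abs_alg (rep_alg x)" by (rule Quotient_abs_rep[OF Quotient_alg, symmetric])
  have "Urel (rep_alg x) (rep_alg x)" by (rule Quotient_rep_reflp[OF Quotient_alg])
  then show "pfin (rep_alg x R)" for R by (auto simp: Urel_def)
qed

lemma fnl_cls: "kills Rel \<phi> \<Longrightarrow> pfin p \<Longrightarrow> fnl Rel \<phi> (cls Rel p) = Re (lin (\<lambda>w. of_real (\<phi> w)) p)"
  unfolding cls_def by (subst fnl_abs) auto

lemma fnl_Wd: "kills Rel \<phi> \<Longrightarrow> fnl Rel \<phi> (Wd Rel w) = \<phi> w"
  by (simp add: Wd_def fnl_cls)

lemma fnl_add: "kills Rel \<phi> \<Longrightarrow> fnl Rel \<phi> (x + y) = fnl Rel \<phi> x + fnl Rel \<phi> y"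
proof -
  assume k: "kills Rel \<phi>"
  obtain f where f: "x = abs_alg f" "\<And>R. pfin (f R)" by (rule alg_cases[of x]) blast
  obtain g where g: "y = abs_alg g" "\<And>R. pfin (g R)" by (rule alg_cases[of y]) blast
  have "x + y = abs_alg (\<lambda>R. padd (f R) (g R))" unfolding f(1) g(1) by (rule plus_alg.abs_eq) (auto intro!: Urel_refl f g)
  then show ?thesis using f g by (simp add: fnl_abs[OF k] lin_padd)
qed

lemma fnl_scaleR: "kills Rel \<phi> \<Longrightarrow> fnl Rel \<phi> (c *\<^sub>R x) = c * fnl Rel \<phi> x"
proof -
  assume k: "kills Rel \<phi>"
  obtain f where f: "x = abs_alg f" "\<And>R. pfin (f R)" by (rule alg_cases[of x]) blast
  have "c *\<^sub>R x = abs_alg (\<lambda>R. psc (of_real c) (f R))" unfolding f(1) by (rule scaleR_alg.abs_eq) (auto intro!: Urel_refl f)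
  then show ?thesis using f by (simp add: fnl_abs[OF k] lin_psc)
qed

lemma fnl_sum: "kills Rel \<phi> \<Longrightarrow> fnl Rel \<phi> (\<Sum>x\<in>A. F x) = (\<Sum>x\<in>A. fnl Rel \<phi> (F x))"
  using fnl_scaleR[of Rel \<phi> 0 0]
  by (induction A rule: infinite_finite_induct) (auto simp: fnl_add)

fun Zr :: "gen \<Rightarrow> nat" where "Zr (Z a al) = a" | "Zr (Zb a al) = a" | "Zr T = 0"
fun Zc :: "gen \<Rightarrow> nat" where "Zc (Z a al) = al" | "Zc (Zb a al) = al" | "Zc T = 0"

definition zw :: "nat list \<Rightarrow> nat list \<Rightarrow> gen list" where
  "zw i j = map2 Z i j"

lemma zw_simps [simp]: "zw [] j = []" "zw i [] = []" "zw (a # i) (b # j) = Z a b # zw i j"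
  by (simp_all add: zw_def)

lemma zw_inv: "length i = length j \<Longrightarrow> map Zr (zw i j) = i \<and> map Zc (zw i j) = j"
  by (induction i j rule: list_induct2) auto

lemma zw_mat_alph: "length i = length j \<Longrightarrow> set (zw i j) \<subseteq> mat_alph n \<longleftrightarrow> set i \<subseteq> ix n \<and> set j \<subseteq> ix n"
  by (induction i j rule: list_induct2) (auto simp: mat_alph_def ix_def)

lemma mat_word: "set w \<subseteq> mat_alph n \<Longrightarrow> w = zw (map Zr w) (map Zc w)"
  by (induction w) (auto simp: mat_alph_def)

lemma Z_mat_alph [simp]: "Z a al \<in> mat_alph n \<longleftrightarrow> a \<in> ix n \<and> al \<in> ix n"
  by (auto simp: mat_alph_def ix_def)

section \<open>The quantum matrix algebra and functionals on it\<close>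

context qp
begin

definition tm :: "poly set \<Rightarrow> nat \<Rightarrow> nat \<Rightarrow> alg" where
  "tm Rel a al = (if a \<in> ix n \<and> al \<in> ix n then Wd Rel [Z a al] else 0)"

lemma Tw_tm: "length i = length j \<Longrightarrow> set i \<subseteq> ix n \<Longrightarrow> set j \<subseteq> ix n \<Longrightarrow> Tw (tm Rel) i j = Wd Rel (zw i j)"
proof (induction i j rule: list_induct2)
  case (Cons a i b j)
  then show ?case using Wd_Cons[of Rel "Z a b" "zw i j"] by (simp add: tm_def)
qed simp

lemma Tw_tm_LL: "i \<in> LL n d \<Longrightarrow> j \<in> LL n d \<Longrightarrow> Tw (tm Rel) i j = Wd Rel (zw i j)"
  by (rule Tw_tm) (auto simp: LL_def)

lemma rel_mat_cases:
  assumes "r \<in> rel_mat n q"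
  obtains (A) a b al be where "a \<in> ix n" "b \<in> ix n" "al \<in> ix n" "be \<in> ix n"
      "(a = b \<and> al < be) \<or> (a < b \<and> al = be)"
      "r = psub (pword [Z a al, Z b be]) (psc (of_real q) (pword [Z b be, Z a al]))"
    | (B) a b al be where "a \<in> ix n" "b \<in> ix n" "al \<in> ix n" "be \<in> ix n" "al < be" "b < a"
      "r = psub (pword [Z a al, Z b be]) (pword [Z b be, Z a al])"
    | (C) a b al be where "a \<in> ix n" "b \<in> ix n" "al \<in> ix n" "be \<in> ix n" "al < be" "a < b"
      "r = psub (psub (pword [Z a al, Z b be]) (pword [Z b be, Z a al]))
                              (psc (of_real (q - inverse q)) (pword [Z a be, Z b al]))"
proof -
  let ?A = "\<lambda>a b al be. ((a = b \<and> al < be) \<or> (a < b \<and> al = be)) \<and>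
      r = psub (pword [Z a al, Z b be]) (psc (of_real q) (pword [Z b be, Z a al]))"
  let ?B = "\<lambda>a b al be. al < be \<and> b < a \<and> r = psub (pword [Z a al, Z b be]) (pword [Z b be, Z a al])"
  let ?C = "\<lambda>a b al be. al < be \<and> a < b \<and> r = psub (psub (pword [Z a al, Z b be]) (pword [Z b be, Z a al]))
                              (psc (of_real (q - inverse q)) (pword [Z a be, Z b al]))"
  obtain a b al be where i: "a \<in> ix n" "b \<in> ix n" "al \<in> ix n" "be \<in> ix n"
    and d: "?A a b al be \<or> ?B a b al be \<or> ?C a b al be"
    using assms unfolding rel_mat_def ix_def mem_Collect_eq by (elim exE conjE)
  from d show thesis
  proof (elim disjE)
    assume "?A a b al be"
    then show thesis by (intro A[OF i]) simp_all
  next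
    assume "?B a b al be"
    then show thesis by (intro B[OF i]) simp_all
  next
    assume "?C a b al be"
    then show thesis by (intro C[OF i]) simp_all
  qed
qed

lemma rel_mat_memI:
  assumes "a \<in> ix n" "b \<in> ix n" "al \<in> ix n" "be \<in> ix n"
  shows "(a = b \<and> al < be) \<or> (a < b \<and> al = be) \<Longrightarrow>
      psub (pword [Z a al, Z b be]) (psc (of_real q) (pword [Z b be, Z a al])) \<in> rel_mat n q"
    "al < be \<Longrightarrow> b < a \<Longrightarrow> psub (pword [Z a al, Z b be]) (pword [Z b be, Z a al]) \<in> rel_mat n q"
    "al < be \<Longrightarrow> a < b \<Longrightarrow> psub (psub (pword [Z a al, Z b be]) (pword [Z b be, Z a al]))
        (psc (of_real (q - inverse q)) (pword [Z a be, Z b al])) \<in> rel_mat n q"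
  unfolding rel_mat_def mem_Collect_eq ix_def[symmetric]
  by (intro exI[of _ a] exI[of _ b] exI[of _ al] exI[of _ be], simp only: assms simp_thms)+

lemma good_rel_mat: "good (rel_mat n q)"
  unfolding good_def
proof
  fix r assume "r \<in> rel_mat n q"
  then show "pfin r \<and> lin ceps r = 0"
    by (cases rule: rel_mat_cases) (auto simp: lin_psub lin_psc ceps_def)
qed

text \<open>The nine relative orders of two rows and two columns are covered by the three kinds of
  defining relations, with the pairs read in either order.\<close>

lemma qm_tm:
  assumes "good Rel" "rel_mat n q \<subseteq> Rel" shows "qm (tm Rel)"
proof -
  let ?t = "\<lambda>a al. Wd Rel [Z a al]"
  have W2: "Wd Rel [x, y] = Wd Rel [x] * Wd Rel [y]" for x y by (rule Wd_Cons)
  have rel: "cls Rel r = 0" if "r \<in> rel_mat n q" for r using cls_rel assms that by blast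
  have A: "?t a al * ?t b be = q *\<^sub>R (?t b be * ?t a al)"
    if "a \<in> ix n" "b \<in> ix n" "al \<in> ix n" "be \<in> ix n" "(a = b \<and> al < be) \<or> (a < b \<and> al = be)" for a b al be
  proof -
    have "psub (pword [Z a al, Z b be]) (psc (of_real q) (pword [Z b be, Z a al])) \<in> rel_mat n q"
      using that by (intro rel_mat_memI)
    from rel[OF this] show ?thesis by (simp add: cls_psub cls_psc Wd_def[symmetric] W2)
  qed
  have B: "?t a al * ?t b be = ?t b be * ?t a al"
    if "a \<in> ix n" "b \<in> ix n" "al \<in> ix n" "be \<in> ix n" "al < be" "b < a" for a b al be
  proof -
    have "psub (pword [Z a al, Z b be]) (pword [Z b be, Z a al]) \<in> rel_mat n q"
      using that by (intro rel_mat_memI)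
    from rel[OF this] show ?thesis by (simp add: cls_psub Wd_def[symmetric] W2)
  qed
  have C: "?t a al * ?t b be - ?t b be * ?t a al = (q - 1 / q) *\<^sub>R (?t a be * ?t b al)"
    if "a \<in> ix n" "b \<in> ix n" "al \<in> ix n" "be \<in> ix n" "al < be" "a < b" for a b al be
  proof -
    have "psub (psub (pword [Z a al, Z b be]) (pword [Z b be, Z a al])) (psc (of_real (q - inverse q)) (pword [Z a be, Z b al])) \<in> rel_mat n q"
      using that by (intro rel_mat_memI)
    from rel[OF this] show ?thesis
      by (simp only: cls_psub cls_psc Wd_def[symmetric] W2 inverse_eq_divide pfin_psub pfin_psc pfin_pword) simp
  qed
  show ?thesis
  proof (rule qmI_RC)
    fix a b c d assume ix: "a \<in> ix n" "b \<in> ix n" "c \<in> ix n" "d \<in> ix n"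
    have E: "RR 0 (\<lambda>i. Tw (tm Rel) i [c, d]) [a, b] = cc a b *\<^sub>R (?t a c * ?t b d) + (if a = b then 0 else ?t b c * ?t a d)"
      "RR 0 (\<lambda>j. Tw (tm Rel) [a, b] j) [c, d] = cc c d *\<^sub>R (?t a c * ?t b d) + (if c = d then 0 else ?t a d * ?t b c)"
      using ix by (simp_all add: RR_def tm_def cong: if_cong)
    have q': "q *\<^sub>R x = y \<Longrightarrow> x = (1 / q) *\<^sub>R y" for x y :: alg using q0 by auto
    consider "a = b" "c = d" | "a = b" "c < d" | "a = b" "d < c" | "a < b" "c = d" | "a < b" "c < d" | "a < b" "d < c"
      | "b < a" "c = d" | "b < a" "c < d" | "b < a" "d < c" by (metis linorder_cases)
    then show "RR 0 (\<lambda>i. Tw (tm Rel) i [c, d]) [a, b] = RR 0 (\<lambda>j. Tw (tm Rel) [a, b] j) [c, d]"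
    proof cases
      case 1 then show ?thesis unfolding E by (simp add: cc_def)
    next
      case 2 then show ?thesis unfolding E using A[OF ix] q0
        by (simp add: cc_def q_sq scaleR_add_left)
    next
      case 3 then show ?thesis unfolding E using A[OF ix(2,1,4,3)] by (simp add: cc_def)
    next
      case 4 then show ?thesis unfolding E using A[OF ix] q0 by (simp add: cc_def q_sq scaleR_add_left)
    next
      case 5 then show ?thesis unfolding E using B[OF ix(2,1,3,4)] by (simp add: cc_def)
    next
      case 6 then show ?thesis unfolding E using C[OF ix(1,2,4,3)] by (simp add: cc_def algebra_simps)
    next
      case 7 then show ?thesis unfolding E using A[OF ix(2,1,4,3)] by (simp add: cc_def)
    next
      case 8 then show ?thesis unfolding E using C[OF ix(2,1,3,4)] B[OF ix] by (simp add: cc_def algebra_simps)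
    next
      case 9 then show ?thesis unfolding E using B[OF ix(1,2,4,3)] by (simp add: cc_def)
    qed
  qed (auto simp: tm_def)
qed

definition wordfn :: "(nat list \<Rightarrow> nat list \<Rightarrow> real) \<Rightarrow> gen list \<Rightarrow> real" where
  "wordfn \<phi> w = (if set w \<subseteq> mat_alph n then \<phi> (map Zr w) (map Zc w) else 0)"

text \<open>Converse to \<open>qm_tm\<close>: the exchange relations of \<open>\<phi>\<close> at one
  position inside a word are the defining relations multiplied by words from both sides.\<close>

lemma kills_wordfn:
  assumes "RC \<phi>" shows "kills (rel_mat n q) (wordfn \<phi>)"
  unfolding kills_def
proof
  fix p assume p: "p \<in> ideal (rel_mat n q)"
  have 0: "lin (\<lambda>w. of_real (wordfn \<phi> w)) (pmul (pmul (pword u) r) (pword v)) = 0" if "r \<in> rel_mat n q" for r u v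
  proof (cases "set u \<subseteq> mat_alph n \<and> set v \<subseteq> mat_alph n")
    case False
    from that show ?thesis
      by (cases rule: rel_mat_cases) (use False in \<open>auto simp: pmul_linear lin_psub lin_psc wordfn_def\<close>)
  next
    case True
    define F where "F a b c d = \<phi> (map Zr u @ a # b # map Zr v) (map Zc u @ c # d # map Zc v)" for a b c d
    have W: "wordfn \<phi> (u @ Z a c # Z b d # v) = F a b c d" if "a \<in> ix n" "b \<in> ix n" "c \<in> ix n" "d \<in> ix n" for a b c d
      using True that by (simp add: wordfn_def F_def)
    have RCF: "cc a b * F a b c d + (if a = b then 0 else F b a c d) = cc c d * F a b c d + (if c = d then 0 else F a b d c)" for a b c d
    proof -
      have "RR (length (map Zr u)) (\<lambda>i. \<phi> i (map Zc u @ c # d # map Zc v)) (map Zr u @ a # b # map Zr v)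
        = RR (length (map Zc u)) (\<phi> (map Zr u @ a # b # map Zr v)) (map Zc u @ c # d # map Zc v)"
        using RCD[OF assms, of "map Zr u @ a # b # map Zr v" "map Zc u @ c # d # map Zc v" "length u"] by simp
      then show ?thesis unfolding RR_at1 F_def by simp
    qed
    from that show ?thesis
    proof (cases rule: rel_mat_cases)
      case (A a b al be)
      have "F a b al be = q * F b a be al"
        using RCF[of a b al be] A(5) q0 by (auto simp: cc_def field_simps split: if_splits)
      then show ?thesis using A by (simp add: pmul_linear lin_psub lin_psc W)
    next
      case (B a b al be)
      have "F a b al be = F b a be al"
        using RCF[of b a al be] B(5,6) by (auto simp: cc_def algebra_simps split: if_splits)
      then show ?thesis using B by (simp add: pmul_linear lin_psub lin_psc W)
    next
      case (C a b al be)
      have "F a b al be - F b a be al = (q - inverse q) * F a b be al"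
        using RCF[of a b be al] C(5,6) by (auto simp: cc_def algebra_simps inverse_eq_divide split: if_splits)
      then have "complex_of_real (F a b al be) - complex_of_real (F b a be al) = (complex_of_real q - inverse (complex_of_real q)) * complex_of_real (F a b be al)"
        by (metis of_real_diff of_real_mult of_real_inverse)
      then show ?thesis using C by (simp add: pmul_linear lin_psub lin_psc W)
    qed
  qed
  have "pfin p \<and> lin (\<lambda>w. of_real (wordfn \<phi> w)) p = 0"
    by (rule lin_ideal[OF 0 _ p]) (use good_rel_mat in \<open>auto simp: good_def\<close>)
  then show "lin (\<lambda>w. of_real (wordfn \<phi> w)) p = 0" ..
qed

abbreviation tA :: "nat \<Rightarrow> nat \<Rightarrow> alg" where "tA \<equiv> tm (rel_mat n q)"

lemma qm_tA: "qm tA" by (rule qm_tm[OF good_rel_mat order_refl])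

definition fn :: "(nat list \<Rightarrow> nat list \<Rightarrow> real) \<Rightarrow> alg \<Rightarrow> real" where
  "fn \<phi> = fnl (rel_mat n q) (wordfn \<phi>)"

lemma fn_linear: "RC \<phi> \<Longrightarrow> fn \<phi> (x + y) = fn \<phi> x + fn \<phi> y" "RC \<phi> \<Longrightarrow> fn \<phi> (c *\<^sub>R x) = c * fn \<phi> x"
  "RC \<phi> \<Longrightarrow> fn \<phi> (\<Sum>x\<in>A. F x) = (\<Sum>x\<in>A. fn \<phi> (F x))"
  unfolding fn_def by (simp_all add: fnl_add fnl_scaleR fnl_sum kills_wordfn)

lemma fn_diff: "RC \<phi> \<Longrightarrow> fn \<phi> (x - y) = fn \<phi> x - fn \<phi> y"
  using fn_linear(1)[of \<phi> x "(-1) *\<^sub>R y"] fn_linear(2)[of \<phi> "-1" y] by simp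

lemma fn_Tw: "RC \<phi> \<Longrightarrow> i \<in> LL n d \<Longrightarrow> j \<in> LL n d \<Longrightarrow> fn \<phi> (Tw tA i j) = \<phi> i j"
  unfolding fn_def using zw_inv[of i j] zw_mat_alph[of i j n]
  by (simp add: Tw_tm_LL fnl_Wd kills_wordfn wordfn_def LL_def)

end

section \<open>The quantum determinant is not a zero divisor\<close>

text \<open>Turns the rearrangement inequality and its equality case, \<open>wt_rearrange\<close>,
  into the nonnegativity of a sum of squares.\<close>

lemma sq_diff_wt:
  fixes i j :: "nat list"
  assumes "length i = length j" "mset i = mset j"
  shows "sum_list (map (\<lambda>(x, y). (int x - int y)\<^sup>2) (zip i j))
    = 2 * int (sum_list (map (\<lambda>(x, y). x * y) (zip i i))) - 2 * int (sum_list (map (\<lambda>(x, y). x * y) (zip i j)))"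
proof -
  have sq: "sum_list (map (\<lambda>(x, y). x * y) (zip l l)) = sum_list (map (\<lambda>x. x * x) l)" for l :: "nat list"
    by (induction l) auto
  have "sum_list (map (\<lambda>(x, y). (int x - int y)\<^sup>2) (zip i j))
    = int (sum_list (map (\<lambda>x. x * x) i)) + int (sum_list (map (\<lambda>x. x * x) j)) - 2 * int (sum_list (map (\<lambda>(x, y). x * y) (zip i j)))"
    using assms(1) by (induction i j rule: list_induct2) (auto simp: power2_eq_square algebra_simps)
  moreover have "sum_list (map (\<lambda>x. x * x) i) = sum_list (map (\<lambda>x. x * x) j)"
  proof -
    have "mset (map (\<lambda>x. x * x) i) = mset (map (\<lambda>x. x * x) j)" using assms(2) by simp
    then show ?thesis by (simp only: sum_mset_sum_list[symmetric])
  qed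
  ultimately show ?thesis by (simp add: sq)
qed

lemma zero_sq_diff:
  fixes i j :: "nat list"
  assumes "length i = length j" "sum_list (map (\<lambda>(x, y). (int x - int y)\<^sup>2) (zip i j)) \<le> 0"
  shows "i = j"
  using assms
proof (induction i j rule: list_induct2)
  case (Cons a i b j)
  have "0 \<le> sum_list (map (\<lambda>(x, y). (int x - int y)\<^sup>2) (zip i j))" by (rule sum_list_nonneg) auto
  moreover have "0 \<le> (int a - int b)\<^sup>2" by simp
  moreover have "(int a - int b)\<^sup>2 + sum_list (map (\<lambda>(x, y). (int x - int y)\<^sup>2) (zip i j)) \<le> 0"
    using Cons.prems by simp
  ultimately have "(int a - int b)\<^sup>2 = 0" "sum_list (map (\<lambda>(x, y). (int x - int y)\<^sup>2) (zip i j)) \<le> 0"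
    by linarith+
  then show ?case using Cons.IH by simp
qed simp

context qp
begin

lemma wt_append: "length i = length j \<Longrightarrow> wt (i @ i') (j @ j') = wt i j + wt i' j'"
  by (simp add: wt_def)

lemma wt_rearrange:
  assumes "length i = length j" "mset i = mset j"
  shows "wt i j \<le> wt i i" "wt i j = wt i i \<Longrightarrow> j = i"
proof -
  have "0 \<le> sum_list (map (\<lambda>(x, y). (int x - int y)\<^sup>2) (zip i j))" by (rule sum_list_nonneg) auto
  then show "wt i j \<le> wt i i" using sq_diff_wt[OF assms] by (simp add: wt_def)
  show "j = i" if "wt i j = wt i i"
    using zero_sq_diff[OF assms(1)] sq_diff_wt[OF assms] that by (simp add: wt_def)
qed

definition idl :: "nat list" where "idl = [1..<Suc n]"

lemma idl_LL: "idl \<in> LL n n" and idl_set: "set idl = ix n" "distinct idl" "length idl = n"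
  by (auto simp: idl_def LL_def ix_def)

lemma idl_sorted: "sorted idl"
  by (simp add: idl_def del: upt_Suc)

lemma perm_LL: "s \<in> permutations_of_set (ix n) \<Longrightarrow> s \<in> LL n n"
  by (auto simp: LL_def permutations_of_set_def distinct_card[symmetric])

lemma perm_mset: "s \<in> permutations_of_set (ix n) \<Longrightarrow> mset s = mset idl"
  by (rule set_eq_iff_mset_eq_distinct[THEN iffD1]) (auto simp: permutations_of_set_def idl_set)

lemma LL_append: "i \<in> LL n k \<Longrightarrow> j \<in> LL n l \<Longrightarrow> i @ j \<in> LL n (k + l)"
  by (auto simp: LL_def)

lemma det_sum: "det t = (\<Sum>s\<in>permutations_of_set (ix n). (- q) ^ invs s *\<^sub>R Tw t idl s)"
  by (simp add: det_def minor_def idl_def)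

text \<open>Leading term argument. \<open>p0\<close> has maximal \<open>wt\<close> among the
  monomials with nonzero coefficient, and the diagonal has maximal \<open>wt\<close> among the terms
  of \<open>det\<close>. By \<open>psi_triangular\<close> the coordinate functional of their
  combined ordered monomial \<open>z\<close> sees no other product, and it is positive on this
  one.\<close>

lemma det_regular_SP:
  assumes "det tA * (\<Sum>p\<in>SP d. c p *\<^sub>R Tw tA (fst p) (snd p)) = 0" "p \<in> SP d"
  shows "c p = 0"
proof (rule ccontr)
  assume "c p \<noteq> 0"
  let ?S = "{p \<in> SP d. c p \<noteq> 0}" and ?P = "permutations_of_set (ix n)"
  let ?w = "\<lambda>p. wt (fst p) (snd p)"
  have "p \<in> ?S" using \<open>c p \<noteq> 0\<close> assms(2) by simp
  then have fin: "finite ?S" "?S \<noteq> {}" by (simp, blast)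
  then have "Max (?w ` ?S) \<in> ?w ` ?S" by (intro Max_in) auto
  then obtain p0 where p0: "p0 \<in> ?S" "?w p0 = Max (?w ` ?S)" by auto
  have max: "?w p \<le> ?w p0" if "p \<in> ?S" for p using that fin p0(2) by simp
  obtain a0 al0 where p0': "p0 = (a0, al0)" by (cases p0)
  have L0: "a0 \<in> LL n d" "al0 \<in> LL n d" "sorted (zip a0 al0)" using p0 p0' by (auto simp: SP_def)
  define z where "z = sort (zip (idl @ a0) (idl @ al0))"
  define b where "b = map fst z"
  define be where "be = map snd z"
  have zb: "zip b be = z" "length b = length be" by (simp_all add: b_def be_def zip_map_fst_snd)
  have zm: "mset z = mset (zip (idl @ a0) (idl @ al0))" by (simp add: z_def)
  let ?f = "psi b be"
  have tri: "(?f i j \<noteq> 0 \<longrightarrow> mset (zip i j) = mset z \<or> wt b be < wt i j) \<and> (mset (zip i j) = mset z \<longrightarrow> ?f i j > 0)"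
    if "length i = length j" for i j
    using psi_triangular[OF that, of b be] zb by (simp add: z_def)
  have wtz: "wt b be = wt idl idl + ?w p0"
    using wt_mset[of b be "idl @ a0" "idl @ al0"] zb zm by (simp add: wt_append p0')
  have term0: "c p * ?f (idl @ fst p) (s @ snd p) = 0" if s: "s \<in> ?P" and p: "p \<in> SP d" and ne: "(s, p) \<noteq> (idl, p0)" for s p
  proof (rule ccontr)
    assume nz: "c p * ?f (idl @ fst p) (s @ snd p) \<noteq> 0"
    obtain a al where pa: "p = (a, al)" by (cases p)
    have L: "a \<in> LL n d" "al \<in> LL n d" "sorted (zip a al)" using p pa by (auto simp: SP_def)
    have len: "length (idl @ a) = length (s @ al)" "length idl = length s"
      using L perm_LL[OF s] by (simp_all add: LL_length idl_set)
    have le: "wt a al \<le> ?w p0" using max[of p] nz p pa by auto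
    have r: "wt idl s \<le> wt idl idl" using wt_rearrange(1)[OF len(2)] perm_mset[OF s] by simp
    have "mset (zip (idl @ a) (s @ al)) = mset z \<or> wt b be < wt (idl @ a) (s @ al)"
      using tri[OF len(1)] nz pa by auto
    moreover have "wt (idl @ a) (s @ al) = wt idl s + wt a al" by (rule wt_append[OF len(2)])
    ultimately have eq: "mset (zip (idl @ a) (s @ al)) = mset z" using wtz le r by auto
    then have "wt idl s + wt a al = wt b be"
      using wt_mset[of "idl @ a" "s @ al" b be] zb wt_append[OF len(2)] by simp
    then have "wt idl s = wt idl idl" using wtz le r by simp
    then have sid: "s = idl" using wt_rearrange(2)[OF len(2)] perm_mset[OF s] by simp
    with eq zm have "mset (zip a al) = mset (zip a0 al0)" by simp
    then have "zip a al = zip a0 al0" using L(3) L0(3) by (metis sort_key_id_if_sorted properties_for_sort)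
    then have "a = a0 \<and> al = al0" using L L0 by (metis LL_length map_fst_zip map_snd_zip)
    with ne sid pa p0' show False by simp
  qed
  have "0 = fn ?f (det tA * (\<Sum>p\<in>SP d. c p *\<^sub>R Tw tA (fst p) (snd p)))"
    using assms(1) fn_linear(2)[OF RC_psi[of b be], of 0 0] by simp
  also have "det tA * (\<Sum>p\<in>SP d. c p *\<^sub>R Tw tA (fst p) (snd p))
     = (\<Sum>s\<in>?P. \<Sum>p\<in>SP d. ((- q) ^ invs s * c p) *\<^sub>R Tw tA (idl @ fst p) (s @ snd p))"
    unfolding det_sum sum_product
    by (intro sum.cong refl) (simp add: Tw_append LL_length[OF perm_LL] idl_set)
  also have "fn ?f \<dots> = (\<Sum>s\<in>?P. \<Sum>p\<in>SP d. (- q) ^ invs s * (c p * ?f (idl @ fst p) (s @ snd p)))"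
    unfolding fn_linear[OF RC_psi]
    by (intro sum.cong refl)
      (auto simp: fn_Tw[OF RC_psi, of _ "n + d"] LL_append idl_LL perm_LL SP_def)
  also have "\<dots> = (\<Sum>y\<in>?P \<times> SP d. if y = (idl, p0) then c p0 * ?f (idl @ a0) (idl @ al0) else 0)"
    unfolding sum.cartesian_product
  proof (rule sum.cong[OF refl])
    fix y assume y: "y \<in> ?P \<times> SP d"
    obtain s p where sp: "y = (s, p)" by (cases y)
    show "(case y of (s, p) \<Rightarrow> (- q) ^ invs s * (c p * ?f (idl @ fst p) (s @ snd p)))
      = (if y = (idl, p0) then c p0 * ?f (idl @ a0) (idl @ al0) else 0)"
    proof (cases "y = (idl, p0)")
      case True
      then show ?thesis by (simp add: p0' invs_sorted idl_sorted)
    next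
      case False
      then have "c p * ?f (idl @ fst p) (s @ snd p) = 0" using y sp by (intro term0) auto
      then show ?thesis using False sp by auto
    qed
  qed
  also have "\<dots> = c p0 * ?f (idl @ a0) (idl @ al0)"
  proof -
    have "(idl, p0) \<in> ?P \<times> SP d" using p0 by (simp add: permutations_of_set_def idl_set)
    moreover have "finite (?P \<times> SP d)" by simp
    ultimately show ?thesis by (simp only: sum.delta if_True)
  qed
  also have "\<dots> \<noteq> 0"
    using p0 tri[of "idl @ a0" "idl @ al0"] L0 zm by (auto simp: LL_length)
  finally show False by simp
qed

text \<open>Homogeneous elements with real coefficients in words. On them the functionals
  \<open>fn \<phi>\<close> separate points (\<open>hom_zero\<close>), which is how identities in
  \<open>tA\<close> are tested.\<close>

definition hom :: "nat \<Rightarrow> alg \<Rightarrow> bool" where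
  "hom d x \<longleftrightarrow> (\<exists>c. x = (\<Sum>p\<in>LL n d \<times> LL n d. c p *\<^sub>R Tw tA (fst p) (snd p)))"

lemma hom_Tw: "i \<in> LL n d \<Longrightarrow> j \<in> LL n d \<Longrightarrow> hom d (Tw tA i j)"
  unfolding hom_def
  by (rule exI[of _ "\<lambda>p. if p = (i, j) then 1 else 0"])
    (simp add: if_distrib[where f="\<lambda>c. c *\<^sub>R _"] sum.delta cong: if_cong)

lemma hom_0: "hom d 0"
  unfolding hom_def by (rule exI[of _ "\<lambda>_. 0"]) simp

lemma hom_add: "hom d x \<Longrightarrow> hom d y \<Longrightarrow> hom d (x + y)"
  unfolding hom_def
proof (elim exE)
  fix c c' assume "x = (\<Sum>p\<in>LL n d \<times> LL n d. c p *\<^sub>R Tw tA (fst p) (snd p))"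
    "y = (\<Sum>p\<in>LL n d \<times> LL n d. c' p *\<^sub>R Tw tA (fst p) (snd p))"
  then show "\<exists>c. x + y = (\<Sum>p\<in>LL n d \<times> LL n d. c p *\<^sub>R Tw tA (fst p) (snd p))"
    by (intro exI[of _ "\<lambda>p. c p + c' p"]) (simp add: scaleR_add_left sum.distrib)
qed

lemma hom_scaleR: "hom d x \<Longrightarrow> hom d (r *\<^sub>R x)"
  unfolding hom_def
proof (elim exE)
  fix c assume "x = (\<Sum>p\<in>LL n d \<times> LL n d. c p *\<^sub>R Tw tA (fst p) (snd p))"
  then show "\<exists>c. r *\<^sub>R x = (\<Sum>p\<in>LL n d \<times> LL n d. c p *\<^sub>R Tw tA (fst p) (snd p))"
    by (intro exI[of _ "\<lambda>p. r * c p"]) (simp add: scaleR_sum_right)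
qed

lemma hom_diff: "hom d x \<Longrightarrow> hom d y \<Longrightarrow> hom d (x - y)"
  using hom_add[of d x "(-1) *\<^sub>R y"] hom_scaleR[of d y "-1"] by simp

lemma hom_sum: "(\<And>x. x \<in> A \<Longrightarrow> hom d (F x)) \<Longrightarrow> hom d (\<Sum>x\<in>A. F x)"
  by (induction A rule: infinite_finite_induct) (auto intro: hom_0 hom_add)

lemma hom_expand:
  assumes "hom d x" shows "x = (\<Sum>p\<in>SP d. fn (psi (fst p) (snd p)) x *\<^sub>R Tw tA (fst p) (snd p))"
proof -
  obtain c where c: "x = (\<Sum>p\<in>LL n d \<times> LL n d. c p *\<^sub>R Tw tA (fst p) (snd p))"
    using assms by (auto simp: hom_def)
  have "x = (\<Sum>p\<in>LL n d \<times> LL n d. \<Sum>r\<in>SP d. (c p * psi (fst r) (snd r) (fst p) (snd p)) *\<^sub>R Tw tA (fst r) (snd r))"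
    unfolding c
  proof (rule sum.cong[OF refl])
    fix p assume "p \<in> LL n d \<times> LL n d"
    then have "Tw tA (fst p) (snd p) = (\<Sum>r\<in>SP d. psi (fst r) (snd r) (fst p) (snd p) *\<^sub>R Tw tA (fst r) (snd r))"
      by (intro RC_expand[OF RC_Tw[OF qm_tA]]) auto
    then show "c p *\<^sub>R Tw tA (fst p) (snd p) = (\<Sum>r\<in>SP d. (c p * psi (fst r) (snd r) (fst p) (snd p)) *\<^sub>R Tw tA (fst r) (snd r))"
      by (simp add: scaleR_sum_right)
  qed
  also have "\<dots> = (\<Sum>r\<in>SP d. (\<Sum>p\<in>LL n d \<times> LL n d. c p * psi (fst r) (snd r) (fst p) (snd p)) *\<^sub>R Tw tA (fst r) (snd r))"
    by (subst sum.swap) (simp add: scaleR_sum_left)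
  also have "\<dots> = (\<Sum>r\<in>SP d. fn (psi (fst r) (snd r)) x *\<^sub>R Tw tA (fst r) (snd r))"
    unfolding c fn_linear[OF RC_psi]
    by (intro sum.cong refl arg_cong2[where f=scaleR]) (auto simp: fn_Tw[OF RC_psi])
  finally show ?thesis .
qed

lemma hom_zero:
  assumes "hom d x" "\<And>\<phi>. RC \<phi> \<Longrightarrow> fn \<phi> x = 0" shows "x = 0"
  by (subst hom_expand[OF assms(1)]) (simp add: assms(2)[OF RC_psi])

lemma det_regular:
  assumes "hom d x" "det tA * x = 0" shows "x = 0"
proof -
  have "fn (psi (fst p) (snd p)) x = 0" if "p \<in> SP d" for p
    using det_regular_SP[where d=d and c="\<lambda>p. fn (psi (fst p) (snd p)) x" and p=p] that assms hom_expand[OF assms(1)] by simp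
  then show ?thesis using hom_expand[OF assms(1)] by simp
qed

end

section \<open>The Haar functional\<close>

text \<open>An orthonormal family of maximal size, which is bounded by Bessel's inequality, spans.\<close>
lemma orthogonal_projection:
  fixes X :: "'a set" and K :: "('a \<Rightarrow> real) set"
  assumes X: "finite X" and zero: "(\<lambda>x. 0) \<in> K"
    and add: "\<And>u v. u \<in> K \<Longrightarrow> v \<in> K \<Longrightarrow> (\<lambda>x. u x + v x) \<in> K"
    and sc: "\<And>c u. u \<in> K \<Longrightarrow> (\<lambda>x. c * u x) \<in> K"
    and supp: "\<And>u x. u \<in> K \<Longrightarrow> x \<notin> X \<Longrightarrow> u x = 0"
  shows "\<exists>P. (\<forall>x y. P x y = P y x) \<and> (\<forall>y. (\<lambda>x. P x y) \<in> K) \<and> (\<forall>v\<in>K. \<forall>x. (\<Sum>y\<in>X. P x y * v y) = v x)"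
proof -
  define ip where "ip u v = (\<Sum>x\<in>X. u x * v x)" for u v :: "'a \<Rightarrow> real"
  define on where "on B \<longleftrightarrow> finite B \<and> B \<subseteq> K \<and> (\<forall>u\<in>B. \<forall>v\<in>B. ip u v = (if u = v then 1 else 0))" for B
  have ip_diff: "ip u (\<lambda>x. v x - w x) = ip u v - ip u w" for u v w
    by (simp add: ip_def right_diff_distrib sum_subtractf)
  have ip_comm: "ip u v = ip v u" for u v by (simp add: ip_def mult.commute)
  have ip_sum: "ip u (\<lambda>x. \<Sum>b\<in>B. c b * b x) = (\<Sum>b\<in>B. c b * ip u b)" for u c and B :: "('a \<Rightarrow> real) set"
    unfolding ip_def sum_distrib_left by (subst sum.swap) (simp add: ac_simps)
  have Ksum: "(\<lambda>x. \<Sum>b\<in>B. c b * b x) \<in> K" if "finite B" "B \<subseteq> K" for B c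
    using that by (induction B rule: finite_induct) (auto intro: zero add sc)
  have bessel: "card B \<le> card X" if B: "on B" for B
  proof -
    have fB: "finite B" using B by (simp add: on_def)
    \<comment> \<open>Bessel's inequality for the unit vector \<open>e\<close> at \<open>x\<close>;
      summation over \<open>x\<close> bounds the size of \<open>B\<close>.\<close>
    have "(\<Sum>b\<in>B. (b x)\<^sup>2) \<le> 1" if x: "x \<in> X" for x
    proof -
      define e where "e y = (if y = x then 1 else (0::real))" for y
      have eb: "ip b e = b x" "ip e b = b x" for b
        using x X by (simp_all add: ip_def e_def if_distrib[where f="\<lambda>c. _ * c"] if_distrib[where f="\<lambda>c. c * _"] cong: if_cong)
      define r where "r y = e y - (\<Sum>b\<in>B. b x * b y)" for y
      have br: "ip b r = 0" if "b \<in> B" for b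
      proof -
        have "ip b r = b x - (\<Sum>b'\<in>B. b' x * ip b b')" unfolding r_def ip_diff ip_sum eb ..
        also have "(\<Sum>b'\<in>B. b' x * ip b b') = (\<Sum>b'\<in>B. if b' = b then b x else 0)"
          using B that by (intro sum.cong) (auto simp: on_def)
        finally show ?thesis using that fB by (simp add: sum.delta)
      qed
      have "ip r r = ip r e - ip r (\<lambda>y. \<Sum>b\<in>B. b x * b y)"
        unfolding ip_diff[symmetric] r_def[symmetric] ..
      also have "ip r (\<lambda>y. \<Sum>b\<in>B. b x * b y) = 0" unfolding ip_sum using br by (simp add: ip_comm[of r])
      also have "ip r e = 1 - (\<Sum>b\<in>B. (b x)\<^sup>2)"
        unfolding ip_comm[of r] r_def ip_diff ip_sum eb by (simp add: e_def power2_eq_square)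
      finally have "1 - (\<Sum>b\<in>B. (b x)\<^sup>2) = ip r r" by simp
      moreover have "ip r r \<ge> 0" unfolding ip_def by (intro sum_nonneg) simp
      ultimately show ?thesis by simp
    qed
    then have "(\<Sum>x\<in>X. \<Sum>b\<in>B. (b x)\<^sup>2) \<le> (\<Sum>x\<in>X. 1)" by (intro sum_mono) simp
    moreover have "(\<Sum>x\<in>X. \<Sum>b\<in>B. (b x)\<^sup>2) = (\<Sum>b\<in>B. ip b b)"
      unfolding ip_def by (subst sum.swap) (simp add: power2_eq_square)
    moreover have "(\<Sum>b\<in>B. ip b b) = (\<Sum>b\<in>B. 1)" using B by (intro sum.cong) (auto simp: on_def)
    ultimately show ?thesis by simp
  qed
  have "on {}" by (simp add: on_def)
  moreover have "\<forall>B. on B \<longrightarrow> card B < Suc (card X)" using bessel by (simp add: less_Suc_eq_le)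
  ultimately have "\<exists>B. on B \<and> (\<forall>B'. on B' \<longrightarrow> card B' \<le> card B)" by (rule ex_has_greatest_nat)
  then obtain B where B: "on B" and max: "\<And>B'. on B' \<Longrightarrow> card B' \<le> card B" by auto
  have fB: "finite B" and BK: "B \<subseteq> K" and orth: "\<And>u v. u \<in> B \<Longrightarrow> v \<in> B \<Longrightarrow> ip u v = (if u = v then 1 else 0)"
    using B by (auto simp: on_def)
  define P where "P x y = (\<Sum>b\<in>B. b x * b y)" for x y
  have "(\<Sum>y\<in>X. P x y * v y) = v x" if v: "v \<in> K" for v x
  proof -
    define w where "w x = v x - (\<Sum>b\<in>B. ip b v * b x)" for x
    have wK: "w \<in> K"
    proof -
      have "(\<lambda>x. (\<Sum>b\<in>B. ip b v * b x)) \<in> K" by (rule Ksum[OF fB BK])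
      from add[OF v sc[OF this, of "-1"]] show ?thesis by (simp add: w_def[abs_def])
    qed
    have bw: "ip b w = 0" if "b \<in> B" for b
    proof -
      have "ip b w = ip b v - (\<Sum>b'\<in>B. ip b' v * ip b b')" unfolding w_def ip_diff ip_sum ..
      also have "(\<Sum>b'\<in>B. ip b' v * ip b b') = (\<Sum>b'\<in>B. if b' = b then ip b v else 0)"
        using orth that by (intro sum.cong) auto
      finally show ?thesis using that fB by (simp add: sum.delta)
    qed
    have "w x = 0"
    proof (rule ccontr)
      assume "w x \<noteq> 0"
      then have xX: "x \<in> X" using supp[OF wK] by blast
      have "ip w w > 0" unfolding ip_def
        using \<open>w x \<noteq> 0\<close> xX X by (intro sum_pos2[of X x]) (auto simp: zero_less_mult_iff linorder_neq_iff)
      \<comment> \<open>The normalised residual of \<open>v\<close> would enlarge the maximal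
        orthonormal family.\<close>
      define u where "u y = (1 / sqrt (ip w w)) * w y" for y
      have uu: "ip u u = 1"
      proof -
        have "ip u u = (1 / sqrt (ip w w)) * (1 / sqrt (ip w w)) * ip w w"
          unfolding u_def ip_def sum_distrib_left by (simp add: ac_simps)
        then show ?thesis using \<open>ip w w > 0\<close> by simp
      qed
      have bu: "ip b u = 0" if "b \<in> B" for b
      proof -
        have "ip b u = (1 / sqrt (ip w w)) * ip b w"
          unfolding u_def ip_def sum_distrib_left by (simp add: ac_simps)
        then show ?thesis using bw[OF that] by simp
      qed
      have "u \<notin> B" using bu uu by force
      moreover have "on (insert u B)"
      proof -
        have "u \<in> K" using sc[OF wK, of "1 / sqrt (ip w w)"] by (simp add: u_def[abs_def])
        moreover have "ip u b = 0" if "b \<in> B" for b using bu[OF that] ip_comm[of u b] by simp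
        moreover have "b \<noteq> u" if "b \<in> B" for b using that \<open>u \<notin> B\<close> by blast
        ultimately show ?thesis unfolding on_def using fB BK orth uu bu by auto
      qed
      ultimately show False using max[of "insert u B"] fB by simp
    qed
    moreover have "(\<Sum>y\<in>X. P x y * v y) = (\<Sum>b\<in>B. ip b v * b x)"
      unfolding P_def ip_def sum_distrib_right by (subst sum.swap) (simp add: ac_simps)
    ultimately show ?thesis by (simp add: w_def)
  qed
  moreover have "(\<lambda>x. P x y) \<in> K" for y
    using Ksum[OF fB BK, of "\<lambda>b. b y"] by (simp add: P_def mult.commute)
  ultimately show ?thesis by (intro exI[of _ P]) (auto simp: P_def mult.commute)
qed

section \<open>Semi-invariant vectors and the projections onto them\<close>

context qp
begin

text \<open>Vectors in the tensor power of degree \<open>m * n\<close> on which the coaction is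
  multiplication by \<open>det ^ m\<close>, i.e. invariants after twisting with the inverse
  determinant.\<close>

definition KK :: "nat \<Rightarrow> (nat list \<Rightarrow> real) set" where
  "KK m = {v. (\<forall>j. j \<notin> LL n (m * n) \<longrightarrow> v j = 0) \<and>
     (\<forall>i\<in>LL n (m * n). (\<Sum>j\<in>LL n (m * n). v j *\<^sub>R Tw tA i j) = v i *\<^sub>R det tA ^ m)}"

text \<open>The orthogonal projection onto \<open>KK m\<close>. Its entries are the values of the Haar functional
  on words of degree \<open>m n\<close> times the \<open>m\<close>-th power of the inverse determinant, see \<open>hr\<close>.\<close>
definition PP :: "nat \<Rightarrow> nat list \<Rightarrow> nat list \<Rightarrow> real" where
  "PP m = (SOME P. (\<forall>x y. P x y = P y x) \<and> (\<forall>y. (\<lambda>x. P x y) \<in> KK m) \<and>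
     (\<forall>v\<in>KK m. \<forall>x. (\<Sum>y\<in>LL n (m * n). P x y * v y) = v x))"

lemma PP: "(\<forall>x y. PP m x y = PP m y x) \<and> (\<forall>y. (\<lambda>x. PP m x y) \<in> KK m) \<and>
     (\<forall>v\<in>KK m. \<forall>x. (\<Sum>y\<in>LL n (m * n). PP m x y * v y) = v x)"
proof -
  have "\<exists>P. (\<forall>x y. P x y = P y x) \<and> (\<forall>y. (\<lambda>x. P x y) \<in> KK m) \<and>
     (\<forall>v\<in>KK m. \<forall>x. (\<Sum>y\<in>LL n (m * n). P x y * v y) = v x)"
  proof (rule orthogonal_projection)
    show "(\<lambda>x. u x + v x) \<in> KK m" if "u \<in> KK m" "v \<in> KK m" for u v
      using that by (simp add: KK_def scaleR_add_left sum.distrib)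
    show "(\<lambda>x. c * u x) \<in> KK m" if "u \<in> KK m" for u c
    proof -
      have "(\<Sum>j\<in>LL n (m * n). (c * u j) *\<^sub>R Tw tA i j) = c *\<^sub>R (\<Sum>j\<in>LL n (m * n). u j *\<^sub>R Tw tA i j)" for i
        by (simp add: scaleR_sum_right)
      then show ?thesis using that by (simp add: KK_def)
    qed
  qed (auto simp: KK_def)
  from someI_ex[OF this] show ?thesis unfolding PP_def[symmetric] .
qed

lemma PP_sym: "PP m x y = PP m y x"
  using conjunct1[OF PP[of m]] by blast

lemma PP_col: "(\<lambda>x. PP m x y) \<in> KK m"
  by (rule spec[OF conjunct1[OF conjunct2[OF PP[of m]]], of y])

lemma PP_fix: "v \<in> KK m \<Longrightarrow> (\<Sum>y\<in>LL n (m * n). PP m x y * v y) = v x"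
  by (rule spec[OF bspec[OF conjunct2[OF conjunct2[OF PP[of m]]]], of v x])

lemma PP_zero: "i \<notin> LL n (m * n) \<or> j \<notin> LL n (m * n) \<Longrightarrow> PP m i j = 0"
  using PP_col[of m j] PP_col[of m i] PP_sym[of m i j] by (auto simp: KK_def)

lemma PP_H1: "i \<in> LL n (m * n) \<Longrightarrow> (\<Sum>p\<in>LL n (m * n). PP m p j *\<^sub>R Tw tA i p) = PP m i j *\<^sub>R det tA ^ m"
  using PP_col[of m j] by (auto simp: KK_def)

lemma RR_sum_LL:
  assumes "Suc k < d"
  shows "(\<Sum>j\<in>LL n d. f j *\<^sub>R RR k g j) = (\<Sum>j\<in>LL n d. RR k f j *\<^sub>R g j)"
proof -
  have "(\<Sum>j\<in>LL n d. if j ! k = j ! Suc k then 0 else f j *\<^sub>R g (swp k j))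
      = (\<Sum>j\<in>LL n d. if j ! k = j ! Suc k then 0 else f (swp k j) *\<^sub>R g j)"
    by (subst sum_LL_swp[OF assms, symmetric]) (use assms in \<open>auto simp: LL_length intro!: sum.cong\<close>)
  moreover have "f j *\<^sub>R RR k g j = cc (j ! k) (j ! Suc k) *\<^sub>R f j *\<^sub>R g j
      + (if j ! k = j ! Suc k then 0 else f j *\<^sub>R g (swp k j))" for j
    by (simp add: RR_def algebra_simps)
  moreover have "RR k f j *\<^sub>R g j = cc (j ! k) (j ! Suc k) *\<^sub>R f j *\<^sub>R g j
      + (if j ! k = j ! Suc k then 0 else f (swp k j) *\<^sub>R g j)" for j
    by (simp add: RR_def algebra_simps)
  ultimately show ?thesis by (simp add: sum.distrib)
qed

text \<open>The coaction commutes with the braiding, so the space of semi-invariants is stable under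
  it.\<close>

lemma KK_RR:
  assumes v: "v \<in> KK m" and k: "Suc k < m * n"
  shows "(\<lambda>i. if i \<in> LL n (m * n) then RR k v i else 0) \<in> KK m"
proof -
  let ?L = "LL n (m * n)"
  have "(\<Sum>j\<in>?L. RR k v j *\<^sub>R Tw tA i j) = RR k v i *\<^sub>R det tA ^ m" if i: "i \<in> ?L" for i
  proof -
    have "(\<Sum>j\<in>?L. RR k v j *\<^sub>R Tw tA i j) = (\<Sum>j\<in>?L. v j *\<^sub>R RR k (Tw tA i) j)" by (rule RR_sum_LL[OF k, symmetric])
    also have "\<dots> = (\<Sum>j\<in>?L. v j *\<^sub>R RR k (\<lambda>i. Tw tA i j) i)"
    proof (rule sum.cong[OF refl])
      fix j assume "j \<in> ?L"
      then have "RR k (\<lambda>i. Tw tA i j) i = RR k (Tw tA i) j"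
        using i k by (intro RCD[OF RC_Tw[OF qm_tA]]) (simp_all add: LL_length)
      then show "v j *\<^sub>R RR k (Tw tA i) j = v j *\<^sub>R RR k (\<lambda>i. Tw tA i j) i" by simp
    qed
    also have "\<dots> = RR k (\<lambda>i. \<Sum>j\<in>?L. v j *\<^sub>R Tw tA i j) i" by (rule RR_sum[symmetric]) simp
    also have "\<dots> = RR k (\<lambda>i. v i *\<^sub>R det tA ^ m) i"
      using v i k by (intro RR_cong) (simp_all add: KK_def LL_length)
    also have "\<dots> = RR k v i *\<^sub>R det tA ^ m" by (simp add: RR_def scaleR_add_left)
    finally show ?thesis .
  qed
  then show ?thesis by (simp add: KK_def cong: sum.cong)
qed

text \<open>An orthogonal projection onto a subspace stable under a symmetric operator commutes with
  that operator.\<close>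

lemma RC_PP: "RC (PP m)"
  unfolding RC_def
proof (intro allI impI)
  fix i j :: "nat list" and k assume ij: "length i = length j" "Suc k < length i"
  let ?L = "LL n (m * n)" and ?P = "PP m"
  show "RR k (\<lambda>i. ?P i j) i = RR k (?P i) j"
  proof (cases "i \<in> ?L \<and> j \<in> ?L")
    case True
    then have "length i = m * n" using LL_length by blast
    then have k: "Suc k < m * n" using ij(2) by simp
    have 1: "(\<Sum>l\<in>?L. ?P a l * RR k (\<lambda>i. ?P i b) l) = RR k (\<lambda>i. ?P i b) a" if "a \<in> ?L" for a b
      using PP_fix[OF KK_RR[OF PP_col[of m b] k], of a] that by (simp cong: sum.cong)
    have "RR k (?P i) j = RR k (\<lambda>x. ?P x i) j" by (rule RR_cong) (rule PP_sym)+
    also have "\<dots> = (\<Sum>l\<in>?L. ?P j l * RR k (\<lambda>x. ?P x i) l)" using 1 True by simp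
    also have "\<dots> = (\<Sum>l\<in>?L. ?P j l *\<^sub>R RR k (\<lambda>x. ?P x i) l)" by simp
    also have "\<dots> = (\<Sum>l\<in>?L. RR k (?P j) l *\<^sub>R ?P l i)" by (rule RR_sum_LL[OF k])
    also have "\<dots> = (\<Sum>l\<in>?L. ?P i l * RR k (\<lambda>x. ?P x j) l)"
    proof (rule sum.cong[OF refl])
      fix l
      have "RR k (?P j) l = RR k (\<lambda>x. ?P x j) l" by (rule RR_cong) (rule PP_sym)+
      then show "RR k (?P j) l *\<^sub>R ?P l i = ?P i l * RR k (\<lambda>x. ?P x j) l" using PP_sym[of m l i] by simp
    qed
    also have "\<dots> = RR k (\<lambda>x. ?P x j) i" using 1 True by simp
    finally show ?thesis ..
  next
    case False
    then have "?P i j = 0" "?P (swp k i) j = 0" "?P i (swp k j) = 0"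
      using ij by (auto intro!: PP_zero) (metis LL_length LL_swp length_swp)+
    then show ?thesis by (simp add: RR_def)
  qed
qed

lemma perm_length: "s \<in> permutations_of_set (ix n) \<Longrightarrow> length s = n"
  by (rule LL_length[OF perm_LL])

text \<open>Coefficients of \<open>det ^ m\<close>: the \<open>m\<close>-fold tensor power of the
  antisymmetric tensor. The value 1 at \<open>idm m\<close>, the word \<open>1, ..., n\<close>
  repeated \<open>m\<close> times, fixes its scale.\<close>

fun vm :: "nat \<Rightarrow> nat list \<Rightarrow> real" where
  "vm 0 j = (if j = [] then 1 else 0)"
| "vm (Suc m) j = (if take n j \<in> permutations_of_set (ix n) then (- q) ^ invs (take n j) * vm m (drop n j) else 0)"

fun idm :: "nat \<Rightarrow> nat list" where
  "idm 0 = []" | "idm (Suc m) = idl @ idm m"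

lemma idm_LL: "idm m \<in> LL n (m * n)"
  by (induction m) (auto intro: LL_append idl_LL simp del: One_nat_def)

lemma vm_zero: "j \<notin> LL n (m * n) \<Longrightarrow> vm m j = 0"
proof (induction m arbitrary: j)
  case (Suc m)
  show ?case
  proof (cases "take n j \<in> permutations_of_set (ix n)")
    case True
    then have "drop n j \<notin> LL n (m * n)"
      using Suc.prems LL_append[OF perm_LL[OF True], of "drop n j" "m * n"] by auto
    then show ?thesis using Suc.IH by simp
  qed simp
qed simp

lemma minor_vm:
  assumes "qm t" "i \<in> LL n n"
  shows "(\<Sum>x\<in>permutations_of_set (ix n). (- q) ^ invs x *\<^sub>R Tw t i x)
     = (if i \<in> permutations_of_set (ix n) then (- q) ^ invs i else 0) *\<^sub>R det t"
proof -
  have m: "(\<Sum>x\<in>permutations_of_set (ix n). (- q) ^ invs x *\<^sub>R Tw t i x) = minor t i (ix n)"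
    by (simp add: minor_def)
  show ?thesis
  proof (cases "distinct i")
    case True
    moreover from this have "set i = ix n"
      using assms(2) by (intro card_subset_eq) (auto simp: LL_def distinct_card)
    ultimately show ?thesis unfolding m using det_minor[OF assms(1)] by (simp add: permutations_of_set_def)
  next
    case False
    then have "minor t i (ix n) = 0" using minor_sort[OF assms(1), of "ix n" i] assms(2) by (simp add: LL_length)
    then show ?thesis unfolding m using False by (simp add: permutations_of_set_def)
  qed
qed

lemma sum_vm_Suc:
  fixes F :: "nat list \<Rightarrow> 'a::real_vector"
  shows "(\<Sum>j\<in>LL n (Suc m * n). vm (Suc m) j *\<^sub>R F j)
    = (\<Sum>x\<in>permutations_of_set (ix n). \<Sum>y\<in>LL n (m * n). ((- q) ^ invs x * vm m y) *\<^sub>R F (x @ y))"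
proof -
  have "(\<Sum>j\<in>LL n (Suc m * n). vm (Suc m) j *\<^sub>R F j)
     = (\<Sum>x\<in>LL n n. if x \<in> permutations_of_set (ix n) then \<Sum>y\<in>LL n (m * n). ((- q) ^ invs x * vm m y) *\<^sub>R F (x @ y) else 0)"
    unfolding mult_Suc sum_LL_add by (intro sum.cong refl) (simp add: LL_length)
  also have "\<dots> = (\<Sum>x\<in>permutations_of_set (ix n). \<Sum>y\<in>LL n (m * n). ((- q) ^ invs x * vm m y) *\<^sub>R F (x @ y))"
    by (rule sum.mono_neutral_cong_right) (auto intro: perm_LL)
  finally show ?thesis .
qed

lemma vm_invariant:
  assumes "qm t" "i \<in> LL n (m * n)"
  shows "(\<Sum>j\<in>LL n (m * n). vm m j *\<^sub>R Tw t i j) = vm m i *\<^sub>R det t ^ m"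
  using assms(2)
proof (induction m arbitrary: i)
    case (Suc m)
    have len: "length i = n + m * n" using Suc.prems by (simp add: LL_length)
    let ?u = "take n i" and ?v = "drop n i"
    have uv: "?u \<in> LL n n" "?v \<in> LL n (m * n)" "i = ?u @ ?v"
      using len Suc.prems by (auto simp: LL_def dest: in_set_takeD in_set_dropD)
    have "(\<Sum>j\<in>LL n (Suc m * n). vm (Suc m) j *\<^sub>R Tw t i j)
      = (\<Sum>x\<in>permutations_of_set (ix n). \<Sum>y\<in>LL n (m * n). ((- q) ^ invs x * vm m y) *\<^sub>R (Tw t ?u x * Tw t ?v y))"
      unfolding sum_vm_Suc
    proof (intro sum.cong refl)
      fix x y assume "x \<in> permutations_of_set (ix n)"
      then have "length x = n" using perm_LL LL_length by blast
      then have "length ?u = length x" using len by simp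
      then show "((- q) ^ invs x * vm m y) *\<^sub>R Tw t i (x @ y) = ((- q) ^ invs x * vm m y) *\<^sub>R (Tw t ?u x * Tw t ?v y)"
        using Tw_append[of ?u x t ?v y] uv(3) by simp
    qed
    also have "\<dots> = (\<Sum>x\<in>permutations_of_set (ix n). (- q) ^ invs x *\<^sub>R Tw t ?u x) * (\<Sum>y\<in>LL n (m * n). vm m y *\<^sub>R Tw t ?v y)"
      unfolding sum_product by (simp add: mult.commute)
    also have "\<dots> = vm (Suc m) i *\<^sub>R det t ^ Suc m"
      unfolding minor_vm[OF assms(1) uv(1)] Suc.IH[OF uv(2)] by simp
    finally show ?case .
qed simp

lemma vm_KK: "vm m \<in> KK m"
  using vm_invariant[OF qm_tA] by (simp add: KK_def vm_zero)

lemma vm_idm: "vm m (idm m) = 1"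
  by (induction m) (auto simp: idl_set invs_sorted idl_sorted permutations_of_set_def)

lemma det_power_sum:
  assumes "qm t" shows "det t ^ m = (\<Sum>j\<in>LL n (m * n). vm m j *\<^sub>R Tw t (idm m) j)"
  using vm_invariant[OF assms idm_LL, of m] by (simp add: vm_idm)

lemmas det_power = det_power_sum[OF qm_tA]

lemma hom_det_power: "hom (m * n) (det tA ^ m)"
  unfolding det_power by (intro hom_sum hom_scaleR hom_Tw idm_LL)

lemma fn_det_power: "RC \<phi> \<Longrightarrow> fn \<phi> (det tA ^ m) = (\<Sum>j\<in>LL n (m * n). vm m j * \<phi> (idm m) j)"
  unfolding det_power fn_linear by (intro sum.cong refl) (simp add: fn_Tw[OF _ idm_LL])

text \<open>Either value, multiplied by the squared norm of \<open>vm m\<close>, is the double sum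
  of \<open>\<phi>\<close> with weights \<open>vm m i * vm m j\<close>, and these weights are
  symmetric in \<open>i\<close> and \<open>j\<close>.\<close>

lemma fn_det_power_transpose:
  assumes "RC \<phi>" shows "fn \<phi> (det tA ^ m) = fn (\<lambda>i j. \<phi> j i) (det tA ^ m)"
proof -
  let ?L = "LL n (m * n)" and ?v = "vm m"
  have *: "(\<Sum>i\<in>?L. \<Sum>j\<in>?L. ?v i * ?v j * \<phi> i j) = (\<Sum>i\<in>?L. (?v i)\<^sup>2) * fn \<phi> (det tA ^ m)" if "RC \<phi>" for \<phi>
  proof -
    have "(\<Sum>j\<in>?L. ?v i * ?v j * \<phi> i j) = (?v i)\<^sup>2 * fn \<phi> (det tA ^ m)" if i: "i \<in> ?L" for i
    proof -
      have "fn \<phi> (\<Sum>j\<in>?L. ?v j *\<^sub>R Tw tA i j) = ?v i * fn \<phi> (det tA ^ m)"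
        using vm_KK[of m] i fn_linear(2)[OF \<open>RC \<phi>\<close>] by (simp add: KK_def)
      then have "(\<Sum>j\<in>?L. ?v j * \<phi> i j) = ?v i * fn \<phi> (det tA ^ m)"
        unfolding fn_linear[OF \<open>RC \<phi>\<close>] using i by (simp add: fn_Tw[OF \<open>RC \<phi>\<close>] cong: sum.cong)
      then show ?thesis by (simp add: sum_distrib_left[symmetric] mult.assoc power2_eq_square)
    qed
    then show ?thesis by (simp add: sum_distrib_right)
  qed
  have "(\<Sum>i\<in>?L. (?v i)\<^sup>2) \<ge> (?v (idm m))\<^sup>2" by (rule member_le_sum) (auto simp: idm_LL)
  then have pos: "(\<Sum>i\<in>?L. (?v i)\<^sup>2) \<noteq> 0" by (simp add: vm_idm)
  have "(\<Sum>i\<in>?L. \<Sum>j\<in>?L. ?v i * ?v j * \<phi> i j) = (\<Sum>i\<in>?L. \<Sum>j\<in>?L. ?v i * ?v j * \<phi> j i)"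
    by (subst sum.swap) (simp add: mult.commute)
  then show ?thesis using *[OF assms] *[OF RC_transpose[OF assms]] pos by simp
qed

text \<open>Derived from \<open>PP_H1\<close> by testing with an \<open>RC\<close> functional and
  exchanging its arguments: \<open>PP\<close> is symmetric, and so is the value at
  \<open>det ^ m\<close>.\<close>

lemma PP_H2:
  assumes "j \<in> LL n (m * n)"
  shows "(\<Sum>p\<in>LL n (m * n). PP m i p *\<^sub>R Tw tA p j) = PP m i j *\<^sub>R det tA ^ m"
proof -
  let ?L = "LL n (m * n)"
  let ?x = "(\<Sum>p\<in>?L. PP m i p *\<^sub>R Tw tA p j) - PP m i j *\<^sub>R det tA ^ m"
  have "?x = 0"
  proof (rule hom_zero)
    show "hom (m * n) ?x"
      using assms by (intro hom_diff hom_sum hom_scaleR hom_Tw hom_det_power) auto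
    fix \<phi> :: "nat list \<Rightarrow> nat list \<Rightarrow> real" assume \<phi>: "RC \<phi>"
    let ?f = "\<lambda>i j. \<phi> j i"
    have "fn ?f (\<Sum>p\<in>?L. PP m p i *\<^sub>R Tw tA j p) = PP m j i * fn ?f (det tA ^ m)"
      using PP_H1[OF assms, of i] fn_linear(2)[OF RC_transpose[OF \<phi>]] by simp
    then have "(\<Sum>p\<in>?L. PP m p i * \<phi> p j) = PP m j i * fn \<phi> (det tA ^ m)"
      unfolding fn_linear[OF RC_transpose[OF \<phi>]] fn_det_power_transpose[OF \<phi>]
      using assms by (simp add: fn_Tw[OF RC_transpose[OF \<phi>]] cong: sum.cong)
    moreover have "fn \<phi> (\<Sum>p\<in>?L. PP m i p *\<^sub>R Tw tA p j) = (\<Sum>p\<in>?L. PP m i p * \<phi> p j)"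
      unfolding fn_linear[OF \<phi>] using assms by (simp add: fn_Tw[OF \<phi>] cong: sum.cong)
    ultimately show "fn \<phi> ?x = 0"
      unfolding fn_diff[OF \<phi>] fn_linear(2)[OF \<phi>] using PP_sym[of m _ i] by simp
  qed
  then show ?thesis by simp
qed

abbreviation pf :: "nat \<Rightarrow> alg \<Rightarrow> real" where "pf m \<equiv> fn (PP m)"

text \<open>The normalisation of the Haar functional: \<open>vm m\<close> is semi-invariant and is
  therefore fixed by the projection.\<close>

lemma pf_det: "pf m (det tA ^ m) = 1"
  unfolding fn_det_power[OF RC_PP] using PP_fix[OF vm_KK[of m], of "idm m"] by (simp add: vm_idm mult.commute)

lemma hom_det_mult: "hom d x \<Longrightarrow> hom (n + d) (det tA * x)"
proof -
  assume "hom d x"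
  then obtain c where c: "x = (\<Sum>p\<in>LL n d \<times> LL n d. c p *\<^sub>R Tw tA (fst p) (snd p))" by (auto simp: hom_def)
  have "hom (n + d) (Tw tA idl s * Tw tA a b)"
    if "s \<in> permutations_of_set (ix n)" "a \<in> LL n d" "b \<in> LL n d" for s a b
    using that hom_Tw[of "idl @ a" "n + d" "s @ b"] Tw_append[of idl s tA a b]
    by (simp add: LL_append idl_LL perm_LL perm_length idl_set)
  then show ?thesis unfolding c det_sum sum_product
    by (intro hom_sum) (auto intro!: hom_scaleR)
qed

text \<open>The matrix of \<open>x \<mapsto> pf (m + 1) (det x)\<close> has its columns in
  the range of \<open>PP m\<close>, because \<open>det\<close> may be cancelled.\<close>
lemma pf_Suc_Tw:
  assumes i: "i \<in> LL n (m * n)" and j: "j \<in> LL n (m * n)"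
  shows "pf (Suc m) (det tA * Tw tA i j) = PP m i j"
proof -
  let ?L = "LL n (m * n)" and ?P' = "PP (Suc m)" and ?S = "permutations_of_set (ix n)"
  define Q where "Q i j = pf (Suc m) (det tA * Tw tA i j)" for i j
  have lin: "pf (Suc m) (x + y) = pf (Suc m) x + pf (Suc m) y" "pf (Suc m) (c *\<^sub>R x) = c * pf (Suc m) x"
    "pf (Suc m) (\<Sum>x\<in>A. F x) = (\<Sum>x\<in>A. pf (Suc m) (F x))" for x y c and A :: "nat list set" and F
    by (rule fn_linear[OF RC_PP])+
  have fT: "pf (Suc m) (Tw tA a b) = ?P' a b" if "a \<in> LL n (n + m * n)" "b \<in> LL n (n + m * n)" for a b
    by (rule fn_Tw[OF RC_PP that])
  have inner: "(\<Sum>s\<in>?S. (- q) ^ invs s * ?P' (r @ p) (s @ j)) = (if r \<in> ?S then (- q) ^ invs r else 0) * Q p j"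
    if "r \<in> LL n n" "p \<in> ?L" "j \<in> ?L" for r p j
  proof -
    have "(\<Sum>s\<in>?S. (- q) ^ invs s * ?P' (r @ p) (s @ j)) = pf (Suc m) (\<Sum>s\<in>?S. (- q) ^ invs s *\<^sub>R Tw tA (r @ p) (s @ j))"
      unfolding lin using that by (intro sum.cong refl) (simp add: fT LL_append perm_LL)
    also have "(\<Sum>s\<in>?S. (- q) ^ invs s *\<^sub>R Tw tA (r @ p) (s @ j)) = (\<Sum>s\<in>?S. (- q) ^ invs s *\<^sub>R Tw tA r s) * Tw tA p j"
      unfolding sum_distrib_right using that
      by (intro sum.cong refl) (simp add: Tw_append LL_length perm_length)
    also have "\<dots> = (if r \<in> ?S then (- q) ^ invs r else 0) *\<^sub>R (det tA * Tw tA p j)"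
      unfolding minor_vm[OF qm_tA that(1)] by simp
    finally show ?thesis by (simp add: lin Q_def)
  qed
  have col: "(\<Sum>p\<in>?L. Q p j *\<^sub>R Tw tA i p) = Q i j *\<^sub>R det tA ^ m" if i: "i \<in> ?L" and j: "j \<in> ?L" for i j
  proof -
    let ?x = "(\<Sum>p\<in>?L. Q p j *\<^sub>R Tw tA i p) - Q i j *\<^sub>R det tA ^ m"
    have "(\<Sum>s\<in>?S. (- q) ^ invs s *\<^sub>R (\<Sum>r\<in>LL n n. \<Sum>p\<in>?L. ?P' (r @ p) (s @ j) *\<^sub>R Tw tA (idl @ i) (r @ p)))
       = (\<Sum>s\<in>?S. (- q) ^ invs s *\<^sub>R (?P' (idl @ i) (s @ j) *\<^sub>R det tA ^ Suc m))"
      using PP_H1[of "idl @ i" "Suc m"] LL_append[OF idl_LL i] by (simp add: sum_LL_add)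
    also have "\<dots> = (\<Sum>s\<in>?S. (- q) ^ invs s * ?P' (idl @ i) (s @ j)) *\<^sub>R det tA ^ Suc m"
      by (simp add: scaleR_sum_left)
    also have "\<dots> = Q i j *\<^sub>R det tA ^ Suc m"
      unfolding inner[OF idl_LL i j] by (simp add: permutations_of_set_def idl_set invs_sorted idl_sorted)
    finally have 1: "(\<Sum>s\<in>?S. (- q) ^ invs s *\<^sub>R (\<Sum>r\<in>LL n n. \<Sum>p\<in>?L. ?P' (r @ p) (s @ j) *\<^sub>R Tw tA (idl @ i) (r @ p)))
      = Q i j *\<^sub>R det tA ^ Suc m" .
    have "(\<Sum>s\<in>?S. (- q) ^ invs s *\<^sub>R (\<Sum>r\<in>LL n n. \<Sum>p\<in>?L. ?P' (r @ p) (s @ j) *\<^sub>R Tw tA (idl @ i) (r @ p)))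
       = (\<Sum>r\<in>LL n n. \<Sum>p\<in>?L. (\<Sum>s\<in>?S. (- q) ^ invs s * ?P' (r @ p) (s @ j)) *\<^sub>R Tw tA (idl @ i) (r @ p))"
      unfolding scaleR_sum_right scaleR_sum_left
      by (subst sum.swap, rule sum.cong[OF refl], subst sum.swap) simp
    also have "\<dots> = (\<Sum>r\<in>LL n n. \<Sum>p\<in>?L. ((if r \<in> ?S then (- q) ^ invs r else 0) *\<^sub>R Tw tA idl r) * (Q p j *\<^sub>R Tw tA i p))"
      using j by (intro sum.cong refl) (simp add: inner Tw_append LL_length idl_set)
    also have "\<dots> = (\<Sum>r\<in>LL n n. (if r \<in> ?S then (- q) ^ invs r else 0) *\<^sub>R Tw tA idl r) * (\<Sum>p\<in>?L. Q p j *\<^sub>R Tw tA i p)"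
      by (simp add: sum_product)
    also have "(\<Sum>r\<in>LL n n. (if r \<in> ?S then (- q) ^ invs r else 0) *\<^sub>R Tw tA idl r) = det tA"
      unfolding det_sum by (rule sum.mono_neutral_cong_right) (auto intro: perm_LL)
    finally have "det tA * ?x = 0" using 1 by (simp add: right_diff_distrib)
    moreover have "hom (m * n) ?x" using i by (intro hom_diff hom_sum hom_scaleR hom_Tw hom_det_power) auto
    ultimately show ?thesis using det_regular[of "m * n" ?x] by simp
  qed
  let ?q = "\<lambda>p. if p \<in> ?L then Q p j else 0"
  have "?q \<in> KK m" using col[OF _ j] by (simp add: KK_def cong: sum.cong)
  \<comment> \<open>\<open>PP m\<close> fixes the columns of \<open>Q\<close>. The same sum is then
    evaluated through the invariance of \<open>PP m\<close> and the normalisation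
    \<open>pf_det\<close>, which gives the entry of \<open>PP m\<close>.\<close>
  from PP_fix[OF this, of i] have "(\<Sum>p\<in>?L. PP m i p * Q p j) = Q i j" using i by (simp cong: sum.cong)
  moreover have "(\<Sum>p\<in>?L. PP m i p * Q p j) = pf (Suc m) (det tA * (\<Sum>p\<in>?L. PP m i p *\<^sub>R Tw tA p j))"
    by (simp add: sum_distrib_left lin Q_def)
  moreover have "\<dots> = PP m i j"
    unfolding PP_H2[OF j] using pf_det[of "Suc m"] by (simp add: lin)
  ultimately show ?thesis by (simp add: Q_def)
qed

end

section \<open>The quantum minors of the statement as minors of matrices\<close>

lemma invs_card: "invs l = card {(i, j). i < j \<and> j < length l \<and> l ! j < l ! i}"
proof (induction l)
  case (Cons x xs)
  let ?A = "{(i, j). i < j \<and> j < length (x # xs) \<and> (x # xs) ! j < (x # xs) ! i}"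
  let ?B = "(\<lambda>j. (0::nat, Suc j)) ` {j. j < length xs \<and> xs ! j < x}"
  let ?C = "(\<lambda>(i, j). (Suc i, Suc j)) ` {(i, j). i < j \<and> j < length xs \<and> xs ! j < xs ! i}"
  have A: "?A = ?B \<union> ?C"
  proof (intro set_eqI iffI)
    fix p assume "p \<in> ?A"
    then obtain i j where p: "p = (i, Suc j)" "i < Suc j" "j < length xs" "xs ! j < (x # xs) ! i"
      by (cases p; cases "snd p") auto
    then show "p \<in> ?B \<union> ?C" by (cases i) (auto simp: image_iff)
  qed auto
  have fin: "finite {(i, j). i < j \<and> j < length xs \<and> xs ! j < xs ! i}"
    by (rule finite_subset[of _ "{..length xs} \<times> {..length xs}"]) auto
  have "card ?A = card ?B + card ?C"
    unfolding A using fin by (intro card_Un_disjoint) auto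
  also have "card ?B = length (filter (\<lambda>y. y < x) xs)"
    by (simp add: card_image inj_on_def length_filter_conv_card)
  also have "card ?C = card {(i, j). i < j \<and> j < length xs \<and> xs ! j < xs ! i}"
    by (intro card_image) (auto simp: inj_on_def)
  finally show ?case using Cons by simp
qed simp

lemma permutes_list_bij:
  assumes "finite (B :: nat set)" and bs: "bs = sorted_list_of_set B"
  shows "bij_betw (\<lambda>s. map (\<lambda>i. bs ! s i) [0..<card B]) {s. s permutes {..<card B}} (permutations_of_set B)"
    (is "bij_betw ?f ?S _")
proof -
  have l: "length bs = card B" "set bs = B" "distinct bs" using assms by auto
  have inj: "inj_on ?f ?S"
  proof (rule inj_onI)
    fix s s' assume s: "s \<in> ?S" "s' \<in> ?S" and eq: "?f s = ?f s'"
    show "s = s'"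
    proof
      fix i
      show "s i = s' i"
      proof (cases "i < card B")
        case True
        then have "bs ! s i = bs ! s' i" using arg_cong[OF eq, of "\<lambda>l. l ! i"] by simp
        moreover have "s i < length bs" "s' i < length bs"
          using s True l permutes_in_image[of _ "{..<card B}"] by (auto simp: lessThan_iff[symmetric] simp del: lessThan_iff)
        ultimately show ?thesis using l(3) by (simp add: nth_eq_iff_index_eq)
      next
        case False
        then show ?thesis using s by (auto simp: permutes_def)
      qed
    qed
  qed
  have sub: "?f ` ?S \<subseteq> permutations_of_set B"
  proof
    fix j assume "j \<in> ?f ` ?S"
    then obtain s where s: "s permutes {..<card B}" "j = ?f s" by auto
    have im: "s ` {..<card B} = {..<card B}" using s(1) by (rule permutes_image)
    have "set j = (!) bs ` (s ` {..<card B})" using s(2) by (auto simp: image_image atLeast0LessThan)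
    also have "\<dots> = B" using im l nth_image[of "card B" bs] by (simp add: atLeast0LessThan)
    finally have "set j = B" .
    moreover from this have "distinct j" using s(2) by (intro card_distinct) simp
    ultimately show "j \<in> permutations_of_set B" by (simp add: permutations_of_set_def)
  qed
  have "card (?f ` ?S) = card (permutations_of_set B)"
    using inj assms(1) by (simp add: card_image card_permutations)
  then have "?f ` ?S = permutations_of_set B" using sub by (intro card_subset_eq) auto
  with inj show ?thesis by (simp add: bij_betw_def)
qed

lemma invs_ninv:
  assumes "finite (B :: nat set)" "bs = sorted_list_of_set B" "s permutes {..<card B}"
  shows "invs (map (\<lambda>i. bs ! s i) [0..<card B]) = ninv (card B) s"
proof -
  have l: "length bs = card B" "sorted_wrt (<) bs" using assms by auto
  have "bs ! s j < bs ! s i \<longleftrightarrow> s j < s i" if "i < card B" "j < card B" for i j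
  proof -
    have "s i < card B" "s j < card B"
      using that permutes_in_image[OF assms(3), of i] permutes_in_image[OF assms(3), of j] by auto
    then show ?thesis using l by (metis sorted_wrt_iff_nth_less linorder_neqE_nat less_asym less_irrefl)
  qed
  then show ?thesis unfolding invs_card ninv_def by (intro arg_cong[where f=card]) auto
qed

context qp
begin

lemma qminor_list:
  assumes "finite A" "finite B" "card A = card B"
  shows "qminor q A B = psum (permutations_of_set B) (\<lambda>j. psc (of_real ((- q) ^ invs j)) (pword (zw (sorted_list_of_set A) j)))"
proof
  fix w
  let ?bs = "sorted_list_of_set B" and ?as = "sorted_list_of_set A"
  let ?f = "\<lambda>s. map (\<lambda>i. ?bs ! s i) [0..<card B]"
  have "zw ?as (?f s) = map (\<lambda>i. Z (?as ! i) (?bs ! s i)) [0..<card A]" for s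
    using assms by (intro nth_equalityI) (auto simp: zw_def)
  then have "qminor q A B w = (\<Sum>s | s permutes {..<card B}. psc (of_real ((- q) ^ invs (?f s))) (pword (zw ?as (?f s))) w)"
    unfolding qminor_def Let_def psum_def
    using assms by (intro sum.cong) (auto simp: invs_ninv)
  also have "\<dots> = (\<Sum>j\<in>permutations_of_set B. psc (of_real ((- q) ^ invs j)) (pword (zw ?as j)) w)"
    by (rule sum.reindex_bij_betw[OF permutes_list_bij[OF assms(2) refl]])
  finally show "qminor q A B w = psum (permutations_of_set B) (\<lambda>j. psc (of_real ((- q) ^ invs j)) (pword (zw (sorted_list_of_set A) j))) w"
    by (simp add: psum_def)
qed

lemma pfin_qminor: "finite A \<Longrightarrow> finite B \<Longrightarrow> card A = card B \<Longrightarrow> pfin (qminor q A B)"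
  unfolding qminor_list by (intro pfin_psum) simp

lemma cls_qminor:
  assumes "A \<subseteq> ix n" "B \<subseteq> ix n" "card A = card B"
  shows "cls Rel (qminor q A B) = minor (tm Rel) (sorted_list_of_set A) B"
proof -
  have fin: "finite A" "finite B" using assms finite_subset finite_ix by blast+
  have "cls Rel (qminor q A B) = (\<Sum>j\<in>permutations_of_set B. (- q) ^ invs j *\<^sub>R Wd Rel (zw (sorted_list_of_set A) j))"
    unfolding qminor_list[OF fin assms(3)]
    by (subst cls_psum) (simp_all only: permutations_of_set_infinite finite_permutations_of_set pfin_psc pfin_pword cls_psc Wd_def)
  also have "\<dots> = minor (tm Rel) (sorted_list_of_set A) B"
    unfolding minor_def
  proof (intro sum.cong refl arg_cong2[where f=scaleR])
    fix j assume "j \<in> permutations_of_set B"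
    then have "length j = card B" "set j = B" by (auto simp: permutations_of_set_def distinct_card)
    then show "Wd Rel (zw (sorted_list_of_set A) j) = Tw (tm Rel) (sorted_list_of_set A) j"
      using assms fin by (intro Tw_tm[symmetric]) auto
  qed
  finally show ?thesis .
qed

lemma qdet_ix: "qdet n q = qminor q (ix n) (ix n)"
  by (simp add: qdet_def ix_def)

lemma cls_qdet: "cls Rel (qdet n q) = det (tm Rel)"
  unfolding qdet_ix det_def sorted_list_1n[symmetric] by (rule cls_qminor) auto

lemma pfin_qdet [simp]: "pfin (qdet n q)"
  unfolding qdet_ix by (rule pfin_qminor) auto

lemma ceps_zw: "length i = length j \<Longrightarrow> ceps (zw i j) = (if i = j then 1 else 0)"
proof (induction i j rule: list_induct2)
  case (Cons a i b j)
  have "ceps (Z a b # zw i j) = (if a = b then 1 else 0) * ceps (zw i j)" by (auto simp: ceps_def)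
  then show ?case using Cons by simp
qed simp

lemma lin_ceps_qdet: "lin ceps (qdet n q) = 1"
proof -
  have "lin ceps (qdet n q) = (\<Sum>j\<in>permutations_of_set (ix n). of_real ((- q) ^ invs j) * ceps (zw idl j))"
    unfolding qdet_ix qminor_list[OF finite_ix finite_ix refl] sorted_list_1n idl_def[symmetric]
    by (subst lin_psum) (simp_all add: lin_psc)
  also have "\<dots> = (\<Sum>j\<in>permutations_of_set (ix n). if j = idl then 1 else 0)"
    by (intro sum.cong refl) (auto simp: ceps_zw perm_length idl_set invs_sorted idl_sorted)
  also have "\<dots> = 1"
  proof -
    have "idl \<in> permutations_of_set (ix n)" by (simp add: permutations_of_set_def idl_set)
    then show ?thesis by (simp only: sum.delta[OF finite_permutations_of_set] if_True)
  qed
  finally show ?thesis .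
qed

section \<open>The localization and the Haar functional on its words\<close>

lemma rel_gl_cases:
  assumes "r \<in> rel_gl n q"
  obtains "r \<in> rel_mat n q" | "r = psub (pmul (pword [T]) (qdet n q)) pone" | "r = psub (pmul (qdet n q) (pword [T])) pone"
  using assms unfolding rel_gl_def by blast

lemma good_rel_gl: "good (rel_gl n q)"
  unfolding good_def
proof
  fix r assume "r \<in> rel_gl n q"
  then show "pfin r \<and> lin ceps r = 0"
  proof (cases rule: rel_gl_cases)
    case 1
    then show ?thesis using good_rel_mat by (simp add: good_def)
  next
    case 2
    have "ceps [T] = 1" by (simp add: ceps_def)
    with 2 show ?thesis by (simp add: lin_psub lin_ceps_pmul lin_ceps_qdet pone_pword)
  next
    case 3
    have "ceps [T] = 1" by (simp add: ceps_def)
    with 3 show ?thesis by (simp add: lin_psub lin_ceps_pmul lin_ceps_qdet pone_pword)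
  qed
qed

lemma rel_mat_gl: "rel_mat n q \<subseteq> rel_gl n q" by (auto simp: rel_gl_def)

abbreviation tO :: "nat \<Rightarrow> nat \<Rightarrow> alg" where "tO \<equiv> tm (rel_gl n q)"

abbreviation WO :: "gen list \<Rightarrow> alg" where "WO \<equiv> Wd (rel_gl n q)"

definition Ti :: alg where "Ti = WO [T]"

lemma qm_tO: "qm tO" by (rule qm_tm[OF good_rel_gl rel_mat_gl])

lemma Ti_det: "Ti * det tO = 1" and det_Ti: "det tO * Ti = 1"
proof -
  have "cls (rel_gl n q) (psub (pmul (pword [T]) (qdet n q)) pone) = 0"
    "cls (rel_gl n q) (psub (pmul (qdet n q) (pword [T])) pone) = 0"
    by (rule cls_rel[OF good_rel_gl], simp add: rel_gl_def)+
  then show "Ti * det tO = 1" "det tO * Ti = 1"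
    by (simp_all add: cls_psub cls_pmul cls_qdet Wd_def[symmetric] Ti_def)
qed

lemma Ti_central: "Ti * tO a b = tO a b * Ti"
proof -
  have "Ti * tO a b = Ti * (tO a b * det tO) * Ti" by (simp add: mult.assoc det_Ti)
  also have "\<dots> = (Ti * det tO) * tO a b * Ti" by (simp only: det_central[OF qm_tO] mult.assoc)
  finally show ?thesis by (simp add: Ti_det)
qed

text \<open>\<open>Ti\<close> is central, so the class of a word in the localization is determined
  by the number of its letters \<open>T\<close> and the word that remains, see
  \<open>Wd_gl\<close>.\<close>

definition cntT :: "gen list \<Rightarrow> nat" where "cntT w = length (filter (\<lambda>g. g = T) w)"
definition zpart :: "gen list \<Rightarrow> gen list" where "zpart w = filter (\<lambda>g. g \<noteq> T) w"

lemma cntT_append [simp]: "cntT (u @ v) = cntT u + cntT v" "cntT [] = 0" "cntT (Z a b # w) = cntT w" "cntT (T # w) = Suc (cntT w)"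
  and zpart_append [simp]: "zpart (u @ v) = zpart u @ zpart v" "zpart [] = []" "zpart (Z a b # w) = Z a b # zpart w" "zpart (T # w) = zpart w"
  by (simp_all add: cntT_def zpart_def)

lemma zpart_alph: "set w \<subseteq> gl_alph n \<Longrightarrow> set (zpart w) \<subseteq> mat_alph n"
  by (auto simp: zpart_def gl_alph_def)

text \<open>A letter \<open>T\<close> has degree \<open>- n\<close>, so the condition on the length
  selects total degree 0.\<close>

definition hr :: "gen list \<Rightarrow> real" where
  "hr w = (if set w \<subseteq> gl_alph n \<and> length (zpart w) = cntT w * n
     then PP (cntT w) (map Zr (zpart w)) (map Zc (zpart w)) else 0)"

text \<open>\<open>Xi K\<close> clears the denominators of words with at most \<open>K\<close> letters \<open>T\<close>.\<close>
definition Xi :: "nat \<Rightarrow> gen list \<Rightarrow> alg" where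
  "Xi K w = (if set w \<subseteq> gl_alph n then det tA ^ (K - cntT w) * Wd (rel_mat n q) (zpart w) else 0)"

lemma rows_cols_LL: "set w \<subseteq> mat_alph n \<Longrightarrow> map Zr w \<in> LL n (length w) \<and> map Zc w \<in> LL n (length w)"
  by (auto simp: LL_def mat_alph_def ix_def)

lemma Wd_mat: "set w \<subseteq> mat_alph n \<Longrightarrow> Wd Rel w = Tw (tm Rel) (map Zr w) (map Zc w)"
  using rows_cols_LL[of w] Tw_tm_LL[of "map Zr w" "length w" "map Zc w" Rel] mat_word[of w n] by simp

lemma det_comm_Wd: "set w \<subseteq> mat_alph n \<Longrightarrow> Wd (rel_mat n q) w * det tA = det tA * Wd (rel_mat n q) w"
  by (simp add: Wd_mat det_central_word[OF qm_tA])

lemma hom_det_pow: "hom d x \<Longrightarrow> hom (k * n + d) (det tA ^ k * x)"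
proof (induction k)
  case (Suc k)
  then show ?case using hom_det_mult[of "k * n + d" "det tA ^ k * x"] by (simp add: mult.assoc add.assoc)
qed simp

lemma pf_hom_zero:
  assumes "hom d x" "d \<noteq> K * n" shows "pf K x = 0"
proof -
  obtain c where c: "x = (\<Sum>p\<in>LL n d \<times> LL n d. c p *\<^sub>R Tw tA (fst p) (snd p))" using assms(1) by (auto simp: hom_def)
  have "PP K i j = 0" if "i \<in> LL n d" for i j
    using that assms(2) by (intro PP_zero) (auto simp: LL_def)
  then show ?thesis unfolding c fn_linear[OF RC_PP] by (intro sum.neutral) (auto simp: fn_Tw[OF RC_PP])
qed

lemma pf_Suc: "hom (m * n) x \<Longrightarrow> pf (Suc m) (det tA * x) = pf m x"
proof -
  assume "hom (m * n) x"
  then obtain c where c: "x = (\<Sum>p\<in>LL n (m * n) \<times> LL n (m * n). c p *\<^sub>R Tw tA (fst p) (snd p))" by (auto simp: hom_def)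
  show ?thesis unfolding c sum_distrib_left mult_scaleR_right fn_linear[OF RC_PP]
    by (intro sum.cong refl) (auto simp: pf_Suc_Tw fn_Tw[OF RC_PP])
qed

lemma pf_det_pow: "hom (m * n) x \<Longrightarrow> pf (k + m) (det tA ^ k * x) = pf m x"
proof (induction k)
  case (Suc k)
  have "hom ((k + m) * n) (det tA ^ k * x)" using hom_det_pow[OF Suc.prems, of k] by (simp add: add_mult_distrib)
  from pf_Suc[OF this] show ?case using Suc by (simp add: mult.assoc)
qed simp

text \<open>The power of \<open>det\<close> used to clear denominators does not influence the value:
  \<open>pf_det_pow\<close> removes the surplus factors, and outside total degree 0 both sides
  vanish.\<close>

lemma pf_Xi:
  assumes "cntT w \<le> K" shows "pf K (Xi K w) = hr w"
proof (cases "set w \<subseteq> gl_alph n")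
  case True
  let ?z = "zpart w" and ?m = "cntT w"
  have z: "set ?z \<subseteq> mat_alph n" by (rule zpart_alph[OF True])
  have L: "map Zr ?z \<in> LL n (length ?z)" "map Zc ?z \<in> LL n (length ?z)" using rows_cols_LL[OF z] by auto
  have X: "Xi K w = det tA ^ (K - ?m) * Tw tA (map Zr ?z) (map Zc ?z)" using True Wd_mat[OF z] by (simp add: Xi_def)
  have h: "hom (length ?z) (Tw tA (map Zr ?z) (map Zc ?z))" using L by (rule hom_Tw)
  show ?thesis
  proof (cases "length ?z = ?m * n")
    case True
    have "pf (K - ?m + ?m) (Xi K w) = pf ?m (Tw tA (map Zr ?z) (map Zc ?z))"
      unfolding X using h True by (intro pf_det_pow) simp
    then show ?thesis using assms True \<open>set w \<subseteq> gl_alph n\<close> L by (simp add: hr_def fn_Tw[OF RC_PP])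
  next
    case False
    have "hom ((K - ?m) * n + length ?z) (Xi K w)" unfolding X by (rule hom_det_pow[OF h])
    moreover have "(K - ?m) * n + length ?z \<noteq> K * n" using False assms
      by (metis add_left_cancel add_mult_distrib le_add_diff_inverse2)
    ultimately show ?thesis using False pf_hom_zero by (simp add: hr_def)
  qed
next
  case False
  then show ?thesis using fn_linear(2)[OF RC_PP, of K 0 0] by (simp add: Xi_def hr_def)
qed

definition preal :: "poly \<Rightarrow> bool" where "preal p \<longleftrightarrow> (\<forall>w. p w \<in> \<real>)"

lemma lin_real:
  assumes "pfin p" "preal p" and add: "\<And>x y. L (x + y) = L x + L y" and sc: "\<And>c x. L (c *\<^sub>R x) = c * L x"
  shows "lin (\<lambda>w. of_real (L (Wd Rel w))) p = of_real (L (cls Rel p))"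
proof -
  have L0: "L 0 = 0" using sc[of 0 0] by simp
  have Ls: "L (\<Sum>x\<in>A. F x) = (\<Sum>x\<in>A. L (F x))" for A :: "gen list set" and F
    by (induction A rule: infinite_finite_induct) (auto simp: L0 add)
  have fin: "finite {w. p w \<noteq> 0}" using assms(1) by (simp add: pfin_def)
  have r: "p w = of_real (Re (p w))" for w using assms(2) by (metis Reals_cases Re_complex_of_real preal_def)
  have "cls Rel p = cls Rel (psum {w. p w \<noteq> 0} (\<lambda>w. psc (of_real (Re (p w))) (pword w)))"
    using pfin_expand[OF assms(1)] r by simp
  also have "\<dots> = (\<Sum>w | p w \<noteq> 0. Re (p w) *\<^sub>R Wd Rel w)"
    using fin by (subst cls_psum) (simp_all add: cls_psc Wd_def)
  finally have "L (cls Rel p) = (\<Sum>w | p w \<noteq> 0. Re (p w) * L (Wd Rel w))" by (simp add: Ls sc)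
  moreover have "p w * of_real x = of_real (Re (p w) * x)" for w x
    using arg_cong[OF r[of w], of "\<lambda>c. c * of_real x"] by (simp only: of_real_mult)
  ultimately show ?thesis unfolding lin_def by (simp only: of_real_sum)
qed

lemma preal_intros [intro, simp]:
  "preal (pword w)" "preal p \<Longrightarrow> preal r \<Longrightarrow> preal (psub p r)" "preal p \<Longrightarrow> preal r \<Longrightarrow> preal (padd p r)"
  "preal p \<Longrightarrow> preal (psc (of_real c) p)" "preal pone"
  by (auto simp: preal_def pword_def psub_def padd_def psc_def pone_def)

lemma preal_psum: "(\<And>x. x \<in> A \<Longrightarrow> preal (F x)) \<Longrightarrow> preal (psum A F)"
  unfolding preal_def psum_def by (auto intro: sum_in_Reals)

lemma preal_pmul: "preal p \<Longrightarrow> preal r \<Longrightarrow> preal (pmul p r)"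
  unfolding preal_def pmul_def by (auto intro!: sum_in_Reals Reals_mult)

lemma preal_qminor: "finite A \<Longrightarrow> finite B \<Longrightarrow> card A = card B \<Longrightarrow> preal (qminor q A B)"
  unfolding qminor_list by (intro preal_psum preal_intros)

lemma preal_qdet: "preal (qdet n q)"
  unfolding qdet_ix by (rule preal_qminor) auto

lemma lin_shift: "pfin r \<Longrightarrow> lin h (pmul (pmul (pword u) r) (pword v)) = lin (\<lambda>x. h (u @ x @ v)) r"
proof -
  assume r: "pfin r"
  have s: "{w. pword u w \<noteq> 0} = {u}" for u by (auto simp: pword_def)
  have "lin h (pmul (pword u) (pmul r (pword v))) = (\<Sum>x | r x \<noteq> 0. r x * h (u @ x @ v))"
  proof -
    have "lin h (pmul (pword u) (pmul r (pword v))) = lin (\<lambda>x. h (u @ x)) (pmul r (pword v))"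
      using r by (subst lin_pmul) (simp_all add: s lin_def, simp add: pword_def)
    also have "\<dots> = (\<Sum>x | r x \<noteq> 0. r x * h (u @ x @ v))"
      using r by (subst lin_pmul) (simp_all add: s, simp add: pword_def)
    finally show ?thesis .
  qed
  then show ?thesis by (simp add: pmul_assoc lin_def)
qed

lemma Wd_Z_words: "set w \<subseteq> mat_alph n \<Longrightarrow> zpart w = w \<and> cntT w = 0"
  by (induction w) (auto simp: mat_alph_def)

lemma lin_cong: "(\<And>w. p w \<noteq> 0 \<Longrightarrow> h w = h' w) \<Longrightarrow> lin h p = lin h' p"
  unfolding lin_def by (intro sum.cong) auto

lemma rel_mat_words: "r \<in> rel_mat n q \<Longrightarrow> r w \<noteq> 0 \<Longrightarrow> set w \<subseteq> mat_alph n"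
  by (cases rule: rel_mat_cases) (auto simp: psub_def psc_def pword_def split: if_splits)

lemma preal_rel_mat: "r \<in> rel_mat n q \<Longrightarrow> preal r"
  by (erule rel_mat_cases) (simp only:, intro preal_intros)+

lemma qdet_words: "qdet n q w \<noteq> 0 \<Longrightarrow> set w \<subseteq> mat_alph n"
proof -
  assume "qdet n q w \<noteq> 0"
  then have "(\<Sum>j\<in>permutations_of_set (ix n). psc (of_real ((- q) ^ invs j)) (pword (zw idl j)) w) \<noteq> 0"
    unfolding qdet_ix qminor_list[OF finite_ix finite_ix refl] sorted_list_1n idl_def[symmetric] psum_def .
  then obtain j where j: "j \<in> permutations_of_set (ix n)" "psc (of_real ((- q) ^ invs j)) (pword (zw idl j)) w \<noteq> 0"
    by (rule sum.not_neutral_contains_not_neutral)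
  then have "w = zw idl j" by (auto simp: psc_def pword_def split: if_splits)
  then show ?thesis using j(1) zw_mat_alph[of idl j n] by (simp add: perm_length idl_set) (simp add: permutations_of_set_def)
qed

text \<open>The strict inequality leaves room for the letter \<open>T\<close> of the relation
  itself. After clearing denominators the relation \<open>T det = 1\<close> says that
  \<open>det ^ e * det\<close> is \<open>det ^ (e + 1)\<close>, once \<open>det\<close> has been
  moved past the word of \<open>u\<close>.\<close>

lemma Xi_relation:
  assumes "r \<in> rel_gl n q" "cntT u + cntT v < K" "RC \<phi>"
  shows "lin (\<lambda>x. of_real (fn \<phi> (Xi K (u @ x @ v)))) r = 0"
proof (cases "set u \<subseteq> gl_alph n \<and> set v \<subseteq> gl_alph n")
  case False
  then have "Xi K (u @ x @ v) = 0" for x by (auto simp: Xi_def)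
  then show ?thesis using fn_linear(2)[OF assms(3), of 0 0] by (simp add: lin_def)
next
  case True
  let ?M = "rel_mat n q"
  let ?U = "Wd ?M (zpart u)" and ?V = "Wd ?M (zpart v)"
  have zu: "set (zpart u) \<subseteq> mat_alph n" using True zpart_alph by blast
  define L where "L e x = fn \<phi> (det tA ^ e * (?U * x * ?V))" for e x
  have L: "L e (x + y) = L e x + L e y" "L e (c *\<^sub>R x) = c * L e x" for e x y c
    by (simp_all add: L_def distrib_left distrib_right fn_linear[OF assms(3)])
  have L0: "L e 0 = 0" for e using L(2)[of e 0 0] by simp
  have gl: "set w \<subseteq> mat_alph n \<Longrightarrow> set w \<subseteq> gl_alph n" for w by (auto simp: gl_alph_def)
  have Xw: "fn \<phi> (Xi K (u @ w @ v)) = L (K - (cntT u + cntT v)) (Wd ?M w)" if "set w \<subseteq> mat_alph n" for w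
    using True gl[OF that] Wd_Z_words[OF that] by (simp add: Xi_def L_def Wd_append mult.assoc)
  define e where "e = K - Suc (cntT u + cntT v)"
  have e: "K - (cntT u + cntT v) = Suc e" using assms(2) by (simp add: e_def)
  have XT: "fn \<phi> (Xi K (u @ (T # w) @ v)) = L e (Wd ?M w)" "fn \<phi> (Xi K (u @ (w @ [T]) @ v)) = L e (Wd ?M w)"
    if "set w \<subseteq> mat_alph n" for w
    using True gl[OF that] Wd_Z_words[OF that]
    by (simp_all add: Xi_def L_def Wd_append mult.assoc e_def) (simp_all add: gl_alph_def)
  have cU: "?U * det tA = det tA * ?U" by (rule det_comm_Wd[OF zu])
  have detL: "L e (det tA) = L (Suc e) 1"
    unfolding L_def cU mult_1_right by (simp only: power_Suc2 mult.assoc)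
  from assms(1) show ?thesis
  proof (cases rule: rel_gl_cases)
    case 1
    have "lin (\<lambda>x. of_real (fn \<phi> (Xi K (u @ x @ v)))) r = lin (\<lambda>x. of_real (L (Suc e) (Wd ?M x))) r"
      using rel_mat_words[OF 1] Xw e by (intro lin_cong) simp
    also have "\<dots> = of_real (L (Suc e) (cls ?M r))"
      using good_rel_mat 1 by (intro lin_real preal_rel_mat L) (auto simp: good_def)
    finally show ?thesis using cls_rel[OF good_rel_mat 1] L0 by simp
  next
    case 2
    have "lin (\<lambda>x. of_real (fn \<phi> (Xi K (u @ x @ v)))) (pmul (pword [T]) (qdet n q))
        = lin (\<lambda>x. of_real (fn \<phi> (Xi K (u @ ([T] @ x) @ v)))) (qdet n q)"
      using lin_shift[of "qdet n q" _ "[T]" "[]"] by (simp add: pone_pword[symmetric])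
    also have "\<dots> = lin (\<lambda>x. of_real (L e (Wd ?M x))) (qdet n q)"
      using qdet_words XT(1) by (intro lin_cong) simp
    also have "\<dots> = of_real (L e (det tA))"
      by (subst lin_real) (auto simp: L cls_qdet preal_qdet)
    finally show ?thesis using 2 detL Xw[of "[]"] e by (simp add: lin_psub pone_pword)
  next
    case 3
    have "lin (\<lambda>x. of_real (fn \<phi> (Xi K (u @ x @ v)))) (pmul (qdet n q) (pword [T]))
        = lin (\<lambda>x. of_real (fn \<phi> (Xi K (u @ (x @ [T]) @ v)))) (qdet n q)"
      using lin_shift[of "qdet n q" _ "[]" "[T]"] by (simp add: pone_pword[symmetric])
    also have "\<dots> = lin (\<lambda>x. of_real (L e (Wd ?M x))) (qdet n q)"
      using qdet_words XT(2) by (intro lin_cong) simp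
    also have "\<dots> = of_real (L e (det tA))"
      by (subst lin_real) (auto simp: L cls_qdet preal_qdet)
    finally show ?thesis using 3 detL Xw[of "[]"] e by (simp add: lin_psub pone_pword)
  qed
qed

text \<open>A member of the ideal is a finite combination of relations between words, so one bound
  \<open>K0\<close> serves all these words and all functionals at once.\<close>

lemma Xi_ideal:
  assumes "p \<in> ideal (rel_gl n q)"
  shows "pfin p \<and> (\<exists>K0. \<forall>K\<ge>K0. \<forall>\<phi>. RC \<phi> \<longrightarrow> lin (\<lambda>x. of_real (fn \<phi> (Xi K x))) p = 0)"
  using assms
proof (induction rule: ideal.induct)
  case zero
  then show ?case by simp
next
  case (add p r)
  from add.IH obtain K1 where K1: "\<forall>K\<ge>K1. \<forall>\<phi>. RC \<phi> \<longrightarrow> lin (\<lambda>x. of_real (fn \<phi> (Xi K x))) p = 0" by (elim conjE exE)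
  from add.IH obtain K2 where K2: "\<forall>K\<ge>K2. \<forall>\<phi>. RC \<phi> \<longrightarrow> lin (\<lambda>x. of_real (fn \<phi> (Xi K x))) r = 0" by (elim conjE exE)
  have fin: "pfin p" "pfin r" using conjunct1[OF add.IH(1)] conjunct1[OF add.IH(2)] .
  have "\<forall>K\<ge>max K1 K2. \<forall>\<phi>. RC \<phi> \<longrightarrow> lin (\<lambda>x. of_real (fn \<phi> (Xi K x))) (padd p r) = 0"
    using K1 K2 fin by (simp add: lin_padd)
  then show ?case using fin by (intro conjI pfin_padd exI[of _ "max K1 K2"])
next
  case (gen r a b)
  let ?A = "{u. a u \<noteq> 0}" and ?B = "{v. b v \<noteq> 0}"
  have fin: "finite ?A" "finite ?B" using gen by (simp_all add: pfin_def)
  have r: "pfin r" using gen(1) good_rel_gl by (simp add: good_def)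
  define K0 where "K0 = Suc ((\<Sum>u\<in>?A. cntT u) + (\<Sum>v\<in>?B. cntT v))"
  have "lin (\<lambda>x. of_real (fn \<phi> (Xi K x))) (pmul (pmul a r) b) = 0" if K: "K0 \<le> K" and \<phi>: "RC \<phi>" for K \<phi>
  proof -
    have "cntT u + cntT v < K" if "u \<in> ?A" "v \<in> ?B" for u v
      using member_le_sum[of u ?A cntT] member_le_sum[of v ?B cntT] fin that K by (simp add: K0_def)
    then show ?thesis
      using gen r by (subst lin_pmul2) (auto simp: lin_shift Xi_relation \<phi> intro!: sum.neutral)
  qed
  moreover have "pfin (pmul (pmul a r) b)" using gen r by simp
  ultimately show ?case by (intro conjI exI[of _ K0]) auto
qed

end

lemma sum_list_concat: "sum_list (concat xss) = sum_list (map sum_list xss)"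
  by (induction xss) auto

lemma pfin_psum_list: "(\<And>p. p \<in> set ps \<Longrightarrow> pfin p) \<Longrightarrow> pfin (psum_list ps)"
  unfolding psum_list_def by (induction ps) auto

lemma lin_psum_list: "(\<And>p. p \<in> set ps \<Longrightarrow> pfin p) \<Longrightarrow> lin h (psum_list ps) = sum_list (map (lin h) ps)"
proof (induction ps)
  case (Cons p ps)
  have "lin h (padd p (psum_list ps)) = lin h p + lin h (psum_list ps)"
    by (rule lin_padd) (use Cons.prems pfin_psum_list in auto)
  then show ?case using Cons by (simp add: psum_list_def)
qed (simp add: psum_list_def)

lemma cls_psum_list: "(\<And>p. p \<in> set ps \<Longrightarrow> pfin p) \<Longrightarrow> cls Rel (psum_list ps) = sum_list (map (cls Rel) ps)"
proof (induction ps)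
  case (Cons p ps)
  have "cls Rel (padd p (psum_list ps)) = cls Rel p + cls Rel (psum_list ps)"
    by (rule cls_padd) (use Cons.prems pfin_psum_list in auto)
  then show ?case using Cons by (simp add: psum_list_def)
qed (simp add: psum_list_def)

section \<open>Transfer of identities between the algebras\<close>

context qp
begin

text \<open>Equal elements of the algebra have equal coordinates in the ordered monomials, and by
  \<open>RC_expand\<close> the coordinates determine the corresponding combination for every
  \<open>RC\<close> function.\<close>

lemma transfer:
  fixes \<Theta> :: "nat list \<Rightarrow> nat list \<Rightarrow> 'a::real_vector"
  assumes \<Theta>: "RC \<Theta>"
    and A: "\<And>x. x \<in> A \<Longrightarrow> f x \<in> LL n d \<and> g x \<in> LL n d" and B: "\<And>y. y \<in> B \<Longrightarrow> f' y \<in> LL n d \<and> g' y \<in> LL n d"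
    and eq: "(\<Sum>x\<in>A. c x *\<^sub>R Tw tA (f x) (g x)) = (\<Sum>y\<in>B. c' y *\<^sub>R Tw tA (f' y) (g' y))"
  shows "(\<Sum>x\<in>A. c x *\<^sub>R \<Theta> (f x) (g x)) = (\<Sum>y\<in>B. c' y *\<^sub>R \<Theta> (f' y) (g' y))"
proof -
  have *: "(\<Sum>x\<in>X. e x *\<^sub>R \<Theta> (u x) (v x)) = (\<Sum>p\<in>SP d. fn (psi (fst p) (snd p)) (\<Sum>x\<in>X. e x *\<^sub>R Tw tA (u x) (v x)) *\<^sub>R \<Theta> (fst p) (snd p))"
    if "\<And>x. x \<in> X \<Longrightarrow> u x \<in> LL n d \<and> v x \<in> LL n d" for X :: "'x set" and e u v
  proof -
    have "(\<Sum>x\<in>X. e x *\<^sub>R \<Theta> (u x) (v x)) = (\<Sum>x\<in>X. \<Sum>p\<in>SP d. (e x * psi (fst p) (snd p) (u x) (v x)) *\<^sub>R \<Theta> (fst p) (snd p))"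
    proof (rule sum.cong[OF refl])
      fix x assume "x \<in> X"
      with that have L: "u x \<in> LL n d" "v x \<in> LL n d" by blast+
      show "e x *\<^sub>R \<Theta> (u x) (v x) = (\<Sum>p\<in>SP d. (e x * psi (fst p) (snd p) (u x) (v x)) *\<^sub>R \<Theta> (fst p) (snd p))"
        by (subst RC_expand[OF \<Theta> L]) (simp add: scaleR_sum_right)
    qed
    also have "\<dots> = (\<Sum>p\<in>SP d. (\<Sum>x\<in>X. e x * psi (fst p) (snd p) (u x) (v x)) *\<^sub>R \<Theta> (fst p) (snd p))"
      by (subst sum.swap) (simp add: scaleR_sum_left)
    also have "\<dots> = (\<Sum>p\<in>SP d. fn (psi (fst p) (snd p)) (\<Sum>x\<in>X. e x *\<^sub>R Tw tA (u x) (v x)) *\<^sub>R \<Theta> (fst p) (snd p))"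
      unfolding fn_linear[OF RC_psi] using that
      by (intro sum.cong refl arg_cong2[where f=scaleR]) (simp add: fn_Tw[OF RC_psi, where d=d])
    finally show ?thesis .
  qed
  show ?thesis using *[of A f g c] *[of B f' g' c'] A B eq by simp
qed

lemma det_power_regular: "hom d x \<Longrightarrow> det tA ^ k * x = 0 \<Longrightarrow> x = 0"
proof (induction k)
  case (Suc k)
  have "det tA * (det tA ^ k * x) = 0" using Suc.prems(2) by (simp add: mult.assoc)
  then have "det tA ^ k * x = 0" by (rule det_regular[OF hom_det_pow[OF Suc.prems(1)]])
  then show ?case using Suc by blast
qed simp

text \<open>Injectivity of the map into the localization: by \<open>Xi_ideal\<close> some power of
  \<open>det\<close> times the difference is annihilated by all functionals, hence is 0, and
  \<open>det\<close> is regular.\<close>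

lemma transfer_gl:
  assumes fin: "finite A" "finite B"
    and A: "\<And>x. x \<in> A \<Longrightarrow> f x \<in> LL n d \<and> g x \<in> LL n d" and B: "\<And>y. y \<in> B \<Longrightarrow> f' y \<in> LL n d \<and> g' y \<in> LL n d"
    and eq: "(\<Sum>x\<in>A. c x *\<^sub>R Tw tO (f x) (g x)) = (\<Sum>y\<in>B. c' y *\<^sub>R Tw tO (f' y) (g' y))"
  shows "(\<Sum>x\<in>A. c x *\<^sub>R Tw tA (f x) (g x)) = (\<Sum>y\<in>B. c' y *\<^sub>R Tw tA (f' y) (g' y))"
proof -
  let ?P = "psum A (\<lambda>x. psc (of_real (c x)) (pword (zw (f x) (g x))))" and ?R = "psum B (\<lambda>y. psc (of_real (c' y)) (pword (zw (f' y) (g' y))))"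
  let ?x = "(\<Sum>x\<in>A. c x *\<^sub>R Tw tA (f x) (g x)) - (\<Sum>y\<in>B. c' y *\<^sub>R Tw tA (f' y) (g' y))"
  have pf: "pfin ?P" "pfin ?R" by (simp_all add: pfin_psum)
  have "cls (rel_gl n q) ?P = (\<Sum>x\<in>A. c x *\<^sub>R Tw tO (f x) (g x))"
    using fin(1) by (subst cls_psum) (simp_all add: cls_psc Wd_def[symmetric] Tw_tm_LL[where d=d] A cong: sum.cong)
  moreover have "cls (rel_gl n q) ?R = (\<Sum>y\<in>B. c' y *\<^sub>R Tw tO (f' y) (g' y))"
    using fin(2) by (subst cls_psum) (simp_all add: cls_psc Wd_def[symmetric] Tw_tm_LL[where d=d] B cong: sum.cong)
  ultimately have "congr (rel_gl n q) ?P ?R" using eq pf by (intro cls_eqD) simp_all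
  then have "psub ?P ?R \<in> ideal (rel_gl n q)" by (simp add: congr_def)
  from Xi_ideal[OF this] obtain K where K: "RC \<phi> \<Longrightarrow> lin (\<lambda>x. of_real (fn \<phi> (Xi K x))) (psub ?P ?R) = 0" for \<phi> by blast
  have X: "Xi K (zw a b) = det tA ^ K * Tw tA a b" if "a \<in> LL n d \<and> b \<in> LL n d" for a b
  proof -
    have L: "a \<in> LL n d" "b \<in> LL n d" using that by blast+
    then have m: "set (zw a b) \<subseteq> mat_alph n" using zw_mat_alph[of a b n] by (simp add: LL_def)
    then have "set (zw a b) \<subseteq> gl_alph n" by (auto simp: gl_alph_def)
    then show ?thesis using Wd_Z_words[OF m] L by (simp add: Xi_def Tw_tm_LL)
  qed
  have hx: "hom d ?x" using A B by (intro hom_diff hom_sum hom_scaleR hom_Tw) auto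
  have "fn \<phi> (det tA ^ K * ?x) = 0" if \<phi>: "RC \<phi>" for \<phi>
  proof -
    have "0 = lin (\<lambda>x. of_real (fn \<phi> (Xi K x))) (psub ?P ?R)" using K[OF \<phi>] by simp
    also have "\<dots> = of_real ((\<Sum>x\<in>A. c x * fn \<phi> (Xi K (zw (f x) (g x)))) - (\<Sum>y\<in>B. c' y * fn \<phi> (Xi K (zw (f' y) (g' y)))))"
      using pf fin by (simp add: lin_psub lin_psum lin_psc)
    also have "(\<Sum>x\<in>A. c x * fn \<phi> (Xi K (zw (f x) (g x)))) = fn \<phi> (det tA ^ K * (\<Sum>x\<in>A. c x *\<^sub>R Tw tA (f x) (g x)))"
      unfolding sum_distrib_left mult_scaleR_right fn_linear[OF \<phi>] using A by (simp add: X cong: sum.cong)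
    also have "(\<Sum>y\<in>B. c' y * fn \<phi> (Xi K (zw (f' y) (g' y)))) = fn \<phi> (det tA ^ K * (\<Sum>y\<in>B. c' y *\<^sub>R Tw tA (f' y) (g' y)))"
      unfolding sum_distrib_left mult_scaleR_right fn_linear[OF \<phi>] using B by (simp add: X cong: sum.cong)
    finally show ?thesis unfolding right_diff_distrib fn_diff[OF \<phi>] by simp
  qed
  then have "det tA ^ K * ?x = 0" by (rule hom_zero[OF hom_det_pow[OF hx]])
  then have "?x = 0" by (rule det_power_regular[OF hx])
  then show ?thesis by simp
qed

lemma PP_qm:
  assumes t: "qm t" and L: "i \<in> LL n (m * n)" "j \<in> LL n (m * n)"
  shows "(\<Sum>p\<in>LL n (m * n). PP m p j *\<^sub>R Tw t i p) = PP m i j *\<^sub>R det t ^ m"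
    and "(\<Sum>p\<in>LL n (m * n). PP m i p *\<^sub>R Tw t p j) = PP m i j *\<^sub>R det t ^ m"
proof -
  let ?L = "LL n (m * n)"
  have "(\<Sum>p\<in>?L. PP m p j *\<^sub>R Tw t i p) = (\<Sum>p\<in>?L. (PP m i j * vm m p) *\<^sub>R Tw t (idm m) p)"
    using PP_H1[OF L(1), of j] L(1)
    by (intro transfer[OF RC_Tw[OF t], where d="m * n"])
      (simp_all add: idm_LL det_power_sum[OF qm_tA, of m] scaleR_sum_right)
  also have "\<dots> = PP m i j *\<^sub>R det t ^ m" by (simp add: det_power_sum[OF t, of m] scaleR_sum_right)
  finally show "(\<Sum>p\<in>?L. PP m p j *\<^sub>R Tw t i p) = PP m i j *\<^sub>R det t ^ m" .
  have "(\<Sum>p\<in>?L. PP m i p *\<^sub>R Tw t p j) = (\<Sum>p\<in>?L. (PP m i j * vm m p) *\<^sub>R Tw t (idm m) p)"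
    using PP_H2[OF L(2), of i] L(2)
    by (intro transfer[OF RC_Tw[OF t], where d="m * n"])
      (simp_all add: idm_LL det_power_sum[OF qm_tA, of m] scaleR_sum_right)
  also have "\<dots> = PP m i j *\<^sub>R det t ^ m" by (simp add: det_power_sum[OF t, of m] scaleR_sum_right)
  finally show "(\<Sum>p\<in>?L. PP m i p *\<^sub>R Tw t p j) = PP m i j *\<^sub>R det t ^ m" .
qed

section \<open>Invariance and uniqueness of the Haar functional\<close>

lemma cop_words:
  "(u, v) \<in> set (cop n w) \<Longrightarrow> set w \<subseteq> gl_alph n \<Longrightarrow>
    set u \<subseteq> gl_alph n \<and> set v \<subseteq> gl_alph n \<and> cntT u = cntT w \<and> cntT v = cntT w"
proof (induction w arbitrary: u v)
  case (Cons g w)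
  show ?case
  proof (cases g)
    case (Z a al)
    with Cons.prems obtain j u' v' where *: "j \<in> ix n" "u = Z a j # u'" "v = Z j al # v'" "(u', v') \<in> set (cop n w)"
      by (auto simp: ix_def less_Suc_eq_le simp del: upt_Suc)
    then show ?thesis using Cons.IH[of u' v'] Cons.prems Z by (auto simp: gl_alph_def)
  next
    case (Zb a al)
    then show ?thesis using Cons.prems by simp
  next
    case T
    with Cons.prems obtain u' v' where *: "u = T # u'" "v = T # v'" "(u', v') \<in> set (cop n w)" by auto
    then show ?thesis using Cons.IH[of u' v'] Cons.prems T by (auto simp: gl_alph_def)
  qed
qed simp

lemma sum_cop:
  fixes G :: "nat \<Rightarrow> gen list \<Rightarrow> gen list \<Rightarrow> 'a::comm_monoid_add"
  shows "set w \<subseteq> gl_alph n \<Longrightarrow>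
    sum_list (map (\<lambda>(u, v). G (cntT u) (zpart u) (zpart v)) (cop n w))
    = (\<Sum>p\<in>LL n (length (zpart w)). G (cntT w) (zw (map Zr (zpart w)) p) (zw p (map Zc (zpart w))))"
proof (induction w arbitrary: G)
  case (Cons g w)
  have w: "set w \<subseteq> gl_alph n" using Cons.prems by simp
  show ?case
  proof (cases g)
    case (Z a al)
    have ixs: "set [1..<n + 1] = ix n" by (auto simp: ix_def)
    have "sum_list (map (\<lambda>(u, v). G (cntT u) (zpart u) (zpart v)) (cop n (g # w)))
      = (\<Sum>j\<leftarrow>[1..<n + 1]. sum_list (map (\<lambda>(u, v). G (cntT u) (Z a j # zpart u) (Z j al # zpart v)) (cop n w)))"
      unfolding Z cop.simps map_concat sum_list_concat map_map
      by (intro arg_cong[where f=sum_list] map_cong refl) (simp add: o_def case_prod_unfold)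
    also have "\<dots> = (\<Sum>j\<in>ix n. \<Sum>p\<in>LL n (length (zpart w)). G (cntT w) (Z a j # zw (map Zr (zpart w)) p) (Z j al # zw p (map Zc (zpart w))))"
      unfolding sum_list_distinct_conv_sum_set[OF distinct_upt] ixs
      by (intro sum.cong refl Cons.IH[OF w, of "\<lambda>k u v. G k (Z a j # u) (Z j al # v)" for j])
    also have "\<dots> = (\<Sum>p\<in>LL n (Suc (length (zpart w))). G (cntT w) (zw (a # map Zr (zpart w)) p) (zw p (al # map Zc (zpart w))))"
      unfolding sum_LL_Suc by simp
    finally show ?thesis using Z by simp
  next
    case (Zb a al)
    then show ?thesis using Cons.prems by (auto simp: gl_alph_def mat_alph_def)
  next
    case T
    have "sum_list (map (\<lambda>(u, v). G (cntT u) (zpart u) (zpart v)) (cop n (g # w)))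
      = sum_list (map (\<lambda>(u, v). G (Suc (cntT u)) (zpart u) (zpart v)) (cop n w))"
      unfolding T cop.simps map_map by (intro arg_cong[where f=sum_list] map_cong refl) (simp add: o_def case_prod_unfold)
    then show ?thesis using Cons.IH[OF w, of "\<lambda>k. G (Suc k)"] T by simp
  qed
qed simp

lemma Ti_comm_Wd: "set w \<subseteq> mat_alph n \<Longrightarrow> WO w * Ti = Ti * WO w"
proof (induction w)
  case (Cons g w)
  then obtain a b where g: "g = Z a b" "a \<in> ix n" "b \<in> ix n" by (auto simp: mat_alph_def ix_def)
  have "WO [g] = tO a b" using g by (simp add: tm_def)
  then show ?case using Cons Ti_central[of a b] by (simp add: Wd_Cons[of _ g w] mult.assoc) (simp add: mult.assoc[symmetric])
qed simp

lemma Wd_gl: "set w \<subseteq> gl_alph n \<Longrightarrow> WO w = Ti ^ cntT w * WO (zpart w)"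
proof (induction w)
  case (Cons g w)
  have w: "set w \<subseteq> gl_alph n" using Cons.prems by simp
  have IH: "WO w = Ti ^ cntT w * WO (zpart w)" using Cons.IH[OF w] .
  show ?case
  proof (cases "g = T")
    case True
    have "WO (g # w) = WO [g] * WO w" by (rule Wd_Cons)
    then have "WO (g # w) = Ti * (Ti ^ cntT w * WO (zpart w))"
      unfolding IH using True by (simp add: Ti_def)
    then show ?thesis using True by (simp add: mult.assoc)
  next
    case False
    then have g: "set [g] \<subseteq> mat_alph n" using Cons.prems by (auto simp: gl_alph_def)
    then obtain a b where gZ: "g = Z a b" by (auto simp: mat_alph_def)
    have c: "WO [g] * Ti ^ k = Ti ^ k * WO [g]" for k
    proof (induction k)
      case (Suc k)
      have "WO [g] * Ti ^ Suc k = (WO [g] * Ti) * Ti ^ k" by (simp add: mult.assoc)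
      also have "\<dots> = Ti * (WO [g] * Ti ^ k)" unfolding Ti_comm_Wd[OF g] by (rule mult.assoc)
      finally show ?case unfolding Suc.IH by (simp add: mult.assoc)
    qed simp
    have "WO (g # w) = WO [g] * WO w" by (rule Wd_Cons)
    also have "\<dots> = (WO [g] * Ti ^ cntT w) * WO (zpart w)"
      unfolding IH by (simp only: mult.assoc)
    also have "\<dots> = Ti ^ cntT w * (WO [g] * WO (zpart w))"
      unfolding c by (rule mult.assoc)
    also have "WO [g] * WO (zpart w) = WO (zpart (g # w))"
      unfolding gZ zpart_append by (rule Wd_Cons[symmetric])
    finally show ?thesis unfolding gZ cntT_append .
  qed
qed simp

text \<open>For \<open>K\<close> at least the number of letters \<open>T\<close> in every word of
  \<open>p\<close>, the functional is \<open>pf K\<close> composed with \<open>Xi K\<close>, to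
  which \<open>Xi_ideal\<close> applies.\<close>

lemma kills_hr: "kills (rel_gl n q) hr"
  unfolding kills_def
proof
  fix p assume p: "p \<in> ideal (rel_gl n q)"
  from Xi_ideal[OF p] obtain K0 where fin: "pfin p"
    and K0: "K0 \<le> K \<Longrightarrow> RC \<phi> \<Longrightarrow> lin (\<lambda>x. of_real (fn \<phi> (Xi K x))) p = 0" for K \<phi> by blast
  define K where "K = max K0 (\<Sum>w | p w \<noteq> 0. cntT w)"
  have "lin (\<lambda>w. of_real (hr w)) p = lin (\<lambda>w. of_real (pf K (Xi K w))) p"
  proof (rule lin_cong)
    fix w assume "p w \<noteq> 0"
    then have "cntT w \<le> (\<Sum>w | p w \<noteq> 0. cntT w)" using fin by (intro member_le_sum) (auto simp: pfin_def)
    then show "complex_of_real (hr w) = of_real (pf K (Xi K w))" using pf_Xi[of w K] by (simp add: K_def)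
  qed
  also have "\<dots> = 0" by (rule K0) (simp_all add: K_def RC_PP)
  finally show "lin (\<lambda>w. of_real (hr w)) p = 0" .
qed

lemma hr_Nil: "hr [] = 1"
proof -
  have "pf 0 (Tw tA [] []) = PP 0 [] []" by (rule fn_Tw[OF RC_PP, of _ 0]) simp_all
  then show ?thesis using pf_det[of 0] by (simp add: hr_def)
qed

lemma Tiz_det: "Ti ^ m * det tO ^ m = 1"
proof (induction m)
  case (Suc m)
  have "Ti ^ Suc m * det tO ^ Suc m = Ti ^ m * (Ti * det tO) * det tO ^ m"
    by (simp only: power_Suc2[of Ti] power_Suc[of "det tO"] mult.assoc)
  then show ?case using Suc by (simp add: Ti_det)
qed simp

text \<open>The coproduct of a word inserts an intermediate index word \<open>p\<close>. The sum
  over \<open>p\<close> is the invariance \<open>PP_qm\<close> of \<open>PP\<close>, and the power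
  of \<open>Ti\<close> cancels \<open>det ^ m\<close>.\<close>

lemma hr_invariant:
  assumes w: "set w \<subseteq> gl_alph n"
  shows "sum_list (map (\<lambda>(u, v). hr v *\<^sub>R WO u) (cop n w)) = hr w *\<^sub>R 1"
    and "sum_list (map (\<lambda>(u, v). hr u *\<^sub>R WO v) (cop n w)) = hr w *\<^sub>R 1"
proof -
  let ?m = "cntT w" and ?z = "zpart w"
  let ?i = "map Zr ?z" and ?j = "map Zc ?z" and ?d = "length ?z"
  let ?P = "\<lambda>z. if length z = ?m * n then PP ?m (map Zr z) (map Zc z) else 0"
  have z: "set ?z \<subseteq> mat_alph n" by (rule zpart_alph[OF w])
  have L: "?i \<in> LL n ?d" "?j \<in> LL n ?d" using rows_cols_LL[OF z] by blast+
  have zz: "length (zw ?i p) = ?d" "map Zr (zw ?i p) = ?i" "map Zc (zw ?i p) = p" "length (zw p ?j) = ?d"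
     "map Zr (zw p ?j) = p" "map Zc (zw p ?j) = ?j" if "p \<in> LL n ?d" for p
    using zw_inv[of ?i p] zw_inv[of p ?j] LL_length[OF that] by (simp_all add: zw_def)
  have rw: "hr u = ?P (zpart u) \<and> WO u = Ti ^ cntT u * WO (zpart u)
      \<and> hr v = ?P (zpart v) \<and> WO v = Ti ^ cntT u * WO (zpart v)"
    if "(u, v) \<in> set (cop n w)" for u v
    using cop_words[OF that w] Wd_gl[of u] Wd_gl[of v] by (simp add: hr_def)
  have hw: "hr w = (if ?d = ?m * n then PP ?m ?i ?j else 0)" using w by (simp add: hr_def)
  have "sum_list (map (\<lambda>(u, v). hr v *\<^sub>R WO u) (cop n w))
     = sum_list (map (\<lambda>(u, v). ?P (zpart v) *\<^sub>R (Ti ^ cntT u * WO (zpart u))) (cop n w))"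
    using rw by (intro arg_cong[where f=sum_list] map_cong refl) (auto simp del: Wd_append)
  also have "\<dots> = (\<Sum>p\<in>LL n ?d. ?P (zw p ?j) *\<^sub>R (Ti ^ ?m * WO (zw ?i p)))"
    by (rule sum_cop[OF w, of "\<lambda>k u v. ?P v *\<^sub>R (Ti ^ k * WO u)"])
  also have "\<dots> = Ti ^ ?m * (\<Sum>p\<in>LL n ?d. (if ?d = ?m * n then PP ?m p ?j else 0) *\<^sub>R Tw tO ?i p)"
    unfolding sum_distrib_left
  proof (rule sum.cong[OF refl])
    fix p assume p: "p \<in> LL n ?d"
    show "?P (zw p ?j) *\<^sub>R (Ti ^ ?m * WO (zw ?i p)) = Ti ^ ?m * ((if ?d = ?m * n then PP ?m p ?j else 0) *\<^sub>R Tw tO ?i p)"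
      unfolding zz[OF p] Tw_tm_LL[OF L(1) p] by simp
  qed
  also have "\<dots> = hr w *\<^sub>R 1"
  proof (cases "?d = ?m * n")
    case True
    from PP_qm(1)[OF qm_tO, of ?i ?m ?j] L True
    have "(\<Sum>p\<in>LL n ?d. PP ?m p ?j *\<^sub>R Tw tO ?i p) = PP ?m ?i ?j *\<^sub>R det tO ^ ?m" by simp
    with True show ?thesis by (simp add: hw Tiz_det)
  qed (simp add: hw)
  finally show "sum_list (map (\<lambda>(u, v). hr v *\<^sub>R WO u) (cop n w)) = hr w *\<^sub>R 1" .
  have "sum_list (map (\<lambda>(u, v). hr u *\<^sub>R WO v) (cop n w))
     = sum_list (map (\<lambda>(u, v). ?P (zpart u) *\<^sub>R (Ti ^ cntT u * WO (zpart v))) (cop n w))"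
    using rw by (intro arg_cong[where f=sum_list] map_cong refl) (auto simp del: Wd_append)
  also have "\<dots> = (\<Sum>p\<in>LL n ?d. ?P (zw ?i p) *\<^sub>R (Ti ^ ?m * WO (zw p ?j)))"
    by (rule sum_cop[OF w, of "\<lambda>k u v. ?P u *\<^sub>R (Ti ^ k * WO v)"])
  also have "\<dots> = Ti ^ ?m * (\<Sum>p\<in>LL n ?d. (if ?d = ?m * n then PP ?m ?i p else 0) *\<^sub>R Tw tO p ?j)"
    unfolding sum_distrib_left
  proof (rule sum.cong[OF refl])
    fix p assume p: "p \<in> LL n ?d"
    show "?P (zw ?i p) *\<^sub>R (Ti ^ ?m * WO (zw p ?j)) = Ti ^ ?m * ((if ?d = ?m * n then PP ?m ?i p else 0) *\<^sub>R Tw tO p ?j)"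
      unfolding zz[OF p] Tw_tm_LL[OF p L(2)] by simp
  qed
  also have "\<dots> = hr w *\<^sub>R 1"
  proof (cases "?d = ?m * n")
    case True
    from PP_qm(2)[OF qm_tO, of ?i ?m ?j] L True
    have "(\<Sum>p\<in>LL n ?d. PP ?m ?i p *\<^sub>R Tw tO p ?j) = PP ?m ?i ?j *\<^sub>R det tO ^ ?m" by simp
    with True show ?thesis by (simp add: hw Tiz_det)
  qed (simp add: hw)
  finally show "sum_list (map (\<lambda>(u, v). hr u *\<^sub>R WO v) (cop n w)) = hr w *\<^sub>R 1" .
qed

lemma haar_cond_hr: "haar_cond n q (\<lambda>w. of_real (hr w))"
  unfolding haar_cond_def
proof (intro conjI allI impI ballI)
  show "complex_of_real (hr []) = 1" by (simp add: hr_Nil)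
  show "complex_of_real (hr w) = 0" if "\<not> set w \<subseteq> gl_alph n" for w using that by (simp add: hr_def)
  show "lin (\<lambda>w. complex_of_real (hr w)) p = 0" if "p \<in> ideal (rel_gl n q)" for p
    using kills_hr that by (simp add: kills_def)
  fix w assume w: "set w \<subseteq> gl_alph n"
  have *: "congr (rel_gl n q) (psum_list (map (\<lambda>(u, v). psc (of_real (f u v)) (pword (g u v))) xs)) (psc (of_real c) pone)"
    if "sum_list (map (\<lambda>(u, v). f u v *\<^sub>R WO (g u v)) xs) = c *\<^sub>R 1" for f g c and xs :: "(gen list \<times> gen list) list"
  proof -
    have pf: "pfin (psum_list (map (\<lambda>(u, v). psc (of_real (f u v)) (pword (g u v))) xs))"
      by (rule pfin_psum_list) auto
    have "cls (rel_gl n q) (psum_list (map (\<lambda>(u, v). psc (of_real (f u v)) (pword (g u v))) xs)) = c *\<^sub>R 1"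
      unfolding that[symmetric]
      by (subst cls_psum_list) (auto simp: o_def case_prod_unfold cls_psc Wd_def)
    then show ?thesis using pf by (intro cls_eqD) (simp_all add: cls_psc)
  qed
  show "congr (rel_gl n q) (psum_list (map (\<lambda>(u, v). psc (complex_of_real (hr v)) (pword u)) (cop n w))) (psc (complex_of_real (hr w)) pone)"
    by (rule *[OF hr_invariant(1)[OF w]])
  show "congr (rel_gl n q) (psum_list (map (\<lambda>(u, v). psc (complex_of_real (hr u)) (pword v)) (cop n w))) (psc (complex_of_real (hr w)) pone)"
    by (rule *[OF hr_invariant(2)[OF w]])
qed

text \<open>The sum of \<open>h v * h' u\<close> over the coproduct of \<open>w\<close> equals
  \<open>h w\<close> by one invariance and \<open>h' w\<close> by the other.\<close>

lemma haar_cond_unique: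
  assumes h: "haar_cond n q h" and h': "haar_cond n q h'" shows "h = h'"
proof
  fix w
  show "h w = h' w"
  proof (cases "set w \<subseteq> gl_alph n")
    case True
    let ?P = "psum_list (map (\<lambda>(u, v). psc (h v) (pword u)) (cop n w))"
      and ?R = "psum_list (map (\<lambda>(u, v). psc (h' u) (pword v)) (cop n w))"
    have pf: "pfin ?P" "pfin ?R" by (rule pfin_psum_list, auto)+
    have "psub ?P (psc (h w) pone) \<in> ideal (rel_gl n q)" "psub ?R (psc (h' w) pone) \<in> ideal (rel_gl n q)"
      using h h' True by (simp_all add: haar_cond_def congr_def)
    then have "lin h' (psub ?P (psc (h w) pone)) = 0" "lin h (psub ?R (psc (h' w) pone)) = 0"
      using h h' pf by (simp_all add: haar_cond_def)
    then have "lin h' ?P = h w" "lin h ?R = h' w"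
      using h h' pf by (simp_all add: lin_psub lin_psc pone_pword haar_cond_def)
    moreover have "lin h' ?P = sum_list (map (\<lambda>(u, v). h v * h' u) (cop n w))"
      by (subst lin_psum_list) (auto simp: o_def case_prod_unfold lin_psc)
    moreover have "lin h ?R = sum_list (map (\<lambda>(u, v). h v * h' u) (cop n w))"
      by (subst lin_psum_list) (auto simp: o_def case_prod_unfold lin_psc mult.commute)
    ultimately show ?thesis by simp
  next
    case False
    then show ?thesis using h h' by (simp add: haar_cond_def)
  qed
qed

lemma haar_eq: "haar n q = (\<lambda>w. of_real (hr w))"
  unfolding haar_def by (rule the_equality) (auto intro: haar_cond_hr haar_cond_unique)

end

section \<open>The antipode and strong invariance\<close>

text \<open>Words in the antipode. The letters are multiplied in reverse order because the antipode
  reverses products.\<close>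

fun Sw :: "(nat \<Rightarrow> nat \<Rightarrow> 'a::real_algebra_1) \<Rightarrow> nat list \<Rightarrow> nat list \<Rightarrow> 'a" where
  "Sw s (a # i) (b # j) = Sw s i j * s a b"
| "Sw s i j = 1"

type_synonym 'a bimod = "(unit, (unit, 'a) op) op"

text \<open>On a linear endomorphism \<open>g\<close> these act by \<open>(Lm u g) x = u g(x)\<close>, \<open>(Rm v g) x = g(x v)\<close> and \<open>(Rl v g) x = g(v x)\<close>.\<close>
definition Lm :: "'a::real_algebra_1 \<Rightarrow> 'a bimod" where "Lm u = lml (lml u)"
definition Rm :: "'a::real_algebra_1 \<Rightarrow> 'a bimod" where "Rm v = rml (rml v)"
definition Rl :: "'a::real_algebra_1 \<Rightarrow> 'a bimod" where "Rl v = rml (lml v)"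

lemma Lm_hom: "Lm (u * v) = Lm u * Lm v" "Lm (u + v) = Lm u + Lm v" "Lm (c *\<^sub>R u) = c *\<^sub>R Lm u" "Lm 1 = 1"
  and Rm_hom: "Rm (u * v) = Rm u * Rm v" "Rm (u + v) = Rm u + Rm v" "Rm (c *\<^sub>R u) = c *\<^sub>R Rm u" "Rm 1 = 1"
  and Rl_hom: "Rl (u * v) = Rl v * Rl u" "Rl (u + v) = Rl u + Rl v" "Rl (c *\<^sub>R u) = c *\<^sub>R Rl u" "Rl 1 = 1"
  and Rm_Lm: "Rm v * Lm u = Lm u * Rm v" and Rl_Lm: "Rl v * Lm u = Lm u * Rl v"
  by (simp_all add: Lm_def Rm_def Rl_def lml_hom rml_hom rml_lml)

lemma scaleR_hom_zero: "(\<And>c u. F (c *\<^sub>R u) = c *\<^sub>R F u) \<Longrightarrow> F 0 = 0"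
  for F :: "'a::real_vector \<Rightarrow> 'b::real_vector"
  using scaleR_zero_left by metis

lemma Lm_0 [simp]: "Lm 0 = 0" and Rm_0 [simp]: "Rm 0 = 0" and Rl_0 [simp]: "Rl 0 = 0"
  by (rule scaleR_hom_zero, rule Lm_hom Rm_hom Rl_hom)+

lemma Lm_sum: "Lm (\<Sum>x\<in>A. F x) = (\<Sum>x\<in>A. Lm (F x))"
  and Rm_sum: "Rm (\<Sum>x\<in>A. F x) = (\<Sum>x\<in>A. Rm (F x))"
  by (induction A rule: infinite_finite_induct) (auto simp: Lm_hom Rm_hom Rl_hom)

lemma Tw_Lm: "length i = length j \<Longrightarrow> Tw (\<lambda>a b. Lm (t a b)) i j = Lm (Tw t i j)"
  and Tw_Rm: "length i = length j \<Longrightarrow> Tw (\<lambda>a b. Rm (t a b)) i j = Rm (Tw t i j)"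
  and Tw_Rl: "length i = length j \<Longrightarrow> Tw (\<lambda>a b. Rl (t a b)) i j = Rl (Sw t i j)"
  by (induction i j rule: list_induct2) (auto simp: Lm_hom Rm_hom Rl_hom)

context qp
begin

lemma qm_hom:
  assumes "qm t" "\<And>u v. F (u * v) = F u * F v" "\<And>u v. F (u + v) = F u + F v" "\<And>c u. F (c *\<^sub>R u) = c *\<^sub>R F u"
  shows "qm (\<lambda>a b. F (t a b))"
proof -
  have F0: "F 0 = 0" by (rule scaleR_hom_zero[OF assms(4)])
  have Fif: "F (if P then x else y) = (if P then F x else F y)" for P x y by simp
  from assms(1) have rel: "cc a b *\<^sub>R (t a c * t b d) + (if a = b then 0 else t b c * t a d)
              = cc c d *\<^sub>R (t a c * t b d) + (if c = d then 0 else t a d * t b c)" for a b c d unfolding qm_def by blast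
  show ?thesis
    unfolding qm_def
  proof (intro conjI allI impI)
    fix a b c d
    show "cc a b *\<^sub>R (F (t a c) * F (t b d)) + (if a = b then 0 else F (t b c) * F (t a d))
        = cc c d *\<^sub>R (F (t a c) * F (t b d)) + (if c = d then 0 else F (t a d) * F (t b c))"
      using arg_cong[OF rel[of a b c d], of F] unfolding assms(2-4) Fif F0 .
  qed (use qm_zero[OF assms(1)] F0 in auto)
qed

lemma minor_hom:
  assumes "\<And>u v. F (u * v) = F u * F v" "\<And>u v. F (u + v) = F u + F v" "\<And>c u. F (c *\<^sub>R u) = c *\<^sub>R F u" "F 1 = 1"
    and "finite J" "length i = card J"
  shows "minor (\<lambda>a b. F (t a b)) i J = F (minor t i J)"
proof -
  have F0: "F 0 = 0" by (rule scaleR_hom_zero[OF assms(3)])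
  have Fs: "F (\<Sum>x\<in>A. f x) = (\<Sum>x\<in>A. F (f x))" for f and A :: "nat list set"
    by (induction A rule: infinite_finite_induct) (auto simp: F0 assms(2))
  have "Tw (\<lambda>a b. F (t a b)) i j = F (Tw t i j)" if "length i = length j" for i j
    using that by (induction i j rule: list_induct2) (auto simp: assms)
  moreover have "length i = length j" if "j \<in> permutations_of_set J" for j
    using that assms(6) by (auto simp: permutations_of_set_def distinct_card)
  ultimately show ?thesis unfolding minor_def Fs assms(3) by (intro sum.cong refl) simp
qed

text \<open>Cramer's rule, with \<open>D\<close> for the inverse determinant. In
  \<open>sm_left\<close> and \<open>sm_right\<close> the factors stand in the order opposite to a
  matrix product; \<open>sm_left'\<close> restores the matrix order at the price of
  \<open>q^(2 (i - j))\<close>, the square of the antipode.\<close>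

definition sm :: "'a::real_algebra_1 \<Rightarrow> (nat \<Rightarrow> nat \<Rightarrow> 'a) \<Rightarrow> nat \<Rightarrow> nat \<Rightarrow> 'a" where
  "sm D t i j = (if i \<in> ix n \<and> j \<in> ix n then (- q) powi (int j - int i) *\<^sub>R (D * cof t j i) else 0)"

context
  fixes t :: "nat \<Rightarrow> nat \<Rightarrow> 'a::real_algebra_1" and D :: 'a
  assumes t: "qm t" and D: "D * det t = 1" "det t * D = 1"
begin

lemma D_central: "D * t a b = t a b * D"
proof -
  have "D * t a b = D * (t a b * det t) * D" by (simp add: mult.assoc D)
  also have "\<dots> = (D * det t) * t a b * D" by (simp only: det_central[OF t] mult.assoc)
  finally show ?thesis by (simp add: D)
qed

lemma sm_left: "i \<in> ix n \<Longrightarrow> l \<in> ix n \<Longrightarrow> (\<Sum>j\<in>ix n. sm D t j l * t i j) = (if i = l then 1 else 0)"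
proof -
  assume il: "i \<in> ix n" "l \<in> ix n"
  have "(\<Sum>j\<in>ix n. sm D t j l * t i j) = D * (\<Sum>j\<in>ix n. (- q) powi (int l - int j) *\<^sub>R (cof t l j * t i j))"
    unfolding sum_distrib_left using il by (intro sum.cong refl) (simp add: sm_def mult.assoc)
  then show ?thesis using lapB[OF t il] D by simp
qed

lemma sm_right: "i \<in> ix n \<Longrightarrow> l \<in> ix n \<Longrightarrow> (\<Sum>j\<in>ix n. t j l * sm D t i j) = (if i = l then 1 else 0)"
proof -
  assume il: "i \<in> ix n" "l \<in> ix n"
  have "t j l * (D * x) = D * (t j l * x)" for j x by (simp only: mult.assoc[symmetric] D_central)
  then have "(\<Sum>j\<in>ix n. t j l * sm D t i j) = D * (\<Sum>j\<in>ix n. (- q) powi (int j - int i) *\<^sub>R (t j l * cof t j i))"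
    unfolding sum_distrib_left using il by (intro sum.cong refl) (simp add: sm_def)
  then show ?thesis using lapC[OF t il(2,1)] D by auto
qed

lemma sm_left': "i \<in> ix n \<Longrightarrow> l \<in> ix n \<Longrightarrow> (\<Sum>j\<in>ix n. q powi (2 * (int i - int j)) *\<^sub>R (sm D t i j * t j l)) = (if i = l then 1 else 0)"
proof -
  assume il: "i \<in> ix n" "l \<in> ix n"
  have e: "q powi (2 * (int i - int j)) * (- q) powi (int j - int i) = (- q) powi (int i - int j)" for j
  proof -
    have "q powi (2 * (int i - int j)) = (- q) powi (2 * (int i - int j))"
      by (simp only: power_int_mult) simp
    moreover have "(- q) powi (2 * (int i - int j)) * (- q) powi (int j - int i) = (- q) powi (2 * (int i - int j) + (int j - int i))"
      using q0 by (intro power_int_add[symmetric]) simp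
    ultimately show ?thesis by simp
  qed
  have "(\<Sum>j\<in>ix n. q powi (2 * (int i - int j)) *\<^sub>R (sm D t i j * t j l)) = D * (\<Sum>j\<in>ix n. (- q) powi (int i - int j) *\<^sub>R (cof t j i * t j l))"
    unfolding sum_distrib_left using il by (intro sum.cong refl) (simp add: sm_def mult.assoc e[unfolded right_diff_distrib])
  then show ?thesis using lapD[OF t il(2,1)] D by auto
qed

lemma sm_unique:
  assumes "\<And>i l. i \<in> ix n \<Longrightarrow> l \<in> ix n \<Longrightarrow> (\<Sum>j\<in>ix n. t j l * X i j) = (if i = l then 1 else 0)"
    and "i \<in> ix n" "l \<in> ix n"
  shows "X i l = sm D t i l"
proof -
  have "sm D t i l = (\<Sum>j\<in>ix n. sm D t j l * (\<Sum>p\<in>ix n. t p j * X i p))"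
    using assms by (simp add: if_distrib[where f="\<lambda>c. _ * c"] sum.delta cong: if_cong sum.cong)
  also have "\<dots> = (\<Sum>p\<in>ix n. (\<Sum>j\<in>ix n. sm D t j l * t p j) * X i p)"
    unfolding sum_distrib_left sum_distrib_right by (subst sum.swap) (simp add: mult.assoc)
  also have "\<dots> = X i l"
    using assms(2,3) by (simp add: sm_left if_distrib[where f="\<lambda>c. c * _"] sum.delta cong: if_cong sum.cong)
  finally show ?thesis ..
qed

lemma Sw_left: "i \<in> LL n d \<Longrightarrow> l \<in> LL n d \<Longrightarrow> (\<Sum>j\<in>LL n d. Sw (sm D t) j l * Tw t i j) = (if i = l then 1 else 0)"
proof (induction d arbitrary: i l)
  case (Suc d)
  then obtain a i' b l' where il: "i = a # i'" "l = b # l'" "a \<in> ix n" "b \<in> ix n" "i' \<in> LL n d" "l' \<in> LL n d"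
    unfolding LL_Suc by auto
  have "(\<Sum>j\<in>LL n (Suc d). Sw (sm D t) j l * Tw t i j)
     = (\<Sum>x\<in>ix n. \<Sum>j\<in>LL n d. Sw (sm D t) j l' * (sm D t x b * t a x) * Tw t i' j)"
    unfolding sum_LL_Suc il by (simp add: mult.assoc)
  also have "\<dots> = (\<Sum>j\<in>LL n d. Sw (sm D t) j l' * (\<Sum>x\<in>ix n. sm D t x b * t a x) * Tw t i' j)"
    unfolding sum_distrib_left sum_distrib_right by (rule sum.swap)
  also have "\<dots> = (if a = b then \<Sum>j\<in>LL n d. Sw (sm D t) j l' * Tw t i' j else 0)"
    unfolding sm_left[OF il(3,4)] by simp
  also have "\<dots> = (if i = l then 1 else 0)" unfolding Suc.IH[OF il(5,6)] using il by simp
  finally show ?case .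
qed simp

lemma Sw_right: "i \<in> LL n d \<Longrightarrow> l \<in> LL n d \<Longrightarrow> (\<Sum>j\<in>LL n d. Tw t j l * Sw (sm D t) i j) = (if i = l then 1 else 0)"
proof (induction d arbitrary: i l)
  case (Suc d)
  then obtain a i' b l' where il: "i = a # i'" "l = b # l'" "a \<in> ix n" "b \<in> ix n" "i' \<in> LL n d" "l' \<in> LL n d"
    unfolding LL_Suc by auto
  have "(\<Sum>j\<in>LL n (Suc d). Tw t j l * Sw (sm D t) i j)
     = (\<Sum>x\<in>ix n. \<Sum>j\<in>LL n d. t x b * (Tw t j l' * Sw (sm D t) i' j) * sm D t a x)"
    unfolding sum_LL_Suc il by (simp add: mult.assoc)
  also have "\<dots> = (\<Sum>x\<in>ix n. t x b * (\<Sum>j\<in>LL n d. Tw t j l' * Sw (sm D t) i' j) * sm D t a x)"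
    unfolding sum_distrib_left sum_distrib_right ..
  also have "\<dots> = (if i' = l' then \<Sum>x\<in>ix n. t x b * sm D t a x else 0)"
    unfolding Suc.IH[OF il(5,6)] by simp
  also have "\<dots> = (if i = l then 1 else 0)" unfolding sm_right[OF il(3,4)] using il by simp
  finally show ?case .
qed simp

lemma Sw_left': "i \<in> LL n d \<Longrightarrow> l \<in> LL n d \<Longrightarrow>
  (\<Sum>j\<in>LL n d. prod_list (map2 (\<lambda>a b. q powi (2 * (int a - int b))) i j) *\<^sub>R (Sw (sm D t) i j * Tw t j l)) = (if i = l then 1 else 0)"
proof (induction d arbitrary: i l)
  case (Suc d)
  let ?w = "\<lambda>a b. q powi (2 * (int a - int b))"
  from Suc obtain a i' b l' where il: "i = a # i'" "l = b # l'" "a \<in> ix n" "b \<in> ix n" "i' \<in> LL n d" "l' \<in> LL n d"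
    unfolding LL_Suc by auto
  have "(\<Sum>j\<in>LL n (Suc d). prod_list (map2 ?w i j) *\<^sub>R (Sw (sm D t) i j * Tw t j l))
     = (\<Sum>x\<in>ix n. \<Sum>j\<in>LL n d. prod_list (map2 ?w i' j) *\<^sub>R (Sw (sm D t) i' j * (?w a x *\<^sub>R (sm D t a x * t x b)) * Tw t j l'))"
    unfolding sum_LL_Suc il by (simp add: mult.assoc mult.commute)
  also have "\<dots> = (\<Sum>j\<in>LL n d. prod_list (map2 ?w i' j) *\<^sub>R (Sw (sm D t) i' j * (\<Sum>x\<in>ix n. ?w a x *\<^sub>R (sm D t a x * t x b)) * Tw t j l'))"
    unfolding sum_distrib_left sum_distrib_right scaleR_sum_right by (rule sum.swap)
  also have "\<dots> = (if a = b then \<Sum>j\<in>LL n d. prod_list (map2 ?w i' j) *\<^sub>R (Sw (sm D t) i' j * Tw t j l') else 0)"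
    unfolding sm_left'[OF il(3,4)] by simp
  also have "\<dots> = (if i = l then 1 else 0)" unfolding Suc.IH[OF il(5,6)] using il by simp
  finally show ?case .
qed simp

lemma RR_mult_LL:
  fixes f g :: "nat list \<Rightarrow> 'a"
  assumes "Suc k < d"
  shows "(\<Sum>j\<in>LL n d. f j * RR k g j) = (\<Sum>j\<in>LL n d. RR k f j * g j)"
proof -
  have "(\<Sum>j\<in>LL n d. if j ! k = j ! Suc k then 0 else f j * g (swp k j))
      = (\<Sum>j\<in>LL n d. if j ! k = j ! Suc k then 0 else f (swp k j) * g j)"
    by (subst sum_LL_swp[OF assms, symmetric]) (use assms in \<open>auto simp: LL_length intro!: sum.cong\<close>)
  moreover have "f j * RR k g j = cc (j ! k) (j ! Suc k) *\<^sub>R (f j * g j)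
      + (if j ! k = j ! Suc k then 0 else f j * g (swp k j))" for j
    by (simp add: RR_def algebra_simps)
  moreover have "RR k f j * g j = cc (j ! k) (j ! Suc k) *\<^sub>R (f j * g j)
      + (if j ! k = j ! Suc k then 0 else f (swp k j) * g j)" for j
    by (simp add: RR_def algebra_simps)
  ultimately show ?thesis by (simp add: sum.distrib)
qed

text \<open>The matrix \<open>Sw\<close> is inverse to \<open>Tw\<close>, which commutes with the symmetric matrix of \<open>RR k\<close>.\<close>
lemma RR_Sw:
  assumes k: "Suc k < d" and L: "i \<in> LL n d" "j \<in> LL n d"
  shows "RR k (\<lambda>i. Sw (sm D t) i j) i = RR k (\<lambda>j. Sw (sm D t) i j) j"
proof -
  let ?S = "Sw (sm D t)" and ?L = "LL n d"
  let ?Z = "\<Sum>p\<in>?L. \<Sum>m\<in>?L. ?S p j * RR k (\<lambda>m. Tw t m p) m * ?S i m"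
  have "?Z = (\<Sum>p\<in>?L. \<Sum>m\<in>?L. ?S p j * Tw t m p * RR k (\<lambda>m. ?S i m) m)"
  proof (rule sum.cong[OF refl])
    fix p
    have "(\<Sum>m\<in>?L. ?S p j * RR k (\<lambda>m. Tw t m p) m * ?S i m) = ?S p j * (\<Sum>m\<in>?L. RR k (\<lambda>m. Tw t m p) m * ?S i m)"
      by (simp add: sum_distrib_left mult.assoc)
    also have "\<dots> = ?S p j * (\<Sum>m\<in>?L. Tw t m p * RR k (?S i) m)" by (simp only: RR_mult_LL[OF k])
    finally show "(\<Sum>m\<in>?L. ?S p j * RR k (\<lambda>m. Tw t m p) m * ?S i m) = (\<Sum>m\<in>?L. ?S p j * Tw t m p * RR k (\<lambda>m. ?S i m) m)"
      by (simp add: sum_distrib_left mult.assoc)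
  qed
  also have "\<dots> = (\<Sum>m\<in>?L. (\<Sum>p\<in>?L. ?S p j * Tw t m p) * RR k (\<lambda>m. ?S i m) m)"
    unfolding sum_distrib_right by (rule sum.swap)
  also have "\<dots> = RR k (?S i) j"
    using L by (simp add: Sw_left if_distrib[where f="\<lambda>c. c * _"] sum.delta cong: if_cong sum.cong)
  finally have 1: "?Z = RR k (?S i) j" .
  have "?Z = (\<Sum>m\<in>?L. (\<Sum>p\<in>?L. ?S p j * RR k (Tw t m) p) * ?S i m)"
    unfolding sum_distrib_right
  proof (subst sum.swap, intro sum.cong refl)
    fix m p assume "m \<in> ?L" "p \<in> ?L"
    then have "RR k (\<lambda>m. Tw t m p) m = RR k (Tw t m) p"
      using k by (intro RCD[OF RC_Tw[OF t]]) (simp_all add: LL_length)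
    then show "?S p j * RR k (\<lambda>m. Tw t m p) m * ?S i m = ?S p j * RR k (Tw t m) p * ?S i m" by simp
  qed
  also have "\<dots> = (\<Sum>m\<in>?L. (\<Sum>p\<in>?L. RR k (\<lambda>p. ?S p j) p * Tw t m p) * ?S i m)"
    by (simp only: RR_mult_LL[OF k])
  also have "\<dots> = (\<Sum>p\<in>?L. RR k (\<lambda>p. ?S p j) p * (\<Sum>m\<in>?L. Tw t m p * ?S i m))"
    unfolding sum_distrib_right sum_distrib_left by (subst sum.swap) (simp add: mult.assoc)
  also have "\<dots> = RR k (\<lambda>p. ?S p j) i"
    using L by (simp add: Sw_right if_distrib[where f="\<lambda>c. _ * c"] sum.delta cong: if_cong sum.cong)
  finally show ?thesis using 1 by simp
qed

lemma Sw_zero: "length i = length j \<Longrightarrow> i \<notin> LL n (length i) \<or> j \<notin> LL n (length i) \<Longrightarrow> Sw (sm D t) i j = 0"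
proof (induction i j rule: list_induct2)
  case (Cons a i b j)
  then show ?case by (auto simp: LL_def sm_def)
qed simp

lemma RC_Sw: "RC (Sw (sm D t))"
  unfolding RC_def
proof (intro allI impI)
  fix i j :: "nat list" and k assume ij: "length i = length j" "Suc k < length i"
  show "RR k (\<lambda>i. Sw (sm D t) i j) i = RR k (Sw (sm D t) i) j"
  proof (cases "i \<in> LL n (length i) \<and> j \<in> LL n (length i)")
    case True
    then show ?thesis using ij by (intro RR_Sw) auto
  next
    case False
    moreover have "swp k i \<in> LL n (length i) \<longleftrightarrow> i \<in> LL n (length i)" "swp k j \<in> LL n (length i) \<longleftrightarrow> j \<in> LL n (length i)"
      using ij by simp_all
    ultimately have "Sw (sm D t) i j = 0" "Sw (sm D t) (swp k i) j = 0" "Sw (sm D t) i (swp k j) = 0"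
      using ij by (intro Sw_zero; auto)+
    then show ?thesis by (simp add: RR_def)
  qed
qed

text \<open>\<open>Rl\<close> reverses products, so the reversed words \<open>Sw\<close> become
  ordinary words in the operators, and \<open>RC_Sw\<close> is their exchange relation.\<close>

lemma qm_Rl_sm: "qm (\<lambda>a b. Rl (sm D t a b))"
proof (rule qmI_RC, goal_cases)
  case (1 a b)
  then show ?case by (auto simp: sm_def)
next
  case (2 a b c d)
  have "RR 0 (\<lambda>i. Sw (sm D t) i [c, d]) [a, b] = RR 0 (\<lambda>j. Sw (sm D t) [a, b] j) [c, d]"
    by (rule RCD[OF RC_Sw]) auto
  from arg_cong[OF this, of Rl] show ?case
    by (simp add: RR_def swp_def Rl_hom if_distrib[where f=Rl] cong: if_cong)
qed

end

section \<open>The coproduct as an operator, and strong invariance\<close>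

definition H :: "alg \<Rightarrow> real" where "H = fnl (rel_gl n q) hr"

lemma H_linear: "H (x + y) = H x + H y" "H (c *\<^sub>R x) = c * H x" "H (\<Sum>x\<in>A. F x) = (\<Sum>x\<in>A. H (F x))"
  and H_Wd: "H (WO w) = hr w"
  by (simp_all add: H_def fnl_add[OF kills_hr] fnl_scaleR[OF kills_hr] fnl_sum[OF kills_hr] fnl_Wd[OF kills_hr])

definition gH :: "(unit, alg) op" where "gH = Op (\<lambda>f x. H (f x) *\<^sub>R 1)"

lemma app_gH: "app gH f x = H (f x) *\<^sub>R 1"
  unfolding gH_def by (subst Op_inverse) (auto simp: fun_eq_iff H_linear scaleR_add_left)

text \<open>With \<open>Lm u * Rm v\<close> in the role of \<open>u \<otimes> v\<close> this is
  \<open>id \<otimes> H\<close>: the operator acts on the map sending \<open>x\<close> to the scalar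
  \<open>H x\<close>, and the resulting map is evaluated at 1.\<close>

definition ev :: "alg bimod \<Rightarrow> alg" where
  "ev E = app (app E (\<lambda>_. gH) ()) (\<lambda>_. 1) ()"

lemma ev_linear: "ev (E + F) = ev E + ev F" "ev (c *\<^sub>R E) = c *\<^sub>R ev E" "ev (\<Sum>x\<in>A. G x) = (\<Sum>x\<in>A. ev (G x))"
  and ev_0: "ev 0 = 0"
  by (simp_all add: ev_def app_sum_op)

lemma ev_Lm_Rm: "ev (Lm u * Rm v) = H v *\<^sub>R u" and ev_Lm_Rl: "ev (Lm u * Rl v) = H v *\<^sub>R u"
  by (simp_all add: ev_def Lm_def Rm_def Rl_def app_gH)

lemma LR_mult: "Lm x * Rm y * (Lm u * Rm v) = Lm (x * u) * Rm (y * v)" for x y u v :: alg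
proof -
  have "Lm x * Rm y * (Lm u * Rm v) = Lm x * (Rm y * Lm u) * Rm v" by (simp only: mult.assoc)
  then show ?thesis by (simp only: Rm_Lm Lm_hom Rm_hom mult.assoc)
qed

abbreviation sO :: "nat \<Rightarrow> nat \<Rightarrow> alg" where "sO \<equiv> sm Ti tO"
abbreviation Lt :: "nat \<Rightarrow> nat \<Rightarrow> alg bimod" where "Lt \<equiv> \<lambda>a b. Lm (tO a b)"
abbreviation Rt :: "nat \<Rightarrow> nat \<Rightarrow> alg bimod" where "Rt \<equiv> \<lambda>a b. Rm (tO a b)"

text \<open>The coproduct of a generator; \<open>DT\<close> is that of the inverse determinant,
  which is group-like by \<open>DT_det\<close>.\<close>

definition Dt :: "nat \<Rightarrow> nat \<Rightarrow> alg bimod" where "Dt a b = (\<Sum>c\<in>ix n. Lm (tO a c) * Rm (tO c b))"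
definition DT :: "alg bimod" where "DT = Lm Ti * Rm Ti"

lemma qm_Lt: "qm Lt" and qm_Rt: "qm Rt"
  by (rule qm_hom[OF qm_tO]; rule Lm_hom Rm_hom)+

lemma Dt_eq: "Dt = (\<lambda>a b. \<Sum>c\<in>ix n. Lt a c * Rt c b)"
  by (simp add: Dt_def fun_eq_iff)

lemma qm_Dt: "qm Dt"
  unfolding Dt_eq by (rule qm_prod[OF qm_Lt qm_Rt Rm_Lm])

lemma Tw_Dt: "length i = length j \<Longrightarrow> Tw Dt i j = (\<Sum>k\<in>LL n (length i). Lm (Tw tO i k) * Rm (Tw tO k j))"
  unfolding Dt_eq by (subst Tw_prod[OF Rm_Lm]) (auto intro!: sum.cong simp: Tw_Lm Tw_Rm LL_length)

text \<open>The sum over column permutations acts on the second factor only, where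
  \<open>minor_vm\<close> reduces it to a multiple of \<open>det Rt\<close>; the remaining
  coefficients assemble \<open>det Lt\<close>.\<close>

lemma det_Dt: "det Dt = Lm (det tO) * Rm (det tO)"
proof -
  let ?P = "permutations_of_set (ix n)"
  have h: "det Lt = Lm (det tO)" "det Rt = Rm (det tO)"
    unfolding det_def by (rule minor_hom, auto simp: Lm_hom Rm_hom simp del: upt_Suc)+
  have "det Dt = (\<Sum>s\<in>?P. (- q) ^ invs s *\<^sub>R (\<Sum>k\<in>LL n n. Tw Lt idl k * Tw Rt k s))"
    unfolding det_sum Dt_eq
    by (intro sum.cong refl) (simp add: Tw_prod[OF Rm_Lm] perm_length idl_set)
  also have "\<dots> = (\<Sum>k\<in>LL n n. Tw Lt idl k * (\<Sum>s\<in>?P. (- q) ^ invs s *\<^sub>R Tw Rt k s))"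
    unfolding scaleR_sum_right sum_distrib_left by (subst sum.swap) simp
  also have "\<dots> = (\<Sum>k\<in>LL n n. ((if k \<in> ?P then (- q) ^ invs k else 0) *\<^sub>R Tw Lt idl k) * det Rt)"
    by (intro sum.cong refl) (simp add: minor_vm[OF qm_Rt])
  also have "\<dots> = (\<Sum>k\<in>LL n n. (if k \<in> ?P then (- q) ^ invs k else 0) *\<^sub>R Tw Lt idl k) * det Rt"
    by (rule sum_distrib_right[symmetric])
  also have "(\<Sum>k\<in>LL n n. (if k \<in> ?P then (- q) ^ invs k else 0) *\<^sub>R Tw Lt idl k) = det Lt"
    unfolding det_sum by (rule sum.mono_neutral_cong_right) (auto intro: perm_LL)
  finally show ?thesis unfolding h .
qed

lemma DT_det: "DT * det Dt = 1" "det Dt * DT = 1"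
  unfolding DT_def det_Dt LR_mult by (simp_all add: Ti_det det_Ti Lm_hom Rm_hom)

lemmas sO_rules = qm_tO Ti_det det_Ti

text \<open>The antipode reverses the coproduct: the right-hand side satisfies the defining
  equations of the inverse of \<open>Dt\<close>, and \<open>sm_unique\<close> applies.\<close>

lemma sm_Dt: "i \<in> ix n \<Longrightarrow> j \<in> ix n \<Longrightarrow> sm DT Dt i j = (\<Sum>k\<in>ix n. Lm (sO k j) * Rm (sO i k))"
proof (rule sm_unique[OF qm_Dt DT_det, symmetric])
  fix i l assume il: "i \<in> ix n" "l \<in> ix n"
  have "(\<Sum>j\<in>ix n. Dt j l * (\<Sum>k\<in>ix n. Lm (sO k j) * Rm (sO i k)))
     = (\<Sum>j\<in>ix n. \<Sum>p\<in>ix n. \<Sum>k\<in>ix n. Lm (tO j p * sO k j) * Rm (tO p l * sO i k))"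
    unfolding Dt_def sum_product LR_mult ..
  also have "\<dots> = (\<Sum>p\<in>ix n. \<Sum>j\<in>ix n. \<Sum>k\<in>ix n. Lm (tO j p * sO k j) * Rm (tO p l * sO i k))"
    by (rule sum.swap)
  also have "\<dots> = (\<Sum>p\<in>ix n. \<Sum>k\<in>ix n. \<Sum>j\<in>ix n. Lm (tO j p * sO k j) * Rm (tO p l * sO i k))"
    by (intro sum.cong[OF refl] sum.swap)
  also have "\<dots> = (\<Sum>p\<in>ix n. \<Sum>k\<in>ix n. Lm (\<Sum>j\<in>ix n. tO j p * sO k j) * Rm (tO p l * sO i k))"
    unfolding Lm_sum sum_distrib_right ..
  also have "\<dots> = (\<Sum>p\<in>ix n. \<Sum>k\<in>ix n. if k = p then Rm (tO p l * sO i k) else 0)"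
    by (intro sum.cong refl) (simp add: sm_right[OF sO_rules] Lm_hom)
  also have "\<dots> = Rm (\<Sum>p\<in>ix n. tO p l * sO i p)"
    unfolding Rm_sum by (simp add: sum.delta)
  finally show "(\<Sum>j\<in>ix n. Dt j l * (\<Sum>k\<in>ix n. Lm (sO k j) * Rm (sO i k))) = (if i = l then 1 else 0)"
    by (simp add: sm_right[OF sO_rules il] Rm_hom)
qed

lemma Sw_Dt: "i \<in> LL n d \<Longrightarrow> j \<in> LL n d \<Longrightarrow> Sw (sm DT Dt) i j = (\<Sum>p\<in>LL n d. Lm (Sw sO p j) * Rm (Sw sO i p))"
proof (induction d arbitrary: i j)
  case 0
  then show ?case by (simp add: Lm_hom Rm_hom)
next
  case (Suc d)
  then obtain a i' b j' where ij: "i = a # i'" "j = b # j'" "a \<in> ix n" "b \<in> ix n" "i' \<in> LL n d" "j' \<in> LL n d"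
    unfolding LL_Suc by auto
  have "Sw (sm DT Dt) i j = (\<Sum>p\<in>LL n d. Lm (Sw sO p j') * Rm (Sw sO i' p)) * (\<Sum>x\<in>ix n. Lm (sO x b) * Rm (sO a x))"
    unfolding ij by (simp add: Suc.IH ij sm_Dt)
  also have "\<dots> = (\<Sum>x\<in>ix n. \<Sum>p\<in>LL n d. Lm (Sw sO (x # p) j) * Rm (Sw sO i (x # p)))"
    unfolding sum_product LR_mult ij Sw.simps by (rule sum.swap)
  finally show ?case unfolding sum_LL_Suc .
qed

definition Dw :: "gen list \<Rightarrow> alg bimod" where
  "Dw w = sum_list (map (\<lambda>(u, v). Lm (WO u) * Rm (WO v)) (cop n w))"

text \<open>A relation in place of a map: an element can be written in words in several ways,
  possibly with different operators. \<open>cw_ev\<close> shows that \<open>ev\<close> takes the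
  same value on all of them.\<close>

inductive cw :: "alg \<Rightarrow> alg bimod \<Rightarrow> bool" where
  word: "set w \<subseteq> gl_alph n \<Longrightarrow> cw (WO w) (Dw w)"
| add: "cw x E \<Longrightarrow> cw y F \<Longrightarrow> cw (x + y) (E + F)"
| scale: "cw x E \<Longrightarrow> cw (c *\<^sub>R x) (c *\<^sub>R E)"

text \<open>\<open>Mp x E\<close> expresses that \<open>E\<close> acts as the coproduct of \<open>x\<close>; it is preserved by all ring operations.\<close>
definition Mp :: "alg \<Rightarrow> alg bimod \<Rightarrow> bool" where
  "Mp x E \<longleftrightarrow> (\<forall>y F. cw y F \<longrightarrow> cw (x * y) (E * F))"

lemma ev_sum_list: "ev (sum_list (map G xs)) = sum_list (map (\<lambda>x. ev (G x)) xs)"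
  by (induction xs) (simp_all add: ev_linear ev_0)

lemma cw_ev: "cw x E \<Longrightarrow> ev E = H x *\<^sub>R 1"
proof (induction rule: cw.induct)
  case (word w)
  have "ev (Dw w) = sum_list (map (\<lambda>(u, v). hr v *\<^sub>R WO u) (cop n w))"
    unfolding Dw_def ev_sum_list by (intro arg_cong[where f=sum_list] map_cong refl) (auto simp: ev_Lm_Rm H_Wd)
  then show ?case using hr_invariant(1)[OF word] by (simp add: H_Wd)
qed (simp_all add: ev_linear H_linear scaleR_add_left)

lemma Mp_1: "Mp 1 1" and Mp_add: "Mp x E \<Longrightarrow> Mp y F \<Longrightarrow> Mp (x + y) (E + F)"
  and Mp_scale: "Mp x E \<Longrightarrow> Mp (c *\<^sub>R x) (c *\<^sub>R E)" and Mp_mult: "Mp x E \<Longrightarrow> Mp y F \<Longrightarrow> Mp (x * y) (E * F)"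
  by (auto simp: Mp_def distrib_right mult.assoc intro: cw.intros)

lemma Mp_0: "Mp 0 0"
  using Mp_scale[OF Mp_1, of 0] by simp

lemma Mp_sum: "(\<And>x. x \<in> A \<Longrightarrow> Mp (f x) (F x)) \<Longrightarrow> Mp (\<Sum>x\<in>A. f x) (\<Sum>x\<in>A. F x)"
  by (induction A rule: infinite_finite_induct) (auto intro: Mp_0 Mp_add)

lemma Mp_ev: "Mp x E \<Longrightarrow> ev E = H x *\<^sub>R 1"
proof -
  assume M: "Mp x E"
  have "cw 1 1" using cw.word[of "[]"] by (simp add: Dw_def Lm_hom Rm_hom)
  with M have "cw (x * 1) (E * 1)" unfolding Mp_def by blast
  then show ?thesis using cw_ev by simp
qed

lemma MpI:
  assumes "\<And>w. set w \<subseteq> gl_alph n \<Longrightarrow> cw (x * WO w) (E * Dw w)"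
  shows "Mp x E"
  unfolding Mp_def
proof (intro allI impI)
  fix y F assume "cw y F"
  then show "cw (x * y) (E * F)"
    by (induction rule: cw.induct) (simp_all add: assms distrib_left cw.add cw.scale)
qed

lemma Mp_Ti: "Mp Ti DT"
proof (rule MpI)
  fix w assume w: "set w \<subseteq> gl_alph n"
  have "DT * Dw w = sum_list (map (\<lambda>(u, v). Lm (Ti * WO u) * Rm (Ti * WO v)) (cop n w))"
    unfolding Dw_def sum_list_const_mult[symmetric] DT_def
    by (intro arg_cong[where f=sum_list] map_cong) (auto simp: LR_mult)
  also have "\<dots> = Dw (T # w)"
    unfolding Dw_def Ti_def Wd_append[symmetric] by (simp add: o_def case_prod_unfold)
  finally have "DT * Dw w = Dw (T # w)" .
  moreover have "Ti * WO w = WO (T # w)" by (simp add: Wd_Cons[of _ T w] Ti_def)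
  moreover have "set (T # w) \<subseteq> gl_alph n" using w by (simp add: gl_alph_def)
  ultimately show "cw (Ti * WO w) (DT * Dw w)" by (simp only: cw.word)
qed

lemma Mp_t: "Mp (tO a b) (Dt a b)"
proof (cases "a \<in> ix n \<and> b \<in> ix n")
  case True
  show ?thesis
  proof (rule MpI)
    fix w assume w: "set w \<subseteq> gl_alph n"
    have tW: "tO c d * WO u = WO (Z c d # u)" if "c \<in> ix n" "d \<in> ix n" for c d u
      using that by (simp add: Wd_Cons[of _ "Z c d" u] tm_def)
    have ixs: "set [1..<n + 1] = ix n" by (auto simp: ix_def)
    have "Dt a b * Dw w = (\<Sum>c\<in>ix n. sum_list (map (\<lambda>(u, v). Lm (tO a c * WO u) * Rm (tO c b * WO v)) (cop n w)))"
      unfolding Dt_def sum_distrib_right unfolding Dw_def sum_list_const_mult[symmetric]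
      by (intro sum.cong refl arg_cong[where f=sum_list] map_cong) (auto simp: LR_mult)
    also have "\<dots> = (\<Sum>c\<in>ix n. sum_list (map (\<lambda>(u, v). Lm (WO (Z a c # u)) * Rm (WO (Z c b # v))) (cop n w)))"
      using True by (intro sum.cong refl arg_cong[where f=sum_list] map_cong) (auto simp: tW)
    also have "\<dots> = (\<Sum>c\<leftarrow>[1..<n + 1]. sum_list (map (\<lambda>(u, v). Lm (WO (Z a c # u)) * Rm (WO (Z c b # v))) (cop n w)))"
      unfolding sum_list_distinct_conv_sum_set[OF distinct_upt] ixs ..
    also have "\<dots> = Dw (Z a b # w)"
      unfolding Dw_def cop.simps map_concat sum_list_concat map_map
      by (intro arg_cong[where f=sum_list] map_cong refl) (simp add: o_def case_prod_unfold)
    finally have "Dt a b * Dw w = Dw (Z a b # w)" .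
    moreover have "tO a b * WO w = WO (Z a b # w)" using True by (simp add: tW)
    moreover have "set (Z a b # w) \<subseteq> gl_alph n" using w True by (simp add: gl_alph_def)
    ultimately show "cw (tO a b * WO w) (Dt a b * Dw w)" by (simp only: cw.word)
  qed
next
  case False
  then have "tO a b = 0" "Dt a b = 0" using qm_zero[OF qm_tO] qm_zero[OF qm_Dt] by auto
  then show ?thesis using Mp_0 by simp
qed

lemma Mp_Tw: "length i = length j \<Longrightarrow> Mp (Tw tO i j) (Tw Dt i j)"
  by (induction i j rule: list_induct2) (auto intro: Mp_1 Mp_mult Mp_t)

lemma Mp_minor:
  assumes "length i = card J"
  shows "Mp (minor tO i J) (minor Dt i J)"
proof -
  have "Mp ((- q) ^ invs x *\<^sub>R Tw tO i x) ((- q) ^ invs x *\<^sub>R Tw Dt i x)" if "x \<in> permutations_of_set J" for x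
  proof -
    have "length i = length x" using that assms by (auto simp: permutations_of_set_def distinct_card)
    then show ?thesis by (rule Mp_scale[OF Mp_Tw])
  qed
  then show ?thesis unfolding minor_def by (rule Mp_sum)
qed

lemma Mp_sm: "Mp (sO i j) (sm DT Dt i j)"
proof (cases "i \<in> ix n \<and> j \<in> ix n")
  case True
  have "Mp (cof tO j i) (cof Dt j i)"
    unfolding cof_def using True by (intro Mp_minor) simp
  from Mp_scale[OF Mp_mult[OF Mp_Ti this]] True show ?thesis by (simp only: sm_def simp_thms if_True)
next
  case False
  then have "sO i j = 0" "sm DT Dt i j = 0" unfolding sm_def by auto
  then show ?thesis using Mp_0 by (simp only:)
qed

lemma Mp_Sw: "length i = length j \<Longrightarrow> Mp (Sw sO i j) (Sw (sm DT Dt) i j)"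
  by (induction i j rule: list_induct2) (auto intro: Mp_1 Mp_mult Mp_sm)

text \<open>The invariance of \<open>H\<close> on \<open>S(i,j) T(k,l)\<close>, expanded by the
  coproduct, is multiplied by \<open>T(j,r)\<close> from the left and summed over \<open>j\<close>.
  Then \<open>T(j,r) S(p,j)\<close> collapses to \<open>p = r\<close> by
  \<open>Sw_right\<close>.\<close>

lemma strong_invariance_gl:
  assumes L: "i \<in> LL n d" "r \<in> LL n d" "k \<in> LL n d" "l \<in> LL n d"
  shows "(\<Sum>m\<in>LL n d. H (Sw sO i r * Tw tO m l) *\<^sub>R Tw tO k m) = (\<Sum>j\<in>LL n d. H (Sw sO i j * Tw tO k l) *\<^sub>R Tw tO j r)"
proof -
  let ?L = "LL n d" and ?S = "Sw sO" and ?T = "Tw tO"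
  have inv: "H (?S i j * ?T k l) *\<^sub>R 1 = (\<Sum>p\<in>?L. \<Sum>m\<in>?L. H (?S i p * ?T m l) *\<^sub>R (?S p j * ?T k m))" if j: "j \<in> ?L" for j
  proof -
    have len: "length i = length j" "length k = length l" "length k = d" using L j by (simp_all add: LL_length)
    have "H (?S i j * ?T k l) *\<^sub>R 1 = ev (Sw (sm DT Dt) i j * Tw Dt k l)"
      using Mp_ev[OF Mp_mult[OF Mp_Sw[OF len(1)] Mp_Tw[OF len(2)]]] by simp
    also have "Sw (sm DT Dt) i j * Tw Dt k l = (\<Sum>p\<in>?L. \<Sum>m\<in>?L. Lm (?S p j * ?T k m) * Rm (?S i p * ?T m l))"
      unfolding Sw_Dt[OF L(1) j] Tw_Dt[OF len(2)] len(3) sum_product LR_mult ..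
    finally show ?thesis unfolding ev_linear ev_Lm_Rm .
  qed
  have "(\<Sum>j\<in>?L. H (?S i j * ?T k l) *\<^sub>R ?T j r) = (\<Sum>j\<in>?L. ?T j r * (H (?S i j * ?T k l) *\<^sub>R 1))" by simp
  also have "\<dots> = (\<Sum>j\<in>?L. \<Sum>p\<in>?L. \<Sum>m\<in>?L. H (?S i p * ?T m l) *\<^sub>R (?T j r * ?S p j * ?T k m))"
  proof (rule sum.cong[OF refl])
    fix j assume j: "j \<in> ?L"
    show "?T j r * (H (?S i j * ?T k l) *\<^sub>R 1) = (\<Sum>p\<in>?L. \<Sum>m\<in>?L. H (?S i p * ?T m l) *\<^sub>R (?T j r * ?S p j * ?T k m))"
      unfolding inv[OF j] sum_distrib_left mult_scaleR_right mult.assoc ..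
  qed
  also have "\<dots> = (\<Sum>p\<in>?L. \<Sum>m\<in>?L. \<Sum>j\<in>?L. H (?S i p * ?T m l) *\<^sub>R (?T j r * ?S p j * ?T k m))"
    by (subst sum.swap, rule sum.cong[OF refl], rule sum.swap)
  also have "\<dots> = (\<Sum>p\<in>?L. \<Sum>m\<in>?L. H (?S i p * ?T m l) *\<^sub>R ((\<Sum>j\<in>?L. ?T j r * ?S p j) * ?T k m))"
    unfolding sum_distrib_right scaleR_sum_right ..
  also have "\<dots> = (\<Sum>p\<in>?L. if p = r then \<Sum>m\<in>?L. H (?S i p * ?T m l) *\<^sub>R ?T k m else 0)"
    by (intro sum.cong refl) (simp add: Sw_right[OF sO_rules _ L(2)])
  also have "\<dots> = (\<Sum>m\<in>?L. H (?S i r * ?T m l) *\<^sub>R ?T k m)" using L(2) by simp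
  finally show ?thesis ..
qed

text \<open>The identity is linear in words of generators, so it passes from the localization to the
  algebra and from there to coordinate functionals.\<close>

lemma strong_invariance:
  fixes \<Theta> :: "nat list \<Rightarrow> nat list \<Rightarrow> 'a::real_vector"
  assumes "RC \<Theta>" and L: "i \<in> LL n d" "r \<in> LL n d" "k \<in> LL n d" "l \<in> LL n d"
  shows "(\<Sum>m\<in>LL n d. H (Sw sO i r * Tw tO m l) *\<^sub>R \<Theta> k m) = (\<Sum>j\<in>LL n d. H (Sw sO i j * Tw tO k l) *\<^sub>R \<Theta> j r)"
  using L by (intro transfer[OF assms(1)] transfer_gl strong_invariance_gl) auto

end

section \<open>The completed tensor product\<close>

lemma tmul_sp: "tmul X Y (u, v) = (\<Sum>p\<in>sp u. \<Sum>r\<in>sp v. X (snd p, fst r) * Y (fst p, snd r))"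
  unfolding tmul_def fst_conv snd_conv
  by (subst sum.reindex_bij_betw[OF sp_bij[of u], symmetric], subst sum.reindex_bij_betw[OF sp_bij[of v], symmetric]) simp

lemma tmul_assoc: "tmul (tmul X Y) W = tmul X (tmul Y W)"
proof
  fix uv :: "gen list \<times> gen list"
  obtain u v where uv: "uv = (u, v)" by (cases uv)
  have "tmul (tmul X Y) W (u, v) = (\<Sum>p\<in>sp u. \<Sum>r\<in>sp v. \<Sum>p'\<in>sp (snd p). \<Sum>r'\<in>sp (fst r).
      X (snd p', fst r') * Y (fst p', snd r') * W (fst p, snd r))"
    unfolding tmul_sp sum_distrib_right ..
  also have "\<dots> = (\<Sum>p\<in>sp u. \<Sum>p'\<in>sp (snd p). \<Sum>r\<in>sp v. \<Sum>r'\<in>sp (fst r).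
      X (snd p', fst r') * Y (fst p', snd r') * W (fst p, snd r))"
    by (rule sum.cong[OF refl], rule sum.swap)
  also have "\<dots> = (\<Sum>p\<in>sp u. \<Sum>p'\<in>sp (snd p). \<Sum>r\<in>sp v. \<Sum>r'\<in>sp (snd r).
      X (snd p', fst r) * Y (fst p', fst r') * W (fst p, snd r'))"
    by (rule sum.cong[OF refl], rule sum.cong[OF refl], rule sp_assoc)
  also have "\<dots> = (\<Sum>p\<in>sp u. \<Sum>p'\<in>sp (fst p). \<Sum>r\<in>sp v. \<Sum>r'\<in>sp (snd r).
      X (snd p, fst r) * Y (snd p', fst r') * W (fst p', snd r'))"
    by (rule sp_assoc[symmetric])
  also have "\<dots> = (\<Sum>p\<in>sp u. \<Sum>r\<in>sp v. \<Sum>p'\<in>sp (fst p). \<Sum>r'\<in>sp (snd r).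
      X (snd p, fst r) * (Y (snd p', fst r') * W (fst p', snd r')))"
    unfolding mult.assoc by (rule sum.cong[OF refl], rule sum.swap)
  also have "\<dots> = tmul X (tmul Y W) (u, v)"
    unfolding tmul_sp sum_distrib_left ..
  finally show "tmul (tmul X Y) W uv = tmul X (tmul Y W) uv" unfolding uv .
qed

lemma tmul_tone [simp]: "tmul tone X = X" "tmul X tone = X"
proof -
  have "(\<Sum>r\<in>sp v. tone (snd p, fst r) * X (fst p, snd r)) = (if p = (u, []) then X (u, v) else 0)" if "p \<in> sp u" for p u v
  proof (cases "p = (u, [])")
    case True
    have "(\<Sum>r\<in>sp v. tone (snd p, fst r) * X (fst p, snd r)) = (\<Sum>r\<in>sp v. if r = ([], v) then X (u, v) else 0)"
      by (rule sum.cong[OF refl]) (use True in \<open>auto simp: tone_def sp_def\<close>)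
    then show ?thesis unfolding sum_sp_delta using True by (simp add: sp_def)
  next
    case False
    then have "snd p \<noteq> []" using that by (cases p) (auto simp: sp_def)
    then show ?thesis using False by (simp add: tone_def)
  qed
  then have "tmul tone X (u, v) = (\<Sum>p\<in>sp u. if p = (u, []) then X (u, v) else 0)" for u v
    unfolding tmul_sp by (rule sum.cong[OF refl])
  then show "tmul tone X = X" unfolding sum_sp_delta by (simp add: fun_eq_iff sp_def)
  have "(\<Sum>r\<in>sp v. X (snd p, fst r) * tone (fst p, snd r)) = (if p = ([], u) then X (u, v) else 0)" if "p \<in> sp u" for p u v
  proof (cases "p = ([], u)")
    case True
    have "(\<Sum>r\<in>sp v. X (snd p, fst r) * tone (fst p, snd r)) = (\<Sum>r\<in>sp v. if r = (v, []) then X (u, v) else 0)"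
      by (rule sum.cong[OF refl]) (use True in \<open>auto simp: tone_def sp_def\<close>)
    then show ?thesis unfolding sum_sp_delta using True by (simp add: sp_def)
  next
    case False
    then have "fst p \<noteq> []" using that by (cases p) (auto simp: sp_def)
    then show ?thesis using False by (simp add: tone_def)
  qed
  then have "tmul X tone (u, v) = (\<Sum>p\<in>sp u. if p = ([], u) then X (u, v) else 0)" for u v
    unfolding tmul_sp by (rule sum.cong[OF refl])
  then show "tmul X tone = X" unfolding sum_sp_delta by (simp add: fun_eq_iff sp_def)
qed

definition tpow :: "tens \<Rightarrow> nat \<Rightarrow> tens" where "tpow X k = (tmul X ^^ k) tone"

lemma tpow_simps [simp]: "tpow X 0 = tone" "tpow X (Suc k) = tmul X (tpow X k)"
  by (simp_all add: tpow_def)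

lemma tpow_commute: "tmul (tpow X k) X = tmul X (tpow X k)"
  by (induction k) (simp_all add: tmul_assoc)

lemma tpow_vanish: "X ([], []) = 0 \<Longrightarrow> length u + length v < k \<Longrightarrow> tpow X k (u, v) = 0"
proof (induction k arbitrary: u v)
  case (Suc k)
  have "X (snd p, fst r) * tpow X k (fst p, snd r) = 0" if "p \<in> sp u" "r \<in> sp v" for p r
  proof (cases "snd p = [] \<and> fst r = []")
    case True
    then show ?thesis using Suc.prems by simp
  next
    case False
    have "length u = length (fst p) + length (snd p)" "length v = length (fst r) + length (snd r)"
      using that by (auto simp: sp_def)
    moreover have "length (snd p) \<noteq> 0 \<or> length (fst r) \<noteq> 0" using False by simp
    ultimately have "length (fst p) + length (snd r) < k" using Suc.prems by linarith
    then show ?thesis using Suc by simp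
  qed
  then show ?case unfolding tpow_simps tmul_sp by (intro sum.neutral ballI)
qed simp

text \<open>The geometric series of \<open>X\<close>. If \<open>X\<close> has no constant term, its
  \<open>k\<close>-th power vanishes on words of total length below \<open>k\<close>, so the
  truncation is exact.\<close>

definition tgeo :: "tens \<Rightarrow> tens" where
  "tgeo X uv = (\<Sum>k\<le>length (fst uv) + length (snd uv). tpow X k uv)"

lemma tgeo_inverse:
  assumes "X ([], []) = 0"
  shows "tmul (\<lambda>uv. tone uv - X uv) (tgeo X) = tone" "tmul (tgeo X) (\<lambda>uv. tone uv - X uv) = tone"
proof -
  let ?X = "\<lambda>uv. tone uv - X uv"
  have tel: "(\<Sum>k\<le>N. tpow X k (u, v) - tpow X (Suc k) (u, v)) = tone (u, v) - tpow X (Suc N) (u, v)" for N u v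
    by (induction N) simp_all
  have geo: "tgeo X (a, b) = (\<Sum>k\<le>length u + length v. tpow X k (a, b))" if "length a + length b \<le> length u + length v" for a b u v
    unfolding tgeo_def fst_conv snd_conv using that assms
    by (intro sum.mono_neutral_left) (auto intro: tpow_vanish)
  have len: "length (fst p) + length (snd r) \<le> length u + length v" "length (snd p) + length (fst r) \<le> length u + length v"
    if "p \<in> sp u" "r \<in> sp v" for p r :: "gen list \<times> gen list" and u v using that by (auto simp: sp_def)
  have dif: "tmul ?X Y (u, v) = Y (u, v) - tmul X Y (u, v)" "tmul Y ?X (u, v) = Y (u, v) - tmul Y X (u, v)" for Y u v
  proof -
    have "tmul ?X Y (u, v) = tmul tone Y (u, v) - tmul X Y (u, v)"
      unfolding tmul_sp by (simp add: left_diff_distrib sum_subtractf)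
    then show "tmul ?X Y (u, v) = Y (u, v) - tmul X Y (u, v)" by simp
    have "tmul Y ?X (u, v) = tmul Y tone (u, v) - tmul Y X (u, v)"
      unfolding tmul_sp by (simp add: right_diff_distrib sum_subtractf)
    then show "tmul Y ?X (u, v) = Y (u, v) - tmul Y X (u, v)" by simp
  qed
  have "tmul ?X (tgeo X) (u, v) = tone (u, v)" for u v
  proof -
    let ?N = "length u + length v"
    have "tmul ?X (tgeo X) (u, v) = (\<Sum>p\<in>sp u. \<Sum>r\<in>sp v. \<Sum>k\<le>?N. ?X (snd p, fst r) * tpow X k (fst p, snd r))"
      unfolding tmul_sp by (intro sum.cong refl) (simp add: geo[OF len(1)] sum_distrib_left)
    also have "\<dots> = (\<Sum>p\<in>sp u. \<Sum>k\<le>?N. \<Sum>r\<in>sp v. ?X (snd p, fst r) * tpow X k (fst p, snd r))"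
      by (rule sum.cong[OF refl], rule sum.swap)
    also have "\<dots> = (\<Sum>k\<le>?N. tmul ?X (tpow X k) (u, v))"
      unfolding tmul_sp by (rule sum.swap)
    also have "\<dots> = tone (u, v)" unfolding dif using tel[of u v ?N] tpow_vanish[of X u v "Suc ?N", OF assms] by simp
    finally show ?thesis .
  qed
  then show "tmul ?X (tgeo X) = tone" by (simp add: fun_eq_iff)
  have "tmul (tgeo X) ?X (u, v) = tone (u, v)" for u v
  proof -
    let ?N = "length u + length v"
    have "tmul (tgeo X) ?X (u, v) = (\<Sum>p\<in>sp u. \<Sum>r\<in>sp v. \<Sum>k\<le>?N. tpow X k (snd p, fst r) * ?X (fst p, snd r))"
      unfolding tmul_sp by (intro sum.cong refl) (simp add: geo[OF len(2)] sum_distrib_right)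
    also have "\<dots> = (\<Sum>p\<in>sp u. \<Sum>k\<le>?N. \<Sum>r\<in>sp v. tpow X k (snd p, fst r) * ?X (fst p, snd r))"
      by (rule sum.cong[OF refl], rule sum.swap)
    also have "\<dots> = (\<Sum>k\<le>?N. tmul (tpow X k) ?X (u, v))"
      unfolding tmul_sp by (rule sum.swap)
    also have "\<dots> = tone (u, v)" unfolding dif using tel[of u v ?N] tpow_vanish[of X u v "Suc ?N", OF assms] by (simp add: tpow_commute)
    finally show ?thesis .
  qed
  then show "tmul (tgeo X) ?X = tone" by (simp add: fun_eq_iff)
qed

text \<open>The inverse is taken on pairs of free words, before any relation is imposed. A two-sided
  inverse is unique by associativity, which settles the definite description.\<close>

lemma tinv_eq:
  assumes "X ([], []) = 1" shows "tinv X = tgeo (\<lambda>uv. tone uv - X uv)"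
    and "tmul (tinv X) X = tone"
proof -
  let ?Y = "tgeo (\<lambda>uv. tone uv - X uv)"
  have "tone ([], []) = 1" by (simp add: tone_def)
  then have Y: "tmul X ?Y = tone" "tmul ?Y X = tone"
    using tgeo_inverse[of "\<lambda>uv. tone uv - X uv"] assms by simp_all
  show "tinv X = ?Y" unfolding tinv_def
  proof (rule the_equality)
    show "Y' = ?Y" if "tmul X Y' = tone \<and> tmul Y' X = tone" for Y'
      using that Y tmul_assoc[of Y' X ?Y] by simp
  qed (use Y in simp)
  with Y show "tmul (tinv X) X = tone" by simp
qed

text \<open>Support in the bidegrees \<open>(d, d)\<close> makes a product split along a single
  degree in \<open>rho_tmul\<close>; real coefficients make \<open>Re\<close> multiplicative
  there.\<close>

definition bal :: "nat \<Rightarrow> tens \<Rightarrow> bool" where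
  "bal n X \<longleftrightarrow> (\<forall>u v. X (u, v) \<in> \<real> \<and> (X (u, v) \<noteq> 0 \<longrightarrow> length u = length v \<and> set u \<subseteq> mat_alph n \<and> set v \<subseteq> bar_alph n))"

lemma bal_tone: "bal n tone"
  by (auto simp: bal_def tone_def)

lemma bal_real: "bal n X \<Longrightarrow> X (u, v) \<in> \<real>" and balD: "bal n X \<Longrightarrow> X (u, v) \<noteq> 0 \<Longrightarrow> length u = length v \<and> set u \<subseteq> mat_alph n \<and> set v \<subseteq> bar_alph n"
  unfolding bal_def by blast+

lemma bal_tmul:
  assumes X: "bal n X" and Y: "bal n Y" shows "bal n (tmul X Y)"
  unfolding bal_def
proof (intro allI conjI[OF _ impI])
  fix u v
  show "tmul X Y (u, v) \<in> \<real>"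
    unfolding tmul_sp by (intro sum_in_Reals Reals_mult bal_real[OF X] bal_real[OF Y])
  assume "tmul X Y (u, v) \<noteq> 0"
  then obtain p where p: "p \<in> sp u" "(\<Sum>r\<in>sp v. X (snd p, fst r) * Y (fst p, snd r)) \<noteq> 0"
    unfolding tmul_sp by (rule sum.not_neutral_contains_not_neutral)
  from p(2) obtain r where r: "r \<in> sp v" "X (snd p, fst r) * Y (fst p, snd r) \<noteq> 0"
    by (rule sum.not_neutral_contains_not_neutral)
  have "u = fst p @ snd p" "v = fst r @ snd r" using p r by (simp_all add: sp_def)
  then show "length u = length v \<and> set u \<subseteq> mat_alph n \<and> set v \<subseteq> bar_alph n"
    using balD[OF X, of "snd p" "fst r"] balD[OF Y, of "fst p" "snd r"] r(2) by auto
qed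

lemma bal_tpow: "bal n X \<Longrightarrow> bal n (tpow X k)"
  by (induction k) (simp_all add: bal_tone bal_tmul)

lemma balI: "(\<And>u v. X (u, v) \<in> \<real>) \<Longrightarrow> (\<And>u v. X (u, v) \<noteq> 0 \<Longrightarrow> length u = length v \<and> set u \<subseteq> mat_alph n \<and> set v \<subseteq> bar_alph n) \<Longrightarrow> bal n X"
  unfolding bal_def by blast

lemma bal_diff:
  assumes X: "bal n X" and Y: "bal n Y" shows "bal n (\<lambda>uv. X uv - Y uv)"
proof (rule balI)
  show "X (u, v) - Y (u, v) \<in> \<real>" for u v by (intro Reals_diff bal_real[OF X] bal_real[OF Y])
  fix u v assume "X (u, v) - Y (u, v) \<noteq> 0"
  then have "X (u, v) \<noteq> 0 \<or> Y (u, v) \<noteq> 0" by auto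
  then show "length u = length v \<and> set u \<subseteq> mat_alph n \<and> set v \<subseteq> bar_alph n"
    using balD[OF X] balD[OF Y] by blast
qed

lemma bal_tsc:
  assumes X: "bal n X" and c: "c \<in> \<real>" shows "bal n (tsc c X)"
proof (rule balI)
  show "tsc c X (u, v) \<in> \<real>" for u v unfolding tsc_def by (intro Reals_mult c bal_real[OF X])
  show "length u = length v \<and> set u \<subseteq> mat_alph n \<and> set v \<subseteq> bar_alph n" if "tsc c X (u, v) \<noteq> 0" for u v
    using balD[OF X, of u v] that by (simp add: tsc_def)
qed

lemma bal_add:
  assumes X: "bal n X" and Y: "bal n Y" shows "bal n (tadd X Y)"
proof -
  have "tadd X Y = (\<lambda>uv. X uv - tsc (- 1) Y uv)" by (simp add: tadd_def tsc_def fun_eq_iff)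
  then show ?thesis using bal_diff[OF X bal_tsc[OF Y, of "- 1"]] by simp
qed

lemma bal_tsum: "(\<And>x. x \<in> A \<Longrightarrow> bal n (F x)) \<Longrightarrow> bal n (tsum A F)"
proof (induction A rule: infinite_finite_induct)
  case (insert x A)
  have "tsum (insert x A) F = tadd (F x) (tsum A F)" using insert by (simp add: fun_eq_iff tsum_def tadd_def)
  then show ?case using insert by (simp add: bal_add)
qed (simp_all add: bal_def tsum_def)

lemma bal_tgeo: "bal n X \<Longrightarrow> bal n (tgeo X)"
proof -
  assume X: "bal n X"
  show ?thesis unfolding bal_def
  proof (intro allI conjI[OF _ impI])
    fix u v
    show "tgeo X (u, v) \<in> \<real>" unfolding tgeo_def by (intro sum_in_Reals bal_real[OF bal_tpow[OF X]])
    assume "tgeo X (u, v) \<noteq> 0"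
    then obtain k where "tpow X k (u, v) \<noteq> 0"
      unfolding tgeo_def by (rule sum.not_neutral_contains_not_neutral)
    then show "length u = length v \<and> set u \<subseteq> mat_alph n \<and> set v \<subseteq> bar_alph n" by (rule balD[OF bal_tpow[OF X]])
  qed
qed

lemma bal_tinv: "bal n X \<Longrightarrow> X ([], []) = 1 \<Longrightarrow> bal n (tinv X)"
  by (simp add: tinv_eq bal_tgeo bal_diff bal_tone)

lemma words_0 [simp]: "words A 0 = {[]}"
  by (auto simp: words_def)

lemma finite_words [simp]: "finite A \<Longrightarrow> finite (words A d)"
  unfolding words_def using finite_lists_length_eq[of A d] by (simp add: conj_commute)

lemma finite_mat_alph [simp]: "finite (mat_alph n)" and finite_bar_alph [simp]: "finite (bar_alph n)"
proof -
  have "mat_alph n = (\<lambda>(a, b). Z a b) ` ({1..n} \<times> {1..n})" "bar_alph n = (\<lambda>(a, b). Zb a b) ` ({1..n} \<times> {1..n})"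
    by (auto simp: mat_alph_def bar_alph_def)
  then show "finite (mat_alph n)" "finite (bar_alph n)" by simp_all
qed

lemma sum_words_add: "(\<Sum>u\<in>words A (i + k). f (take i u) (drop i u)) = (\<Sum>x\<in>words A i. \<Sum>y\<in>words A k. f x y)"
proof -
  have "(\<Sum>u\<in>words A (i + k). f (take i u) (drop i u)) = (\<Sum>p\<in>words A i \<times> words A k. f (fst p) (snd p))"
    by (rule sum.reindex_bij_witness[of _ "\<lambda>p. fst p @ snd p" "\<lambda>u. (take i u, drop i u)"])
      (auto simp: words_def dest: in_set_takeD in_set_dropD)
  then show ?thesis by (simp add: sum.cartesian_product case_prod_unfold)
qed

section \<open>Pairing with the Haar functional\<close>

context qp
begin

fun thb :: "gen \<Rightarrow> alg" where
  "thb (Zb a al) = q powi (int al - int n) *\<^sub>R sO al a" | "thb g = 0"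

definition Th :: "gen list \<Rightarrow> alg" where "Th v = prod_list (map thb v)"

text \<open>\<open>Th v\<close> is the image of \<open>v\<close> under \<open>\<theta> \<circ> \<psi>\<close>. Evaluated by \<open>ev\<close>, \<open>rho d X\<close> pairs the component of
  bidegree \<open>(d, d)\<close> with the Haar functional. The opposite multiplication in the first tensor factor
  makes \<open>rho\<close> reverse products.\<close>
definition rho :: "nat \<Rightarrow> tens \<Rightarrow> alg bimod" where
  "rho d X = (\<Sum>u\<in>words (mat_alph n) d. \<Sum>v\<in>words (bar_alph n) d. Re (X (u, v)) *\<^sub>R (Lm (WO u) * Rl (Th v)))"

lemma rho_tadd: "rho d (tadd X Y) = rho d X + rho d Y"
  by (simp add: rho_def tadd_def scaleR_add_left sum.distrib)

lemma rho_tsc: "c = of_real r \<Longrightarrow> rho d (tsc c X) = r *\<^sub>R rho d X"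
  by (simp add: rho_def tsc_def scaleR_sum_right)

lemma rho_tsum: "rho d (tsum A F) = (\<Sum>x\<in>A. rho d (F x))"
proof -
  have "rho d (tsum A F) = (\<Sum>u\<in>words (mat_alph n) d. \<Sum>v\<in>words (bar_alph n) d. \<Sum>x\<in>A. Re (F x (u, v)) *\<^sub>R (Lm (WO u) * Rl (Th v)))"
    by (simp add: rho_def tsum_def scaleR_sum_left)
  also have "\<dots> = (\<Sum>u\<in>words (mat_alph n) d. \<Sum>x\<in>A. \<Sum>v\<in>words (bar_alph n) d. Re (F x (u, v)) *\<^sub>R (Lm (WO u) * Rl (Th v)))"
    by (rule sum.cong[OF refl], rule sum.swap)
  also have "\<dots> = (\<Sum>x\<in>A. rho d (F x))" unfolding rho_def by (rule sum.swap)
  finally show ?thesis .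
qed

lemma rho_tone: "rho d tone = (if d = 0 then 1 else 0)"
proof (cases d)
  case 0
  then show ?thesis by (simp add: rho_def tone_def Th_def Lm_hom Rl_hom)
next
  case (Suc k)
  then show ?thesis by (auto simp: rho_def tone_def words_def intro!: sum.neutral)
qed

lemma LRl_mult: "Lm x * Rl y * (Lm u * Rl v) = Lm (x * u) * Rl (v * y)" for x y u v :: alg
proof -
  have "Lm x * Rl y * (Lm u * Rl v) = Lm x * (Rl y * Lm u) * Rl v" by (simp only: mult.assoc)
  then show ?thesis by (simp only: Rl_Lm Lm_hom Rl_hom mult.assoc)
qed

lemma rho_tmul:
  assumes X: "bal n X" and Y: "bal n Y"
  shows "rho d (tmul X Y) = (\<Sum>i\<le>d. rho i Y * rho (d - i) X)"
proof -
  let ?M = "mat_alph n" and ?B = "bar_alph n"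
  let ?r = "\<lambda>u v. Lm (WO u) * Rl (Th v)"
  have r: "?r (u @ u') (v @ v') = ?r u v' * ?r u' v" for u u' v v'
    unfolding LRl_mult by (simp add: Wd_append Th_def)
  let ?g = "\<lambda>x y x' y'. (Re (X (y, x')) * Re (Y (x, y'))) *\<^sub>R ?r (x @ y) (x' @ y')"
  have inner: "Re (tmul X Y (u, v)) *\<^sub>R ?r u v = (\<Sum>i\<le>d. ?g (take i u) (drop i u) (take (d - i) v) (drop (d - i) v))"
    if "u \<in> words ?M d" "v \<in> words ?B d" for u v
  proof -
    have len: "length u = d" "length v = d" using that by (simp_all add: words_def)
    have "tmul X Y (u, v) = (\<Sum>i\<le>d. X (drop i u, take (d - i) v) * Y (take i u, drop (d - i) v))"
      unfolding tmul_def fst_conv snd_conv len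
    proof (rule sum.cong[OF refl])
      fix i assume i: "i \<in> {..d}"
      \<comment> \<open>Equal lengths in both arguments of \<open>X\<close> leave the single cut
        \<open>j = d - i\<close> of the second word.\<close>
      have "X (drop i u, take j v) * Y (take i u, drop j v) = (if j = d - i then X (drop i u, take (d - i) v) * Y (take i u, drop (d - i) v) else 0)"
        if j: "j \<in> {..d}" for j
      proof (cases "X (drop i u, take j v) = 0")
        case False
        then have "length (drop i u) = length (take j v)" using balD[OF X] by blast
        then have "j = d - i" using len i j by simp
        then show ?thesis by simp
      qed auto
      then have "(\<Sum>j\<le>d. X (drop i u, take j v) * Y (take i u, drop j v)) = (\<Sum>j\<le>d. if j = d - i then X (drop i u, take (d - i) v) * Y (take i u, drop (d - i) v) else 0)"
        by (rule sum.cong[OF refl])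
      then show "(\<Sum>j\<le>d. X (drop i u, take j v) * Y (take i u, drop j v)) = X (drop i u, take (d - i) v) * Y (take i u, drop (d - i) v)"
        by simp
    qed
    moreover have "Re (X a * Y b) = Re (X a) * Re (Y b)" for a b
      using bal_real[OF X, of "fst a" "snd a"] by (auto elim!: Reals_cases)
    ultimately show ?thesis by (simp only: scaleR_sum_left Re_sum append_take_drop_id)
  qed
  have "rho d (tmul X Y) = (\<Sum>u\<in>words ?M d. \<Sum>v\<in>words ?B d. \<Sum>i\<le>d. ?g (take i u) (drop i u) (take (d - i) v) (drop (d - i) v))"
    unfolding rho_def by (intro sum.cong refl inner)
  also have "\<dots> = (\<Sum>u\<in>words ?M d. \<Sum>i\<le>d. \<Sum>v\<in>words ?B d. ?g (take i u) (drop i u) (take (d - i) v) (drop (d - i) v))"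
    by (rule sum.cong[OF refl], rule sum.swap)
  also have "\<dots> = (\<Sum>i\<le>d. \<Sum>u\<in>words ?M d. \<Sum>v\<in>words ?B d. ?g (take i u) (drop i u) (take (d - i) v) (drop (d - i) v))"
    by (rule sum.swap)
  also have "\<dots> = (\<Sum>i\<le>d. rho i Y * rho (d - i) X)"
  proof (rule sum.cong[OF refl])
    fix i assume "i \<in> {..d}"
    then have d: "i + (d - i) = d" "(d - i) + i = d" by auto
    have 1: "(\<Sum>v\<in>words ?B d. ?g x y (take (d - i) v) (drop (d - i) v)) = (\<Sum>x'\<in>words ?B (d - i). \<Sum>y'\<in>words ?B i. ?g x y x' y')" for x y
      using sum_words_add[of "?g x y" "d - i" ?B i] unfolding d .
    have 2: "(\<Sum>u\<in>words ?M d. G (take i u) (drop i u)) = (\<Sum>x\<in>words ?M i. \<Sum>y\<in>words ?M (d - i). G x y)" for G :: "_ \<Rightarrow> _ \<Rightarrow> alg bimod"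
      using sum_words_add[of G i ?M "d - i"] unfolding d .
    have "(\<Sum>u\<in>words ?M d. \<Sum>v\<in>words ?B d. ?g (take i u) (drop i u) (take (d - i) v) (drop (d - i) v))
       = (\<Sum>x\<in>words ?M i. \<Sum>y\<in>words ?M (d - i). \<Sum>x'\<in>words ?B (d - i). \<Sum>y'\<in>words ?B i. ?g x y x' y')" unfolding 1 by (rule 2)
    also have "\<dots> = (\<Sum>x\<in>words ?M i. \<Sum>y\<in>words ?M (d - i). \<Sum>y'\<in>words ?B i. \<Sum>x'\<in>words ?B (d - i).
        (Re (Y (x, y')) *\<^sub>R ?r x y') * (Re (X (y, x')) *\<^sub>R ?r y x'))"
      unfolding r by (intro sum.cong[OF refl], subst sum.swap) (simp add: mult.commute)
    also have "\<dots> = (\<Sum>x\<in>words ?M i. \<Sum>y'\<in>words ?B i. \<Sum>y\<in>words ?M (d - i). \<Sum>x'\<in>words ?B (d - i).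
        (Re (Y (x, y')) *\<^sub>R ?r x y') * (Re (X (y, x')) *\<^sub>R ?r y x'))"
      by (rule sum.cong[OF refl], rule sum.swap)
    also have "\<dots> = rho i Y * rho (d - i) X"
      unfolding rho_def sum_distrib_right unfolding sum_distrib_left ..
    finally show "(\<Sum>u\<in>words ?M d. \<Sum>v\<in>words ?B d. ?g (take i u) (drop i u) (take (d - i) v) (drop (d - i) v)) = rho i Y * rho (d - i) X" .
  qed
  finally show ?thesis .
qed

end

section \<open>The kernel\<close>

definition tw :: "gen list \<Rightarrow> gen list \<Rightarrow> tens" where "tw u v uv = (if uv = (u, v) then 1 else 0)"

lemma barg_barg [simp]: "barg (barg g) = g"
  by (cases g) auto

definition bw :: "gen list \<Rightarrow> gen list" where "bw w = rev (map barg w)"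

lemma bw_bw [simp]: "bw (bw w) = w"
  by (simp add: bw_def rev_map o_def)

lemma bal_tw: "length u = length v \<Longrightarrow> set u \<subseteq> mat_alph n \<Longrightarrow> set v \<subseteq> bar_alph n \<Longrightarrow> bal n (tw u v)"
  by (rule balI) (auto simp: tw_def split: if_splits)

lemma barg_mat [simp]: "barg g \<in> bar_alph n \<longleftrightarrow> g \<in> mat_alph n"
  by (cases g) (auto simp: mat_alph_def bar_alph_def)

lemma invs_append_less: "(\<And>x y. x \<in> set u \<Longrightarrow> y \<in> set v \<Longrightarrow> x < y) \<Longrightarrow> invs (u @ v) = invs u + invs v"
proof (induction u)
  case (Cons a u)
  have "filter (\<lambda>y. y < a) v = []" using Cons.prems[of a] by (auto simp: filter_empty_conv dest: less_asym)
  then show ?case using Cons by simp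
qed simp

lemma sort_append_less:
  fixes u v :: "'a::linorder list"
  assumes "\<And>x y. x \<in> set u \<Longrightarrow> y \<in> set v \<Longrightarrow> x < y" shows "sort (u @ v) = sort u @ sort v"
  by (rule properties_for_sort) (use assms in \<open>auto simp: sorted_append intro: less_imp_le\<close>)

lemma sorted_block:
  fixes a :: "nat list"
  shows "sorted a \<Longrightarrow> (\<And>x. x \<in> set a \<Longrightarrow> x \<le> Suc m) \<Longrightarrow>
    filter (\<lambda>x. x \<le> m) a @ replicate (length a - length (filter (\<lambda>x. x \<le> m) a)) (Suc m) = a"
proof (induction a)
  case (Cons x a)
  show ?case
  proof (cases "x \<le> m")
    case True
    then show ?thesis using Cons by simp
  next
    case False
    then have "x = Suc m" using Cons.prems(2)[of x] by simp
    moreover from this have a: "y = Suc m" if "y \<in> set a" for y using Cons.prems that by force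
    then have "filter (\<lambda>x. x \<le> m) a = []" by (fastforce simp: filter_empty_conv)
    moreover have "replicate (length a) (Suc m) = a" using a by (simp add: replicate_length_same)
    ultimately show ?thesis by simp
  qed
qed simp

text \<open>The final block of letters \<open>Suc m\<close> is split off, leaving a sorted word in
  the letters up to \<open>m\<close>; this drives the recursion \<open>Gf_Suc\<close>.\<close>

lemma sum_sorted_Suc:
  "(\<Sum>a\<in>{a \<in> LL (Suc m) d. sorted a}. f a) = (\<Sum>k\<le>d. \<Sum>a\<in>{a \<in> LL m k. sorted a}. f (a @ replicate (d - k) (Suc m)))"
proof -
  have "(\<Sum>a\<in>{a \<in> LL (Suc m) d. sorted a}. f a)
     = (\<Sum>z\<in>(SIGMA k:{..d}. {a \<in> LL m k. sorted a}). f (snd z @ replicate (d - fst z) (Suc m)))"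
  proof (rule sum.reindex_bij_witness[of _ "\<lambda>z. snd z @ replicate (d - fst z) (Suc m)"
        "\<lambda>a. (length (filter (\<lambda>x. x \<le> m) a), filter (\<lambda>x. x \<le> m) a)"])
    fix a assume "a \<in> {a \<in> LL (Suc m) d. sorted a}"
    then have a: "length a = d" "sorted a" "\<And>x. x \<in> set a \<Longrightarrow> 1 \<le> x \<and> x \<le> Suc m" by (auto simp: LL_def ix_def)
    have b: "filter (\<lambda>x. x \<le> m) a @ replicate (length a - length (filter (\<lambda>x. x \<le> m) a)) (Suc m) = a"
      using a by (intro sorted_block) auto
    show "snd (length (filter (\<lambda>x. x \<le> m) a), filter (\<lambda>x. x \<le> m) a) @ replicate (d - fst (length (filter (\<lambda>x. x \<le> m) a), filter (\<lambda>x. x \<le> m) a)) (Suc m) = a"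
      using b a(1) by simp
    then show "f (snd (length (filter (\<lambda>x. x \<le> m) a), filter (\<lambda>x. x \<le> m) a) @ replicate (d - fst (length (filter (\<lambda>x. x \<le> m) a), filter (\<lambda>x. x \<le> m) a)) (Suc m)) = f a"
      by simp
    show "(length (filter (\<lambda>x. x \<le> m) a), filter (\<lambda>x. x \<le> m) a) \<in> (SIGMA k:{..d}. {a \<in> LL m k. sorted a})"
      using a by (auto simp: LL_def ix_def sorted_filter[where f="\<lambda>x. x", simplified])
  next
    fix z assume z: "z \<in> (SIGMA k:{..d}. {a \<in> LL m k. sorted a})"
    then have l: "fst z \<le> d" "length (snd z) = fst z" "sorted (snd z)" and s: "\<And>x. x \<in> set (snd z) \<Longrightarrow> 1 \<le> x \<and> x \<le> m"
      by (auto simp: LL_def ix_def)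
    have "filter (\<lambda>x. x \<le> m) (snd z @ replicate (d - fst z) (Suc m)) = snd z" using s by (simp add: filter_id_conv)
    then show "(length (filter (\<lambda>x. x \<le> m) (snd z @ replicate (d - fst z) (Suc m))), filter (\<lambda>x. x \<le> m) (snd z @ replicate (d - fst z) (Suc m))) = z"
      using l(2) by (simp add: prod_eq_iff)
    show "snd z @ replicate (d - fst z) (Suc m) \<in> {a \<in> LL (Suc m) d. sorted a}"
      using l s by (force simp: LL_def ix_def sorted_append)
  qed
  also have "\<dots> = (\<Sum>k\<le>d. \<Sum>a\<in>{a \<in> LL m k. sorted a}. f (a @ replicate (d - k) (Suc m)))"
    by (subst sum.Sigma) (auto simp: case_prod_unfold)
  finally show ?thesis .
qed

lemma zip_replicate_map: "zip (replicate (length g) x) g = map (Pair x) g"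
  by (induction g) auto

lemma sort_map_Pair: "sort (map (Pair x) g) = map (Pair x) (sort g)" for x :: nat and g :: "nat list"
  by (rule properties_for_sort) (auto simp: sorted_map less_eq_prod_def)

lemma invs_map_Pair: "invs (map (Pair x) g) = invs g" for x :: nat and g :: "nat list"
  by (induction g) (auto simp: filter_map o_def less_prod_def)

definition Sub :: "nat \<Rightarrow> nat \<Rightarrow> nat set set" where "Sub n k = {J. J \<subseteq> ix n \<and> card J = k}"

lemma finite_Sub [simp]: "finite (Sub n k)"
  unfolding Sub_def by (rule finite_subset[of _ "Pow (ix n)"]) auto

lemma Sub_finite: "J \<in> Sub n k \<Longrightarrow> finite J"
  unfolding Sub_def using finite_subset[OF _ finite_ix] by blast

lemma SubD: "J \<in> Sub n k \<Longrightarrow> finite J \<and> J \<subseteq> ix n \<and> card J = k"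
  using Sub_finite unfolding Sub_def by blast

lemma sum_distinct_LL:
  assumes "\<And>p. p \<in> LL n k \<Longrightarrow> \<not> distinct p \<Longrightarrow> f p = 0"
  shows "(\<Sum>p\<in>LL n k. f p) = (\<Sum>J\<in>Sub n k. \<Sum>p\<in>permutations_of_set J. f p)"
proof -
  have "(\<Sum>p\<in>LL n k. f p) = (\<Sum>p\<in>{p \<in> LL n k. distinct p}. f p)"
    using assms by (intro sum.mono_neutral_right) auto
  also have "\<dots> = (\<Sum>J\<in>Sub n k. \<Sum>p\<in>{p \<in> {p \<in> LL n k. distinct p}. set p = J}. f p)"
    by (rule sum.group[symmetric]) (simp, simp, auto simp: LL_def Sub_def distinct_card)
  also have "\<dots> = (\<Sum>J\<in>Sub n k. \<Sum>p\<in>permutations_of_set J. f p)"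
    by (intro sum.cong refl) (auto simp: LL_def Sub_def permutations_of_set_def distinct_card)
  finally show ?thesis .
qed

lemma sort_perm_set: "p \<in> permutations_of_set J \<Longrightarrow> sort p = sorted_list_of_set J"
  by (metis permutations_of_setD sorted_list_of_set_sort_remdups distinct_remdups_id)

lemma perm_set_length: "p \<in> permutations_of_set J \<Longrightarrow> length p = card J"
  by (auto simp: permutations_of_set_def distinct_card)

section \<open>The image of the kernel under the pairing\<close>

context qp
begin

lemma trk_sort: "trk \<kappa> t l = (\<Sum>j\<in>LL n l. eps \<kappa> j *\<^sub>R Tw t (sort j) j)"
  unfolding trk_def EE_def sum_LL_sort
proof (intro sum.cong refl)
  fix g j assume "g \<in> {g \<in> LL n l. sorted g}" "j \<in> permutations_of_multiset (mset g)"
  then have "sort j = g" by (intro properties_for_sort) (auto simp: permutations_of_multiset_def)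
  then show "eps \<kappa> j *\<^sub>R Tw t g j = eps \<kappa> j *\<^sub>R Tw t (sort j) j" by simp
qed

lemma trk_minor: "trk nk t k = (\<Sum>J\<in>Sub n k. minor t (sorted_list_of_set J) J)"
proof -
  have "trk nk t k = (\<Sum>J\<in>Sub n k. \<Sum>p\<in>permutations_of_set J. eps nk p *\<^sub>R Tw t (sort p) p)"
    unfolding trk_sort by (rule sum_distinct_LL) (simp add: eps_nk_not_distinct)
  also have "\<dots> = (\<Sum>J\<in>Sub n k. minor t (sorted_list_of_set J) J)"
    unfolding minor_def
    by (intro sum.cong refl) (auto simp: sort_perm_set eps_nk_distinct permutations_of_setD)
  finally show ?thesis .
qed

lemma trk_nk_0: "trk nk t 0 = 1"
  by (simp add: trk_sort eps_def)

lemma trk_nk_large: "n < k \<Longrightarrow> trk nk t k = 0"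
proof -
  assume "n < k"
  have "Sub n k = {}"
  proof (rule equals0I)
    fix J assume "J \<in> Sub n k"
    then have "J \<subseteq> ix n" "card J = k" by (simp_all add: Sub_def)
    then show False using card_mono[OF finite_ix, of J n] \<open>n < k\<close> by simp
  qed
  then show ?thesis by (simp add: trk_minor)
qed

text \<open>The scaling by \<open>q^(al - n)\<close> in \<open>theta\<close>, accumulated over a
  word of column indices.\<close>

definition wq :: "nat list \<Rightarrow> real" where "wq i = prod_list (map (\<lambda>a. q powi (int a - int n)) i)"

definition Rs :: "nat \<Rightarrow> nat \<Rightarrow> alg bimod" where "Rs a b = Rl (sO a b)"

lemma qm_Rs: "qm Rs"
  unfolding Rs_def[abs_def] by (rule qm_Rl_sm[OF sO_rules])

lemma Tw_Rs: "length i = length j \<Longrightarrow> Tw Rs i j = Rl (Sw sO i j)"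
  unfolding Rs_def[abs_def] by (rule Tw_Rl)

text \<open>Up to the row scaling coming from \<open>theta\<close> a product of two commuting
  quantum matrices, the antipode and the generators, so that \<open>qm_prod\<close> applies. Its
  trace is the image of \<open>chi n q 1\<close>.\<close>

definition tau :: "nat \<Rightarrow> nat \<Rightarrow> alg bimod" where
  "tau a b = q powi (int a - int n) *\<^sub>R (\<Sum>c\<in>ix n. Rs a c * Lt c b)"

lemma Lt_Rs: "Lt a b * Rs c d = Rs c d * Lt a b"
  by (simp add: Rs_def Rl_Lm)

lemma qm_tau: "qm tau"
  unfolding tau_def[abs_def] by (intro qm_scale_rows qm_prod qm_Rs qm_Lt Lt_Rs)

lemma Tw_tau: "length i = length j \<Longrightarrow> Tw tau i j = wq i *\<^sub>R (\<Sum>k\<in>LL n (length i). Rl (Sw sO i k) * Lm (Tw tO k j))"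
proof -
  assume l: "length i = length j"
  have w: "length i = length j \<Longrightarrow> prod_list (map2 (\<lambda>a b. q powi (int a - int n)) i j) = wq i" for i j :: "nat list"
    by (induction i j rule: list_induct2) (auto simp: wq_def)
  have "Tw tau i j = wq i *\<^sub>R Tw (\<lambda>a b. \<Sum>c\<in>ix n. Rs a c * Lt c b) i j"
    unfolding tau_def[abs_def] by (subst Tw_scale[OF l]) (simp add: w[OF l])
  also have "Tw (\<lambda>a b. \<Sum>c\<in>ix n. Rs a c * Lt c b) i j = (\<Sum>k\<in>LL n (length i). Rl (Sw sO i k) * Lm (Tw tO k j))"
    using l by (subst Tw_prod[OF Lt_Rs]) (auto intro!: sum.cong simp: Tw_Rs Tw_Lm LL_length)
  finally show ?thesis .
qed

lemma Th_bw: "length a = length j \<Longrightarrow> Th (bw (zw a j)) = wq j *\<^sub>R Sw sO j a"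
  by (induction a j rule: list_induct2) (auto simp: Th_def bw_def wq_def)

lemma rho_tw:
  "rho d (tw u v) = (if u \<in> words (mat_alph n) d \<and> v \<in> words (bar_alph n) d then Lm (WO u) * Rl (Th v) else 0)"
proof -
  let ?f = "\<lambda>u v. Lm (WO u) * Rl (Th v)"
  have "(\<Sum>y\<in>words (bar_alph n) d. Re (tw u v (x, y)) *\<^sub>R ?f x y) = (if x = u then if v \<in> words (bar_alph n) d then ?f u v else 0 else 0)" for x
  proof (cases "x = u")
    case True
    then have "(\<Sum>y\<in>words (bar_alph n) d. Re (tw u v (x, y)) *\<^sub>R ?f x y) = (\<Sum>y\<in>words (bar_alph n) d. if y = v then ?f u v else 0)"
      by (intro sum.cong refl) (simp add: tw_def)
    also have "\<dots> = (if v \<in> words (bar_alph n) d then ?f u v else 0)" by (rule sum.delta) simp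
    finally show ?thesis using True by simp
  qed (simp add: tw_def)
  then have "rho d (tw u v) = (\<Sum>x\<in>words (mat_alph n) d. if x = u then if v \<in> words (bar_alph n) d then ?f u v else 0 else 0)"
    unfolding rho_def by (rule sum.cong[OF refl])
  also have "\<dots> = (if u \<in> words (mat_alph n) d \<and> v \<in> words (bar_alph n) d then ?f u v else 0)"
    by (simp add: sum.delta)
  finally show ?thesis .
qed

lemma chi_tw:
  "chi n q k = tsum (Sub n k \<times> Sub n k) (\<lambda>J. tsum (permutations_of_set (fst J) \<times> permutations_of_set (fst J))
     (\<lambda>j. tsc (of_real ((- q) ^ invs (fst j) * (- q) ^ invs (snd j)))
        (tw (zw (sorted_list_of_set (snd J)) (fst j)) (bw (zw (sorted_list_of_set (snd J)) (snd j))))))"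
proof
  fix uv :: "gen list \<times> gen list"
  obtain u v where uv: "uv = (u, v)" by (cases uv)
  let ?s = sorted_list_of_set
  have S: "{(J1, J2). J1 \<subseteq> {1..n} \<and> J2 \<subseteq> {1..n} \<and> card J1 = k \<and> card J2 = k} = Sub n k \<times> Sub n k"
    by (auto simp: Sub_def ix_def)
  have t: "tpure (qminor q J2 J1) (pstar (qminor q J2 J1)) (u, v)
     = (\<Sum>j\<in>permutations_of_set J1 \<times> permutations_of_set J1. tsc (of_real ((- q) ^ invs (fst j) * (- q) ^ invs (snd j)))
        (tw (zw (?s J2) (fst j)) (bw (zw (?s J2) (snd j)))) (u, v))"
    if J: "J1 \<in> Sub n k" "J2 \<in> Sub n k" for J1 J2
  proof -
    have fin: "finite J1" "finite J2" "card J2 = card J1" using SubD[OF J(1)] SubD[OF J(2)] by simp_all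
    have m: "qminor q J2 J1 w = (\<Sum>j\<in>permutations_of_set J1. of_real ((- q) ^ invs j) * (if w = zw (?s J2) j then 1 else 0))" for w
      unfolding qminor_list[OF fin(2,1,3)] by (simp add: psum_def psc_def pword_def)
    have b: "bw v = w \<longleftrightarrow> v = bw w" for w using bw_bw[of v] bw_bw[of w] by auto
    have "pstar (qminor q J2 J1) v = (\<Sum>j\<in>permutations_of_set J1. of_real ((- q) ^ invs j) * (if v = bw (zw (?s J2) j) then 1 else 0))"
      unfolding pstar_def bw_def[symmetric] m b by (simp add: if_distrib[where f=cnj] cong: if_cong)
    then have "tpure (qminor q J2 J1) (pstar (qminor q J2 J1)) (u, v) = (\<Sum>i\<in>permutations_of_set J1. \<Sum>j\<in>permutations_of_set J1.
       (of_real ((- q) ^ invs i) * (if u = zw (?s J2) i then 1 else 0)) * (of_real ((- q) ^ invs j) * (if v = bw (zw (?s J2) j) then 1 else 0)))"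
      by (simp only: tpure_def fst_conv snd_conv m sum_product)
    also have "\<dots> = (\<Sum>j\<in>permutations_of_set J1 \<times> permutations_of_set J1. tsc (of_real ((- q) ^ invs (fst j) * (- q) ^ invs (snd j)))
        (tw (zw (?s J2) (fst j)) (bw (zw (?s J2) (snd j)))) (u, v))"
      unfolding sum.cartesian_product by (intro sum.cong refl) (auto simp: tsc_def tw_def)
    finally show ?thesis .
  qed
  show "chi n q k uv = tsum (Sub n k \<times> Sub n k) (\<lambda>J. tsum (permutations_of_set (fst J) \<times> permutations_of_set (fst J))
     (\<lambda>j. tsc (of_real ((- q) ^ invs (fst j) * (- q) ^ invs (snd j)))
        (tw (zw (?s (snd J)) (fst j)) (bw (zw (?s (snd J)) (snd j)))))) uv"
    unfolding uv chi_def S unfolding tsum_def by (intro sum.cong refl) (auto simp: t)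
qed

lemma chi_word:
  assumes "J1 \<in> Sub n k" "J2 \<in> Sub n k" "i \<in> permutations_of_set J1"
  shows "length (sorted_list_of_set J2) = length i" "sorted_list_of_set J2 \<in> LL n k" "i \<in> LL n k"
    "zw (sorted_list_of_set J2) i \<in> words (mat_alph n) k" "bw (zw (sorted_list_of_set J2) i) \<in> words (bar_alph n) k"
proof -
  have fin: "finite J2" "J2 \<subseteq> ix n" "card J2 = k" "J1 \<subseteq> ix n" "card J1 = k" using SubD[OF assms(1)] SubD[OF assms(2)] by simp_all
  show l: "length (sorted_list_of_set J2) = length i"
    using fin by (simp add: perm_set_length[OF assms(3)])
  show L: "sorted_list_of_set J2 \<in> LL n k" "i \<in> LL n k"
    using fin perm_set_length[OF assms(3)] permutations_of_setD[OF assms(3)] by (simp_all add: LL_def)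
  have "length (zw (sorted_list_of_set J2) i) = k" using l L by (simp add: zw_def LL_length)
  moreover have m: "set (zw (sorted_list_of_set J2) i) \<subseteq> mat_alph n" using zw_mat_alph[OF l] L by (simp add: LL_def)
  ultimately show "zw (sorted_list_of_set J2) i \<in> words (mat_alph n) k" "bw (zw (sorted_list_of_set J2) i) \<in> words (bar_alph n) k"
    by (auto simp: words_def bw_def)
qed

lemma bal_chi: "bal n (chi n q k)"
  unfolding chi_tw
proof (intro bal_tsum bal_tsc bal_tw)
  fix J j assume "J \<in> Sub n k \<times> Sub n k" "j \<in> permutations_of_set (fst J) \<times> permutations_of_set (fst J)"
  then have "fst J \<in> Sub n k" "snd J \<in> Sub n k" "fst j \<in> permutations_of_set (fst J)" "snd j \<in> permutations_of_set (fst J)" by auto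
  note c = chi_word[OF this(1,2,3)] chi_word[OF this(1,2,4)]
  show "length (zw (sorted_list_of_set (snd J)) (fst j)) = length (bw (zw (sorted_list_of_set (snd J)) (snd j)))"
    "set (zw (sorted_list_of_set (snd J)) (fst j)) \<subseteq> mat_alph n" "set (bw (zw (sorted_list_of_set (snd J)) (snd j))) \<subseteq> bar_alph n"
    using c(4,10) by (auto simp: words_def)
qed (rule Reals_of_real)

lemma chi_Nil: "1 \<le> k \<Longrightarrow> chi n q k ([], []) = 0"
proof -
  assume "1 \<le> k"
  have "tw (zw (sorted_list_of_set (snd J)) (fst j)) (bw (zw (sorted_list_of_set (snd J)) (snd j))) ([], []) = 0"
    if "J \<in> Sub n k \<times> Sub n k" "j \<in> permutations_of_set (fst J) \<times> permutations_of_set (fst J)" for J j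
    using chi_word(4)[of "fst J" k "snd J" "fst j"] that \<open>1 \<le> k\<close> by (auto simp: tw_def words_def)
  then show ?thesis unfolding chi_tw tsum_def tsc_def by (intro sum.neutral ballI) simp
qed

text \<open>Cauchy-Binet: a principal minor of \<open>tau\<close> is a sum of products of a minor of
  the antipode and a minor of the generators. The involution exchanges rows and columns in the
  second tensor factor, which \<open>minor_transpose\<close> undoes.\<close>

lemma rho_chi: "rho d (chi n q k) = (if d = k then trk nk tau k else 0)"
proof -
  let ?s = sorted_list_of_set and ?P = permutations_of_set
  have "rho d (chi n q k) = (\<Sum>J\<in>Sub n k \<times> Sub n k. \<Sum>j\<in>?P (fst J) \<times> ?P (fst J).
      ((- q) ^ invs (fst j) * (- q) ^ invs (snd j)) *\<^sub>R rho d (tw (zw (?s (snd J)) (fst j)) (bw (zw (?s (snd J)) (snd j)))))"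
    unfolding chi_tw rho_tsum by (simp only: rho_tsc[OF refl])
  also have "\<dots> = (\<Sum>J1\<in>Sub n k. \<Sum>J2\<in>Sub n k. \<Sum>i\<in>?P J1. \<Sum>j\<in>?P J1.
      ((- q) ^ invs i * (- q) ^ invs j) *\<^sub>R rho d (tw (zw (?s J2) i) (bw (zw (?s J2) j))))"
    by (simp only: sum.cartesian_product' fst_conv snd_conv)
  also have "\<dots> = (if d = k then trk nk tau k else 0)"
  proof (cases "d = k")
    case False
    have "rho d (tw (zw (?s J2) i) (bw (zw (?s J2) j))) = 0" if "J1 \<in> Sub n k" "J2 \<in> Sub n k" "i \<in> ?P J1" for J1 J2 i j
      using chi_word(4)[OF that] False by (simp add: rho_tw words_def)
    then show ?thesis using False by simp
  next
    case True
    have r: "rho d (tw (zw (?s J2) i) (bw (zw (?s J2) j))) = wq (?s J1) *\<^sub>R (Lm (Tw tO (?s J2) i) * Tw (\<lambda>a b. Rs b a) (?s J2) j)"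
      if J: "J1 \<in> Sub n k" "J2 \<in> Sub n k" and i: "i \<in> ?P J1" and j: "j \<in> ?P J1" for J1 J2 i j
    proof -
      note ci = chi_word[OF J i] and cj = chi_word[OF J j]
      have "mset j = mset (?s J1)" using sort_perm_set[OF j] by (metis mset_sort)
      then have w: "wq j = wq (?s J1)" unfolding wq_def by (metis mset_map prod_mset_prod_list)
      have "rho d (tw (zw (?s J2) i) (bw (zw (?s J2) j))) = Lm (Tw tO (?s J2) i) * Rl (wq j *\<^sub>R Sw sO j (?s J2))"
        using ci(4) cj(5) by (simp add: rho_tw True Th_bw[OF cj(1)] Tw_tm_LL[OF ci(2,3)])
      then show ?thesis using Tw_transpose[OF cj(1), of Rs] Tw_Rs[OF cj(1)[symmetric]] w by (simp add: Rl_hom)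
    qed
    have "(\<Sum>J1\<in>Sub n k. \<Sum>J2\<in>Sub n k. \<Sum>i\<in>?P J1. \<Sum>j\<in>?P J1.
        ((- q) ^ invs i * (- q) ^ invs j) *\<^sub>R rho d (tw (zw (?s J2) i) (bw (zw (?s J2) j))))
      = (\<Sum>J1\<in>Sub n k. \<Sum>J2\<in>Sub n k. wq (?s J1) *\<^sub>R (Lm (minor tO (?s J2) J1) * minor Rs (?s J1) J2))"
    proof (intro sum.cong refl)
      fix J1 J2 assume J: "J1 \<in> Sub n k" "J2 \<in> Sub n k"
      have "(\<Sum>i\<in>?P J1. \<Sum>j\<in>?P J1. ((- q) ^ invs i * (- q) ^ invs j) *\<^sub>R rho d (tw (zw (?s J2) i) (bw (zw (?s J2) j))))
        = (\<Sum>i\<in>?P J1. \<Sum>j\<in>?P J1. wq (?s J1) *\<^sub>R (((- q) ^ invs i *\<^sub>R Lm (Tw tO (?s J2) i)) * ((- q) ^ invs j *\<^sub>R Tw (\<lambda>a b. Rs b a) (?s J2) j)))"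
        by (intro sum.cong refl) (simp add: r[OF J] mult.commute)
      also have "\<dots> = wq (?s J1) *\<^sub>R (Lm (minor tO (?s J2) J1) * minor (\<lambda>a b. Rs b a) (?s J2) J1)"
        unfolding minor_def Lm_sum Lm_hom sum_product scaleR_sum_right ..
      also have "minor (\<lambda>a b. Rs b a) (?s J2) J1 = minor Rs (?s J1) J2"
        using SubD[OF J(1)] SubD[OF J(2)] by (intro minor_transpose[OF qm_Rs]) simp_all
      finally show "(\<Sum>i\<in>?P J1. \<Sum>j\<in>?P J1. ((- q) ^ invs i * (- q) ^ invs j) *\<^sub>R rho d (tw (zw (?s J2) i) (bw (zw (?s J2) j))))
        = wq (?s J1) *\<^sub>R (Lm (minor tO (?s J2) J1) * minor Rs (?s J1) J2)" .
    qed
    also have "\<dots> = (\<Sum>J\<in>Sub n k. minor tau (?s J) J)"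
    proof (rule sum.cong[OF refl])
      fix J assume J: "J \<in> Sub n k"
      have fJ: "finite J" "card J = k" using SubD[OF J] by simp_all
      have ms: "minor tO p J = (if distinct p then (- q) ^ invs p *\<^sub>R minor tO (sort p) J else 0)" if "length p = k" for p
        using that fJ by (intro minor_sort[OF qm_tO]) auto
      have "minor tau (?s J) J = (\<Sum>j\<in>?P J. (- q) ^ invs j *\<^sub>R (wq (?s J) *\<^sub>R (\<Sum>p\<in>LL n k. Rl (Sw sO (?s J) p) * Lm (Tw tO p j))))"
        unfolding minor_def using chi_word[OF J J] fJ by (intro sum.cong refl) (simp add: Tw_tau LL_length)
      also have "\<dots> = wq (?s J) *\<^sub>R (\<Sum>p\<in>LL n k. Rl (Sw sO (?s J) p) * Lm (minor tO p J))"
        unfolding minor_def Lm_sum Lm_hom scaleR_sum_right sum_distrib_left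
        by (subst sum.swap) (simp add: mult.commute)
      also have "(\<Sum>p\<in>LL n k. Rl (Sw sO (?s J) p) * Lm (minor tO p J)) = (\<Sum>I\<in>Sub n k. \<Sum>p\<in>?P I. Rl (Sw sO (?s J) p) * Lm (minor tO p J))"
        by (rule sum_distinct_LL) (simp add: ms LL_length)
      also have "\<dots> = (\<Sum>I\<in>Sub n k. Lm (minor tO (?s I) J) * minor Rs (?s J) I)"
      proof (rule sum.cong[OF refl])
        fix I assume I: "I \<in> Sub n k"
        have "(\<Sum>p\<in>?P I. Rl (Sw sO (?s J) p) * Lm (minor tO p J)) = (\<Sum>p\<in>?P I. Lm (minor tO (?s I) J) * ((- q) ^ invs p *\<^sub>R Tw Rs (?s J) p))"
        proof (rule sum.cong[OF refl])
          fix p assume p: "p \<in> ?P I"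
          have "length p = k" "distinct p" using p I by (auto simp: perm_set_length Sub_def permutations_of_setD)
          then show "Rl (Sw sO (?s J) p) * Lm (minor tO p J) = Lm (minor tO (?s I) J) * ((- q) ^ invs p *\<^sub>R Tw Rs (?s J) p)"
            using fJ by (simp add: ms sort_perm_set[OF p] Lm_hom Tw_Rs Rl_Lm)
        qed
        then show "(\<Sum>p\<in>?P I. Rl (Sw sO (?s J) p) * Lm (minor tO p J)) = Lm (minor tO (?s I) J) * minor Rs (?s J) I"
          by (simp add: minor_def sum_distrib_left)
      qed
      finally show "(\<Sum>I\<in>Sub n k. wq (?s J) *\<^sub>R (Lm (minor tO (?s I) J) * minor Rs (?s J) I)) = minor tau (?s J) J"
        by (simp add: scaleR_sum_right)
    qed
    finally show ?thesis using True by (simp add: trk_minor)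
  qed
  finally show ?thesis .
qed

definition Fj :: "nat \<Rightarrow> tens" where
  "Fj j = tadd tone (tsum {1..n} (\<lambda>k. tsc ((- (of_real q ^ (2 * j))) ^ k) (chi n q k)))"

lemma Cq_Fj: "Cq n q = foldr (\<lambda>j acc. tmul (tinv (Fj j)) acc) [0..<n] tone"
  by (simp add: Cq_def Fj_def)

lemma bal_Fj: "bal n (Fj j)"
  unfolding Fj_def
proof (intro bal_add bal_tone bal_tsum bal_tsc bal_chi)
  show "(- (complex_of_real q ^ (2 * j))) ^ k \<in> \<real>" for k by (intro Reals_power Reals_minus Reals_of_real)
qed

lemma Fj_Nil: "Fj j ([], []) = 1"
  by (simp add: Fj_def tadd_def tsum_def tsc_def chi_Nil tone_def)

lemma rho_Fj: "rho d (Fj j) = ((- 1) ^ d * q ^ (2 * j * d)) *\<^sub>R trk nk tau d"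
proof -
  have e: "(- (complex_of_real q ^ (2 * j))) ^ k = of_real ((- 1) ^ k * q ^ (2 * j * k))" for k
  proof -
    have "(- (complex_of_real q ^ (2 * j))) ^ k = (- 1) ^ k * (complex_of_real q ^ (2 * j)) ^ k" by (rule power_minus)
    also have "(complex_of_real q ^ (2 * j)) ^ k = complex_of_real q ^ (2 * j * k)" by (rule power_mult[symmetric])
    finally show ?thesis by (simp only: of_real_mult of_real_power of_real_minus of_real_1)
  qed
  have "rho d (Fj j) = (if d = 0 then 1 else 0) + (\<Sum>k\<in>{1..n}. if k = d then ((- 1) ^ d * q ^ (2 * j * d)) *\<^sub>R trk nk tau d else 0)"
    unfolding Fj_def rho_tadd rho_tone rho_tsum
    by (intro arg_cong2[where f="(+)"] sum.cong refl) (simp add: rho_tsc[OF e] rho_chi)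
  then show ?thesis by (auto simp: sum.delta trk_nk_0 trk_nk_large not_le Suc_le_eq)
qed

text \<open>The components of the identity \<open>tmul (tinv (Fj j)) (Fj j) = tone\<close> form a
  recursion. By \<open>macmahon\<close> the complete symmetric traces satisfy the same one, the
  exponent of \<open>q\<close> being additive in the degree.\<close>

lemma rho_tinv_Fj: "rho d (tinv (Fj j)) = q ^ (2 * j * d) *\<^sub>R trk q tau d"
proof (induction d rule: less_induct)
  case (less d)
  let ?Y = "tinv (Fj j)"
  have "rho d (tmul ?Y (Fj j)) = (if d = 0 then 1 else 0)"
    unfolding tinv_eq(2)[where X="Fj j", OF Fj_Nil] by (rule rho_tone)
  then have eq: "(\<Sum>i\<le>d. rho i (Fj j) * rho (d - i) ?Y) = (if d = 0 then 1 else 0)"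
    unfolding rho_tmul[OF bal_tinv[OF bal_Fj Fj_Nil] bal_Fj] .
  show ?case
  proof (cases d)
    case 0
    then show ?thesis using eq by (simp add: rho_Fj trk_nk_0) (simp add: trk_sort eps_def)
  next
    case (Suc e)
    have split: "(\<Sum>i\<le>d. f i) = f 0 + (\<Sum>i<d. f (Suc i))" for f :: "nat \<Rightarrow> alg bimod"
      unfolding Suc sum.atMost_Suc_shift lessThan_Suc_atMost ..
    have "(\<Sum>i<d. rho (Suc i) (Fj j) * rho (d - Suc i) ?Y)
       = (\<Sum>i<d. q ^ (2 * j * d) *\<^sub>R ((- 1) ^ Suc i *\<^sub>R (trk nk tau (Suc i) * trk q tau (d - Suc i))))"
    proof (rule sum.cong[OF refl])
      fix i assume "i \<in> {..<d}"
      then have i: "d - Suc i < d" "Suc i + (d - Suc i) = d" by auto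
      have "q ^ (2 * j * Suc i) * q ^ (2 * j * (d - Suc i)) = q ^ (2 * j * d)"
        by (simp only: power_add[symmetric] distrib_left[symmetric] i(2))
      then show "rho (Suc i) (Fj j) * rho (d - Suc i) ?Y = q ^ (2 * j * d) *\<^sub>R ((- 1) ^ Suc i *\<^sub>R (trk nk tau (Suc i) * trk q tau (d - Suc i)))"
        unfolding rho_Fj less.IH[OF i(1)] by (simp only: mult_scaleR_left mult_scaleR_right scaleR_scaleR ac_simps)
    qed
    also have "\<dots> = q ^ (2 * j * d) *\<^sub>R (\<Sum>i<d. (- 1) ^ Suc i *\<^sub>R (trk nk tau (Suc i) * trk q tau (d - Suc i)))"
      by (rule scaleR_sum_right[symmetric])
    also have "(\<Sum>i<d. (- 1) ^ Suc i *\<^sub>R (trk nk tau (Suc i) * trk q tau (d - Suc i))) = - trk q tau d"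
      using macmahon[OF qm_tau, of d] Suc unfolding split by (simp add: trk_nk_0 eq_neg_iff_add_eq_0 add.commute)
    finally have "rho d ?Y - q ^ (2 * j * d) *\<^sub>R trk q tau d = 0"
      using eq Suc unfolding split by (simp add: rho_Fj trk_nk_0)
    then show ?thesis by simp
  qed
qed

text \<open>Column indices of the ordered monomial made from the pairs of \<open>a\<close> and
  \<open>g\<close>. For sorted \<open>a\<close> this sorts \<open>g\<close> within the blocks of
  equal letters of \<open>a\<close>.\<close>

definition bs :: "nat list \<Rightarrow> nat list \<Rightarrow> nat list" where "bs a g = map snd (sort (zip a g))"

definition wa :: "nat list \<Rightarrow> real" where "wa a = prod_list (map (\<lambda>x. q ^ (2 * (n - x))) a)"

text \<open>The factor of \<open>Cq\<close> with index \<open>j\<close> contributes the entries \<open>n - j\<close> of the sorted list \<open>a\<close>, whence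
  the weights \<open>q\<^sup>2\<^sup>j\<close> in \<open>wa\<close>.\<close>
definition Gf :: "nat \<Rightarrow> nat \<Rightarrow> alg bimod" where
  "Gf m d = (\<Sum>a\<in>{a \<in> LL m d. sorted a}. wa a *\<^sub>R (\<Sum>g\<in>LL n d. (1 / q) ^ invs (zip a g) *\<^sub>R Tw tau (bs a g) g))"

lemma Gf_0: "Gf 0 d = (if d = 0 then 1 else 0)"
proof -
  have "{a \<in> LL 0 d. sorted a} = (if d = 0 then {[]} else {})" by (auto simp: LL_def ix_def)
  then show ?thesis by (simp add: Gf_def wa_def bs_def)
qed

text \<open>Pairs in the last block are larger than all others in the lexicographic order. Hence
  inversions and sorting split, and the last block alone yields \<open>trk q tau\<close>.\<close>

lemma Gf_Suc: "Gf (Suc m) d = (\<Sum>k\<le>d. Gf m k * (q ^ (2 * (n - Suc m) * (d - k)) *\<^sub>R trk q tau (d - k)))"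
  unfolding Gf_def sum_sorted_Suc
proof (rule sum.cong[OF refl])
  fix k assume "k \<in> {..d}"
  then have d: "d = k + (d - k)" by simp
  let ?l = "d - k"
  have "wa (a @ replicate ?l (Suc m)) *\<^sub>R (\<Sum>g\<in>LL n d. (1 / q) ^ invs (zip (a @ replicate ?l (Suc m)) g) *\<^sub>R Tw tau (bs (a @ replicate ?l (Suc m)) g) g)
     = (wa a *\<^sub>R (\<Sum>g\<in>LL n k. (1 / q) ^ invs (zip a g) *\<^sub>R Tw tau (bs a g) g)) * (q ^ (2 * (n - Suc m) * ?l) *\<^sub>R trk q tau ?l)"
    if "a \<in> {a \<in> LL m k. sorted a}" for a
  proof -
    have a: "length a = k" "\<And>x. x \<in> set a \<Longrightarrow> x \<le> m" using that by (auto simp: LL_def ix_def)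
    have w: "wa (a @ replicate ?l (Suc m)) = wa a * q ^ (2 * (n - Suc m) * ?l)"
      by (simp add: wa_def prod_list_replicate power_mult)
    have "(\<Sum>g\<in>LL n (k + ?l). (1 / q) ^ invs (zip (a @ replicate ?l (Suc m)) g) *\<^sub>R Tw tau (bs (a @ replicate ?l (Suc m)) g) g)
       = (\<Sum>x\<in>LL n k. \<Sum>y\<in>LL n ?l. ((1 / q) ^ invs (zip a x) *\<^sub>R Tw tau (bs a x) x) * ((1 / q) ^ invs y *\<^sub>R Tw tau (sort y) y))"
      unfolding sum_LL_add
    proof (intro sum.cong refl)
      fix x y assume xy: "x \<in> LL n k" "y \<in> LL n ?l"
      have len: "length x = k" "length y = ?l" using xy by (simp_all add: LL_length)
      have z: "zip (a @ replicate ?l (Suc m)) (x @ y) = zip a x @ map (Pair (Suc m)) y"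
        using a(1) len zip_replicate_map[of y "Suc m"] by simp
      have less: "p < r" if "p \<in> set (zip a x)" "r \<in> set (map (Pair (Suc m)) y)" for p r
      proof -
        have "(fst p, snd p) \<in> set (zip a x)" using that(1) by simp
        then have "fst p \<in> set a" by (rule set_zip_leftD)
        then show ?thesis using a(2)[of "fst p"] that(2) by (cases p) (auto simp: less_prod_def)
      qed
      have inv: "invs (zip a x @ map (Pair (Suc m)) y) = invs (zip a x) + invs y"
        using invs_append_less[of "zip a x" "map (Pair (Suc m)) y", OF less] by (simp add: invs_map_Pair)
      have b: "bs (a @ replicate ?l (Suc m)) (x @ y) = bs a x @ sort y"
      proof -
        have "sort (zip a x @ map (Pair (Suc m)) y) = sort (zip a x) @ sort (map (Pair (Suc m)) y)"
          by (rule sort_append_less) (rule less)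
        then show ?thesis unfolding bs_def z sort_map_Pair by (simp add: o_def)
      qed
      have "length (bs a x) = length x" using a(1) len by (simp add: bs_def)
      from Tw_append[OF this, of tau "sort y" y]
      show "(1 / q) ^ invs (zip (a @ replicate ?l (Suc m)) (x @ y)) *\<^sub>R Tw tau (bs (a @ replicate ?l (Suc m)) (x @ y)) (x @ y)
         = ((1 / q) ^ invs (zip a x) *\<^sub>R Tw tau (bs a x) x) * ((1 / q) ^ invs y *\<^sub>R Tw tau (sort y) y)"
        unfolding b z inv power_add by (simp only: mult_scaleR_left mult_scaleR_right scaleR_scaleR ac_simps)
    qed
    also have "\<dots> = (\<Sum>g\<in>LL n k. (1 / q) ^ invs (zip a g) *\<^sub>R Tw tau (bs a g) g) * trk q tau ?l"
      unfolding trk_sort sum_product by (simp add: eps_def)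
    finally show ?thesis unfolding w d[symmetric] by simp
  qed
  then show "(\<Sum>a\<in>{a \<in> LL m k. sorted a}. wa (a @ replicate ?l (Suc m)) *\<^sub>R (\<Sum>g\<in>LL n d. (1 / q) ^ invs (zip (a @ replicate ?l (Suc m)) g) *\<^sub>R Tw tau (bs (a @ replicate ?l (Suc m)) g) g))
     = (\<Sum>a\<in>{a \<in> LL m k. sorted a}. wa a *\<^sub>R (\<Sum>g\<in>LL n k. (1 / q) ^ invs (zip a g) *\<^sub>R Tw tau (bs a g) g)) * (q ^ (2 * (n - Suc m) * ?l) *\<^sub>R trk q tau ?l)"
    unfolding sum_distrib_right by (rule sum.cong[OF refl])
qed

text \<open>The head of the list is the outermost factor. As \<open>rho\<close> reverses products,
  it appears on the right, as the block of the largest letter in \<open>Gf_Suc\<close>.\<close>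

lemma rho_fold:
  assumes "m \<le> n"
  shows "bal n (foldr (\<lambda>j acc. tmul (tinv (Fj j)) acc) [n - m..<n] tone) \<and>
    (\<forall>d. rho d (foldr (\<lambda>j acc. tmul (tinv (Fj j)) acc) [n - m..<n] tone) = Gf m d)"
  using assms
proof (induction m)
  case 0
  then show ?case by (simp add: bal_tone rho_tone Gf_0)
next
  case (Suc m)
  let ?X = "foldr (\<lambda>j acc. tmul (tinv (Fj j)) acc) [n - m..<n] tone"
  have "[n - Suc m..<n] = (n - Suc m) # [n - m..<n]"
    using Suc.prems by (simp add: upt_conv_Cons Suc_diff_Suc)
  then have f: "foldr (\<lambda>j acc. tmul (tinv (Fj j)) acc) [n - Suc m..<n] tone = tmul (tinv (Fj (n - Suc m))) ?X" by simp
  have X: "bal n ?X" "\<And>d. rho d ?X = Gf m d" using Suc by auto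
  have Y: "bal n (tinv (Fj (n - Suc m)))" by (rule bal_tinv[OF bal_Fj Fj_Nil])
  show ?case unfolding f
    using bal_tmul[OF Y X(1)] by (simp add: rho_tmul[OF Y X(1)] X(2) rho_tinv_Fj Gf_Suc)
qed

lemma bal_Cq: "bal n (Cq n q)" and rho_Cq: "rho d (Cq n q) = Gf n d"
  using rho_fold[of n] by (simp_all add: Cq_Fj)

section \<open>The reproducing property on words\<close>

lemma RC_scaled:
  fixes \<Theta> :: "nat list \<Rightarrow> nat list \<Rightarrow> 'a::real_vector"
  assumes "RC \<Theta>" "\<And>i k. Suc k < length i \<Longrightarrow> f (swp k i) = f i" "\<And>j k. Suc k < length j \<Longrightarrow> g (swp k j) = g j"
  shows "RC (\<lambda>i j. (f i * g j) *\<^sub>R \<Theta> i j)"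
  unfolding RC_def
proof (intro allI impI)
  fix i j :: "nat list" and k assume ij: "length i = length j" "Suc k < length i"
  have "RR k (\<lambda>i. (f i * g j) *\<^sub>R \<Theta> i j) i = (f i * g j) *\<^sub>R RR k (\<lambda>i. \<Theta> i j) i"
    using assms(2) ij by (simp add: RR_def algebra_simps)
  also have "RR k (\<lambda>i. \<Theta> i j) i = RR k (\<Theta> i) j" using ij by (intro RCD[OF assms(1)])
  also have "(f i * g j) *\<^sub>R \<dots> = RR k (\<lambda>j. (f i * g j) *\<^sub>R \<Theta> i j) j"
    using assms(3) ij by (simp add: RR_def algebra_simps)
  finally show "RR k (\<lambda>i. (f i * g j) *\<^sub>R \<Theta> i j) i = RR k (\<lambda>j. (f i * g j) *\<^sub>R \<Theta> i j) j" .
qed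

lemma RC_linear:
  fixes \<Theta> :: "nat list \<Rightarrow> nat list \<Rightarrow> 'a::real_vector" and F :: "'a \<Rightarrow> 'b::real_vector"
  assumes "RC \<Theta>" "\<And>x y. F (x + y) = F x + F y" "\<And>c x. F (c *\<^sub>R x) = c *\<^sub>R F x"
  shows "RC (\<lambda>i j. F (\<Theta> i j))"
  unfolding RC_def
proof (intro allI impI)
  fix i j :: "nat list" and k assume ij: "length i = length j" "Suc k < length i"
  have F0: "F 0 = 0" by (rule scaleR_hom_zero[OF assms(3)])
  have Fif: "F (if P then x else y) = (if P then F x else F y)" for P x y by simp
  show "RR k (\<lambda>i. F (\<Theta> i j)) i = RR k (\<lambda>j. F (\<Theta> i j)) j"
    using arg_cong[OF RCD[OF assms(1) ij], of F] unfolding RR_def assms(2,3) Fif F0 .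
qed

lemma prod_list_swp: "Suc k < length i \<Longrightarrow> prod_list (map f (swp k i)) = (prod_list (map f i) :: real)"
proof -
  assume "Suc k < length i"
  then have "mset (map f (swp k i)) = mset (map f i)" by simp
  then show ?thesis by (metis prod_mset_prod_list)
qed

lemma bs_zip:
  assumes "length a = length g" "sorted a"
  shows "zip a (bs a g) = sort (zip a g)" "length (bs a g) = length a" "mset (bs a g) = mset g"
proof -
  show l: "length (bs a g) = length a" using assms by (simp add: bs_def)
  have "sorted (map fst (sort (zip a g)))"
  proof -
    have "sorted (sort (zip a g))" by simp
    then show ?thesis unfolding sorted_map by (rule sorted_wrt_mono_rel[rotated]) (auto simp: less_eq_prod_def less_imp_le)
  qed
  moreover have "mset (map fst (sort (zip a g))) = mset a" using assms(1) by (metis map_fst_zip mset_map mset_sort)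
  ultimately have "map fst (sort (zip a g)) = a" using assms(2) by (metis sort_key_id_if_sorted properties_for_sort)
  then show "zip a (bs a g) = sort (zip a g)" unfolding bs_def using zip_map_fst_snd[of "sort (zip a g)"] by simp
  show "mset (bs a g) = mset g" unfolding bs_def using assms(1) by (metis map_snd_zip mset_map mset_sort)
qed

lemma SP_sorted: "(a, b) \<in> SP d \<Longrightarrow> sorted a \<and> a \<in> LL n d \<and> b \<in> LL n d"
proof -
  assume "(a, b) \<in> SP d"
  then have ab: "sorted (zip a b)" "length a = length b" "a \<in> LL n d" "b \<in> LL n d" by (auto simp: SP_def LL_def)
  then have "sorted (map fst (zip a b))"
    unfolding sorted_map by (intro sorted_wrt_mono_rel[OF _ ab(1)]) (auto simp: less_eq_prod_def less_imp_le)
  then show ?thesis using ab by simp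
qed

text \<open>For given \<open>a\<close> and \<open>g\<close> exactly one ordered monomial with rows
  \<open>a\<close> has a nonzero coefficient \<open>gcoef\<close> at \<open>g\<close>, the one with
  columns \<open>bs a g\<close>.\<close>

lemma sum_SP_gcoef:
  fixes F :: "nat list \<Rightarrow> nat list \<Rightarrow> nat list \<Rightarrow> real"
  shows "(\<Sum>a\<in>{a \<in> LL n d. sorted a}. \<Sum>g\<in>LL n d. (1 / q) ^ invs (zip a g) * F a (bs a g) g)
    = (\<Sum>p\<in>SP d. \<Sum>g\<in>LL n d. gcoef (fst p) (snd p) g * F (fst p) (snd p) g)"
proof -
  have SP: "SP d = (SIGMA a:{a \<in> LL n d. sorted a}. {b. (a, b) \<in> SP d})"
    using SP_sorted by (auto simp: SP_def)
  have fin: "finite {b. (a, b) \<in> SP d}" for a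
    by (rule finite_subset[of _ "LL n d"]) (auto simp: SP_def)
  have "(\<Sum>p\<in>SP d. \<Sum>g\<in>LL n d. gcoef (fst p) (snd p) g * F (fst p) (snd p) g)
     = (\<Sum>a\<in>{a \<in> LL n d. sorted a}. \<Sum>b\<in>{b. (a, b) \<in> SP d}. \<Sum>g\<in>LL n d. gcoef a b g * F a b g)"
    by (subst SP, subst sum.Sigma) (simp_all add: fin case_prod_unfold)
  also have "\<dots> = (\<Sum>a\<in>{a \<in> LL n d. sorted a}. \<Sum>g\<in>LL n d. \<Sum>b\<in>{b. (a, b) \<in> SP d}. gcoef a b g * F a b g)"
    by (rule sum.cong[OF refl], rule sum.swap)
  also have "\<dots> = (\<Sum>a\<in>{a \<in> LL n d. sorted a}. \<Sum>g\<in>LL n d. (1 / q) ^ invs (zip a g) * F a (bs a g) g)"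
  proof (intro sum.cong refl)
    fix a g assume ag: "a \<in> {a \<in> LL n d. sorted a}" "g \<in> LL n d"
    then have len: "length a = length g" "sorted a" by (auto simp: LL_length)
    note bz = bs_zip[OF len]
    have "bs a g \<in> LL n d" using ag(2) bz(3) LL_mset by blast
    then have bSP: "(a, bs a g) \<in> SP d" using ag bz(1) by (simp add: SP_def)
    have uniq: "b = bs a g" if b: "(a, b) \<in> SP d" and m: "mset (zip a g) = mset (zip a b)" for b
    proof -
      have "length a = length b" "sorted (zip a b)" using b by (auto simp: SP_def LL_def)
      moreover from this m have "sort (zip a g) = zip a b" by (intro properties_for_sort) auto
      ultimately show ?thesis unfolding bs_def by simp
    qed
    have "(\<Sum>b\<in>{b. (a, b) \<in> SP d}. gcoef a b g * F a b g) = (\<Sum>b\<in>{b. (a, b) \<in> SP d}. if b = bs a g then (1 / q) ^ invs (zip a g) * F a (bs a g) g else 0)"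
    proof (rule sum.cong[OF refl])
      fix b assume "b \<in> {b. (a, b) \<in> SP d}"
      then have b: "(a, b) \<in> SP d" by simp
      show "gcoef a b g * F a b g = (if b = bs a g then (1 / q) ^ invs (zip a g) * F a (bs a g) g else 0)"
      proof (cases "b = bs a g")
        case True
        have "mset (zip a g) = mset (zip a b)" unfolding True bz(1) by simp
        then show ?thesis using True len by (simp add: gcoef_def)
      next
        case False
        then have "mset (zip a g) \<noteq> mset (zip a b)" using uniq[OF b] by blast
        then show ?thesis using False by (simp add: gcoef_def)
      qed
    qed
    then show "(\<Sum>b\<in>{b. (a, b) \<in> SP d}. gcoef a b g * F a b g) = (1 / q) ^ invs (zip a g) * F a (bs a g) g"
      using bSP by (simp add: sum.delta[OF fin])
  qed
  finally show ?thesis ..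
qed

lemma wq_pos: "wq i > 0"
  unfolding wq_def using q0 by (induction i) auto

text \<open>Letter by letter \<open>2 (n - p) + (m - n) = (n - m) + 2 (m - p)\<close>: the weights
  of \<open>C_q\<close> and of \<open>theta\<close> combine to the square of the antipode and one
  inverse weight.\<close>

lemma wa_wq:
  assumes "m \<in> LL n d" "p \<in> LL n d"
  shows "wa p * wq m = (1 / wq m) * prod_list (map2 (\<lambda>a b. q powi (2 * (int a - int b))) m p)"
proof -
  have "length m = length p" using assms by (simp add: LL_length)
  then have "set m \<subseteq> ix n \<Longrightarrow> set p \<subseteq> ix n \<Longrightarrow> wa p * wq m = (1 / wq m) * prod_list (map2 (\<lambda>a b. q powi (2 * (int a - int b))) m p)"
  proof (induction m p rule: list_induct2)
    case (Cons a m b p)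
    have q: "q \<noteq> 0" using q0 by simp
    have "b \<le> n" using Cons.prems by (auto simp: ix_def)
    then have "int (2 * (n - b)) = 2 * (int n - int b)" by (simp add: of_nat_diff)
    then have 1: "q ^ (2 * (n - b)) = q powi (2 * (int n - int b))" by (metis power_int_of_nat)
    have "q powi (2 * (int n - int b)) * q powi (int a - int n) * q powi (int a - int n)
        = q powi (2 * (int n - int b) + (int a - int n) + (int a - int n))"
      using q by (simp only: power_int_add simp_thms)
    also have "2 * (int n - int b) + (int a - int n) + (int a - int n) = 2 * (int a - int b)" by simp
    finally have "q ^ (2 * (n - b)) * q powi (int a - int n) = (1 / q powi (int a - int n)) * q powi (2 * (int a - int b))"
      unfolding 1 using q by (simp add: field_simps)
    moreover have "wa p * wq m = (1 / wq m) * prod_list (map2 (\<lambda>a b. q powi (2 * (int a - int b))) m p)"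
      using Cons by simp
    ultimately have "(q ^ (2 * (n - b)) * q powi (int a - int n)) * (wa p * wq m)
       = ((1 / q powi (int a - int n)) * q powi (2 * (int a - int b))) * ((1 / wq m) * prod_list (map2 (\<lambda>a b. q powi (2 * (int a - int b))) m p))"
      by (simp only:)
    then show ?case by (simp add: wa_def wq_def ac_simps)
  qed (simp add: wa_def wq_def)
  then show ?thesis using assms by (simp add: LL_def)
qed

lemma kernel_moment:
  assumes m: "m \<in> LL n d" and l: "l \<in> LL n d"
  shows "(\<Sum>a\<in>{a \<in> LL n d. sorted a}. \<Sum>g\<in>LL n d. (1 / q) ^ invs (zip a g) * (wa a * wq (bs a g) * H (Sw sO (bs a g) g * Tw tO m l)))
    = (if m = l then 1 / wq l else 0)"
proof -
  let ?S = "Sw sO" and ?T = "Tw tO" and ?L = "LL n d"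
  have "(\<Sum>a\<in>{a \<in> LL n d. sorted a}. \<Sum>g\<in>LL n d. (1 / q) ^ invs (zip a g) * (wa a * wq (bs a g) * H (?S (bs a g) g * ?T m l)))
     = (\<Sum>r\<in>SP d. \<Sum>g\<in>?L. gcoef (fst r) (snd r) g * (wa (fst r) * wq (snd r) * H (?S (snd r) g * ?T m l)))"
    by (rule sum_SP_gcoef[of "\<lambda>a b g. wa a * wq b * H (?S b g * ?T m l)"])
  also have "\<dots> = (\<Sum>r\<in>SP d. \<Sum>p\<in>?L. psi (fst r) (snd r) p m * (wa (fst r) * wq (snd r) * H (?S (snd r) (fst r) * ?T p l)))"
  proof (rule sum.cong[OF refl])
    fix r assume r: "r \<in> SP d"
    obtain a b where ab: "r = (a, b)" by (cases r)
    then have L: "sorted a" "a \<in> ?L" "b \<in> ?L" using SP_sorted r by auto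
    \<comment> \<open>On a sorted row word the sorting operator is 1, so the coefficient is a value
      of \<open>psi\<close>, to which strong invariance can be applied.\<close>
    have g: "gcoef a b g = psi a b a g" if "g \<in> ?L" for g
      using L that by (simp add: psi_def Opr_sorted LL_length sort_key_id_if_sorted)
    have "(\<Sum>g\<in>?L. gcoef a b g * (wa a * wq b * H (?S b g * ?T m l))) = wa a * wq b * (\<Sum>g\<in>?L. H (?S b g * ?T m l) *\<^sub>R psi a b a g)"
      unfolding sum_distrib_left by (intro sum.cong refl) (simp add: g)
    also have "(\<Sum>g\<in>?L. H (?S b g * ?T m l) *\<^sub>R psi a b a g) = (\<Sum>p\<in>?L. H (?S b a * ?T p l) *\<^sub>R psi a b p m)"
      by (rule strong_invariance[OF RC_transpose[OF RC_psi], symmetric]) (use L m l in auto)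
    finally have "(\<Sum>g\<in>?L. gcoef a b g * (wa a * wq b * H (?S b g * ?T m l))) = (\<Sum>p\<in>?L. psi a b p m * (wa a * wq b * H (?S b a * ?T p l)))"
      unfolding sum_distrib_left by (simp add: mult.commute mult.left_commute)
    then show "(\<Sum>g\<in>?L. gcoef (fst r) (snd r) g * (wa (fst r) * wq (snd r) * H (?S (snd r) g * ?T m l)))
       = (\<Sum>p\<in>?L. psi (fst r) (snd r) p m * (wa (fst r) * wq (snd r) * H (?S (snd r) (fst r) * ?T p l)))" using ab by simp
  qed
  also have "\<dots> = (\<Sum>p\<in>?L. \<Sum>r\<in>SP d. psi (fst r) (snd r) p m * (wa (fst r) * wq (snd r) * H (?S (snd r) (fst r) * ?T p l)))"
    by (rule sum.swap)
  also have "\<dots> = (\<Sum>p\<in>?L. wa p * wq m * H (?S m p * ?T p l))"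
  proof (rule sum.cong[OF refl])
    fix p assume p: "p \<in> ?L"
    \<comment> \<open>For fixed \<open>p\<close> the sum over ordered monomials is the basis
      expansion of this function, evaluated at the words \<open>p\<close> and
      \<open>m\<close>.\<close>
    have "RC (\<lambda>x y. (wa x * wq y) *\<^sub>R H (?S y x * ?T p l))"
    proof (rule RC_scaled)
      show "RC (\<lambda>x y. H (?S y x * ?T p l))"
        by (rule RC_linear[OF RC_transpose[OF RC_Sw[OF sO_rules]]]) (simp_all add: H_linear distrib_right)
    qed (simp_all add: wa_def wq_def prod_list_swp)
    from RC_expand[OF this p m]
    show "(\<Sum>r\<in>SP d. psi (fst r) (snd r) p m * (wa (fst r) * wq (snd r) * H (?S (snd r) (fst r) * ?T p l))) = wa p * wq m * H (?S m p * ?T p l)"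
      by simp
  qed
  also have "\<dots> = (1 / wq m) * H (\<Sum>p\<in>?L. prod_list (map2 (\<lambda>a b. q powi (2 * (int a - int b))) m p) *\<^sub>R (?S m p * ?T p l))"
    unfolding H_linear sum_distrib_left using m by (intro sum.cong refl) (simp add: wa_wq)
  also have "\<dots> = (if m = l then 1 / wq l else 0)"
    unfolding Sw_left'[OF sO_rules m l] using H_Wd[of "[]"] hr_Nil H_linear(2)[of 0 0] by simp
  finally show ?thesis .
qed

text \<open>Strong invariance for \<open>T\<close> itself: the sum over the inner index of
  \<open>tau\<close> becomes a combination of words that keep the row \<open>k\<close> of the
  argument.\<close>

lemma ev_tau:
  assumes L: "b \<in> LL n d" "g \<in> LL n d" "k \<in> LL n d" "l \<in> LL n d"
  shows "ev (Rl (Tw tO k l) * Tw tau b g) = wq b *\<^sub>R (\<Sum>m\<in>LL n d. H (Sw sO b g * Tw tO m l) *\<^sub>R Tw tO k m)"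
proof -
  have len: "length b = length g" "length b = d" using L by (simp_all add: LL_length)
  have e: "Rl y * (Rl s * Lm t) = Lm t * Rl (s * y)" for y s t :: alg
    unfolding mult.assoc[symmetric] Rl_hom(1)[symmetric] by (rule Rl_Lm)
  have "ev (Rl (Tw tO k l) * Tw tau b g) = wq b *\<^sub>R (\<Sum>p\<in>LL n d. H (Sw sO b p * Tw tO k l) *\<^sub>R Tw tO p g)"
    unfolding Tw_tau[OF len(1)] len(2) mult_scaleR_right sum_distrib_left e ev_linear ev_Lm_Rl ..
  also have "(\<Sum>p\<in>LL n d. H (Sw sO b p * Tw tO k l) *\<^sub>R Tw tO p g) = (\<Sum>m\<in>LL n d. H (Sw sO b g * Tw tO m l) *\<^sub>R Tw tO k m)"
    by (rule strong_invariance_gl[symmetric]) (use L in auto)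
  finally show ?thesis .
qed

text \<open>The weight \<open>wq l\<close> is the effect of \<open>theta\<close> on the argument; it
  cancels the \<open>1 / wq l\<close> in \<open>kernel_moment\<close>.\<close>

lemma reproducing:
  assumes kl: "k \<in> LL n d" "l \<in> LL n d"
  shows "ev (Rl (wq l *\<^sub>R Tw tO k l) * rho d (Cq n q)) = Tw tO k l"
proof -
  let ?L = "LL n d" and ?A = "{a \<in> LL n d. sorted a}"
  let ?c = "\<lambda>a g m. (1 / q) ^ invs (zip a g) * (wa a * wq (bs a g) * H (Sw sO (bs a g) g * Tw tO m l))"
  have "ev (Rl (wq l *\<^sub>R Tw tO k l) * rho d (Cq n q))
     = wq l *\<^sub>R (\<Sum>a\<in>?A. wa a *\<^sub>R (\<Sum>g\<in>?L. (1 / q) ^ invs (zip a g) *\<^sub>R ev (Rl (Tw tO k l) * Tw tau (bs a g) g)))"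
    unfolding rho_Cq Gf_def Rl_hom mult_scaleR_left ev_linear sum_distrib_left mult_scaleR_right
    by (simp add: scaleR_sum_right mult.commute mult.left_commute)
  also have "\<dots> = wq l *\<^sub>R (\<Sum>a\<in>?A. \<Sum>g\<in>?L. \<Sum>m\<in>?L. ?c a g m *\<^sub>R Tw tO k m)"
  proof (intro arg_cong2[where f=scaleR] sum.cong refl)
    fix a assume a: "a \<in> ?A"
    have "ev (Rl (Tw tO k l) * Tw tau (bs a g) g) = wq (bs a g) *\<^sub>R (\<Sum>m\<in>?L. H (Sw sO (bs a g) g * Tw tO m l) *\<^sub>R Tw tO k m)" if g: "g \<in> ?L" for g
    proof (rule ev_tau[OF _ g kl])
      have "length a = length g" "sorted a" using a g by (auto simp: LL_length)
      from bs_zip(3)[OF this] show "bs a g \<in> ?L" using g LL_mset by blast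
    qed
    then show "wa a *\<^sub>R (\<Sum>g\<in>?L. (1 / q) ^ invs (zip a g) *\<^sub>R ev (Rl (Tw tO k l) * Tw tau (bs a g) g)) = (\<Sum>g\<in>?L. \<Sum>m\<in>?L. ?c a g m *\<^sub>R Tw tO k m)"
      unfolding scaleR_sum_right by (intro sum.cong refl) (simp add: scaleR_sum_right ac_simps)
  qed
  also have "(\<Sum>a\<in>?A. \<Sum>g\<in>?L. \<Sum>m\<in>?L. ?c a g m *\<^sub>R Tw tO k m) = (\<Sum>a\<in>?A. \<Sum>m\<in>?L. \<Sum>g\<in>?L. ?c a g m *\<^sub>R Tw tO k m)"
    by (rule sum.cong[OF refl], rule sum.swap)
  also have "\<dots> = (\<Sum>m\<in>?L. (\<Sum>a\<in>?A. \<Sum>g\<in>?L. ?c a g m) *\<^sub>R Tw tO k m)"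
    unfolding scaleR_sum_left by (rule sum.swap)
  also have "\<dots> = (\<Sum>m\<in>?L. if m = l then (1 / wq l) *\<^sub>R Tw tO k l else 0)"
    using kl by (intro sum.cong refl) (simp add: kernel_moment)
  also have "\<dots> = (1 / wq l) *\<^sub>R Tw tO k l" using kl by simp
  finally show ?thesis using wq_pos[of l] by simp
qed

end

section \<open>The integral\<close>

lemma lin_pextend:
  assumes "pfin P" "\<And>w. P w \<noteq> 0 \<Longrightarrow> pfin (pprod_list (map \<phi> w))"
  shows "lin h (pextend \<phi> P) = lin (\<lambda>w. lin h (pprod_list (map \<phi> w))) P"
proof -
  have "finite {w. P w \<noteq> 0}" using assms(1) by (simp add: pfin_def)
  then have "lin h (pextend \<phi> P) = (\<Sum>w | P w \<noteq> 0. P w * lin h (pprod_list (map \<phi> w)))"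
    unfolding pextend_def using assms(2) by (subst lin_psum) (simp_all add: lin_psc)
  then show ?thesis by (simp add: lin_def)
qed

lemma pprod_list_simps [simp]: "pprod_list [] = pone" "pprod_list (p # ps) = pmul p (pprod_list ps)"
  by (simp_all add: pprod_list_def)

lemma pfin_pprod: "(\<And>p. p \<in> set ps \<Longrightarrow> pfin p) \<Longrightarrow> pfin (pprod_list ps)"
  by (induction ps) auto

lemma congr_psum: "finite A \<Longrightarrow> (\<And>x. x \<in> A \<Longrightarrow> congr Rel (F x) (G x)) \<Longrightarrow> congr Rel (psum A F) (psum A G)"
  by (induction A rule: finite_induct) (auto intro: congr_padd)

text \<open>Real parts are taken because the values lie in a real vector space; on polynomials
  satisfying \<open>preal\<close> nothing is lost, and \<open>evl_pmul\<close> makes it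
  multiplicative.\<close>

definition evl :: "(gen list \<Rightarrow> 'a::real_vector) \<Rightarrow> poly \<Rightarrow> 'a" where
  "evl E p = (\<Sum>w | p w \<noteq> 0. Re (p w) *\<^sub>R E w)"

lemma evl_eq: "finite A \<Longrightarrow> {w. p w \<noteq> 0} \<subseteq> A \<Longrightarrow> evl E p = (\<Sum>w\<in>A. Re (p w) *\<^sub>R E w)"
  unfolding evl_def by (rule sum.mono_neutral_left) auto

lemma evl_pword [simp]: "evl E (pword w) = E w"
  by (subst evl_eq[of "{w}"]) (auto simp: pword_def)

lemma evl_padd: "pfin p \<Longrightarrow> pfin r \<Longrightarrow> evl E (padd p r) = evl E p + evl E r"
proof -
  assume "pfin p" "pfin r"
  let ?A = "{w. p w \<noteq> 0} \<union> {w. r w \<noteq> 0}"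
  have fin: "finite ?A" using \<open>pfin p\<close> \<open>pfin r\<close> by (simp add: pfin_def)
  have "evl E (padd p r) = (\<Sum>w\<in>?A. Re (padd p r w) *\<^sub>R E w)" "evl E p = (\<Sum>w\<in>?A. Re (p w) *\<^sub>R E w)" "evl E r = (\<Sum>w\<in>?A. Re (r w) *\<^sub>R E w)"
    by (rule evl_eq[OF fin], auto simp: padd_def)+
  then show ?thesis by (simp add: padd_def scaleR_add_left sum.distrib)
qed

lemma evl_psc: "pfin p \<Longrightarrow> evl E (psc (of_real c) p) = c *\<^sub>R evl E p"
  by (subst evl_eq[of "{w. p w \<noteq> 0}"]) (auto simp: pfin_def psc_def evl_def scaleR_sum_right)

lemma evl_pzero [simp]: "evl E pzero = 0"
  by (simp add: evl_def pzero_def)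

lemma evl_psum: "finite A \<Longrightarrow> (\<And>x. x \<in> A \<Longrightarrow> pfin (F x)) \<Longrightarrow> evl E (psum A F) = (\<Sum>x\<in>A. evl E (F x))"
  by (induction A rule: finite_induct) (auto simp: evl_padd pfin_psum)

context qp
begin

lemma evl_pmul:
  fixes E :: "gen list \<Rightarrow> 'a::real_algebra_1"
  assumes fin: "pfin p" "pfin r" and real: "preal p" "preal r" and E: "\<And>u v. E (u @ v) = E u * E v"
  shows "evl E (pmul p r) = evl E p * evl E r"
proof -
  have f: "finite {w. p w \<noteq> 0}" "finite {w. r w \<noteq> 0}" using fin by (simp_all add: pfin_def)
  have c: "p u * r v = of_real (Re (p u) * Re (r v))" for u v
    using real unfolding preal_def by (metis Reals_cases Re_complex_of_real of_real_mult)
  have "evl E (pmul p r) = (\<Sum>u | p u \<noteq> 0. \<Sum>v | r v \<noteq> 0. evl E (psc (of_real (Re (p u) * Re (r v))) (pword (u @ v))))"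
    unfolding pmul_expand[OF fin] c using f by (simp add: evl_psum pfin_psum del: of_real_mult)
  also have "\<dots> = evl E p * evl E r"
    unfolding evl_def[of E p] evl_def[of E r] sum_product
    by (intro sum.cong refl) (simp add: evl_psc E del: of_real_mult)
  finally show ?thesis .
qed

lemma preal_pprod: "(\<And>p. p \<in> set ps \<Longrightarrow> preal p) \<Longrightarrow> preal (pprod_list ps)"
  by (induction ps) (auto intro: preal_pmul)

lemma evl_pprod:
  fixes E :: "gen list \<Rightarrow> 'a::real_algebra_1"
  assumes "\<And>p. p \<in> set ps \<Longrightarrow> pfin p \<and> preal p" and E: "\<And>u v. E (u @ v) = E u * E v" "E [] = 1"
  shows "evl E (pprod_list ps) = prod_list (map (evl E) ps)"
  using assms(1)
proof (induction ps)
  case Nil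
  then show ?case using E(2) by (simp add: pone_pword)
next
  case (Cons p ps)
  then have "evl E (pmul p (pprod_list ps)) = evl E p * evl E (pprod_list ps)"
    by (intro evl_pmul E(1)) (auto intro: pfin_pprod preal_pprod)
  then show ?case using Cons by simp
qed

lemma cls_pprod: "(\<And>p. p \<in> set ps \<Longrightarrow> pfin p) \<Longrightarrow> cls Rel (pprod_list ps) = prod_list (map (cls Rel) ps)"
  by (induction ps) (auto simp: cls_pmul pfin_pprod)

lemma lin_haar: "pfin p \<Longrightarrow> preal p \<Longrightarrow> lin (haar n q) p = of_real (H (cls (rel_gl n q) p))"
  using lin_real[of p H "rel_gl n q"] by (simp add: haar_eq H_Wd H_linear)

definition wT :: real where "wT = inverse (\<Prod>al\<in>{1..n}. q powi (int al - int n))"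

lemma theta_gen_real:
  "theta_gen n q (Z a al) = psc (of_real (q powi (int al - int n))) (pword [Z a al])"
  "theta_gen n q T = psc (of_real wT) (pword [T])"
  by (simp_all add: wT_def)

lemma theta_gen_fin: "pfin (theta_gen n q g) \<and> preal (theta_gen n q g)"
proof (cases g)
  case (Z a al)
  then show ?thesis unfolding Z theta_gen_real by (intro conjI preal_intros pfin_psc pfin_pword)
next
  case T
  then show ?thesis unfolding T theta_gen_real by (intro conjI preal_intros pfin_psc pfin_pword)
qed simp

definition eth :: "gen \<Rightarrow> alg" where "eth g = cls (rel_gl n q) (theta_gen n q g)"

lemma eth_simps: "a \<in> ix n \<Longrightarrow> al \<in> ix n \<Longrightarrow> eth (Z a al) = q powi (int al - int n) *\<^sub>R tO a al"
  "eth T = wT *\<^sub>R Ti"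
  unfolding eth_def theta_gen_real by (simp_all add: cls_psc Wd_def[symmetric] tm_def Ti_def del: of_real_power_int)

definition Eth :: "gen list \<Rightarrow> alg" where "Eth w = prod_list (map eth w)"

lemma Eth_append: "Eth (u @ v) = Eth u * Eth v" and Eth_Nil: "Eth [] = 1"
  by (simp_all add: Eth_def)

lemma lin_theta: "lin (haar n q) (pprod_list (map (theta_gen n q) w)) = of_real (H (Eth w))"
proof -
  have "pfin (pprod_list (map (theta_gen n q) w))" "preal (pprod_list (map (theta_gen n q) w))"
    using theta_gen_fin by (auto intro!: pfin_pprod preal_pprod)
  moreover have "cls (rel_gl n q) (pprod_list (map (theta_gen n q) w)) = Eth w"
    using theta_gen_fin by (subst cls_pprod) (auto simp: Eth_def eth_def[abs_def] o_def)
  ultimately show ?thesis by (simp add: lin_haar)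
qed

lemma integral_lin: "pfin g \<Longrightarrow> integral_S n q g = lin (\<lambda>w. of_real (H (Eth w))) g"
  unfolding integral_S_def using theta_gen_fin
  by (subst lin_pextend) (auto intro!: pfin_pprod simp: lin_theta)

lemma lin_evl:
  assumes "pfin p" "preal p" shows "lin (\<lambda>w. of_real (H (E w))) p = of_real (H (evl E p))"
proof -
  have r: "p w * of_real x = of_real (Re (p w) * x)" for w x
    using assms(2) unfolding preal_def by (metis Reals_cases Re_complex_of_real of_real_mult)
  show ?thesis unfolding lin_def evl_def H_linear r by simp
qed

lemma Eth_zw: "i \<in> LL n d \<Longrightarrow> j \<in> LL n d \<Longrightarrow> Eth (zw i j) = wq j *\<^sub>R Tw tO i j"
proof (induction d arbitrary: i j)
  case (Suc d)
  then obtain a i' b j' where ij: "i = a # i'" "j = b # j'" "a \<in> ix n" "b \<in> ix n" "i' \<in> LL n d" "j' \<in> LL n d"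
    unfolding LL_Suc by auto
  have "Eth (zw i j) = eth (Z a b) * Eth (zw i' j')" by (simp add: ij Eth_def)
  then show ?case using Suc.IH[OF ij(5,6)] ij by (simp add: eth_simps wq_def mult.commute)
qed (simp add: Eth_def wq_def)

lemma qcof_fin: "a \<in> ix n \<Longrightarrow> al \<in> ix n \<Longrightarrow> pfin (qcof n q a al) \<and> preal (qcof n q a al)"
  unfolding qcof_def ix_def[symmetric] by (intro conjI pfin_qminor preal_qminor) auto

lemma evl_qcof:
  assumes "a \<in> ix n" "al \<in> ix n"
  shows "evl Eth (qcof n q a al) = (\<Prod>x\<in>ix n - {al}. q powi (int x - int n)) *\<^sub>R cof tO a al"
proof -
  let ?A = "ix n - {a}" and ?B = "ix n - {al}"
  have fin: "finite ?A" "finite ?B" "card ?A = card ?B" using assms by auto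
  have LA: "sorted_list_of_set ?A \<in> LL n (card ?B)" using fin by (auto simp: LL_def)
  have "evl Eth (qcof n q a al) = (\<Sum>j\<in>permutations_of_set ?B. (- q) ^ invs j *\<^sub>R Eth (zw (sorted_list_of_set ?A) j))"
    unfolding qcof_def ix_def[symmetric] qminor_list[OF fin]
    by (subst evl_psum) (simp_all only: finite_permutations_of_set pfin_psc pfin_pword evl_psc evl_pword)
  also have "\<dots> = (\<Sum>j\<in>permutations_of_set ?B. (\<Prod>x\<in>?B. q powi (int x - int n)) *\<^sub>R ((- q) ^ invs j *\<^sub>R Tw tO (sorted_list_of_set ?A) j))"
  proof (rule sum.cong[OF refl])
    fix j assume j: "j \<in> permutations_of_set ?B"
    have "j \<in> LL n (card ?B)" using j by (auto simp: LL_def perm_set_length permutations_of_setD)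
    moreover have "wq j = (\<Prod>x\<in>?B. q powi (int x - int n))"
      unfolding wq_def using permutations_of_setD[OF j] by (simp add: prod.distinct_set_conv_list[symmetric])
    ultimately show "(- q) ^ invs j *\<^sub>R Eth (zw (sorted_list_of_set ?A) j)
      = (\<Prod>x\<in>?B. q powi (int x - int n)) *\<^sub>R ((- q) ^ invs j *\<^sub>R Tw tO (sorted_list_of_set ?A) j)"
      by (simp add: Eth_zw[OF LA])
  qed
  finally show ?thesis by (simp add: cof_def minor_def scaleR_sum_right)
qed

lemma psi_gen_real: "psi_gen n q (Zb a al) = psc (of_real ((- q) powi (int a + int al - 2 * int n))) (pmul (pword [T]) (qcof n q a al))"
  by simp

lemma psi_gen_mat: "g \<in> mat_alph n \<Longrightarrow> pfin (psi_gen n q g) \<and> preal (psi_gen n q g) \<and> evl Eth (psi_gen n q g) = eth g"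
  by (cases g) (auto simp: mat_alph_def Eth_def)

lemma psi_gen_bar:
  assumes "g \<in> bar_alph n"
  shows "pfin (psi_gen n q g) \<and> preal (psi_gen n q g) \<and> evl Eth (psi_gen n q g) = thb g"
proof -
  obtain a al where g: "g = Zb a al" "a \<in> ix n" "al \<in> ix n" using assms by (auto simp: bar_alph_def ix_def)
  note qc = qcof_fin[OF g(2,3)]
  have fr: "pfin (psi_gen n q g) \<and> preal (psi_gen n q g)"
    unfolding g psi_gen_real using qc by (intro conjI preal_intros preal_pmul pfin_psc pfin_pmul pfin_pword) auto
  have q: "q \<noteq> 0" "- q \<noteq> 0" using q0 by auto
  let ?w = "\<lambda>x. q powi (int x - int n)"
  \<comment> \<open>\<open>theta\<close> divides \<open>T\<close> by all column weights and the
    cofactor carries all of them but that of \<open>al\<close>, so the weight of \<open>al\<close>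
    stays in the denominator.\<close>
  have "prod ?w (ix n) = ?w al * prod ?w (ix n - {al})" using g by (intro prod.remove) auto
  moreover have "prod ?w (ix n - {al}) \<noteq> 0" using q by simp
  ultimately have w: "wT * prod ?w (ix n - {al}) = inverse (?w al)"
    unfolding wT_def ix_def[symmetric] by (simp add: field_simps)
  have "evl Eth (psi_gen n q g) = (- q) powi (int a + int al - 2 * int n) *\<^sub>R (Eth [T] * evl Eth (qcof n q a al))"
  proof -
    have "evl Eth (pmul (pword [T]) (qcof n q a al)) = evl Eth (pword [T]) * evl Eth (qcof n q a al)"
      using qc by (intro evl_pmul Eth_append preal_intros pfin_pword) auto
    moreover have "pfin (pmul (pword [T]) (qcof n q a al))" using qc by simp
    ultimately show ?thesis unfolding g psi_gen_real by (simp only: evl_psc evl_pword)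
  qed
  also have "Eth [T] * evl Eth (qcof n q a al) = inverse (?w al) *\<^sub>R (Ti * cof tO a al)"
    unfolding evl_qcof[OF g(2,3)] w[symmetric] by (simp add: Eth_def eth_simps)
  also have "(- q) powi (int a + int al - 2 * int n) *\<^sub>R (inverse (?w al) *\<^sub>R (Ti * cof tO a al)) = thb g"
  proof -
    \<comment> \<open>The even part \<open>2 (al - n)\<close> of the exponent loses its sign and
      leaves \<open>q^(al - n)\<close> after the division; the rest is the factor in
      \<open>sm\<close>.\<close>
    have "(- q) powi (int a + int al - 2 * int n) = (- q) powi ((int a - int al) + 2 * (int al - int n))"
      by (rule arg_cong[where f="\<lambda>x. (- q) powi x"]) simp
    also have "\<dots> = (- q) powi (int a - int al) * ((- q) powi 2) powi (int al - int n)"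
      using q by (simp only: power_int_add power_int_mult simp_thms)
    also have "((- q) powi 2) powi (int al - int n) = (q powi 2) powi (int al - int n)" by simp
    also have "\<dots> = ?w al * ?w al" using q by (simp add: power2_eq_square power_int_mult_distrib)
    finally have "(- q) powi (int a + int al - 2 * int n) * inverse (?w al) = ?w al * (- q) powi (int a - int al)"
      using q by simp
    then show ?thesis using g by (simp add: sm_def)
  qed
  finally show ?thesis using fr by simp
qed

lemma integral_word:
  assumes v: "set v \<subseteq> bar_alph n" and w: "set w \<subseteq> mat_alph n"
  shows "pfin (pprod_list (map (psi_gen n q) (v @ w)))"
    and "lin (\<lambda>w. of_real (H (Eth w))) (pprod_list (map (psi_gen n q) (v @ w))) = of_real (H (Th v * Eth w))"
proof -
  have "pfin (psi_gen n q g) \<and> preal (psi_gen n q g)" if "g \<in> set (v @ w)" for g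
    using that v w psi_gen_mat[of g] psi_gen_bar[of g] by auto
  then have ps: "\<And>p. p \<in> set (map (psi_gen n q) (v @ w)) \<Longrightarrow> pfin p \<and> preal p" by auto
  show fin: "pfin (pprod_list (map (psi_gen n q) (v @ w)))" using ps by (intro pfin_pprod) blast
  have real: "preal (pprod_list (map (psi_gen n q) (v @ w)))" using ps by (intro preal_pprod) blast
  have "evl Eth (pprod_list (map (psi_gen n q) (v @ w))) = prod_list (map (\<lambda>g. evl Eth (psi_gen n q g)) v) * prod_list (map (\<lambda>g. evl Eth (psi_gen n q g)) w)"
    using evl_pprod[of "map (psi_gen n q) (v @ w)" Eth, OF _ Eth_append Eth_Nil] ps by (simp add: o_def)
  also have "map (\<lambda>g. evl Eth (psi_gen n q g)) v = map thb v" using v psi_gen_bar by (intro map_cong) auto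
  also have "map (\<lambda>g. evl Eth (psi_gen n q g)) w = map eth w" using w psi_gen_mat by (intro map_cong) auto
  finally show "lin (\<lambda>w. of_real (H (Eth w))) (pprod_list (map (psi_gen n q) (v @ w))) = of_real (H (Th v * Eth w))"
    unfolding lin_evl[OF fin real] by (simp add: Th_def Eth_def)
qed

lemma integral_eval:
  assumes v: "set v \<subseteq> bar_alph n" and f: "pfin f" "\<forall>w. f w \<noteq> 0 \<longrightarrow> set w \<subseteq> mat_alph n"
  shows "integral_S n q (pextend (psi_gen n q) (pmul (pword v) f)) = (\<Sum>w | f w \<noteq> 0. f w * of_real (H (Th v * Eth w)))"
proof -
  have vs: "{w. pword v w \<noteq> 0} = {v}" by (auto simp: pword_def)
  have P: "pfin (pmul (pword v) f)" using f by simp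
  have supp: "pfin (pprod_list (map (psi_gen n q) x))" if nz: "pmul (pword v) f x \<noteq> 0" for x
  proof -
    from nz obtain z where "z \<in> sp x" "pword v (fst z) * f (snd z) \<noteq> 0"
      unfolding pmul_sp by (rule sum.not_neutral_contains_not_neutral)
    then obtain b where "x = v @ b" "f b \<noteq> 0" by (cases z) (auto simp: pword_def sp_def split: if_splits)
    then show ?thesis using integral_word(1)[OF v] f(2) by blast
  qed
  have fin: "pfin (pextend (psi_gen n q) (pmul (pword v) f))"
    unfolding pextend_def using supp by (intro pfin_psum pfin_psc) auto
  have "integral_S n q (pextend (psi_gen n q) (pmul (pword v) f))
     = lin (\<lambda>x. lin (\<lambda>w. of_real (H (Eth w))) (pprod_list (map (psi_gen n q) x))) (pmul (pword v) f)"
    unfolding integral_lin[OF fin] by (rule lin_pextend[OF P supp])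
  also have "\<dots> = (\<Sum>w | f w \<noteq> 0. f w * of_real (H (Th v * Eth w)))"
    using f by (subst lin_pmul) (auto simp: vs pword_def integral_word(2)[OF v] simp del: map_append intro!: sum.cong)
  finally show ?thesis .
qed

section \<open>Degrees and the final summation\<close>

definition dgw :: "gen list \<Rightarrow> int" where "dgw w = int (length (zpart w)) - int n * int (cntT w)"

lemma dgw_append: "dgw (u @ v) = dgw u + dgw v"
  by (simp add: dgw_def algebra_simps)

inductive dg :: "int \<Rightarrow> alg \<Rightarrow> bool" for e where
  word: "dgw w = e \<Longrightarrow> dg e (WO w)"
| zero: "dg e 0"
| add: "dg e x \<Longrightarrow> dg e y \<Longrightarrow> dg e (x + y)"
| scale: "dg e x \<Longrightarrow> dg e (c *\<^sub>R x)"

lemma dg_H: "dg e x \<Longrightarrow> e \<noteq> 0 \<Longrightarrow> H x = 0"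
proof (induction rule: dg.induct)
  case (word w)
  then have "length (zpart w) \<noteq> cntT w * n" unfolding dgw_def by (metis diff_self mult.commute of_nat_mult)
  then show ?case by (simp add: H_Wd hr_def)
next
  case zero
  show ?case using H_linear(2)[of 0 0] by simp
qed (simp_all add: H_linear)

lemma dg_mult: "dg e x \<Longrightarrow> dg f y \<Longrightarrow> dg (e + f) (x * y)"
proof (induction rule: dg.induct)
  case (word w)
  from word.prems show ?case
  proof (induction rule: dg.induct)
    case (word w')
    have "dgw (w @ w') = e + f" using dgw_append[of w w'] \<open>dgw w = e\<close> word by simp
    then show ?case unfolding Wd_append[symmetric] by (rule dg.word)
  qed (simp_all add: distrib_left dg.intros)
qed (simp_all add: distrib_right dg.intros)

lemma dg_sum: "(\<And>x. x \<in> A \<Longrightarrow> dg e (F x)) \<Longrightarrow> dg e (\<Sum>x\<in>A. F x)"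
  by (induction A rule: infinite_finite_induct) (auto intro: dg.intros)

lemma dg_t: "dg 1 (tO a b)" and dg_Ti: "dg (- int n) Ti"
  unfolding tm_def Ti_def by (auto intro!: dg.intros simp: dgw_def)

lemma dg_Tw: "length i = length j \<Longrightarrow> dg (int (length i)) (Tw tO i j)"
proof (induction i j rule: list_induct2)
  case Nil
  then show ?case using dg.word[of "[]" 0] by (simp add: dgw_def)
next
  case (Cons a i b j)
  from dg_mult[OF dg_t Cons.IH] show ?case by simp
qed

lemma dg_sO: "dg (- 1) (sO i j)"
proof (cases "i \<in> ix n \<and> j \<in> ix n")
  case True
  have "dg (int (n - 1)) (cof tO j i)"
    unfolding cof_def minor_def
  proof (rule dg_sum, rule dg.scale)
    fix x assume x: "x \<in> permutations_of_set (ix n - {i})"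
    have "length (sorted_list_of_set (ix n - {j})) = n - 1" using True by simp
    moreover have "length x = n - 1" using perm_set_length[OF x] True by simp
    ultimately show "dg (int (n - 1)) (Tw tO (sorted_list_of_set (ix n - {j})) x)" using dg_Tw[of "sorted_list_of_set (ix n - {j})" x] by simp
  qed
  from dg.scale[OF dg_mult[OF dg_Ti this]] have "dg (- int n + int (n - 1)) (sO i j)" using True by (simp add: sm_def)
  then show ?thesis using n1 by (simp add: of_nat_diff)
qed (auto simp: sm_def intro: dg.intros)

lemma dg_Th: "set v \<subseteq> bar_alph n \<Longrightarrow> dg (- int (length v)) (Th v)"
proof (induction v)
  case Nil
  then show ?case using dg.word[of "[]" 0] by (simp add: dgw_def Th_def)
next
  case (Cons g v)
  have "dg (- 1) (thb g)" by (cases g) (auto intro: dg.intros dg_sO)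
  from dg_mult[OF this Cons.IH] Cons.prems show ?case by (simp add: Th_def)
qed

text \<open>An entry of the antipode has degree \<open>(n - 1) - n\<close>, so \<open>Th v\<close>
  has degree minus the length of \<open>v\<close>, and \<open>H\<close> vanishes outside degree 0.
  This is why only finitely many components contribute.\<close>

lemma H_degree:
  assumes "set v \<subseteq> bar_alph n" "set w \<subseteq> mat_alph n" "length v \<noteq> length w"
  shows "H (Th v * Eth w) = 0"
proof -
  have L: "map Zr w \<in> LL n (length w)" "map Zc w \<in> LL n (length w)" using rows_cols_LL[OF assms(2)] by auto
  have "Eth w = wq (map Zc w) *\<^sub>R Tw tO (map Zr w) (map Zc w)" using Eth_zw[OF L] mat_word[OF assms(2)] by simp
  then have "dg (int (length w)) (Eth w)" using dg_Tw[of "map Zr w" "map Zc w"] by (simp add: dg.scale)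
  from dg_H[OF dg_mult[OF dg_Th[OF assms(1)] this]] assms(3) show ?thesis by simp
qed

text \<open>The contribution of a single word of \<open>f\<close>. The integral is linear, so
  complex coefficients can stay outside while the pairing itself is real.\<close>

definition Kw :: "nat \<Rightarrow> gen list \<Rightarrow> poly" where
  "Kw d w = psum (words (mat_alph n) d \<times> words (bar_alph n) d) (\<lambda>(u, v). psc (Cq n q (u, v) * of_real (H (Th v * Eth w))) (pword u))"

lemma Kw_degree: "set w \<subseteq> mat_alph n \<Longrightarrow> d \<noteq> length w \<Longrightarrow> Kw d w x = 0"
  unfolding Kw_def psum_def psc_def by (intro sum.neutral) (auto simp: words_def H_degree)

text \<open>\<open>reproducing\<close> is an identity in the localization. Both of its sides are
  real combinations of words without \<open>T\<close>, so \<open>transfer_gl\<close> brings it back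
  to the quantum matrix algebra.\<close>

lemma Kw_word:
  assumes w: "set w \<subseteq> mat_alph n"
  shows "congr (rel_mat n q) (pword w) (Kw (length w) w)"
proof -
  let ?d = "length w"
  let ?W = "words (mat_alph n) ?d \<times> words (bar_alph n) ?d"
  let ?k = "map Zr w" and ?l = "map Zc w"
  have kl: "?k \<in> LL n ?d" "?l \<in> LL n ?d" using rows_cols_LL[OF w] by auto
  have E: "Eth w = wq ?l *\<^sub>R Tw tO ?k ?l" using Eth_zw[OF kl] mat_word[OF w] by simp
  let ?c = "\<lambda>p. Re (Cq n q p) * H (Th (snd p) * Eth w)"
  have fin: "finite ?W" by simp
  have u: "map Zr (fst p) \<in> LL n ?d \<and> map Zc (fst p) \<in> LL n ?d" "Wd Rel (fst p) = Tw (tm Rel) (map Zr (fst p)) (map Zc (fst p))" if "p \<in> ?W" for p Rel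
  proof -
    have "set (fst p) \<subseteq> mat_alph n" "length (fst p) = ?d" using that by (auto simp: words_def)
    then show "map Zr (fst p) \<in> LL n ?d \<and> map Zc (fst p) \<in> LL n ?d" "Wd Rel (fst p) = Tw (tm Rel) (map Zr (fst p)) (map Zc (fst p))"
      using rows_cols_LL[of "fst p"] Wd_mat[of "fst p" Rel] by simp_all
  qed
  have e: "Rl y * (Lm s * Rl t) = Lm s * Rl (t * y)" for y s t :: alg
    unfolding Rl_hom(1) mult.assoc[symmetric] by (simp only: Rl_Lm)
  have "Tw tO ?k ?l = ev (Rl (Eth w) * rho ?d (Cq n q))" using reproducing[OF kl] E by simp
  also have "\<dots> = (\<Sum>x\<in>words (mat_alph n) ?d. \<Sum>v\<in>words (bar_alph n) ?d. Re (Cq n q (x, v)) *\<^sub>R (H (Th v * Eth w) *\<^sub>R WO x))"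
    unfolding rho_def sum_distrib_left mult_scaleR_right e ev_linear ev_Lm_Rl ..
  also have "\<dots> = (\<Sum>p\<in>?W. ?c p *\<^sub>R WO (fst p))" unfolding sum.cartesian_product by (simp add: case_prod_unfold)
  also have "\<dots> = (\<Sum>p\<in>?W. ?c p *\<^sub>R Tw tO (map Zr (fst p)) (map Zc (fst p)))" by (intro sum.cong refl) (simp add: u(2))
  finally have "(\<Sum>y\<in>{()}. 1 *\<^sub>R Tw tO ?k ?l) = (\<Sum>p\<in>?W. ?c p *\<^sub>R Tw tO (map Zr (fst p)) (map Zc (fst p)))" by simp
  from transfer_gl[OF _ fin _ u(1) this] kl
  have A: "Tw tA ?k ?l = (\<Sum>p\<in>?W. ?c p *\<^sub>R Tw tA (map Zr (fst p)) (map Zc (fst p)))" by simp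
  have K: "Kw ?d w = psum ?W (\<lambda>p. psc (of_real (?c p)) (pword (fst p)))"
    unfolding Kw_def
  proof (rule psum_cong[OF refl])
    fix p :: "gen list \<times> gen list" assume "p \<in> ?W"
    have "Cq n q p = of_real (Re (Cq n q p))"
      using bal_real[OF bal_Cq, of "fst p" "snd p"] by (auto elim!: Reals_cases)
    then have "Cq n q p * of_real (H (Th (snd p) * Eth w)) = of_real (?c p)" by (metis of_real_mult)
    then show "(case p of (u, v) \<Rightarrow> psc (Cq n q (u, v) * of_real (H (Th v * Eth w))) (pword u)) = psc (of_real (?c p)) (pword (fst p))"
      by (cases p) (simp only: prod.case fst_conv snd_conv)
  qed
  have pf: "pfin (Kw ?d w)" unfolding K by (intro pfin_psum pfin_psc pfin_pword)
  have "cls (rel_mat n q) (Kw ?d w) = (\<Sum>p\<in>?W. ?c p *\<^sub>R Wd (rel_mat n q) (fst p))"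
    unfolding K using fin by (subst cls_psum) (simp_all only: pfin_psc pfin_pword cls_psc Wd_def)
  also have "\<dots> = Tw tA ?k ?l" unfolding A by (intro sum.cong refl) (simp add: u(2))
  also have "\<dots> = cls (rel_mat n q) (pword w)" using Wd_mat[OF w, of "rel_mat n q"] by (simp add: Wd_def)
  finally show ?thesis using pf by (intro cls_eqD) simp_all
qed

lemma rhs_comp_eq:
  assumes f: "pfin f" "\<forall>w. f w \<noteq> 0 \<longrightarrow> set w \<subseteq> mat_alph n"
  shows "rhs_comp n q f d1 d2 x = (if d1 = d2 then \<Sum>w | f w \<noteq> 0. f w * Kw d1 w x else 0)"
proof (cases "d1 = d2")
  case True
  let ?W = "words (mat_alph n) d1 \<times> words (bar_alph n) d1"
  have "rhs_comp n q f d1 d2 x = (\<Sum>p\<in>?W. \<Sum>w | f w \<noteq> 0. f w * (Cq n q p * of_real (H (Th (snd p) * Eth w)) * pword (fst p) x))"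
    unfolding rhs_comp_def psum_def psc_def True[symmetric]
  proof (rule sum.cong[OF refl])
    fix p assume "p \<in> ?W"
    then obtain u v where p: "p = (u, v)" "set v \<subseteq> bar_alph n" by (auto simp: words_def)
    show "(case p of (u, v) \<Rightarrow> \<lambda>w. Cq n q (u, v) * integral_S n q (pextend (psi_gen n q) (pmul (pword v) f)) * pword u w) x
      = (\<Sum>w | f w \<noteq> 0. f w * (Cq n q p * of_real (H (Th (snd p) * Eth w)) * pword (fst p) x))"
      unfolding p(1) prod.case fst_conv snd_conv integral_eval[OF p(2) f] sum_distrib_left sum_distrib_right
      by (intro sum.cong refl) (simp only: ac_simps)
  qed
  also have "\<dots> = (\<Sum>w | f w \<noteq> 0. f w * Kw d1 w x)"
    unfolding Kw_def psum_def psc_def sum_distrib_left by (subst sum.swap) (simp add: case_prod_unfold)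
  finally show ?thesis using True by simp
next
  case False
  have "Cq n q (u, v) = 0" if "u \<in> words (mat_alph n) d1" "v \<in> words (bar_alph n) d2" for u v
    using balD[OF bal_Cq, of u v] that False by (auto simp: words_def)
  then show ?thesis using False unfolding rhs_comp_def psum_def psc_def by (auto intro!: sum.neutral)
qed

lemma reproducing_kernel:
  assumes f: "pfin f" "\<forall>w. f w \<noteq> 0 \<longrightarrow> set w \<subseteq> mat_alph n"
  shows "\<exists>N. (\<forall>d1 d2. (N < d1 \<or> N < d2) \<longrightarrow> congr (rel_mat n q) (rhs_comp n q f d1 d2) pzero)
           \<and> congr (rel_mat n q) f (psum ({..N} \<times> {..N}) (\<lambda>(d1, d2). rhs_comp n q f d1 d2))"
proof -
  let ?F = "{w. f w \<noteq> 0}"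
  have fm: "\<And>w. f w \<noteq> 0 \<Longrightarrow> set w \<subseteq> mat_alph n" using f(2) by blast
  have fin: "finite ?F" using f(1) by (simp add: pfin_def)
  \<comment> \<open>Any common bound on the lengths of the words in \<open>f\<close> serves; the sum
    of the lengths is one.\<close>
  define N where "N = (\<Sum>w\<in>?F. length w)"
  have N: "length w \<le> N" if "f w \<noteq> 0" for w
    unfolding N_def using that fin by (intro member_le_sum) auto
  have "rhs_comp n q f d1 d2 = pzero" if "N < d1 \<or> N < d2" for d1 d2
  proof
    fix x
    have "Kw d1 w x = 0" if "f w \<noteq> 0" "d1 = d2" for w
      using Kw_degree[OF fm[OF that(1)], of d1 x] N[OF that(1)] that(2) \<open>N < d1 \<or> N < d2\<close> by auto
    then show "rhs_comp n q f d1 d2 x = pzero x" unfolding rhs_comp_eq[OF f] pzero_def by simp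
  qed
  moreover have "congr (rel_mat n q) f (psum ({..N} \<times> {..N}) (\<lambda>(d1, d2). rhs_comp n q f d1 d2))"
  proof -
    have "psum ({..N} \<times> {..N}) (\<lambda>(d1, d2). rhs_comp n q f d1 d2) = psum ?F (\<lambda>w. psc (f w) (Kw (length w) w))"
    proof
      fix x
      have "psum ({..N} \<times> {..N}) (\<lambda>(d1, d2). rhs_comp n q f d1 d2) x = (\<Sum>d1\<le>N. \<Sum>d2\<le>N. if d1 = d2 then \<Sum>w\<in>?F. f w * Kw d1 w x else 0)"
        unfolding psum_def sum.cartesian_product by (intro sum.cong refl) (auto simp: rhs_comp_eq[OF f])
      also have "\<dots> = (\<Sum>d\<le>N. \<Sum>w\<in>?F. f w * Kw d w x)" by (simp add: sum.delta')
      also have "\<dots> = (\<Sum>w\<in>?F. \<Sum>d\<le>N. f w * Kw d w x)" by (rule sum.swap)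
      also have "\<dots> = (\<Sum>w\<in>?F. \<Sum>d\<le>N. if d = length w then f w * Kw (length w) w x else 0)"
        using Kw_degree[OF fm] by (intro sum.cong refl) auto
      also have "\<dots> = psum ?F (\<lambda>w. psc (f w) (Kw (length w) w)) x"
        using N by (simp add: psum_def psc_def)
      finally show "psum ({..N} \<times> {..N}) (\<lambda>(d1, d2). rhs_comp n q f d1 d2) x = psum ?F (\<lambda>w. psc (f w) (Kw (length w) w)) x" .
    qed
    moreover have "congr (rel_mat n q) (psum ?F (\<lambda>w. psc (f w) (pword w))) (psum ?F (\<lambda>w. psc (f w) (Kw (length w) w)))"
      using fin fm by (intro congr_psum congr_psc Kw_word) auto
    ultimately show ?thesis using pfin_expand[OF f(1)] by simp
  qed
  ultimately show ?thesis by (intro exI[of _ N]) simp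
qed

end

theorem theorem2:
  fixes q :: real and n :: nat and f :: poly
  assumes "0 < q" and "q < 1" and "1 \<le> n"
    and "pfin f" and "\<forall>w. f w \<noteq> 0 \<longrightarrow> set w \<subseteq> mat_alph n"
  shows "\<exists>N. (\<forall>d1 d2. (N < d1 \<or> N < d2) \<longrightarrow> congr (rel_mat n q) (rhs_comp n q f d1 d2) pzero)
           \<and> congr (rel_mat n q) f (psum ({..N} \<times> {..N}) (\<lambda>(d1, d2). rhs_comp n q f d1 d2))"
proof -
  interpret qp q n using assms by unfold_locales
  show ?thesis by (rule reproducing_kernel[OF assms(4,5)])
qed

end
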